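(* Let $G$ be a connected, simply connected two step nilpotent Lie group with the MW condition, with $\mathfrak g=\mathfrak v\oplus\mathfrak z$, $k=\dim\mathfrak z$, and sublaplacian $\mathcal L$. Let $w$ be the solution of the Schrödinger equation $$\frac{\partial w}{\partial t}(g,t)=i\mathcal L w(g,t),\quad g\in G,\ t\in\mathbb{R},\qquad w(g,0)=f(g),\quad g\in G,$$ with $f\in L^2(G)$. Suppose that, for some constant $C$: (a) $f(v,z)$ is continuous and compactly supported in the $v$-variable (there is a compact $K\subset\mathfrak v$ with $f(v,z)=0$ for $v\notin K$ and all $z\in\mathfrak z$), and $$|f(v,z)|\le C\frac{e^{-|z|\theta(|z|)}}{(1+|z|^2)^k}\quad\text{for all } v\in\mathfrak v,\ z\in\mathfrak z,$$ where $\theta$ is a nonnegative decreasing function on $[0,\infty)$ with $\lim_{s\to\infty}\theta(s)=0$; (b) for some nonzero $t_0\in\mathbb{R}$ and some nonnegative nondecreasing function $\psi$ on $[0,\infty)$, $$|w((v,z),t_0)|\le C e^{-\psi(|v|)}\frac{e^{-|z|\theta(|z|)}}{(1+|z|^2)^k}\quad\text{for almost every }(v,z)\in\mathfrak v\times\mathfrak z .$$ If $$\int_{\mathbb{R}}\frac{\psi(r)}{1+r^2}\,dr=\infty\quad\text{and}\quad\int_1^\infty\frac{\theta(r)}{r}\,dr=\infty,$$ then $w$ is zero on $G\times\mathbb{R}$.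
   Context: The Lie algebra of $G$ is $\mathfrak g=\mathfrak v\oplus\mathfrak z$ with $\mathfrak z$ the center and $\{0\}\neq[\mathfrak g,\mathfrak g]=[\mathfrak v,\mathfrak v]\subset\mathfrak z$; $\mathfrak g$ carries an inner product with $\mathfrak v\perp\mathfrak z$, and $|v|,|z|$ are the corresponding norms. $G$ is identified with $\mathfrak v\oplus\mathfrak z$ through $\exp$, writing $(v,z)=\exp(v+z)$, with product $(V,Z)(V',Z')=(V+V',Z+Z'+\frac12[V,V'])$ and Haar measure $dv\,dz$. The MW condition means there exists $\nu\in\mathfrak z^*$ such that the bilinear form $B_\nu(V,V')=\nu([V,V'])$ on $\mathfrak v$ is nondegenerate. For $X\in\mathfrak g$, the left invariant differential operator is $Xf(g)=\frac{d}{dt}\big|_{t=0}f(g\exp tX)$. With $\{X_1,\dots,X_m\}$ an orthonormal basis of $\mathfrak v$, the sublaplacian is $\mathcal L=\sum_{i=1}^mX_i^2$. The solution of the Schrödinger equation is $w(g,t)=e^{it\mathcal L}f(g)$ (the unitary group on $L^2(G)$ generated by $i\mathcal L$). The function $\psi$ on $[0,\infty)$ is extended to $\mathbb{R}$ as an even function in the integral over $\mathbb{R}$. *)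

theory Defs
  imports "HOL-Analysis.Analysis"
begin

text \<open>
  The Lie algebra \<open>\<gg> = \<vv> \<oplus> \<zz>\<close> is \<open>'v \<times> 'z\<close> with the product inner product, so that
  \<open>\<vv> = UNIV \<times> {0}\<close> is orthogonal to \<open>\<zz> = {0} \<times> UNIV\<close>; the bracket is the only further datum.
  The group \<open>G\<close> has the same carrier (exponential coordinates) and Haar measure
  \<open>lborel\<close> on \<open>'v \<times> 'z\<close>.
\<close>

locale two_step_lie_algebra =
  fixes lie :: "'v::euclidean_space \<times> 'z::euclidean_space \<Rightarrow> 'v \<times> 'z \<Rightarrow> 'v \<times> 'z"
  assumes bilinear_lie: "bilinear lie"
    and lie_self: "lie X X = 0"
    and jacobi: "lie X (lie Y W) + lie Y (lie W X) + lie W (lie X Y) = 0"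
    and two_step: "lie (lie X Y) W = 0"
    and not_abelian: "\<exists>X Y. lie X Y \<noteq> 0"
    and center: "{X. \<forall>Y. lie X Y = 0} = {0} \<times> UNIV"

definition MW_form :: "('v::euclidean_space \<times> 'z::euclidean_space \<Rightarrow> 'v \<times> 'z \<Rightarrow> 'v \<times> 'z) \<Rightarrow>
    ('z \<Rightarrow> real) \<Rightarrow> 'v \<Rightarrow> 'v \<Rightarrow> real"
  where "MW_form lie \<nu> V V' = \<nu> (snd (lie (V, 0) (V', 0)))"

definition MW_condition ::
    "('v::euclidean_space \<times> 'z::euclidean_space \<Rightarrow> 'v \<times> 'z \<Rightarrow> 'v \<times> 'z) \<Rightarrow> bool"
  where "MW_condition lie \<longleftrightarrow>
    (\<exists>\<nu>. linear \<nu> \<and> (\<forall>V. (\<forall>V'. MW_form lie \<nu> V V' = 0) \<longrightarrow> V = 0))"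

text \<open>The Baker--Campbell--Hausdorff product, which stops at the first bracket.\<close>

definition gmul :: "('v::euclidean_space \<times> 'z::euclidean_space \<Rightarrow> 'v \<times> 'z \<Rightarrow> 'v \<times> 'z) \<Rightarrow>
    'v \<times> 'z \<Rightarrow> 'v \<times> 'z \<Rightarrow> 'v \<times> 'z"
  where "gmul lie g h = g + h + (1/2) *\<^sub>R lie g h"

lemma (in two_step_lie_algebra) gmul_Pair:
  "gmul lie (V, Z) (V', Z') = (V + V', Z + Z' + (1/2) *\<^sub>R snd (lie (V, 0) (V', 0)))"
proof -
  have anti: "lie X Y = - lie Y X" for X Y
  proof -
    have "lie (X + Y) (X + Y) = lie X X + lie X Y + (lie Y X + lie Y Y)"
      by (simp add: bilinear_ladd[OF bilinear_lie] bilinear_radd[OF bilinear_lie])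
    then show ?thesis
      by (simp add: lie_self eq_neg_iff_add_eq_0)
  qed
  have c1: "lie (0, W) Y = 0" for W Y
    using center by blast
  have c2: "lie Y (0, W) = 0" for W Y
    using anti[of Y "(0, W)"] c1 by simp
  have "lie (V, Z) (V', Z') = lie ((V, 0) + (0, Z)) ((V', 0) + (0, Z'))"
    by simp
  also have "\<dots> = lie (V, 0) (V', 0)"
    by (simp only: bilinear_ladd[OF bilinear_lie] bilinear_radd[OF bilinear_lie] c1 c2 add_0_right)
  finally have eq: "lie (V, Z) (V', Z') = lie (V, 0) (V', 0)" .
  have "lie (V, 0) (V', 0) \<in> {X. \<forall>Y. lie X Y = 0}"
    using two_step by simp
  then have "lie (V, 0) (V', 0) \<in> {0} \<times> UNIV"
    by (simp only: center)
  then have "fst (lie (V, 0) (V', 0)) = 0"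
    by (simp add: mem_Times_iff)
  then show ?thesis
    by (simp add: gmul_def eq prod_eq_iff)
qed

text \<open>In exponential coordinates \<open>exp (t X)\<close> is the point \<open>t X\<close>.\<close>

definition left_inv :: "('v::euclidean_space \<times> 'z::euclidean_space \<Rightarrow> 'v \<times> 'z \<Rightarrow> 'v \<times> 'z) \<Rightarrow>
    'v \<times> 'z \<Rightarrow> ('v \<times> 'z \<Rightarrow> complex) \<Rightarrow> 'v \<times> 'z \<Rightarrow> complex"
  where "left_inv lie X f g = vector_derivative (\<lambda>t. f (gmul lie g (t *\<^sub>R X))) (at 0)"

text \<open>On smooth functions the operator does not depend on the choice of the orthonormal basis
  of \<open>\<vv>\<close>; \<open>Basis\<close> is one.\<close>

definition sublaplacian :: "('v::euclidean_space \<times> 'z::euclidean_space \<Rightarrow> 'v \<times> 'z \<Rightarrow> 'v \<times> 'z) \<Rightarrow>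
    ('v \<times> 'z \<Rightarrow> complex) \<Rightarrow> 'v \<times> 'z \<Rightarrow> complex"
  where "sublaplacian lie f g = (\<Sum>e\<in>Basis. left_inv lie (e, 0) (left_inv lie (e, 0) f) g)"

primrec Ck :: "nat \<Rightarrow> ('a::euclidean_space \<Rightarrow> complex) \<Rightarrow> bool" where
  "Ck 0 f \<longleftrightarrow> continuous_on UNIV f"
| "Ck (Suc n) f \<longleftrightarrow> f differentiable_on UNIV \<and> (\<forall>e. Ck n (\<lambda>x. frechet_derivative f (at x) e))"

definition test_functions :: "('a::euclidean_space \<Rightarrow> complex) set"
  where "test_functions = {f. (\<forall>n. Ck n f) \<and> (\<exists>K. compact K \<and> (\<forall>x. x \<notin> K \<longrightarrow> f x = 0))}"

text \<open>
  Elements of \<open>L\<^sup>2\<close> are represented by functions; identities between them are almost everywhere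
  identities, and \<open>L2_norm\<close> is meaningful only on \<open>L2\<close>.
\<close>

definition L2 :: "('a::euclidean_space \<Rightarrow> complex) set"
  where "L2 = {f. f \<in> borel_measurable lborel \<and> integrable lborel (\<lambda>x. (cmod (f x))\<^sup>2)}"

definition L2_norm :: "('a::euclidean_space \<Rightarrow> complex) \<Rightarrow> real"
  where "L2_norm f = sqrt (\<integral>x. (cmod (f x))\<^sup>2 \<partial>lborel)"

text \<open>
  Strongly continuous one-parameter unitary groups on \<open>L\<^sup>2\<close>. Compatibility with almost everywhere
  equality follows from linearity and isometry, surjectivity from the group law.
\<close>

locale unitary_group =
  fixes U :: "real \<Rightarrow> ('a::euclidean_space \<Rightarrow> complex) \<Rightarrow> 'a \<Rightarrow> complex"
  assumes closed: "f \<in> L2 \<Longrightarrow> U t f \<in> L2"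
    and linear: "f \<in> L2 \<Longrightarrow> h \<in> L2 \<Longrightarrow>
      AE x in lborel. U t (\<lambda>y. a * f y + b * h y) x = a * U t f x + b * U t h x"
    and isometry: "f \<in> L2 \<Longrightarrow> L2_norm (U t f) = L2_norm f"
    and at_zero: "f \<in> L2 \<Longrightarrow> AE x in lborel. U 0 f x = f x"
    and group_law: "f \<in> L2 \<Longrightarrow> AE x in lborel. U (s + t) f x = U s (U t f) x"
    and strongly_continuous:
      "f \<in> L2 \<Longrightarrow> ((\<lambda>t. L2_norm (\<lambda>x. U t f x - f x)) \<longlongrightarrow> 0) (at 0)"

text \<open>Unbounded operators on \<open>L\<^sup>2\<close> are given by their graphs.\<close>

definition generator_graph :: "(real \<Rightarrow> ('a::euclidean_space \<Rightarrow> complex) \<Rightarrow> 'a \<Rightarrow> complex) \<Rightarrow>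
    (('a \<Rightarrow> complex) \<times> ('a \<Rightarrow> complex)) set"
  where "generator_graph U = {(u, h). u \<in> L2 \<and> h \<in> L2 \<and>
    ((\<lambda>t. L2_norm (\<lambda>x. (U t u x - u x) / complex_of_real t - h x)) \<longlongrightarrow> 0) (at 0)}"

definition closure_graph :: "(('a::euclidean_space \<Rightarrow> complex) \<Rightarrow> 'a \<Rightarrow> complex) \<Rightarrow>
    (('a \<Rightarrow> complex) \<times> ('a \<Rightarrow> complex)) set"
  where "closure_graph A = {(u, h). u \<in> L2 \<and> h \<in> L2 \<and>
    (\<exists>\<phi>. (\<forall>n::nat. \<phi> n \<in> test_functions) \<and>
      (\<lambda>n. L2_norm (\<lambda>x. \<phi> n x - u x)) \<longlonglongrightarrow> 0 \<and>
      (\<lambda>n. L2_norm (\<lambda>x. A (\<phi> n) x - h x)) \<longlonglongrightarrow> 0)}"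

text \<open>
  The sublaplacian is essentially self-adjoint on the test functions, so its \<open>L\<^sup>2\<close> realization is
  the closure from there, and by Stone's theorem \<open>e\<^bsup>itL\<^esup>\<close> is the unitary group whose
  generator is \<open>\<i>\<close> times that closure. Such a group exists and is unique up to null sets.
\<close>

definition sublaplacian_group ::
    "('v::euclidean_space \<times> 'z::euclidean_space \<Rightarrow> 'v \<times> 'z \<Rightarrow> 'v \<times> 'z) \<Rightarrow>
     (real \<Rightarrow> ('v \<times> 'z \<Rightarrow> complex) \<Rightarrow> 'v \<times> 'z \<Rightarrow> complex) \<Rightarrow> bool"
  where "sublaplacian_group lie U \<longleftrightarrow> unitary_group U \<and>
    generator_graph U = closure_graph (\<lambda>\<phi> x. \<i> * sublaplacian lie \<phi> x)"

definition schroedinger_solution ::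
    "('v::euclidean_space \<times> 'z::euclidean_space \<Rightarrow> 'v \<times> 'z \<Rightarrow> 'v \<times> 'z) \<Rightarrow>
     ('v \<times> 'z \<Rightarrow> complex) \<Rightarrow> ('v \<times> 'z \<Rightarrow> real \<Rightarrow> complex) \<Rightarrow> bool"
  where "schroedinger_solution lie f w \<longleftrightarrow>
    (\<exists>U. sublaplacian_group lie U \<and> (\<forall>t. AE g in lborel. w g t = U t f g))"

end

theory Submission
  imports Defs "HOL-Probability.Probability" "HOL-Complex_Analysis.Complex_Analysis"
begin

text \<open>
  Write \<open>x = (v, z)\<close> and let \<open>J \<xi>\<close> be the skew operator on \<open>\<vv>\<close> with \<open>J \<xi> v \<bullet> w = \<xi> \<bullet> [v, w]\<close>. The Fourier transform in the
  central variable \<open>z\<close> decomposes the Schroedinger evolution into evolutions on \<open>\<vv>\<close>, one for each frequency \<open>\<xi>\<close>, which describe a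
  particle in the constant magnetic field \<open>J \<xi>\<close>. By the MW condition \<open>J \<xi>\<close> is invertible for \<open>\<xi>\<close> in some open set of arbitrarily
  small frequencies. There the modulus \<open>H \<xi> = \<surd>(- (J \<xi>)\<^sup>2)\<close> is positive definite, and for every momentum \<open>p\<close> there is an explicit
  solution, a Gaussian of shape \<open>H \<xi>\<close> which starts at the origin with momentum \<open>p\<close> and follows the classical orbit
  (\<open>gen_eq_rate\<close>).

  The pairing of a solution with such a wave packet is conserved (\<open>transform_invariant\<close>). At time 0 it is the Euclidean
  Fourier transform, at \<open>p\<close>, of the function \<open>f\<^sup>\<xi> v exp (- v \<bullet> H \<xi> v / 4)\<close>, where \<open>f\<^sup>\<xi> v\<close> is the Fourier transform of \<open>f (v, \<cdot>)\<close> at \<open>\<xi>\<close>. At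
  time \<open>t\<^sub>0\<close> the packet is centred at distance at least \<open>|t\<^sub>0| |p|\<close> from the origin, provided that \<open>\<xi>\<close> is small, so by the decay of the solution
  the pairing is at most a constant times \<open>exp (- \<psi> (|t\<^sub>0| |p| / 2)) + exp (- b |p|\<^sup>2)\<close> (\<open>partial_fourier_decay\<close>). A function of
  compact support whose Fourier transform is that small is zero, because the logarithmic integral of \<open>\<psi>\<close> diverges
  (\<open>compact_support_log_integral_zero\<close>). Hence \<open>f\<^sup>\<xi> v = 0\<close> for all \<open>v\<close> and all \<open>\<xi>\<close> in an open set.

  The decay of \<open>f (v, z)\<close> in \<open>z\<close>, together with the divergence of the integral of \<open>\<theta> r / r\<close>, makes \<open>f\<^sup>\<xi> v\<close> quasianalytic in \<open>\<xi>\<close>. So it vanishes for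
  all \<open>\<xi>\<close> (\<open>fourier_quasianalytic\<close>, from the Denjoy--Carleman theorem), \<open>f\<close> is zero almost everywhere, and so is the solution at
  every time.

  The unitary group is given only through its generator, the closure of \<open>\<i>\<close> times the sublaplacian on test functions. Conservation
  of the pairing is therefore proved for integrals of packets over a box of frequencies, with arbitrary continuous coefficients.
  These are smooth and square integrable by the Bessel inequality, are limits of test functions in the graph norm
  (\<open>superpose_in_closure_graph\<close>), and are differentiable in time (\<open>superpose_time_derivative\<close>); an individual packet
  is recovered because the coefficients are arbitrary.
\<close>

section \<open>A logarithmic integral theorem in the half-plane\<close>

text \<open>
  The product of the rotates of \<open>h\<close> by the \<open>n\<close>-th roots of unity is holomorphic and takes the value
  \<open>h 0 ^ n\<close> at the centre. On the circle only the average of \<open>ln |h|\<close> over a regular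
  \<open>n\<close>-gon matters, which makes this a form of Jensen's inequality that needs no integral of
  \<open>ln |h|\<close>.
\<close>
lemma rotation_product_bound:
  fixes h :: "complex \<Rightarrow> complex" and n :: nat
  assumes cont: "continuous_on (cball 0 1) h" and hol: "h holomorphic_on ball 0 1"
    and B: "\<And>\<zeta>. norm \<zeta> = 1 \<Longrightarrow> (\<Prod>k<n. norm (h (cis (2 * pi / n) ^ k * \<zeta>))) \<le> B"
  shows "norm (h 0) ^ n \<le> B"
proof -
  define \<omega> where "\<omega> = cis (2 * pi / n)"
  define P where "P \<zeta> = (\<Prod>k<n. h (\<omega> ^ k * \<zeta>))" for \<zeta>
  have \<omega>: "norm (\<omega> ^ k) = 1" for k by (simp add: \<omega>_def norm_power)
  have "norm (P 0) \<le> B"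
  proof (rule maximum_modulus_frontier[where S = "cball 0 1" and f = P and \<xi> = 0])
    show "P holomorphic_on interior (cball 0 1)"
      unfolding P_def interior_cball
    proof (rule holomorphic_on_prod)
      fix k assume "k \<in> {..<n}"
      show "(\<lambda>z. h (\<omega> ^ k * z)) holomorphic_on ball 0 1"
        by (rule holomorphic_on_compose_gen[of "\<lambda>z. \<omega> ^ k * z", unfolded o_def, OF _ hol])
          (auto intro!: holomorphic_intros simp: norm_mult \<omega>)
    qed
    show "continuous_on (closure (cball 0 1)) P"
      unfolding P_def
    proof (intro continuous_on_prod)
      fix k assume "k \<in> {..<n}"
      show "continuous_on (closure (cball 0 1)) (\<lambda>z. h (\<omega> ^ k * z))"
        by (rule continuous_on_compose2[OF cont]) (auto intro!: continuous_intros simp: norm_mult \<omega>)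
    qed
    fix z assume "z \<in> frontier (cball (0::complex) 1)"
    then have "norm z = 1" by simp
    then show "norm (P z) \<le> B"
      using B[of z] by (simp add: P_def prod_norm \<omega>_def)
  qed auto
  then show ?thesis by (simp add: P_def norm_power)
qed

text \<open>
  Cauchy condensation in finite form: it turns the average over an \<open>n\<close>-gon into dyadic samples.
\<close>
lemma antimono_dyadic_block_sum:
  fixes g :: "nat \<Rightarrow> real"
  assumes "\<And>i j. 0 < i \<Longrightarrow> i \<le> j \<Longrightarrow> g j \<le> g i"
  shows "(\<Sum>m<M. 2 ^ m * g (2 ^ Suc m)) \<le> (\<Sum>j<2 ^ M. g (Suc j)) - g 1"
proof (induction M)
  case (Suc M)
  have "(\<Sum>j<2 ^ Suc M. g (Suc j)) = (\<Sum>j<2 ^ M. g (Suc j)) + (\<Sum>j=2 ^ M..<2 ^ Suc M. g (Suc j))"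
    unfolding lessThan_atLeast0 by (rule sum.atLeastLessThan_concat[symmetric]) auto
  moreover have "(\<Sum>j=2 ^ M..<2 ^ Suc M. g (Suc j)) \<ge> (\<Sum>j=2 ^ M..<2 ^ Suc M::nat. g (2 ^ Suc M))"
    by (intro sum_mono assms) auto
  ultimately show ?case using Suc by simp
qed simp

text \<open>
  Vertex \<open>k\<close> of a regular \<open>n\<close>-gon on the circle, counted from the point 1, has an angle of at most
  \<open>2 \<pi> (k + 1) / n\<close>, so that there \<open>|h| \<le> exp (- \<psi> (c n / (k + 1)))\<close>. With \<open>n = 2 ^ (M + 2)\<close>,
  condensing the sum over the vertices gives \<open>|h 0| \<le> exp (- \<Sigma> M / 8)\<close>, where \<open>\<Sigma> M\<close> is a partial
  sum of the divergent series.
\<close>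
lemma disc_log_integral_zero:
  fixes h :: "complex \<Rightarrow> complex" and \<psi> :: "real \<Rightarrow> real"
  assumes cont: "continuous_on (cball 0 1) h" and hol: "h holomorphic_on ball 0 1"
    and le1: "\<And>\<zeta>. norm \<zeta> = 1 \<Longrightarrow> norm (h \<zeta>) \<le> 1"
    and decay: "\<And>\<phi>. 0 < \<phi> \<Longrightarrow> \<phi> \<le> 2 \<Longrightarrow> norm (h (cis \<phi>)) \<le> exp (- \<psi> (y / \<phi>))"
    and y: "y > 0"
    and \<psi>0: "\<And>s. 0 \<le> s \<Longrightarrow> 0 \<le> \<psi> s" and \<psi>m: "mono_on {0..} \<psi>"
    and div: "\<And>c. c > 0 \<Longrightarrow> \<not> summable (\<lambda>l::nat. \<psi> (c * 2 ^ l) / 2 ^ l)"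
  shows "h 0 = 0"
proof -
  define c where "c = y / (2 * pi)"
  have c: "c > 0" using y by (simp add: c_def)
  define \<Sigma> where "\<Sigma> M = (\<Sum>l<M. \<psi> (4 * c * 2 ^ l) / 2 ^ l)" for M
  have bound: "norm (h 0) \<le> exp (- (\<Sigma> M / 8))" for M
  proof -
    \<comment> \<open>The vertices \<open>k < 2 ^ M\<close> are those with angle at most \<open>\<pi> / 2 \<le> 2\<close>; the others contribute a factor of at most 1.\<close>
    define n where "n = (2::nat) ^ (M + 2)"
    define \<omega> where "\<omega> = cis (2 * pi / n)"
    define g where "g i = \<psi> (c * n / real i)" for i :: nat
    have n0: "n > 0" by (simp add: n_def)
    have \<omega>n: "\<omega> ^ n = 1"
    proof -
      have "\<omega> ^ n = cis (real n * (2 * pi / real n))" by (simp only: \<omega>_def Complex.DeMoivre)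
      also have "real n * (2 * pi / real n) = 2 * pi" using n0 by simp
      finally show ?thesis by simp
    qed
    define P where "P \<zeta> = (\<Prod>k<n. norm (h (\<omega> ^ k * \<zeta>)))" for \<zeta>
    have Pshift: "P (\<omega> * \<zeta>) = P \<zeta>" for \<zeta>
    proof -
      obtain n' where n': "n = Suc n'" using n0 gr0_implies_Suc by blast
      have "P (\<omega> * \<zeta>) = (\<Prod>k<n. norm (h (\<omega> ^ Suc k * \<zeta>)))"
        unfolding P_def by (intro prod.cong) (auto simp: mult_ac)
      also have "\<dots> = (\<Prod>k<n'. norm (h (\<omega> ^ Suc k * \<zeta>))) * norm (h \<zeta>)"
        unfolding n' prod.lessThan_Suc using \<omega>n n' by simp
      also have "\<dots> = P \<zeta>"
        unfolding P_def n' prod.lessThan_Suc_shift by simp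
      finally show ?thesis .
    qed
    have Pshift_n: "P (\<omega> ^ m * \<zeta>) = P \<zeta>" for m \<zeta>
      by (induction m) (use Pshift in \<open>auto simp: mult.assoc\<close>)
    have "P \<zeta> \<le> exp (- (\<Sum>j<2 ^ M. g (Suc j)))" if \<zeta>: "norm \<zeta> = 1" for \<zeta>
    proof -
      obtain \<alpha> where \<alpha>: "\<zeta> = cis \<alpha>" "0 \<le> \<alpha>" "\<alpha> < 2 * pi"
        using Arg2pi_eq[of \<zeta>] Arg2pi_ge_0[of \<zeta>] Arg2pi_lt_2pi[of \<zeta>] \<zeta>
        by (auto simp: cis_conv_exp)
      \<comment> \<open>The angle is taken in \<open>(0, 2 \<pi>]\<close>, since at angle 0 there is no decay.\<close>
      define \<beta> where "\<beta> = (if \<alpha> = 0 then 2 * pi else \<alpha>)"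
      have \<beta>: "\<zeta> = cis \<beta>" "0 < \<beta>" using \<alpha> by (auto simp: \<beta>_def)
      define m where "m = nat (\<lceil>\<beta> * n / (2 * pi)\<rceil> - 1)"
      define \<alpha>0 where "\<alpha>0 = \<beta> - 2 * pi * m / n"
      have pos: "\<beta> * n / (2 * pi) > 0" using \<beta> n0 by simp
      then have "\<lceil>\<beta> * n / (2 * pi)\<rceil> \<ge> 1" by linarith
      then have m: "real m < \<beta> * n / (2 * pi)" "\<beta> * n / (2 * pi) \<le> m + 1"
        unfolding m_def using pos by linarith+
      have \<alpha>0: "0 < \<alpha>0" "\<alpha>0 \<le> 2 * pi / n"
        using m n0 by (auto simp: \<alpha>0_def pos_le_divide_eq pos_less_divide_eq pos_divide_le_eq pos_divide_less_eq diff_le_eq le_diff_eq algebra_simps add_divide_distrib[symmetric])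
      have "\<zeta> = \<omega> ^ m * cis \<alpha>0"
        unfolding \<beta>(1) \<omega>_def Complex.DeMoivre cis_mult by (rule arg_cong[where f = cis]) (simp add: \<alpha>0_def)
      then have "P \<zeta> = P (cis \<alpha>0)" using Pshift_n by simp
      also have "\<dots> = (\<Prod>k<n. norm (h (cis (\<alpha>0 + 2 * pi * k / n))))"
        unfolding P_def \<omega>_def Complex.DeMoivre cis_mult by (intro prod.cong refl) (simp add: mult_ac add_ac)
      also have "\<dots> \<le> (\<Prod>k<n. if k < 2 ^ M then exp (- g (Suc k)) else 1)"
      proof (intro prod_mono conjI norm_ge_zero)
        fix k assume "k \<in> {..<n}"
        define \<phi> where "\<phi> = \<alpha>0 + 2 * pi * k / n"
        have "norm (h (cis \<phi>)) \<le> (if k < 2 ^ M then exp (- g (Suc k)) else 1)"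
        proof (cases "k < 2 ^ M")
          case True
          have \<phi>0: "0 < \<phi>" using \<alpha>0 n0 by (auto simp: \<phi>_def intro!: add_pos_nonneg)
          have \<phi>1: "\<phi> \<le> 2 * pi * Suc k / n" using \<alpha>0 by (simp add: \<phi>_def field_simps add_divide_distrib)
          have "real (Suc k) \<le> 2 ^ M" using True by (metis Suc_leI of_nat_le_iff of_nat_numeral of_nat_power)
          then have "2 * pi * Suc k / n \<le> 2 * pi * 2 ^ M / n"
            using n0 by (intro divide_right_mono mult_left_mono) auto
          also have "\<dots> = pi / 2" by (simp add: n_def)
          also have "\<dots> \<le> 2" using pi_less_4 by simp
          finally have \<phi>2: "\<phi> \<le> 2" using \<phi>1 by simp
          have "norm (h (cis \<phi>)) \<le> exp (- \<psi> (y / \<phi>))" by (rule decay[OF \<phi>0 \<phi>2])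
          also have "\<dots> \<le> exp (- g (Suc k))"
          proof -
            have "c * n / real (Suc k) = y / (2 * pi * Suc k / n)" by (simp add: c_def)
            also have "\<dots> \<le> y / \<phi>" using y \<phi>0 \<phi>1 n0 by (intro divide_left_mono) (auto intro!: mult_pos_pos divide_pos_pos)
            finally show ?thesis unfolding g_def
              using y \<phi>0 c by (auto intro!: mono_onD[OF \<psi>m])
          qed
          finally show ?thesis using True by simp
        next
          case False
          then show ?thesis using le1[of "cis \<phi>"] by simp
        qed
        then show "norm (h (cis (\<alpha>0 + 2 * pi * k / n))) \<le> (if k < 2 ^ M then exp (- g (Suc k)) else 1)"
          by (simp add: \<phi>_def)
      qed
      also have "\<dots> = (\<Prod>k\<in>{k\<in>{..<n}. k < 2 ^ M}. exp (- g (Suc k)))"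
        by (subst prod.inter_filter) auto
      also have "{k\<in>{..<n}. k < 2 ^ M} = {..<2 ^ M}" by (auto simp: n_def)
      also have "(\<Prod>k<2 ^ M. exp (- g (Suc k))) = exp (- (\<Sum>j<2 ^ M. g (Suc j)))"
        by (simp add: exp_sum sum_negf[symmetric])
      finally show ?thesis .
    qed
    then have "norm (h 0) ^ n \<le> exp (- (\<Sum>j<2 ^ M. g (Suc j)))"
      by (intro rotation_product_bound[OF cont hol]) (simp add: P_def \<omega>_def)
    also have "\<dots> \<le> exp (- (n * (\<Sigma> M / 8)))"
    proof -
      have "g j \<le> g i" if "0 < i" "i \<le> j" for i j unfolding g_def
        by (rule mono_onD[OF \<psi>m]) (use that c n0 in \<open>auto intro!: divide_left_mono divide_nonneg_nonneg mult_pos_pos\<close>)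
      then have "(\<Sum>m<M. 2 ^ m * g (2 ^ Suc m)) \<le> (\<Sum>j<2 ^ M. g (Suc j)) - g 1"
        by (rule antimono_dyadic_block_sum)
      moreover have "g 1 \<ge> 0" unfolding g_def using c by (auto intro!: \<psi>0)
      moreover have "(\<Sum>m<M. 2 ^ m * g (2 ^ Suc m)) = n * (\<Sigma> M / 8)"
      proof -
        have "(\<Sum>m<M. 2 ^ m * g (2 ^ Suc m)) = (\<Sum>m<M. 2 ^ (M - Suc m) * g (2 ^ Suc (M - Suc m)))"
          by (rule sum.nat_diff_reindex[symmetric])
        also have "\<dots> = (\<Sum>m<M. n * (\<psi> (4 * c * 2 ^ m) / 2 ^ m / 8))"
        proof (intro sum.cong refl)
          fix m assume "m \<in> {..<M}"
          then obtain d where d: "M = Suc (m + d)" using less_iff_Suc_add by auto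
          have "M - Suc m = d" using d by simp
          moreover have "c * n / real (2 ^ Suc d) = 4 * c * 2 ^ m"
            by (simp add: n_def d power_add)
          ultimately show "2 ^ (M - Suc m) * g (2 ^ Suc (M - Suc m)) = n * (\<psi> (4 * c * 2 ^ m) / 2 ^ m / 8)"
            unfolding g_def by (simp add: n_def d power_add mult.assoc)
        qed
        finally show ?thesis by (simp add: \<Sigma>_def sum_distrib_left sum_divide_distrib)
      qed
      ultimately show ?thesis by simp
    qed
    also have "\<dots> = exp (- (\<Sigma> M / 8)) ^ n" by (simp add: exp_of_nat_mult[symmetric])
    finally show ?thesis using n0 by (simp add: power_mono_iff)
  qed
  have "\<not> (\<exists>K. \<forall>M. \<Sigma> M \<le> K)"
  proof
    assume "\<exists>K. \<forall>M. \<Sigma> M \<le> K"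
    then obtain K where "\<And>M. \<Sigma> M \<le> K" by blast
    then have "summable (\<lambda>l::nat. \<psi> (4 * c * 2 ^ l) / 2 ^ l)"
      unfolding \<Sigma>_def using c \<psi>0 by (intro summableI_nonneg_bounded[where x=K]) auto
    then show False using div[of "4 * c"] c by simp
  qed
  then have unb: "\<exists>M. \<Sigma> M > K" for K by (meson not_le)
  show ?thesis
  proof (rule ccontr)
    assume "h 0 \<noteq> 0"
    then have p: "norm (h 0) > 0" by simp
    obtain M where "\<Sigma> M > - 8 * ln (norm (h 0))" using unb by blast
    then have "- (\<Sigma> M / 8) < ln (norm (h 0))" by simp
    then have "exp (- (\<Sigma> M / 8)) < norm (h 0)" using p by (metis exp_less_mono exp_ln)
    then show False using bound[of M] by simp
  qed
qed

lemma cayley_circle: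
  assumes "sin (\<phi>/2) \<noteq> 0"
  shows "\<i> * (1 + cis \<phi>) / (1 - cis \<phi>) = complex_of_real (- cot (\<phi>/2))"
proof -
  define \<theta> where "\<theta> = \<phi> / 2"
  have \<phi>: "cis \<phi> = cis \<theta> * cis \<theta>" by (simp add: cis_mult \<theta>_def)
  have "1 + cis \<phi> = cis \<theta> * (cis (-\<theta>) + cis \<theta>)" by (simp add: \<phi> ring_distribs cis_mult)
  also have "cis (-\<theta>) + cis \<theta> = 2 * cos \<theta>" by (simp add: complex_eq_iff)
  finally have a: "1 + cis \<phi> = cis \<theta> * (2 * cos \<theta>)" .
  have "1 - cis \<phi> = cis \<theta> * (cis (-\<theta>) - cis \<theta>)" by (simp add: \<phi> ring_distribs cis_mult)
  also have "cis (-\<theta>) - cis \<theta> = - 2 * \<i> * sin \<theta>" by (simp add: complex_eq_iff)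
  finally have b: "1 - cis \<phi> = cis \<theta> * (- 2 * \<i> * sin \<theta>)" .
  show ?thesis unfolding a b using assms
    by (simp add: \<theta>_def[symmetric] cot_def field_simps cis_neq_zero)
qed

text \<open>
  The Cayley map \<open>Z\<close> transplants \<open>G\<close> to the disc and sends the centre to \<open>\<i> y\<close>. At the boundary
  point 1, which corresponds to infinity, \<open>G \<circ> Z\<close> is merely bounded; the factor \<open>(1 - \<zeta>) / 2\<close> restores
  continuity there without affecting the decay. A point of the circle at a small angle \<open>\<phi>\<close> is sent to
  a real number of size at least \<open>y / \<phi>\<close>.
\<close>
lemma half_plane_log_integral_zero:
  fixes G :: "complex \<Rightarrow> complex" and \<psi> :: "real \<Rightarrow> real"
  assumes cont: "continuous_on {z. Im z \<ge> 0} G" and hol: "G holomorphic_on {z. Im z > 0}"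
    and bdd: "\<And>z. Im z \<ge> 0 \<Longrightarrow> norm (G z) \<le> B"
    and decay: "\<And>x::real. norm (G (of_real x)) \<le> B * exp (- \<psi> \<bar>x\<bar>)"
    and \<psi>0: "\<And>s. 0 \<le> s \<Longrightarrow> 0 \<le> \<psi> s" and \<psi>m: "mono_on {0..} \<psi>"
    and div: "\<And>c. c > 0 \<Longrightarrow> \<not> summable (\<lambda>l::nat. \<psi> (c * 2 ^ l) / 2 ^ l)"
    and B: "B > 0" and y: "y > 0"
  shows "G (\<i> * of_real y) = 0"
proof -
  define Z where "Z \<zeta> = y * (\<i> * (1 + \<zeta>) / (1 - \<zeta>))" for \<zeta> :: complex
  define h where "h \<zeta> = (1 - \<zeta>) / 2 * G (Z \<zeta>) / B" for \<zeta>
  have ImZ: "Im (Z \<zeta>) = y * (1 - (norm \<zeta>)\<^sup>2) / (norm (1 - \<zeta>))\<^sup>2" for \<zeta>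
  proof -
    have "Im (of_real y * (\<i> * w)) = y * Re w" for w by simp
    then have "Im (Z \<zeta>) = y * Re ((1 + \<zeta>) / (1 - \<zeta>))"
      unfolding Z_def times_divide_eq_right[symmetric] .
    also have "Re ((1 + \<zeta>) / (1 - \<zeta>)) = (1 - (norm \<zeta>)\<^sup>2) / (norm (1 - \<zeta>))\<^sup>2"
      unfolding Re_divide cmod_power2 by (simp add: power2_eq_square algebra_simps)
    finally show ?thesis by simp
  qed
  have ImZ0: "Im (Z \<zeta>) \<ge> 0" if "norm \<zeta> \<le> 1" for \<zeta>
    unfolding ImZ using that y by (auto intro!: divide_nonneg_nonneg simp: power_le_one)
  have ImZ1: "Im (Z \<zeta>) > 0" if "norm \<zeta> < 1" for \<zeta>
    unfolding ImZ using that y by (auto intro!: divide_pos_pos simp: power_less_one_iff)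
  have contZ: "continuous_on (- {1}) Z"
    unfolding Z_def by (auto intro!: continuous_intros)
  have GB: "norm (G (Z \<zeta>) / B) \<le> 1" if "norm \<zeta> \<le> 1" for \<zeta>
    using bdd[OF ImZ0[OF that]] B by (simp add: norm_divide)
  have hle: "norm (h \<zeta>) \<le> norm (1 - \<zeta>) / 2" if "norm \<zeta> \<le> 1" for \<zeta>
  proof -
    have "norm (h \<zeta>) = norm (1 - \<zeta>) / 2 * norm (G (Z \<zeta>) / B)"
      by (simp add: h_def norm_mult norm_divide)
    also have "\<dots> \<le> norm (1 - \<zeta>) / 2 * 1" by (intro mult_left_mono GB that) auto
    finally show ?thesis by simp
  qed
  have "h 0 = 0"
  proof (rule disc_log_integral_zero[where \<psi> = \<psi> and y = y])
    show "continuous_on (cball 0 1) h"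
      unfolding continuous_on_eq_continuous_within
    proof
      fix \<zeta> :: complex assume \<zeta>: "\<zeta> \<in> cball 0 1"
      show "continuous (at \<zeta> within cball 0 1) h"
      proof (cases "\<zeta> = 1")
        case True
        have "(h \<longlongrightarrow> 0) (at 1 within cball 0 1)"
        proof (rule Lim_null_comparison)
          show "\<forall>\<^sub>F x in at 1 within cball 0 1. norm (h x) \<le> norm (1 - x) / 2"
            using hle by (auto simp: eventually_at_filter)
          show "((\<lambda>x::complex. norm (1 - x) / 2) \<longlongrightarrow> 0) (at 1 within cball 0 1)"
            by (auto intro!: tendsto_eq_intros)
        qed
        then show ?thesis using True by (simp add: continuous_within h_def)
      next
        case False
        have "continuous_on (cball 0 1 \<inter> - {1}) h"
          unfolding h_def
          by (intro continuous_intros continuous_on_compose2[OF cont, of _ Z]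
              continuous_on_subset[OF contZ]) (use ImZ0 B in auto)
        then have "continuous (at \<zeta> within cball 0 1 \<inter> - {1}) h"
          using \<zeta> False by (simp add: continuous_on_eq_continuous_within)
        moreover have "at \<zeta> within cball 0 1 \<inter> - {1} = at \<zeta> within cball 0 1"
          by (rule at_within_nhd[of _ "- {1}"]) (use False in auto)
        ultimately show ?thesis by (simp add: continuous_within)
      qed
    qed
    show "h holomorphic_on ball 0 1"
    proof -
      have "Z holomorphic_on ball 0 1" unfolding Z_def by (intro holomorphic_intros) auto
      then have "(G \<circ> Z) holomorphic_on ball 0 1"
        by (rule holomorphic_on_compose_gen[OF _ hol]) (use ImZ1 in auto)
      then show ?thesis unfolding h_def o_def using B by (intro holomorphic_intros) auto
    qed
    show "norm (h \<zeta>) \<le> 1" if "norm \<zeta> = 1" for \<zeta>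
      using hle[of \<zeta>] norm_triangle_ineq4[of 1 \<zeta>] that by simp
    show "norm (h (cis \<phi>)) \<le> exp (- \<psi> (y / \<phi>))" if \<phi>: "0 < \<phi>" "\<phi> \<le> 2" for \<phi>
    proof -
      have s: "sin (\<phi>/2) > 0" using \<phi> pi_gt3 by (intro sin_gt_zero) auto
      have Zc: "Z (cis \<phi>) = of_real (- (y * cot (\<phi>/2)))"
        unfolding Z_def using cayley_circle[of \<phi>] s by simp
      have "cos (\<phi>/2) \<ge> 1/2"
      proof -
        have "cos (\<phi>/2) \<ge> cos (pi/3)" using \<phi> pi_gt3 by (intro cos_monotone_0_pi_le) auto
        then show ?thesis by (simp add: cos_60)
      qed
      moreover have "sin (\<phi>/2) \<le> \<phi>/2" using \<phi> by (intro sin_x_le_x) auto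
      ultimately have "cot (\<phi>/2) \<ge> (1/2) / (\<phi>/2)"
        unfolding cot_def using s \<phi> by (intro frac_le) auto
      then have cot: "cot (\<phi>/2) \<ge> 1/\<phi>" by simp
      then have le: "y / \<phi> \<le> y * cot (\<phi>/2)" using y mult_left_mono[OF cot, of y] by simp
      have nn: "y / \<phi> > 0" using y \<phi> by simp
      have "norm (h (cis \<phi>)) = norm (1 - cis \<phi>) / 2 * (norm (G (Z (cis \<phi>))) / B)"
        using B by (simp add: h_def norm_mult norm_divide)
      also have "\<dots> \<le> 1 * (norm (G (Z (cis \<phi>))) / B)"
        using norm_triangle_ineq4[of 1 "cis \<phi>"] B by (intro mult_right_mono) auto
      also have "\<dots> \<le> exp (- \<psi> (y * cot (\<phi>/2)))"
        using decay[of "- (y * cot (\<phi>/2))"] B le nn unfolding Zc by (simp add: field_simps)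
      also have "\<dots> \<le> exp (- \<psi> (y / \<phi>))"
        using mono_onD[OF \<psi>m, of "y / \<phi>" "y * cot (\<phi>/2)"] le nn by auto
      finally show ?thesis .
    qed
  qed (use y \<psi>0 \<psi>m div in auto)
  then show ?thesis using B by (simp add: h_def Z_def mult.commute)
qed

section \<open>The Denjoy--Carleman theorem, after Bang\<close>

text \<open>
  Comparison with the curve \<open>B exp (\<kappa> \<tau>)\<close>, whose derivative is the bound that is assumed.
\<close>
lemma norm_le_exp_of_derivative_bound:
  fixes g g' :: "real \<Rightarrow> 'a::real_normed_vector"
  assumes der: "\<And>\<tau>. 0 \<le> \<tau> \<Longrightarrow> (g has_vector_derivative g' \<tau>) (at \<tau>)"
    and g0: "norm (g 0) \<le> B" and g': "\<And>\<tau>. 0 \<le> \<tau> \<Longrightarrow> norm (g' \<tau>) \<le> \<kappa> * B * exp (\<kappa> * \<tau>)"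
    and h: "0 \<le> h"
  shows "norm (g h) \<le> B * exp (\<kappa> * h)"
proof (cases "h = 0")
  case False
  have "norm (g h - g 0) \<le> B * exp (\<kappa> * h) - B * exp (\<kappa> * 0)"
  proof (rule differentiable_bound_general)
    show "0 < h" using h False by simp
    show "continuous_on {0..h} g"
      by (intro continuous_at_imp_continuous_on) (auto intro: has_vector_derivative_continuous[OF der])
    show "continuous_on {0..h} (\<lambda>\<tau>. B * exp (\<kappa> * \<tau>))" by (intro continuous_intros)
    fix \<tau> assume \<tau>: "0 < \<tau>" "\<tau> < h"
    show "(g has_vector_derivative g' \<tau>) (at \<tau>)" using der \<tau> by simp
    show "((\<lambda>\<tau>. B * exp (\<kappa> * \<tau>)) has_vector_derivative \<kappa> * B * exp (\<kappa> * \<tau>)) (at \<tau>)"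
      unfolding has_real_derivative_iff_has_vector_derivative[symmetric]
      by (auto intro!: derivative_eq_intros)
    show "norm (g' \<tau>) \<le> \<kappa> * B * exp (\<kappa> * \<tau>)" using g' \<tau> by simp
  qed
  then show ?thesis using g0 norm_triangle_ineq2[of "g h" "g 0"] by simp
qed (use g0 in simp)

text \<open>
  Say that \<open>x\<close> has level \<open>N\<close> if \<open>|G j x| \<le> e ^ (j - N) M j\<close> for all \<open>j \<le> N\<close>. A point of level \<open>N + 1\<close>
  has only points of level \<open>N\<close> within distance \<open>M N / (e M (N + 1))\<close> to its right: descending from
  \<open>j = N + 1\<close>, each \<open>G j\<close> grows at most at the exponential rate \<open>\<kappa> = e M (N + 1) / M N\<close>, because the
  ratios \<open>M (j + 1) / M j\<close> increase with \<open>j\<close>, and over this distance that is a factor of at most \<open>e\<close>.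
\<close>
lemma bang_step:
  fixes G :: "nat \<Rightarrow> real \<Rightarrow> 'a::real_normed_vector" and M :: "nat \<Rightarrow> real"
  assumes der: "\<And>n x. (G n has_vector_derivative G (Suc n) x) (at x)"
    and bound: "\<And>n x. norm (G n x) \<le> M n"
    and pos: "\<And>n. M n > 0" and convex: "incseq (\<lambda>n. M (Suc n) / M n)"
    and P: "\<And>j. j \<le> Suc N \<Longrightarrow> norm (G j x) \<le> exp (real j - real (Suc N)) * M j"
    and h: "0 \<le> h" "h \<le> M N / M (Suc N) / exp 1" and j: "j \<le> N"
  shows "norm (G j (x + h)) \<le> exp (real j - real N) * M j"
proof -
  define \<kappa> where "\<kappa> = exp 1 * (M (Suc N) / M N)"
  define B where "B j = exp (real j - real (Suc N)) * M j" for j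
  have \<kappa>: "\<kappa> > 0" using pos by (simp add: \<kappa>_def)
  have B0: "B j > 0" for j using pos by (simp add: B_def)
  have "norm (G j (x + h)) \<le> B j * exp (\<kappa> * h)" if "j \<le> Suc N" "0 \<le> h" for j h
    using that
  proof (induction j arbitrary: h rule: inc_induct)
    case base
    have "norm (G (Suc N) (x + h)) \<le> B (Suc N) * 1" using bound by (simp add: B_def)
    also have "\<dots> \<le> B (Suc N) * exp (\<kappa> * h)"
      using \<kappa> base B0[of "Suc N"] by (intro mult_left_mono) auto
    finally show ?case .
  next
    case (step j)
    show ?case
    proof (rule norm_le_exp_of_derivative_bound[where g = "\<lambda>\<tau>. G j (x + \<tau>)" and g' = "\<lambda>\<tau>. G (Suc j) (x + \<tau>)"])
      fix \<tau> :: real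
      have "((\<lambda>\<tau>. x + \<tau>) has_vector_derivative 1) (at \<tau>)" by (auto intro!: derivative_eq_intros)
      from vector_diff_chain_at[OF this der[of j "x + \<tau>"]]
      show "((\<lambda>\<tau>. G j (x + \<tau>)) has_vector_derivative G (Suc j) (x + \<tau>)) (at \<tau>)"
        by (simp add: o_def)
      assume \<tau>: "0 \<le> \<tau>"
      have "B (Suc j) = exp 1 * (M (Suc j) / M j) * B j"
        using pos[of j] by (simp add: B_def exp_add[symmetric] field_simps exp_diff)
      also have "\<dots> \<le> \<kappa> * B j"
        unfolding \<kappa>_def using B0[of j] step incseqD[OF convex, of j N]
        by (intro mult_right_mono mult_left_mono) auto
      finally have BS: "B (Suc j) \<le> \<kappa> * B j" .
      show "norm (G (Suc j) (x + \<tau>)) \<le> \<kappa> * B j * exp (\<kappa> * \<tau>)"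
        using step.IH[OF \<tau>] mult_right_mono[OF BS, of "exp (\<kappa> * \<tau>)"] by (rule order_trans) simp
    qed (use P[of j] step in \<open>auto simp: B_def\<close>)
  qed
  from this[of j h] j h have "norm (G j (x + h)) \<le> B j * exp (\<kappa> * h)" by simp
  also have "\<dots> \<le> B j * exp 1"
  proof -
    have "\<kappa> * h \<le> 1" unfolding \<kappa>_def using h(2) pos[of N] pos[of "Suc N"] by (simp add: field_simps)
    then show ?thesis using B0[of j] by simp
  qed
  also have "\<dots> = exp (real j - real N) * M j"
    by (simp add: B_def mult.commute mult.left_commute exp_add[symmetric])
  finally show ?thesis .
qed

text \<open>
  A common zero of all \<open>G n\<close> has every level. Descending from level \<open>n + d\<close> to level \<open>n\<close> covers the
  distance \<open>1 / e\<close> times a block of the divergent series, hence reaches \<open>x\<close> for large \<open>d\<close>. So \<open>x\<close> has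
  every level \<open>n\<close>, which means \<open>|G 0 x| \<le> e ^ (- n) M 0\<close>.
\<close>
lemma bang_zero_forward:
  fixes G :: "nat \<Rightarrow> real \<Rightarrow> 'a::real_normed_vector" and M :: "nat \<Rightarrow> real"
  assumes der: "\<And>n x. (G n has_vector_derivative G (Suc n) x) (at x)"
    and bound: "\<And>n x. norm (G n x) \<le> M n"
    and pos: "\<And>n. M n > 0" and convex: "incseq (\<lambda>n. M (Suc n) / M n)"
    and div: "\<not> summable (\<lambda>n. M n / M (Suc n))"
    and zero: "\<And>n. G n x0 = 0" and x: "x0 \<le> x"
  shows "G 0 x = 0"
proof -
  have propagate: "norm (G j (y + h)) \<le> exp (real j - real n) * M j"
    if "\<And>j. j \<le> n + d \<Longrightarrow> norm (G j y) \<le> exp (real j - real (n + d)) * M j"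
      "0 \<le> h" "h \<le> (\<Sum>i=n..<n + d. M i / M (Suc i)) / exp 1" "j \<le> n" for d n y h j
    using that
  proof (induction d arbitrary: y h)
    case (Suc d)
    define a where "a = M (n + d) / M (Suc (n + d)) / exp 1"
    have a: "a \<ge> 0" using pos by (simp add: a_def less_imp_le)
    define h1 where "h1 = min h a"
    have h1: "0 \<le> h1" "h1 \<le> M (n + d) / M (Suc (n + d)) / exp 1"
      unfolding a_def[symmetric] using Suc.prems(2) a by (auto simp: h1_def)
    have 1: "norm (G i (y + h1)) \<le> exp (real i - real (n + d)) * M i" if "i \<le> n + d" for i
      by (rule bang_step[OF der bound pos convex, where N = "n + d"])
        (use Suc.prems(1) h1 that in simp_all)
    have "norm (G j ((y + h1) + (h - h1))) \<le> exp (real j - real n) * M j"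
    proof (rule Suc.IH[OF 1])
      show "h - h1 \<le> (\<Sum>i=n..<n + d. M i / M (Suc i)) / exp 1"
      proof -
        have "0 \<le> (\<Sum>i=n..<n + d. M i / M (Suc i)) / exp 1"
          using pos by (intro divide_nonneg_pos sum_nonneg) (auto intro: less_imp_le)
        then show ?thesis using Suc.prems(3) by (auto simp: h1_def a_def min_def add_divide_distrib)
      qed
    qed (use Suc.prems in \<open>auto simp: h1_def\<close>)
    then show ?case by simp
  qed auto
  have "norm (G 0 x) \<le> exp (- real n) * M 0" for n
  proof -
    have "\<exists>d. (x - x0) * exp 1 \<le> (\<Sum>i=n..<n + d. M i / M (Suc i))"
    proof (rule ccontr)
      assume "\<not> ?thesis"
      then have le: "(\<Sum>i=n..<n + d. M i / M (Suc i)) \<le> (x - x0) * exp 1" for d by (meson linear)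
      have "(\<Sum>i<d. M (i + n) / M (Suc (i + n))) \<le> (x - x0) * exp 1" for d
        using le[of d] sum.shift_bounds_nat_ivl[of "\<lambda>i. M i / M (Suc i)" 0 n d]
        by (simp add: lessThan_atLeast0 add.commute)
      then have "summable (\<lambda>i. M (i + n) / M (Suc (i + n)))"
        by (intro summableI_nonneg_bounded[where x = "(x - x0) * exp 1"]) (use pos in \<open>auto intro!: less_imp_le\<close>)
      then show False using div summable_iff_shift[of "\<lambda>n. M n / M (Suc n)" n] by simp
    qed
    then obtain d where "(x - x0) * exp 1 \<le> (\<Sum>i=n..<n + d. M i / M (Suc i))" by blast
    then have "x - x0 \<le> (\<Sum>i=n..<n + d. M i / M (Suc i)) / exp 1" by (simp add: field_simps)
    from propagate[OF _ _ this, of x0 0] show ?thesis using x zero pos by (simp add: less_imp_le)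
  qed
  then have "norm (G 0 x) \<le> 0"
  proof (intro LIMSEQ_le_const)
    have "(\<lambda>n. exp (-1) ^ n * M 0) \<longlonglongrightarrow> 0 * M 0"
      by (intro tendsto_mult LIMSEQ_power_zero tendsto_const) auto
    then show "(\<lambda>n. exp (- real n) * M 0) \<longlonglongrightarrow> 0"
      by (simp add: exp_of_nat_mult[symmetric])
  qed auto
  then show ?thesis by simp
qed

text \<open>
  Points to the left of the zero are reached by reflecting the line.
\<close>
theorem denjoy_carleman_bang:
  fixes G :: "nat \<Rightarrow> real \<Rightarrow> 'a::real_normed_vector" and M :: "nat \<Rightarrow> real"
  assumes der: "\<And>n x. (G n has_vector_derivative G (Suc n) x) (at x)"
    and bound: "\<And>n x. norm (G n x) \<le> M n"
    and pos: "\<And>n. M n > 0" and convex: "incseq (\<lambda>n. M (Suc n) / M n)"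
    and div: "\<not> summable (\<lambda>n. M n / M (Suc n))"
    and zero: "\<And>n. G n x0 = 0"
  shows "G 0 x = 0"
proof (cases "x0 \<le> x")
  case True
  then show ?thesis using bang_zero_forward[OF assms] by blast
next
  case False
  define G' where "G' n y = (-1) ^ n *\<^sub>R G n (- y)" for n y
  have "G' 0 (- x) = 0"
  proof (rule bang_zero_forward[where M = M and ?x0.0 = "- x0"])
    fix n y
    have neg: "((\<lambda>y. - y) has_vector_derivative - 1) (at y)" for y :: real
      by (auto intro!: derivative_eq_intros)
    from vector_diff_chain_at[OF neg der[of n "- y"]]
    have "((\<lambda>y. G n (- y)) has_vector_derivative - G (Suc n) (- y)) (at y)" by (simp add: o_def)
    then have "((\<lambda>y. (-1) ^ n *\<^sub>R G n (- y)) has_vector_derivative (-1) ^ n *\<^sub>R - G (Suc n) (- y)) (at y)"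
      by (rule bounded_linear.has_vector_derivative[OF bounded_linear_scaleR_right])
    then show "(G' n has_vector_derivative G' (Suc n) y) (at y)" unfolding G'_def by simp
    show "norm (G' n y) \<le> M n" using bound by (simp add: G'_def power_abs)
    show "G' n (- x0) = 0" using zero by (simp add: G'_def)
  qed (use pos convex div False in auto)
  then show ?thesis by (simp add: G'_def)
qed

text \<open>
  The terms vanish while \<open>2 ^ k a < 1\<close>; afterwards they are geometric up to a factor linear in \<open>k\<close>, so the sum is of the order of
  \<open>2 ^ (- k)\<close> for the first such \<open>k\<close>, which is at most \<open>a\<close>. The induction carries a bound for the remainder.
\<close>
lemma dyadic_log_sum_le:
  fixes a :: real assumes a: "a > 0"
  shows "(\<Sum>k<K. max 0 (ln (2 ^ k * a)) / 2 ^ k) \<le> 4 * a"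
proof -
  have "(\<Sum>k<Suc K. max 0 (ln (2 ^ k * a)) / 2 ^ k) \<le>
      (if 2 ^ K * a < 1 then 0 else 4 * a - (ln (2 ^ K * a) + 2) / 2 ^ K)" for K
  proof (induction K)
    case 0
    show ?case using a ln_le_minus_one[of a] by (auto simp: max_def)
  next
    case (Suc K)
    have ln: "ln (2 ^ Suc K * a) = ln 2 + ln (2 ^ K * a)" using a by (simp add: ln_mult)
    consider "2 ^ Suc K * a < 1" | "2 ^ K * a < 1" "2 ^ Suc K * a \<ge> 1" | "2 ^ K * a \<ge> 1" by linarith
    then show ?case
    proof cases
      case 1
      then have "2 ^ K * a < 1" using a by (simp add: less_le_trans[of "2 ^ K * a" "2 * (2 ^ K * a)"])
      then show ?thesis using Suc 1 a by simp
    next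
      case 2
      define x where "x = 2 ^ Suc K * a"
      have x: "x \<ge> 1" using 2 by (simp add: x_def)
      have "(\<Sum>k<Suc (Suc K). max 0 (ln (2 ^ k * a)) / 2 ^ k) \<le> 0 + ln x / 2 ^ Suc K"
        using Suc 2 x unfolding sum.lessThan_Suc[of _ "Suc K"] x_def[symmetric] by (intro add_mono) auto
      also have "\<dots> \<le> (4 * x - (ln x + 2)) / 2 ^ Suc K"
        using ln_le_minus_one[of x] x by (intro divide_right_mono[of "ln x" "4 * x - (ln x + 2)", THEN order_trans[rotated]]) auto
      also have "\<dots> = 4 * a - (ln x + 2) / 2 ^ Suc K" by (simp add: x_def diff_divide_distrib)
      finally show ?thesis using 2 by (simp add: x_def)
    next
      case 3
      then have c3: "2 ^ Suc K * a \<ge> 1" using a by simp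
      define L where "L = ln (2 ^ K * a)"
      have L: "L \<ge> 0" using 3 by (simp add: L_def)
      have "(\<Sum>k<Suc (Suc K). max 0 (ln (2 ^ k * a)) / 2 ^ k) \<le> 4 * a - (L + 2) / 2 ^ K + (ln 2 + L) / 2 ^ Suc K"
        using Suc 3 L ln unfolding sum.lessThan_Suc[of _ "Suc K"] L_def[symmetric] by (intro add_mono) (auto simp: L_def[symmetric])
      also have "\<dots> = 4 * a - (L + 4 - ln 2) / 2 ^ Suc K" by (simp add: field_simps)
      also have "\<dots> \<le> 4 * a - (ln 2 + L + 2) / 2 ^ Suc K"
        using ln_le_minus_one[of "2::real"] by (intro diff_left_mono divide_right_mono) auto
      finally show ?thesis using c3 ln by (simp add: L_def)
    qed
  qed
  moreover have "(\<Sum>k<K. max 0 (ln (2 ^ k * a)) / 2 ^ k) \<le> (\<Sum>k<Suc K. max 0 (ln (2 ^ k * a)) / 2 ^ k)" by simp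
  moreover have "(if 2 ^ K * a < 1 then 0 else 4 * a - (ln (2 ^ K * a) + 2) / 2 ^ K) \<le> 4 * a"
    using a by (auto intro!: divide_nonneg_pos)
  ultimately show ?thesis by (meson order_trans)
qed

text \<open>
  With \<open>a j = M j / M (j + 1)\<close>, smallness of \<open>M (n k)\<close> says that the product of the \<open>2 ^ k a j\<close> over
  \<open>j < n k\<close> is at least \<open>e ^ n k M 0\<close>. Taking logarithms, dividing by \<open>2 ^ k\<close> and exchanging the sums
  over \<open>j\<close> and \<open>k\<close> bounds \<open>\<Sum>k. n k / 2 ^ k\<close> by \<open>4 \<Sum>j. a j\<close> plus a constant.
\<close>
lemma ratio_series_diverges:
  fixes M :: "nat \<Rightarrow> real" and n :: "nat \<Rightarrow> nat"
  assumes pos: "\<And>n. M n > 0"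
    and small: "\<And>k. k \<ge> k0 \<Longrightarrow> M (n k) \<le> exp (- real (n k)) * (2 ^ k) ^ n k"
    and div: "\<not> summable (\<lambda>k. real (n k) / 2 ^ k)"
  shows "\<not> summable (\<lambda>j. M j / M (Suc j))"
proof
  define a where "a j = M j / M (Suc j)" for j
  have a: "a j > 0" for j using pos by (simp add: a_def)
  assume "summable (\<lambda>j. M j / M (Suc j))"
  then have sm: "summable a" by (simp add: a_def[abs_def])
  define L where "L k j = max 0 (ln (2 ^ k * a j)) / 2 ^ k" for k j
  have telescope: "(\<Prod>j<n. 2 ^ k * a j) = (2 ^ k) ^ n * M 0 / M n" for n k
    using pos by (induction n) (auto simp: a_def less_imp_neq[THEN not_sym] field_simps)
  have step: "real (n k) / 2 ^ k \<le> (\<Sum>j<n k. L k j) + \<bar>ln (M 0)\<bar> / 2 ^ k" if "k \<ge> k0" for k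
  proof -
    have "exp (real (n k)) * M 0 \<le> (2 ^ k) ^ n k * M 0 / M (n k)"
      using small[OF that] pos[of "n k"] pos[of 0] by (simp add: exp_minus field_simps)
    then have "exp (real (n k)) * M 0 \<le> (\<Prod>j<n k. 2 ^ k * a j)" by (simp add: telescope)
    then have "ln (exp (real (n k)) * M 0) \<le> ln (\<Prod>j<n k. 2 ^ k * a j)"
      using pos[of 0] a by (subst ln_le_cancel_iff) (auto intro!: prod_pos)
    then have "real (n k) + ln (M 0) \<le> (\<Sum>j<n k. ln (2 ^ k * a j))"
      using pos[of 0] a less_imp_neq[OF a, THEN not_sym] by (simp add: ln_mult ln_prod)
    also have "\<dots> \<le> (\<Sum>j<n k. max 0 (ln (2 ^ k * a j)))" by (intro sum_mono) auto
    finally have "real (n k) \<le> (\<Sum>j<n k. max 0 (ln (2 ^ k * a j))) + \<bar>ln (M 0)\<bar>" by linarith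
    then show ?thesis
      by (simp add: L_def sum_divide_distrib[symmetric] add_divide_distrib[symmetric] divide_right_mono)
  qed
  have "(\<Sum>k<K. real (n (k + k0)) / 2 ^ (k + k0)) \<le> 4 * suminf a + 2 * \<bar>ln (M 0)\<bar>" for K
  proof -
    define J where "J = Suc (Max ((\<lambda>k. n (k + k0)) ` {..K}))"
    have J: "n (k + k0) \<le> J" if "k < K" for k
      unfolding J_def using that by (intro le_SucI Max_ge) auto
    have L0: "L k j \<ge> 0" for k j by (simp add: L_def)
    have "(\<Sum>k<K. real (n (k + k0)) / 2 ^ (k + k0)) \<le> (\<Sum>k<K. (\<Sum>j<J. L (k + k0) j) + \<bar>ln (M 0)\<bar> / 2 ^ k)"
    proof (rule sum_mono)
      fix k assume k: "k \<in> {..<K}"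
      have "real (n (k + k0)) / 2 ^ (k + k0) \<le> (\<Sum>j<n (k + k0). L (k + k0) j) + \<bar>ln (M 0)\<bar> / 2 ^ (k + k0)"
        by (rule step) simp
      also have "\<dots> \<le> (\<Sum>j<J. L (k + k0) j) + \<bar>ln (M 0)\<bar> / 2 ^ k"
        using J[of k] k L0 by (intro add_mono sum_mono2 divide_left_mono power_increasing) auto
      finally show "real (n (k + k0)) / 2 ^ (k + k0) \<le> (\<Sum>j<J. L (k + k0) j) + \<bar>ln (M 0)\<bar> / 2 ^ k" .
    qed
    also have "\<dots> = (\<Sum>k<K. \<Sum>j<J. L (k + k0) j) + \<bar>ln (M 0)\<bar> * (\<Sum>k<K. (1/2) ^ k)"
      by (simp add: sum.distrib sum_distrib_left power_divide)
    also have "(\<Sum>k<K. \<Sum>j<J. L (k + k0) j) = (\<Sum>j<J. \<Sum>k<K. L (k + k0) j)" by (rule sum.swap)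
    also have "\<dots> \<le> (\<Sum>j<J. 4 * a j)"
    proof (rule sum_mono)
      fix j
      have "(\<Sum>k<K. L (k + k0) j) = (\<Sum>k=k0..<K + k0. L k j)"
        using sum.shift_bounds_nat_ivl[of "\<lambda>k. L k j" 0 k0 K] by (simp add: lessThan_atLeast0)
      also have "\<dots> \<le> (\<Sum>k<K + k0. L k j)" using L0 by (intro sum_mono2) auto
      also have "\<dots> \<le> 4 * a j" unfolding L_def by (rule dyadic_log_sum_le[OF a])
      finally show "(\<Sum>k<K. L (k + k0) j) \<le> 4 * a j" .
    qed
    also have "\<dots> = 4 * (\<Sum>j<J. a j)" by (simp add: sum_distrib_left)
    also have "\<dots> \<le> 4 * suminf a" using a by (intro mult_left_mono sum_le_suminf sm) (auto intro: less_imp_le)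
    finally have "(\<Sum>k<K. real (n (k + k0)) / 2 ^ (k + k0)) \<le>
        4 * suminf a + \<bar>ln (M 0)\<bar> * (\<Sum>k<K. (1/2) ^ k)" by simp
    moreover have "(\<Sum>k<K. (1/2::real) ^ k) \<le> 2"
    proof -
      have "(\<Sum>k<K. (1/2::real) ^ k) \<le> (\<Sum>k. (1/2) ^ k)" by (intro sum_le_suminf summable_geometric) auto
      also have "\<dots> = 2" by (subst suminf_geometric) auto
      finally show ?thesis .
    qed
    then have "\<bar>ln (M 0)\<bar> * (\<Sum>k<K. (1/2) ^ k) \<le> \<bar>ln (M 0)\<bar> * 2" by (intro mult_left_mono) auto
    ultimately show ?thesis by linarith
  qed
  then have "summable (\<lambda>k. real (n (k + k0)) / 2 ^ (k + k0))"
    by (intro summableI_nonneg_bounded) auto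
  then show False using div summable_iff_shift[of "\<lambda>k. real (n k) / 2 ^ k" k0] by simp
qed

section \<open>Weights with divergent logarithmic integral\<close>

text \<open>
  Between \<open>b ^ k\<close> and \<open>b ^ (k + 1)\<close> the integrand is at most \<open>\<theta> (b ^ k) / b ^ k\<close>.
\<close>
lemma antimono_integral_imp_not_summable:
  fixes \<theta> :: "real \<Rightarrow> real"
  assumes \<theta>0: "\<And>s. 0 \<le> s \<Longrightarrow> 0 \<le> \<theta> s" and \<theta>m: "antimono_on {0..} \<theta>"
    and div: "(\<integral>\<^sup>+ r\<in>{1..}. ennreal (\<theta> r / r) \<partial>lborel) = \<infinity>" and b: "b > 1"
  shows "\<not> summable (\<lambda>k::nat. \<theta> (b ^ k))"
proof
  assume sm: "summable (\<lambda>k::nat. \<theta> (b ^ k))"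
  have bp: "b ^ k > 0" for k :: nat using b by simp
  have t0: "\<theta> (b ^ k) \<ge> 0" for k :: nat using bp[of k] by (intro \<theta>0) simp
  have "(\<integral>\<^sup>+ r\<in>{1..}. ennreal (\<theta> r / r) \<partial>lborel) \<le>
      (\<integral>\<^sup>+ r. (\<Sum>k. ennreal (\<theta> (b ^ k) / b ^ k) * indicator {b ^ k..b ^ Suc k} r) \<partial>lborel)"
  proof (rule nn_integral_mono)
    fix r :: real
    show "ennreal (\<theta> r / r) * indicator {1..} r \<le>
      (\<Sum>k. ennreal (\<theta> (b ^ k) / b ^ k) * indicator {b ^ k..b ^ Suc k} r)"
    proof (cases "r \<ge> 1")
      case True
      define k where "k = nat \<lfloor>log b r\<rfloor>"
      have l0: "log b r \<ge> 0" using True b by simp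
      have "real k \<le> log b r" "log b r \<le> real (Suc k)"
        unfolding k_def using l0 by linarith+
      then have "b powr real k \<le> r" "r \<le> b powr real (Suc k)"
        using True b by (auto simp: le_log_iff log_le_iff)
      then have k: "b ^ k \<le> r" "r \<le> b ^ Suc k"
        using b by (auto simp: powr_realpow simp del: power_Suc of_nat_Suc)
      have "\<theta> r / r \<le> \<theta> (b ^ k) / b ^ k"
        using k bp[of k] True t0[of k] \<theta>0[of r] by (intro frac_le monotone_onD[OF \<theta>m]) auto
      define F where "F j = ennreal (\<theta> (b ^ j) / b ^ j) * indicator {b ^ j..b ^ Suc j} r" for j
      from \<open>\<theta> r / r \<le> \<theta> (b ^ k) / b ^ k\<close> have "ennreal (\<theta> r / r) * indicator {1..} r \<le> F k"
        using True k by (simp add: ennreal_leI F_def)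
      also have "\<dots> \<le> (\<Sum>k. F k)" using sum_le_suminf[of F "{k}"] by simp
      finally show ?thesis by (simp only: F_def)
    qed simp
  qed
  also have "\<dots> = (\<Sum>k. (\<integral>\<^sup>+ r. ennreal (\<theta> (b ^ k) / b ^ k) * indicator {b ^ k..b ^ Suc k} r \<partial>lborel))"
    by (rule nn_integral_suminf) auto
  also have "\<dots> = (\<Sum>k. ennreal (\<theta> (b ^ k) * (b - 1)))"
  proof (rule suminf_cong)
    fix k :: nat
    have "b ^ Suc k - b ^ k = (b - 1) * b ^ k" by (simp add: algebra_simps)
    moreover have "b ^ k \<le> b ^ Suc k" using b by (intro power_increasing) auto
    ultimately show "(\<integral>\<^sup>+ r. ennreal (\<theta> (b ^ k) / b ^ k) * indicator {b ^ k..b ^ Suc k} r \<partial>lborel) =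
        ennreal (\<theta> (b ^ k) * (b - 1))"
      using bp[of k] t0[of k] b by (simp add: nn_integral_cmult_indicator ennreal_mult'[symmetric] del: power_Suc)
  qed
  also have "\<dots> = ennreal (\<Sum>k. \<theta> (b ^ k) * (b - 1))"
    using t0 b sm by (intro suminf_ennreal2 summable_mult2) auto
  also have "\<dots> < \<infinity>" by simp
  finally show False using div by simp
qed

lemma power_le_exp_sqrt:
  fixes c :: real assumes c: "c > 0"
  shows "\<exists>K. \<forall>r\<ge>0. r ^ n * exp (- (c * sqrt r)) \<le> K"
proof (cases "n = 0")
  case True
  have "r ^ n * exp (- (c * sqrt r)) \<le> 1" if "r \<ge> 0" for r
    using True c that by simp
  then show ?thesis by blast
next
  case False
  define N where "N = 2 * n"
  have N: "N > 0" using False by (simp add: N_def)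
  have "r ^ n * exp (- (c * sqrt r)) \<le> (N / c) ^ N" if r: "r \<ge> 0" for r
  proof -
    have "(c * sqrt r / N) ^ N \<le> (1 + c * sqrt r / N) ^ N" using c r by (intro power_mono) auto
    also have "\<dots> \<le> exp (c * sqrt r)"
      by (rule exp_ge_one_plus_x_over_n_power_n) (use c r N in \<open>auto intro: order_trans[of _ 0]\<close>)
    finally have 1: "(c * sqrt r / N) ^ N \<le> exp (c * sqrt r)" .
    have "r ^ n = sqrt r ^ N" using r by (simp add: N_def power_mult)
    also have "\<dots> = (N / c) ^ N * (c * sqrt r / N) ^ N"
      unfolding power_mult_distrib[symmetric] using c N by simp
    also have "\<dots> \<le> (N / c) ^ N * exp (c * sqrt r)" using 1 c by (intro mult_left_mono) auto
    finally show ?thesis by (simp add: exp_minus field_simps)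
  qed
  then show ?thesis by blast
qed

text \<open>
  The moments \<open>M n = sup r ^ n exp (- W r)\<close> with \<open>W r = r \<theta> r + c \<surd>r\<close> are logarithmically convex, being a
  supremum of geometric progressions. For \<open>\<sigma> = 2 ^ k\<close> and \<open>n = \<lfloor>\<sigma> \<theta> (\<sigma> ^ 8)\<rfloor>\<close> one has
  \<open>n (ln (r / \<sigma>) + 1) \<le> W r\<close> for every \<open>r\<close>, that is, \<open>M n \<le> (\<sigma> / e) ^ n\<close>. Up to \<open>r = \<sigma> ^ 8\<close> this holds because
  \<open>ln (r / \<sigma>) + 1 \<le> r / \<sigma>\<close> and \<open>\<theta>\<close> decreases; beyond, the term \<open>c \<surd>r\<close> wins once \<open>\<sigma>\<close> is large. The same
  term makes all moments finite. The base 256 is \<open>2 ^ 8\<close>.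
\<close>
lemma weighted_moments:
  fixes \<theta> :: "real \<Rightarrow> real"
  assumes \<theta>0: "\<And>s. 0 \<le> s \<Longrightarrow> 0 \<le> \<theta> s" and \<theta>m: "antimono_on {0..} \<theta>"
    and div: "\<not> summable (\<lambda>k::nat. \<theta> (256 ^ k))" and c: "c > 0"
  obtains M :: "nat \<Rightarrow> real" where "\<And>n. M n > 0"
    "\<And>n r. r \<ge> 0 \<Longrightarrow> r ^ n * exp (- (r * \<theta> r + c * sqrt r)) \<le> M n"
    "incseq (\<lambda>n. M (Suc n) / M n)" "\<not> summable (\<lambda>n. M n / M (Suc n))"
proof -
  define W where "W r = r * \<theta> r + c * sqrt r" for r
  define M where "M n = (SUP r\<in>{0..}. r ^ n * exp (- W r))" for n
  have W: "W r \<ge> c * sqrt r" if "r \<ge> 0" for r using \<theta>0[OF that] that by (simp add: W_def)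
  have bdd: "bdd_above ((\<lambda>r. r ^ n * exp (- W r)) ` {0..})" for n
  proof -
    obtain K where K: "\<forall>r\<ge>0. r ^ n * exp (- (c * sqrt r)) \<le> K" using power_le_exp_sqrt[OF c] by blast
    have "r ^ n * exp (- W r) \<le> K" if "r \<ge> 0" for r
    proof -
      have "r ^ n * exp (- W r) \<le> r ^ n * exp (- (c * sqrt r))"
        using W[OF that] that by (intro mult_left_mono) auto
      then show ?thesis using K that by (meson order_trans)
    qed
    then show ?thesis by (intro bdd_aboveI2[where M = K]) auto
  qed
  have le: "r ^ n * exp (- W r) \<le> M n" if "r \<ge> 0" for r n
    unfolding M_def by (rule cSUP_upper[OF _ bdd]) (use that in auto)
  have pos: "M n > 0" for n
  proof -
    have "exp (- W 1) \<le> M n" using le[of 1 n] by simp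
    then show ?thesis using exp_gt_zero[of "- W 1"] by linarith
  qed
  have convex: "M (Suc n) * M (Suc n) \<le> M n * M (Suc (Suc n))" for n
  proof -
    have "M (Suc n) \<le> sqrt (M n * M (Suc (Suc n)))"
      unfolding M_def[of "Suc n"]
    proof (rule cSUP_least)
      fix r :: real assume "r \<in> {0..}"
      then have r: "r \<ge> 0" by simp
      have "(r ^ Suc n * exp (- W r))\<^sup>2 = (r ^ n * exp (- W r)) * (r ^ Suc (Suc n) * exp (- W r))"
        by (simp add: power2_eq_square)
      also have "\<dots> \<le> M n * M (Suc (Suc n))"
        using r by (intro mult_mono le) (auto intro: less_imp_le[OF pos])
      finally show "r ^ Suc n * exp (- W r) \<le> sqrt (M n * M (Suc (Suc n)))" by (rule real_le_rsqrt)
    qed auto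
    then have "(M (Suc n))\<^sup>2 \<le> (sqrt (M n * M (Suc (Suc n))))\<^sup>2"
      using pos by (intro power_mono) (auto intro: less_imp_le)
    then show ?thesis using pos[of n] pos[of "Suc (Suc n)"] by (simp add: power2_eq_square[symmetric])
  qed
  define n where "n k = nat \<lfloor>2 ^ k * \<theta> (256 ^ k)\<rfloor>" for k :: nat
  have small: "M (n k) \<le> exp (- real (n k)) * (2 ^ k) ^ n k" if k: "2 ^ k \<ge> 4 * \<theta> 0 / c" for k
  proof -
    define \<sigma> :: real where "\<sigma> = 2 ^ k"
    have \<sigma>: "\<sigma> \<ge> 1" by (simp add: \<sigma>_def)
    have \<sigma>8: "256 ^ k = \<sigma> ^ 8" by (simp add: \<sigma>_def power_mult[symmetric] mult.commute[of k] power_mult)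
    have \<theta>s: "\<theta> (256 ^ k) \<ge> 0" by (rule \<theta>0) simp
    have nle: "real (n k) \<le> \<sigma> * \<theta> (\<sigma> ^ 8)"
      unfolding n_def \<sigma>_def[symmetric] \<sigma>8[symmetric] using \<theta>s \<sigma> by (simp add: of_nat_nat)
    have "r ^ n k * exp (- W r) \<le> exp (- real (n k)) * \<sigma> ^ n k" if r: "r \<ge> 0" for r
    proof (cases "r = 0 \<or> n k = 0")
      case True
      have "0 \<le> W r" using c r by (intro order_trans[OF _ W[OF r]]) simp
      then show ?thesis using True \<sigma> by (cases "n k = 0") (auto simp: power_0_left)
    next
      case False
      then have r: "r > 0" using r by simp
      have "n k * (ln (r / \<sigma>) + 1) \<le> W r"
      proof (cases "r \<le> \<sigma> ^ 8")
        case True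
        have "ln (r / \<sigma>) + 1 \<le> r / \<sigma>" using ln_le_minus_one[of "r / \<sigma>"] r \<sigma> by simp
        then have "n k * (ln (r / \<sigma>) + 1) \<le> n k * (r / \<sigma>)" by (intro mult_left_mono) auto
        also have "\<dots> \<le> \<sigma> * \<theta> (\<sigma> ^ 8) * (r / \<sigma>)" using nle r \<sigma> by (intro mult_right_mono) auto
        also have "\<dots> = r * \<theta> (\<sigma> ^ 8)" using \<sigma> by simp
        also have "\<dots> \<le> r * \<theta> r"
          using True r by (intro mult_left_mono monotone_onD[OF \<theta>m]) auto
        also have "\<dots> \<le> W r" using c r by (simp add: W_def)
        finally show ?thesis .
      next
        case False
        \<comment> \<open>Writing \<open>r = q ^ 4\<close> makes \<open>ln r = 4 ln q\<close> at most of order \<open>q\<close>, while \<open>\<surd>r = q\<^sup>2 \<ge> \<sigma>\<^sup>2 q\<close>.\<close>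
        define q where "q = sqrt (sqrt r)"
        have q: "q > 0" "sqrt r = q\<^sup>2" "r = q ^ 4"
        proof -
          show "q > 0" and q2: "sqrt r = q\<^sup>2" using r by (auto simp: q_def)
          have "q ^ 4 = (q\<^sup>2)\<^sup>2" by (simp flip: power_mult)
          then have "q ^ 4 = (sqrt r)\<^sup>2" by (simp only: q2)
          then show "r = q ^ 4" using r by simp
        qed
        have "\<sigma>\<^sup>2 \<le> q"
        proof (rule power_le_imp_le_base)
          show "(\<sigma>\<^sup>2) ^ Suc 3 \<le> q ^ Suc 3" using False q by (simp flip: power_mult)
        qed (use q in simp)
        have "ln (r / \<sigma>) + 1 \<le> ln r + 1" using r \<sigma> by (simp add: ln_div)
        also have "ln r = 4 * ln q" using q by (simp add: ln_realpow)
        also have "4 * ln q + 1 \<le> 4 * q" using ln_le_minus_one[of q] q by simp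
        finally have "n k * (ln (r / \<sigma>) + 1) \<le> n k * (4 * q)" by (intro mult_left_mono) auto
        also have "\<dots> \<le> \<sigma> * \<theta> 0 * (4 * q)"
        proof (intro mult_right_mono)
          have "\<theta> (\<sigma> ^ 8) \<le> \<theta> 0" using \<sigma> by (intro monotone_onD[OF \<theta>m]) auto
          then show "real (n k) \<le> \<sigma> * \<theta> 0" using nle \<sigma> by (smt (verit) mult_left_mono)
        qed (use q in auto)
        also have "\<dots> = (4 * \<theta> 0) * \<sigma> * q" by simp
        also have "\<dots> \<le> (c * \<sigma>) * \<sigma> * q"
          using k c q \<sigma> by (intro mult_right_mono) (auto simp: \<sigma>_def[symmetric] field_simps)
        also have "\<dots> \<le> c * q * q" using \<open>\<sigma>\<^sup>2 \<le> q\<close> c q by (simp add: power2_eq_square)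
        also have "\<dots> = c * sqrt r" using q by (simp add: power2_eq_square)
        also have "\<dots> \<le> W r" using W r by simp
        finally show ?thesis .
      qed
      then have "n k * ln r - W r \<le> n k * ln \<sigma> - n k" using r \<sigma> by (simp add: ln_div algebra_simps)
      then have "exp (n k * ln r - W r) \<le> exp (n k * ln \<sigma> - n k)" by simp
      moreover have "exp (n k * ln r) = r ^ n k" "exp (n k * ln \<sigma>) = \<sigma> ^ n k"
        using r \<sigma> by (simp_all add: exp_of_nat_mult)
      ultimately show ?thesis by (simp add: exp_diff exp_minus divide_inverse mult.commute)
    qed
    then show ?thesis unfolding M_def \<sigma>_def[symmetric] by (intro cSUP_least) auto
  qed
  obtain k0 :: nat where k0: "4 * \<theta> 0 / c < 2 ^ k0" using real_arch_pow[of 2] by auto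
  have "\<not> summable (\<lambda>j. M j / M (Suc j))"
  proof (rule ratio_series_diverges[OF pos])
    show "M (n k) \<le> exp (- real (n k)) * (2 ^ k) ^ n k" if "k \<ge> k0" for k
      by (intro small) (use k0 power_increasing[OF that, of "2::real"] in linarith)
    show "\<not> summable (\<lambda>k. real (n k) / 2 ^ k)"
    proof
      assume "summable (\<lambda>k. real (n k) / 2 ^ k)"
      then have "summable (\<lambda>k. real (n k) / 2 ^ k + (1/2) ^ k)"
        by (intro summable_add summable_geometric) auto
      then have "summable (\<lambda>k. \<theta> (256 ^ k))"
      proof (rule summable_comparison_test'[where N = 0])
        fix k :: nat
        have \<theta>s: "\<theta> (256 ^ k) \<ge> 0" by (rule \<theta>0) simp
        have "2 ^ k * \<theta> (256 ^ k) \<le> real (n k) + 1" unfolding n_def using \<theta>s by linarith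
        then show "norm (\<theta> (256 ^ k)) \<le> real (n k) / 2 ^ k + (1/2) ^ k"
          using \<theta>s by (simp add: power_divide field_simps)
      qed
      then show False using div by simp
    qed
  qed
  moreover have "incseq (\<lambda>n. M (Suc n) / M n)"
  proof (rule incseq_SucI)
    fix n
    show "M (Suc n) / M n \<le> M (Suc (Suc n)) / M (Suc n)"
      using convex[of n] pos[of n] pos[of "Suc n"] by (simp add: field_simps)
  qed
  ultimately show ?thesis using that pos le unfolding W_def by blast
qed

text \<open>
  The product of squared cosines with the summable frequencies \<open>1 / (j + 1)\<^sup>2\<close>: as a finite trigonometric
  sum it is a multiplier that moves Fourier transforms by a bounded distance, whatever \<open>N\<close> is, and yet its limit decays
  exponentially in \<open>\<surd>|x|\<close>.
\<close>
definition cosine_product :: "nat \<Rightarrow> real \<Rightarrow> real" where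
  "cosine_product N x = (\<Prod>j<N. (cos (x / (real (Suc j))\<^sup>2))\<^sup>2)"

lemma cos_sq_le_one: "(cos x)\<^sup>2 \<le> (1::real)"
  by (simp add: abs_square_le_1)

lemma cosine_product_bounds: "0 \<le> cosine_product N x" "cosine_product N x \<le> 1"
  by (auto simp: cosine_product_def intro!: prod_nonneg prod_le_1 cos_sq_le_one)

lemma cosine_product_decseq: "decseq (\<lambda>N. cosine_product N x)"
proof (rule decseq_SucI)
  fix N
  show "cosine_product (Suc N) x \<le> cosine_product N x"
    using mult_left_mono[OF cos_sq_le_one cosine_product_bounds(1)[of N x]]
    by (simp add: cosine_product_def)
qed

definition cosine_weight :: "real \<Rightarrow> real" where
  "cosine_weight x = lim (\<lambda>N. cosine_product N x)"

lemma cosine_product_LIMSEQ: "(\<lambda>N. cosine_product N x) \<longlonglongrightarrow> cosine_weight x"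
proof -
  have "convergent (\<lambda>N. cosine_product N x)"
    using decseq_convergent[OF cosine_product_decseq, of 0 x] cosine_product_bounds by (metis convergentI)
  then show ?thesis by (simp add: cosine_weight_def convergent_LIMSEQ_iff)
qed

lemma cosine_weight_le: "cosine_weight x \<le> cosine_product N x"
  by (rule decseq_ge[OF cosine_product_decseq cosine_product_LIMSEQ])

lemma cosine_weight_bounds: "0 \<le> cosine_weight x" "cosine_weight x \<le> 1"
proof -
  show "0 \<le> cosine_weight x"
    by (rule LIMSEQ_le_const[OF cosine_product_LIMSEQ]) (use cosine_product_bounds in auto)
  show "cosine_weight x \<le> 1" using cosine_weight_le[of x 0] by (simp add: cosine_product_def)
qed

lemma cosine_product_measurable [measurable]: "cosine_product N \<in> borel_measurable borel"
  unfolding cosine_product_def by measurable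

lemma cosine_weight_measurable [measurable]: "cosine_weight \<in> borel_measurable borel"
  by (rule borel_measurable_LIMSEQ_real[OF cosine_product_LIMSEQ]) measurable

text \<open>
  With \<open>J\<close> about \<open>\<surd>|x|\<close>, each factor with \<open>J \<le> j < 2 J\<close> has an argument between \<open>1 / 16\<close> and 1, and is at most
  \<open>1 - 1 / 1024\<close> because \<open>sin (1 / 16) \<ge> 1 / 32\<close>.
\<close>
lemma cosine_weight_decay: "cosine_weight x \<le> exp 1 * exp (- (sqrt \<bar>x\<bar> / 1024))"
proof (cases "\<bar>x\<bar> \<ge> 1")
  case False
  then have "sqrt \<bar>x\<bar> \<le> 1" by simp
  then have "0 \<le> 1 + - (sqrt \<bar>x\<bar> / 1024)" by linarith
  then have "1 \<le> exp (1 + - (sqrt \<bar>x\<bar> / 1024))" by (rule one_le_exp_iff[THEN iffD2])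
  then show ?thesis using cosine_weight_bounds(2)[of x] unfolding exp_add by linarith
next
  case True
  define s where "s = sqrt \<bar>x\<bar>"
  define J where "J = nat \<lceil>s\<rceil>"
  have s: "s \<ge> 1" "\<bar>x\<bar> = s\<^sup>2" using True by (auto simp: s_def)
  have J: "s \<le> real J" "real J \<le> 2 * s" unfolding J_def using s by linarith+
  have "cosine_weight x \<le> cosine_product (2 * J) x" by (rule cosine_weight_le)
  also have "\<dots> \<le> (\<Prod>j<2 * J. if J \<le> j then exp (- (1 / 1024)) else 1)"
    unfolding cosine_product_def
  proof (intro prod_mono conjI zero_le_power2)
    fix j assume j: "j \<in> {..<2 * J}"
    define y where "y = \<bar>x\<bar> / (real (Suc j))\<^sup>2"
    have cy: "(cos (x / (real (Suc j))\<^sup>2))\<^sup>2 = (cos y)\<^sup>2"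
      by (cases "x \<ge> 0") (auto simp: y_def)
    show "(cos (x / (real (Suc j))\<^sup>2))\<^sup>2 \<le> (if J \<le> j then exp (- (1 / 1024)) else 1)"
    proof (cases "J \<le> j")
      case jJ: True
      have sj: "s \<le> real (Suc j)" "real (Suc j) \<le> 4 * s" using j jJ J by auto
      have "s\<^sup>2 / (4 * s)\<^sup>2 \<le> y"
        unfolding y_def s(2) using sj s by (intro divide_left_mono power_mono) auto
      then have y1: "1 / 16 \<le> y" using s by (simp add: power_mult_distrib)
      have y2: "y \<le> 1" unfolding y_def s(2) using sj s by (auto intro!: divide_le_eq_1_pos[THEN iffD2] power_mono)
      have "1 / 32 \<le> sin (1 / 16 :: real)"
      proof -
        have "\<bar>sin (1/16) - (1/16 :: real)\<bar> \<le> 1 / 32"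
          using Maclaurin_sin_bound[of "1/16::real" 3]
          by (simp add: numeral_3_eq_3 sin_coeff_def power_divide)
        then show ?thesis by linarith
      qed
      also have "sin (1 / 16) \<le> sin y"
        using y1 y2 pi_gt3 by (intro sin_monotone_2pi_le) auto
      finally have "(1/32)\<^sup>2 \<le> (sin y)\<^sup>2" by (intro power_mono) auto
      then have "(cos y)\<^sup>2 \<le> 1 - 1 / 1024" by (simp add: cos_squared_eq power_divide)
      also have "\<dots> \<le> exp (- (1 / 1024))" using exp_ge_add_one_self[of "- (1/1024)"] by simp
      finally show ?thesis using jJ cy by simp
    qed (simp add: cos_sq_le_one)
  qed
  also have "\<dots> = (\<Prod>j\<in>{j\<in>{..<2 * J}. J \<le> j}. exp (- (1 / 1024)))"
    by (rule prod.inter_filter[symmetric]) simp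
  also have "{j\<in>{..<2 * J}. J \<le> j} = {J..<2 * J}" by auto
  also have "(\<Prod>j\<in>{J..<2 * J}. exp (- (1 / 1024))) = exp (- (real J / 1024))"
    by (simp add: exp_of_nat_mult[symmetric])
  also have "\<dots> \<le> exp (- (s / 1024))" using J by simp
  also have "\<dots> \<le> exp 1 * exp (- (s / 1024))" by simp
  finally show ?thesis by (simp add: s_def)
qed

lemma one_minus_cosine_product_le: "1 - cosine_product N x \<le> x\<^sup>2 * (\<Sum>j<N. 1 / (real (Suc j))\<^sup>2)"
proof (induction N)
  case (Suc N)
  define y where "y = x / (real (Suc N))\<^sup>2"
  have "1 - cosine_product (Suc N) x = (1 - cosine_product N x) + cosine_product N x * (sin y)\<^sup>2"
  proof -
    have "cosine_product (Suc N) x = cosine_product N x * (cos y)\<^sup>2" by (simp add: cosine_product_def y_def)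
    then show ?thesis by (simp add: cos_squared_eq algebra_simps)
  qed
  also have "cosine_product N x * (sin y)\<^sup>2 \<le> 1 * y\<^sup>2"
    using abs_sin_x_le_abs_x[of y] cosine_product_bounds[of N x]
    by (intro mult_mono) (auto simp: abs_le_square_iff)
  also have "y\<^sup>2 \<le> x\<^sup>2 * (1 / (real (Suc N))\<^sup>2)"
  proof -
    have "1 / ((real (Suc N))\<^sup>2)\<^sup>2 \<le> 1 / (real (Suc N))\<^sup>2"
      by (intro divide_left_mono) (auto simp: power2_eq_square mult_ge1_I)
    then have "x\<^sup>2 * (1 / ((real (Suc N))\<^sup>2)\<^sup>2) \<le> x\<^sup>2 * (1 / (real (Suc N))\<^sup>2)" by (rule mult_left_mono) simp
    then show ?thesis by (simp add: y_def power_divide)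
  qed
  finally show ?case using Suc by (simp add: algebra_simps del: of_nat_Suc)
qed (simp add: cosine_product_def)

lemma summable_inverse_squares: "summable (\<lambda>j. 1 / (real (Suc j))\<^sup>2)"
  using inverse_power_summable[of 2, where ?'a = real] summable_Suc_iff[of "\<lambda>n. inverse (real n ^ 2)"]
  by (simp add: divide_inverse)

lemma cosine_weight_tendsto_1:
  assumes "\<delta> \<longlonglongrightarrow> 0" shows "(\<lambda>n. cosine_weight (\<delta> n * x)) \<longlonglongrightarrow> 1"
proof -
  define Z where "Z = (\<Sum>j. 1 / (real (Suc j))\<^sup>2)"
  have "1 - cosine_weight y \<le> y\<^sup>2 * Z" for y
  proof -
    have "1 - y\<^sup>2 * Z \<le> cosine_product N y" for N
    proof -
      have "(\<Sum>j<N. 1 / (real (Suc j))\<^sup>2) \<le> Z"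
        unfolding Z_def by (rule sum_le_suminf[OF summable_inverse_squares]) auto
      then have "y\<^sup>2 * (\<Sum>j<N. 1 / (real (Suc j))\<^sup>2) \<le> y\<^sup>2 * Z" by (rule mult_left_mono) simp
      then show ?thesis using one_minus_cosine_product_le[of N y] by linarith
    qed
    then have "1 - y\<^sup>2 * Z \<le> cosine_weight y"
      by (intro LIMSEQ_le_const[OF cosine_product_LIMSEQ]) auto
    then show ?thesis by simp
  qed
  then have 1: "1 - (\<delta> n * x)\<^sup>2 * Z \<le> cosine_weight (\<delta> n * x)" for n by (smt (verit))
  show ?thesis
  proof (rule real_tendsto_sandwich[OF _ _ _ tendsto_const])
    show "\<forall>\<^sub>F n in sequentially. 1 - (\<delta> n * x)\<^sup>2 * Z \<le> cosine_weight (\<delta> n * x)" using 1 by simp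
    show "\<forall>\<^sub>F n in sequentially. cosine_weight (\<delta> n * x) \<le> 1" using cosine_weight_bounds by simp
    show "(\<lambda>n. 1 - (\<delta> n * x)\<^sup>2 * Z) \<longlonglongrightarrow> 1" using assms by (auto intro!: tendsto_eq_intros)
  qed
qed

section \<open>Quasianalyticity of Fourier transforms\<close>

lemma norm_cis_diff_le: "norm (cis a - cis b) \<le> \<bar>a - b\<bar>"
proof -
  have "cis a - cis b = cis b * (cis (a - b) - 1)" by (simp add: right_diff_distrib cis_mult)
  then have "norm (cis a - cis b) = norm (cis (a - b) - 1)" by (simp add: norm_mult)
  also have "\<dots> \<le> \<bar>a - b\<bar>" using iexp_approx1[of "a - b" 0] by (simp add: cis_conv_exp)
  finally show ?thesis .
qed

lemma cis_measurable [measurable]: "cis \<in> borel_measurable borel"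
  by (intro borel_measurable_continuous_onI continuous_intros)

lemma has_vector_derivative_cis_linear:
  "((\<lambda>s. cis (- (s * u))) has_vector_derivative - \<i> * of_real u * cis (- (s * u))) (at s)"
proof -
  have "((\<lambda>w. exp (- \<i> * of_real u * w)) has_field_derivative - \<i> * of_real u * exp (- \<i> * of_real u * of_real s))
      (at (of_real s))"
    by (auto intro!: derivative_eq_intros)
  then have "((\<lambda>s. exp (- \<i> * of_real u * of_real s)) has_vector_derivative
      - \<i> * of_real u * exp (- \<i> * of_real u * of_real s)) (at s)"
    by (rule has_vector_derivative_real_field)
  then show ?thesis by (simp add: cis_conv_exp mult_ac)
qed

text \<open>
  Differentiation under the integral sign: a difference quotient of the character differs from its derivative by at most
  \<open>2 |u z|\<close>.
\<close>
lemma has_vector_derivative_fourier_integral: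
  fixes g :: "'a::euclidean_space \<Rightarrow> complex" and u :: "'a \<Rightarrow> real"
  assumes [measurable]: "u \<in> borel_measurable borel" and g: "integrable lborel g"
    and ug: "integrable lborel (\<lambda>z. of_real (u z) * g z)"
  shows "((\<lambda>s. \<integral>z. g z * cis (- (s * u z)) \<partial>lborel) has_vector_derivative
    (\<integral>z. (- \<i> * of_real (u z) * g z) * cis (- (s * u z)) \<partial>lborel)) (at s)"
proof -
  have [measurable]: "g \<in> borel_measurable borel" using g by (simp add: borel_measurable_integrable)
  define F where "F s = (\<integral>z. g z * cis (- (s * u z)) \<partial>lborel)" for s
  define D where "D = (\<integral>z. (- \<i> * of_real (u z) * g z) * cis (- (s * u z)) \<partial>lborel)"
  have intF: "integrable lborel (\<lambda>z. g z * cis (- (s * u z)))" for s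
    by (rule Bochner_Integration.integrable_bound[OF g]) (auto simp: norm_mult)
  have intD: "integrable lborel (\<lambda>z. (- \<i> * of_real (u z) * g z) * cis (- (s * u z)))"
    by (rule Bochner_Integration.integrable_bound[OF ug]) (auto simp: norm_mult)
  have "(\<lambda>n. norm (F (s + S n) - F s - S n *\<^sub>R D) / norm (S n)) \<longlonglongrightarrow> 0"
    if S: "\<And>n. S n \<noteq> 0" "S \<longlonglongrightarrow> 0" for S :: "nat \<Rightarrow> real"
  proof -
    define d where "d n z = (cis (- ((s + S n) * u z)) - cis (- (s * u z)) - S n *\<^sub>R (- \<i> * of_real (u z) * cis (- (s * u z)))) / of_real (S n)" for n z
    have lim_d: "(\<lambda>n. d n z) \<longlonglongrightarrow> 0" for z
    proof -
      have "(\<lambda>h. norm (cis (- ((s + h) * u z)) - cis (- (s * u z)) - h *\<^sub>R (- \<i> * of_real (u z) * cis (- (s * u z)))) / norm h) \<midarrow>0\<rightarrow> 0"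
        using has_vector_derivative_cis_linear[of "u z" s]
        unfolding has_vector_derivative_def has_derivative_at by blast
      then have "(\<lambda>n. norm (d n z)) \<longlonglongrightarrow> 0"
        using S unfolding LIMSEQ_SEQ_conv[symmetric] d_def by (auto simp: norm_divide)
      then show ?thesis by (rule tendsto_norm_zero_cancel)
    qed
    have le_d: "norm (d n z) \<le> 2 * \<bar>u z\<bar>" for n z
    proof -
      have "norm (cis (- ((s + S n) * u z)) - cis (- (s * u z)) - S n *\<^sub>R (- \<i> * of_real (u z) * cis (- (s * u z))))
        \<le> \<bar>- ((s + S n) * u z) - - (s * u z)\<bar> + \<bar>S n\<bar> * \<bar>u z\<bar>"
        by (rule order_trans[OF norm_triangle_ineq4 add_mono[OF norm_cis_diff_le]]) (simp add: norm_mult)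
      also have "\<dots> = 2 * \<bar>u z\<bar> * \<bar>S n\<bar>" by (simp add: algebra_simps abs_mult)
      finally show ?thesis using S(1)[of n] by (simp add: d_def norm_divide field_simps)
    qed
    have [measurable]: "d n \<in> borel_measurable borel" for n
      unfolding d_def cis_conv_exp by measurable
    have "(\<lambda>n. \<integral>z. g z * d n z \<partial>lborel) \<longlonglongrightarrow> (\<integral>z. 0 \<partial>(lborel::'a measure))"
    proof (rule integral_dominated_convergence)
      show "integrable lborel (\<lambda>z. 2 * norm (of_real (u z) * g z))" using ug by (intro integrable_mult_right integrable_norm)
      show "AE z in lborel. (\<lambda>n. g z * d n z) \<longlonglongrightarrow> 0"
        by (rule AE_I2) (use tendsto_mult[OF tendsto_const lim_d] in simp)
      show "AE z in lborel. norm (g z * d n z) \<le> 2 * norm (of_real (u z) * g z)" for n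
      proof (rule AE_I2)
        fix z
        have "norm (g z) * norm (d n z) \<le> norm (g z) * (2 * \<bar>u z\<bar>)" by (rule mult_left_mono[OF le_d]) simp
        then show "norm (g z * d n z) \<le> 2 * norm (of_real (u z) * g z)" by (simp add: norm_mult mult_ac)
      qed
    qed measurable
    moreover have "norm (\<integral>z. g z * d n z \<partial>lborel) = norm (F (s + S n) - F s - S n *\<^sub>R D) / norm (S n)" for n
    proof -
      have "F (s + S n) - F s - S n *\<^sub>R D =
        (\<integral>z. g z * cis (- ((s + S n) * u z)) - g z * cis (- (s * u z)) -
          S n *\<^sub>R ((- \<i> * of_real (u z) * g z) * cis (- (s * u z))) \<partial>lborel)"
        unfolding F_def D_def
        by (simp only: Bochner_Integration.integral_diff Bochner_Integration.integrable_diff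
            intF intD integrable_scaleR_right integral_scaleR_right)
      also have "\<dots> = (\<integral>z. of_real (S n) * (g z * d n z) \<partial>lborel)"
      proof (intro Bochner_Integration.integral_cong refl)
        fix z
        have "of_real (S n) * d n z = cis (- ((s + S n) * u z)) - cis (- (s * u z)) - S n *\<^sub>R (- \<i> * of_real (u z) * cis (- (s * u z)))"
          using S(1)[of n] by (simp add: d_def)
        then have "of_real (S n) * (g z * d n z) = g z * (cis (- ((s + S n) * u z)) - cis (- (s * u z)) - S n *\<^sub>R (- \<i> * of_real (u z) * cis (- (s * u z))))"
          by (simp add: mult.left_commute)
        then show "g z * cis (- ((s + S n) * u z)) - g z * cis (- (s * u z)) -
          S n *\<^sub>R ((- \<i> * of_real (u z) * g z) * cis (- (s * u z))) = of_real (S n) * (g z * d n z)"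
          by (simp add: right_diff_distrib scaleR_conv_of_real mult_ac distrib_left)
      qed
      finally show ?thesis using S(1)[of n] by (simp add: norm_mult)
    qed
    ultimately show ?thesis using tendsto_norm_zero by force
  qed
  then have "(F has_vector_derivative D) (at s)"
    unfolding has_vector_derivative_def has_derivative_at
    by (simp add: bounded_linear_scaleR_left LIMSEQ_SEQ_conv[symmetric])
  then show ?thesis by (simp add: F_def[abs_def] D_def)
qed

definition fourier_vanishes :: "('a::euclidean_space \<Rightarrow> complex) \<Rightarrow> 'a \<Rightarrow> real \<Rightarrow> bool" where
  "fourier_vanishes g \<xi>0 \<rho> \<longleftrightarrow> integrable lborel g \<and>
    (\<forall>\<xi>. norm (\<xi> - \<xi>0) < \<rho> \<longrightarrow> (\<integral>z. g z * cis (- (\<xi> \<bullet> z)) \<partial>lborel) = 0)"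

lemma fourier_vanishes_mono: "fourier_vanishes g \<xi>0 \<rho> \<Longrightarrow> \<rho>' \<le> \<rho> \<Longrightarrow> fourier_vanishes g \<xi>0 \<rho>'"
  by (auto simp: fourier_vanishes_def)

text \<open>
  Multiplication by a cosine replaces the Fourier transform by the mean of its translates by \<open>u\<close> and \<open>- u\<close>.
\<close>
lemma fourier_vanishes_cos:
  assumes "fourier_vanishes g \<xi>0 \<rho>"
  shows "fourier_vanishes (\<lambda>z. g z * of_real (cos (u \<bullet> z))) \<xi>0 (\<rho> - norm u)"
  unfolding fourier_vanishes_def
proof (intro conjI allI impI)
  have g: "integrable lborel g" using assms by (simp add: fourier_vanishes_def)
  then have [measurable]: "g \<in> borel_measurable borel" by (simp add: borel_measurable_integrable)
  show "integrable lborel (\<lambda>z. g z * of_real (cos (u \<bullet> z)))"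
    by (rule Bochner_Integration.integrable_bound[OF g]) (auto simp: norm_mult mult_left_le)
  fix \<xi> assume \<xi>: "norm (\<xi> - \<xi>0) < \<rho> - norm u"
  have int: "integrable lborel (\<lambda>z. g z * cis (- (\<mu> \<bullet> z)))" for \<mu>
    by (rule Bochner_Integration.integrable_bound[OF g]) (auto simp: norm_mult cis_conv_exp)
  have "norm (\<xi> - u - \<xi>0) < \<rho>" "norm (\<xi> + u - \<xi>0) < \<rho>"
    using \<xi> norm_triangle_ineq4[of "\<xi> - \<xi>0" u] norm_triangle_ineq[of "\<xi> - \<xi>0" u] by (simp_all add: algebra_simps)
  then have z: "(\<integral>z. g z * cis (- ((\<xi> - u) \<bullet> z)) \<partial>lborel) = 0" "(\<integral>z. g z * cis (- ((\<xi> + u) \<bullet> z)) \<partial>lborel) = 0"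
    using assms by (simp_all add: fourier_vanishes_def)
  have eq: "g z * of_real (cos (u \<bullet> z)) * cis (- (\<xi> \<bullet> z)) =
      (g z * cis (- ((\<xi> - u) \<bullet> z)) + g z * cis (- ((\<xi> + u) \<bullet> z))) / 2" for z
  proof -
    have c: "of_real (cos a) = (cis a + cis (- a)) / 2" for a by (simp add: complex_eq_iff)
    have "of_real (cos (u \<bullet> z)) * cis (- (\<xi> \<bullet> z)) =
      (cis (u \<bullet> z) * cis (- (\<xi> \<bullet> z)) + cis (- (u \<bullet> z)) * cis (- (\<xi> \<bullet> z))) / 2"
      unfolding c by (simp only: times_divide_eq_left distrib_right)
    then show ?thesis by (simp add: cis_mult inner_diff_left inner_add_left mult.assoc algebra_simps)
  qed
  show "(\<integral>z. g z * of_real (cos (u \<bullet> z)) * cis (- (\<xi> \<bullet> z)) \<partial>lborel) = 0"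
    unfolding eq using int z by simp
qed

text \<open>
  Each squared cosine costs twice its frequency; the total cost stays below the sum of the series for every \<open>N\<close>.
\<close>
lemma fourier_vanishes_cosine_product:
  fixes e :: "'a::euclidean_space"
  assumes "fourier_vanishes g \<xi>0 \<rho>" and e: "norm e = 1" and \<delta>: "\<delta> \<ge> 0"
  shows "fourier_vanishes (\<lambda>z. g z * of_real (cosine_product N (\<delta> * (z \<bullet> e)))) \<xi>0
    (\<rho> - 2 * \<delta> * (\<Sum>j. 1 / (real (Suc j))\<^sup>2))"
proof -
  have "fourier_vanishes (\<lambda>z. g z * of_real (cosine_product N (\<delta> * (z \<bullet> e)))) \<xi>0
    (\<rho> - 2 * \<delta> * (\<Sum>j<N. 1 / (real (Suc j))\<^sup>2))"
  proof (induction N)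
    case 0
    then show ?case using assms by (simp add: cosine_product_def)
  next
    case (Suc N)
    define u where "u = (\<delta> / (real (Suc N))\<^sup>2) *\<^sub>R e"
    have nu: "norm u = \<delta> / (real (Suc N))\<^sup>2" using e \<delta> by (simp add: u_def)
    have uz: "u \<bullet> z = \<delta> * (z \<bullet> e) / (real (Suc N))\<^sup>2" for z by (simp add: u_def inner_commute)
    have prod_eq: "(\<lambda>z. g z * of_real (cosine_product N (\<delta> * (z \<bullet> e))) * of_real (cos (u \<bullet> z)) * of_real (cos (u \<bullet> z))) =
        (\<lambda>z. g z * of_real (cosine_product (Suc N) (\<delta> * (z \<bullet> e))))"
      unfolding uz by (simp add: cosine_product_def power2_eq_square mult.assoc)
    have rad_eq: "\<rho> - 2 * \<delta> * (\<Sum>j<N. 1 / (real (Suc j))\<^sup>2) - norm u - norm u =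
        \<rho> - 2 * \<delta> * (\<Sum>j<Suc N. 1 / (real (Suc j))\<^sup>2)"
      unfolding nu by (simp add: algebra_simps del: of_nat_Suc)
    show ?case
      using fourier_vanishes_cos[OF fourier_vanishes_cos[OF Suc, of u], of u] unfolding prod_eq rad_eq .
  qed
  then show ?thesis
    by (rule fourier_vanishes_mono)
      (use \<delta> sum_le_suminf[OF summable_inverse_squares, of "{..<N}"] in \<open>auto intro!: mult_left_mono\<close>)
qed

definition cutoff_weight :: "real \<Rightarrow> 'a::euclidean_space \<Rightarrow> real" where
  "cutoff_weight \<delta> z = (\<Prod>e\<in>Basis. cosine_weight (\<delta> * (z \<bullet> e)))"

lemma cutoff_weight_measurable [measurable]: "cutoff_weight \<delta> \<in> borel_measurable borel"
  unfolding cutoff_weight_def by measurable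

lemma cutoff_weight_bounds: "0 \<le> cutoff_weight \<delta> z" "cutoff_weight \<delta> z \<le> 1"
  by (auto simp: cutoff_weight_def intro!: prod_nonneg prod_le_1 cosine_weight_bounds)

text \<open>
  The factor of the largest coordinate of \<open>z\<close> alone gives the decay.
\<close>
lemma cutoff_weight_decay:
  fixes z :: "'a::euclidean_space"
  assumes \<delta>: "\<delta> > 0"
  shows "cutoff_weight \<delta> z \<le> exp 1 * exp (- (sqrt (\<delta> / DIM('a)) / 1024 * sqrt (norm z)))"
proof -
  obtain e where e: "e \<in> Basis" and ne: "norm z \<le> DIM('a) * \<bar>z \<bullet> e\<bar>"
  proof -
    have "\<exists>e\<in>Basis. norm z \<le> DIM('a) * \<bar>z \<bullet> e\<bar>"
    proof (rule ccontr)
      assume "\<not> ?thesis"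
      then have "\<bar>z \<bullet> e\<bar> < norm z / DIM('a)" if "e \<in> Basis" for e
        using that by (auto simp: not_le field_simps)
      then have "(\<Sum>e\<in>Basis. \<bar>z \<bullet> e\<bar>) < (\<Sum>e\<in>(Basis::'a set). norm z / DIM('a))"
        by (intro sum_strict_mono) auto
      then show False using norm_le_l1[of z] by simp
    qed
    then show ?thesis using that by blast
  qed
  have "cutoff_weight \<delta> z = cosine_weight (\<delta> * (z \<bullet> e)) * (\<Prod>e\<in>Basis - {e}. cosine_weight (\<delta> * (z \<bullet> e)))"
    unfolding cutoff_weight_def using e by (subst prod.remove[of _ e]) auto
  also have "\<dots> \<le> cosine_weight (\<delta> * (z \<bullet> e)) * 1"
    by (intro mult_left_mono prod_le_1 conjI cosine_weight_bounds)
  also have "\<dots> \<le> exp 1 * exp (- (sqrt \<bar>\<delta> * (z \<bullet> e)\<bar> / 1024))" using cosine_weight_decay by simp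
  also have "\<dots> \<le> exp 1 * exp (- (sqrt (\<delta> / DIM('a)) / 1024 * sqrt (norm z)))"
  proof -
    have "\<delta> / DIM('a) * norm z \<le> \<bar>\<delta> * (z \<bullet> e)\<bar>"
      using mult_left_mono[OF ne, of "\<delta> / DIM('a)"] \<delta> by (simp add: abs_mult)
    then have "sqrt (\<delta> / DIM('a)) * sqrt (norm z) \<le> sqrt \<bar>\<delta> * (z \<bullet> e)\<bar>"
      unfolding real_sqrt_mult[symmetric] by (rule real_sqrt_le_mono)
    then show ?thesis by simp
  qed
  finally show ?thesis .
qed

lemma fourier_vanishes_cutoff_weight:
  fixes g :: "'a::euclidean_space \<Rightarrow> complex"
  assumes fv: "fourier_vanishes g \<xi>0 \<rho>" and \<delta>: "\<delta> \<ge> 0"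
  shows "fourier_vanishes (\<lambda>z. g z * of_real (cutoff_weight \<delta> z)) \<xi>0
    (\<rho> - DIM('a) * (2 * \<delta> * (\<Sum>j. 1 / (real (Suc j))\<^sup>2)))"
proof -
  define Z where "Z = 2 * \<delta> * (\<Sum>j. 1 / (real (Suc j))\<^sup>2)"
  have g: "integrable lborel g" using fv by (simp add: fourier_vanishes_def)
  then have [measurable]: "g \<in> borel_measurable borel" by (simp add: borel_measurable_integrable)
  define K where "K N z = (\<Prod>e\<in>Basis. cosine_product N (\<delta> * (z \<bullet> e)))" for N and z :: 'a
  have [measurable]: "K N \<in> borel_measurable borel" for N unfolding K_def by measurable
  have K1: "0 \<le> K N z" "K N z \<le> 1" for N z
    by (auto simp: K_def intro!: prod_nonneg prod_le_1 cosine_product_bounds)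
  have "fourier_vanishes (\<lambda>z. g z * of_real (\<Prod>e\<in>A. cosine_product N (\<delta> * (z \<bullet> e)))) \<xi>0 (\<rho> - card A * Z)"
    if "A \<subseteq> Basis" for A N
    using finite_subset[OF that finite_Basis] that
  proof (induction A rule: finite_induct)
    case (insert e A)
    have "fourier_vanishes (\<lambda>z. g z * of_real (\<Prod>e\<in>A. cosine_product N (\<delta> * (z \<bullet> e))) *
        of_real (cosine_product N (\<delta> * (z \<bullet> e)))) \<xi>0 (\<rho> - card A * Z - Z)"
      unfolding Z_def by (rule fourier_vanishes_cosine_product)
        (use insert \<delta> in \<open>auto simp: Z_def\<close>)
    moreover have "\<rho> - card A * Z - Z = \<rho> - card (insert e A) * Z"
      using insert by (simp add: algebra_simps)
    moreover have "(\<lambda>z. g z * of_real (\<Prod>e\<in>A. cosine_product N (\<delta> * (z \<bullet> e))) *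
        of_real (cosine_product N (\<delta> * (z \<bullet> e)))) =
        (\<lambda>z. g z * of_real (\<Prod>e\<in>insert e A. cosine_product N (\<delta> * (z \<bullet> e))))"
      using insert by (auto simp: mult_ac)
    ultimately show ?case by simp
  qed (use fv in simp)
  from this[of Basis] have fvK: "fourier_vanishes (\<lambda>z. g z * of_real (K N z)) \<xi>0 (\<rho> - DIM('a) * Z)" for N
    by (simp add: K_def)
  show ?thesis unfolding fourier_vanishes_def Z_def[symmetric]
  proof (intro conjI allI impI)
    show "integrable lborel (\<lambda>z. g z * of_real (cutoff_weight \<delta> z))"
      by (rule Bochner_Integration.integrable_bound[OF g])
        (auto simp: norm_mult abs_of_nonneg[OF cutoff_weight_bounds(1)] intro!: AE_I2 mult_left_le cutoff_weight_bounds)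
    fix \<xi> assume \<xi>: "norm (\<xi> - \<xi>0) < \<rho> - DIM('a) * Z"
    have "(\<lambda>N. \<integral>z. g z * of_real (K N z) * cis (- (\<xi> \<bullet> z)) \<partial>lborel) \<longlonglongrightarrow>
        (\<integral>z. g z * of_real (cutoff_weight \<delta> z) * cis (- (\<xi> \<bullet> z)) \<partial>lborel)"
    proof (rule integral_dominated_convergence)
      show "integrable lborel (\<lambda>z. norm (g z))" using g by simp
      show "AE z in lborel. (\<lambda>N. g z * of_real (K N z) * cis (- (\<xi> \<bullet> z))) \<longlonglongrightarrow>
          g z * of_real (cutoff_weight \<delta> z) * cis (- (\<xi> \<bullet> z))"
        unfolding K_def cutoff_weight_def
        by (intro AE_I2 tendsto_intros cosine_product_LIMSEQ)
      show "AE z in lborel. norm (g z * of_real (K N z) * cis (- (\<xi> \<bullet> z))) \<le> norm (g z)" for N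
        using K1 by (auto simp: norm_mult mult_left_le abs_of_nonneg[OF cutoff_weight_bounds(1)])
    qed measurable
    moreover have "(\<integral>z. g z * of_real (K N z) * cis (- (\<xi> \<bullet> z)) \<partial>lborel) = 0" for N
      using fvK \<xi> by (simp add: fourier_vanishes_def)
    ultimately show "(\<integral>z. g z * of_real (cutoff_weight \<delta> z) * cis (- (\<xi> \<bullet> z)) \<partial>lborel) = 0"
      by (simp add: LIMSEQ_const_iff)
  qed
qed

text \<open>
  Comparison with the product of the one-dimensional functions \<open>1 / (1 + x\<^sup>2)\<close> over the coordinates.
\<close>
lemma integrable_inverse_one_plus_norm_sq_power:
  "integrable lborel (\<lambda>z::'a::euclidean_space. 1 / (1 + (norm z)\<^sup>2) ^ DIM('a))"
proof (rule integrableI_bounded)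
  have "(\<integral>\<^sup>+z. ennreal (norm (1 / (1 + (norm (z::'a))\<^sup>2) ^ DIM('a))) \<partial>lborel) \<le>
      (\<integral>\<^sup>+z. (\<Prod>b\<in>(Basis::'a set). ennreal (inverse (1 + (z \<bullet> b)\<^sup>2))) \<partial>lborel)"
  proof (rule nn_integral_mono)
    fix z :: 'a
    have "(\<Prod>b\<in>(Basis::'a set). 1 + (z \<bullet> b)\<^sup>2) \<le> (\<Prod>b\<in>(Basis::'a set). 1 + (norm z)\<^sup>2)"
      by (intro prod_mono conjI add_left_mono) (auto simp: abs_le_square_iff[symmetric] Basis_le_norm)
    then have "1 / (1 + (norm z)\<^sup>2) ^ DIM('a) \<le> 1 / (\<Prod>b\<in>(Basis::'a set). 1 + (z \<bullet> b)\<^sup>2)"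
      by (intro divide_left_mono mult_pos_pos prod_pos) (auto simp: add_pos_nonneg)
    also have "\<dots> = (\<Prod>b\<in>(Basis::'a set). inverse (1 + (z \<bullet> b)\<^sup>2))" by (simp add: prod_inversef[symmetric] o_def divide_inverse)
    finally show "ennreal (norm (1 / (1 + (norm z)\<^sup>2) ^ DIM('a))) \<le> (\<Prod>b\<in>(Basis::'a set). ennreal (inverse (1 + (z \<bullet> b)\<^sup>2)))"
      by (subst prod_ennreal) (auto intro!: ennreal_leI)
  qed
  also have "\<dots> = (\<Prod>b\<in>(Basis::'a set). \<integral>\<^sup>+x. ennreal (inverse (1 + x\<^sup>2)) \<partial>lborel)"
    by (rule nn_integral_lborel_prod) auto
  also have "\<dots> < \<infinity>"
  proof -
    have "integrable lborel (\<lambda>x::real. inverse (1 + x\<^sup>2))"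
      using integrable_inverse_1_plus_square by (simp add: set_integrable_def)
    then have "(\<integral>\<^sup>+x. ennreal (norm (inverse (1 + x\<^sup>2))) \<partial>(lborel::real measure)) < \<infinity>"
      by (simp add: integrable_iff_bounded)
    then show ?thesis by (simp add: power_less_top_ennreal)
  qed
  finally show "(\<integral>\<^sup>+z. ennreal (norm (1 / (1 + (norm (z::'a))\<^sup>2) ^ DIM('a))) \<partial>lborel) < \<infinity>" .
qed measurable

text \<open>
  After multiplication of \<open>h\<close> by \<open>cutoff_weight \<delta>\<close>, the Fourier transform restricted to the line through \<open>\<xi>0\<close> and \<open>\<xi>\<close>
  has its \<open>n\<close>-th derivative bounded by a constant multiple of the moment \<open>M n\<close> of \<open>weighted_moments\<close>, and it vanishes near
  \<open>\<xi>0\<close>; so it vanishes on the whole line by \<open>denjoy_carleman_bang\<close>. The multiplier costs an amount of the radius \<open>\<rho>\<close>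
  proportional to \<open>\<delta>\<close>, and is removed by \<open>\<delta> \<rightarrow> 0\<close>.
\<close>
theorem fourier_quasianalytic:
  fixes h :: "'a::euclidean_space \<Rightarrow> complex" and \<theta> :: "real \<Rightarrow> real"
  assumes [measurable]: "h \<in> borel_measurable borel"
    and hle: "\<And>z. norm (h z) \<le> C * (exp (- (norm z * \<theta> (norm z))) / (1 + (norm z)\<^sup>2) ^ DIM('a))"
    and \<theta>0: "\<And>s. 0 \<le> s \<Longrightarrow> 0 \<le> \<theta> s" and \<theta>m: "antimono_on {0..} \<theta>"
    and div: "\<not> summable (\<lambda>k::nat. \<theta> (256 ^ k))"
    and \<rho>: "\<rho> > 0" and zero: "\<And>\<xi>. norm (\<xi> - \<xi>0) < \<rho> \<Longrightarrow> (\<integral>z. h z * cis (- (\<xi> \<bullet> z)) \<partial>lborel) = 0"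
  shows "(\<integral>z. h z * cis (- (\<xi> \<bullet> z)) \<partial>lborel) = 0"
proof -
  define q where "q z = 1 / (1 + (norm z)\<^sup>2) ^ DIM('a)" for z :: 'a
  have q: "integrable lborel q" unfolding q_def[abs_def] by (rule integrable_inverse_one_plus_norm_sq_power)
  have q0: "q z \<ge> 0" for z by (simp add: q_def)
  have C: "C \<ge> 0"
  proof -
    have "0 \<le> norm (h 0)" by simp
    also have "\<dots> \<le> C" using hle[of 0] by simp
    finally show ?thesis .
  qed
  have hq: "norm (h z) \<le> C * exp (- (norm z * \<theta> (norm z))) * q z" for z
    using hle[of z] by (simp add: q_def)
  have hint: "integrable lborel h"
  proof (rule Bochner_Integration.integrable_bound)
    show "integrable lborel (\<lambda>z. C * q z)" using q by simp
    have "C * exp (- (norm z * \<theta> (norm z))) * q z \<le> C * 1 * q z" for z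
      using C q0 \<theta>0[of "norm z"] by (intro mult_right_mono mult_left_mono) auto
    then show "AE z in lborel. norm (h z) \<le> norm (C * q z)"
      using hq C q0 by (intro AE_I2) (auto intro: order_trans)
  qed measurable
  define Z where "Z = 2 * (\<Sum>j. 1 / (real (Suc j))\<^sup>2)"
  have Z: "Z \<ge> 0" unfolding Z_def by (intro mult_nonneg_nonneg suminf_nonneg summable_inverse_squares) auto
  have fvh: "fourier_vanishes h \<xi>0 \<rho>" using hint zero by (simp add: fourier_vanishes_def)
  have weighted: "(\<integral>z. h z * of_real (cutoff_weight \<delta> z) * cis (- (\<xi> \<bullet> z)) \<partial>lborel) = 0"
    if \<delta>: "\<delta> > 0" "DIM('a) * (\<delta> * Z) < \<rho>" for \<delta>
  proof (cases "\<xi> = \<xi>0")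
    case True
    have "fourier_vanishes (\<lambda>z. h z * of_real (cutoff_weight \<delta> z)) \<xi>0 (\<rho> - DIM('a) * (\<delta> * Z))"
      using fourier_vanishes_cutoff_weight[OF fvh, of \<delta>] \<delta> by (simp add: Z_def mult_ac)
    then show ?thesis using True \<delta> by (simp add: fourier_vanishes_def)
  next
    case False
    define \<mu> where "\<mu> = sgn (\<xi> - \<xi>0)"
    define \<rho>' where "\<rho>' = \<rho> - DIM('a) * (\<delta> * Z)"
    have \<rho>': "\<rho>' > 0" using \<delta> by (simp add: \<rho>'_def)
    have \<mu>: "norm \<mu> = 1" using False by (simp add: \<mu>_def norm_sgn)
    define g where "g z = h z * of_real (cutoff_weight \<delta> z)" for z
    have [measurable]: "g \<in> borel_measurable borel" unfolding g_def[abs_def] by measurable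
    have fvg: "fourier_vanishes g \<xi>0 \<rho>'"
      using fourier_vanishes_cutoff_weight[OF fvh, of \<delta>] \<delta> by (simp add: Z_def mult_ac g_def[abs_def] \<rho>'_def)
    define c where "c = sqrt (\<delta> / DIM('a)) / 1024"
    have c: "c > 0" using \<delta> by (simp add: c_def)
    obtain M where M: "\<And>n. M n > 0"
      "\<And>n r. r \<ge> 0 \<Longrightarrow> r ^ n * exp (- (r * \<theta> r + c * sqrt r)) \<le> M n"
      "incseq (\<lambda>n. M (Suc n) / M n)" "\<not> summable (\<lambda>n. M n / M (Suc n))"
      using weighted_moments[OF \<theta>0 \<theta>m div c] by blast
    have gle: "norm (g z) \<le> C * exp 1 * exp (- (norm z * \<theta> (norm z) + c * sqrt (norm z))) * q z" for z
    proof -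
      have "norm (g z) = norm (h z) * cutoff_weight \<delta> z" by (simp add: g_def norm_mult abs_of_nonneg[OF cutoff_weight_bounds(1)])
      also have "\<dots> \<le> (C * exp (- (norm z * \<theta> (norm z))) * q z) * (exp 1 * exp (- (c * sqrt (norm z))))"
        using hq[of z] cutoff_weight_decay[OF \<delta>(1), of z] C q0[of z] cutoff_weight_bounds[of \<delta> z]
        unfolding c_def by (intro mult_mono) auto
      also have "\<dots> = C * exp 1 * exp (- (norm z * \<theta> (norm z) + c * sqrt (norm z))) * q z"
        by (simp add: exp_add[symmetric] mult_ac exp_diff exp_minus field_simps)
      finally show ?thesis .
    qed
    \<comment> \<open>\<open>G n\<close> is the \<open>n\<close>-th derivative of the Fourier transform of \<open>g\<close> along the line \<open>\<xi>0 + s \<mu>\<close>.\<close>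
    define Gf where "Gf n s z = (- \<i> * of_real (\<mu> \<bullet> z)) ^ n * (g z * cis (- (\<xi>0 \<bullet> z))) * cis (- (s * (\<mu> \<bullet> z)))" for n s z
    define G where "G n s = (\<integral>z. Gf n s z \<partial>lborel)" for n s
    have [measurable]: "Gf n s \<in> borel_measurable borel" for n s unfolding Gf_def[abs_def] cis_conv_exp by measurable
    have Gfle: "norm (Gf n s z) \<le> C * exp 1 * M n * q z" for n s z
    proof -
      have "norm (Gf n s z) = \<bar>\<mu> \<bullet> z\<bar> ^ n * norm (g z)" by (simp add: Gf_def norm_mult norm_power)
      also have "\<dots> \<le> norm z ^ n * (C * exp 1 * exp (- (norm z * \<theta> (norm z) + c * sqrt (norm z))) * q z)"
        using Cauchy_Schwarz_ineq2[of \<mu> z] \<mu> by (intro mult_mono power_mono gle) auto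
      also have "\<dots> = C * exp 1 * (norm z ^ n * exp (- (norm z * \<theta> (norm z) + c * sqrt (norm z)))) * q z" by simp
      also have "\<dots> \<le> C * exp 1 * M n * q z"
        using C q0 by (intro mult_right_mono mult_left_mono M(2)) auto
      finally show ?thesis .
    qed
    have Gfint: "integrable lborel (Gf n s)" for n s
      by (rule Bochner_Integration.integrable_bound[where g="Gf n s" and f = "\<lambda>z. C * exp 1 * M n * q z"])
        (use q Gfle C q0 M(1)[of n] in \<open>auto intro: order_trans\<close>)
    \<comment> \<open>The summand 1 keeps the bounds \<open>I * M n\<close> positive when \<open>C = 0\<close>.\<close>
    define I where "I = C * exp 1 * (\<integral>z. q z \<partial>lborel) + 1"
    have I: "I > 0" unfolding I_def using C q0 by (auto intro!: add_nonneg_pos mult_nonneg_nonneg integral_nonneg)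
    have G_der: "(G n has_vector_derivative G (Suc n) s) (at s)" for n s
    proof -
      have 0: "integrable lborel (\<lambda>z. (- \<i> * of_real (\<mu> \<bullet> z)) ^ k * (g z * cis (- (\<xi>0 \<bullet> z))))" for k
        using Gfint[of k 0] by (simp add: Gf_def[abs_def])
      have 1: "integrable lborel (\<lambda>z. of_real (\<mu> \<bullet> z) * ((- \<i> * of_real (\<mu> \<bullet> z)) ^ n * (g z * cis (- (\<xi>0 \<bullet> z)))))"
        using integrable_mult_right[OF 0[of "Suc n"], of \<i>] by (simp add: mult_ac)
      have "((\<lambda>s. \<integral>z. Gf n s z \<partial>lborel) has_vector_derivative
        (\<integral>z. (- \<i> * of_real (\<mu> \<bullet> z) * ((- \<i> * of_real (\<mu> \<bullet> z)) ^ n * (g z * cis (- (\<xi>0 \<bullet> z))))) * cis (- (s * (\<mu> \<bullet> z))) \<partial>lborel)) (at s)"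
        unfolding Gf_def by (rule has_vector_derivative_fourier_integral[OF _ 0 1]) measurable
      moreover have "(\<integral>z. (- \<i> * of_real (\<mu> \<bullet> z) * ((- \<i> * of_real (\<mu> \<bullet> z)) ^ n * (g z * cis (- (\<xi>0 \<bullet> z))))) * cis (- (s * (\<mu> \<bullet> z))) \<partial>lborel) = G (Suc n) s"
        by (simp add: G_def Gf_def mult.assoc)
      ultimately show ?thesis by (simp add: G_def[abs_def])
    qed
    have G0: "G 0 s = (\<integral>z. g z * cis (- ((\<xi>0 + s *\<^sub>R \<mu>) \<bullet> z)) \<partial>lborel)" for s
      unfolding G_def Gf_def by (intro Bochner_Integration.integral_cong) (auto simp: cis_mult inner_add_left mult.assoc)
    have Gzero: "G n s = 0" if "\<bar>s\<bar> < \<rho>'" for n s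
      using that
    proof (induction n arbitrary: s)
      case 0
      then show ?case using fvg \<mu> unfolding G0 fourier_vanishes_def by simp
    next
      case (Suc n)
      have "((\<lambda>s. 0) has_vector_derivative G (Suc n) s) (at s)"
        by (rule has_vector_derivative_transform_within_open[OF G_der[of n s], where S = "{-\<rho>'<..<\<rho>'}"])
          (use Suc in auto)
      then show ?case using vector_derivative_unique_at[OF _ has_vector_derivative_const] by blast
    qed
    have "G 0 (norm (\<xi> - \<xi>0)) = 0"
    proof (rule denjoy_carleman_bang[where M = "\<lambda>n. I * M n" and ?x0.0 = 0])
      fix n s
      have "norm (G n s) \<le> (\<integral>z. norm (Gf n s z) \<partial>lborel)" unfolding G_def by (rule integral_norm_bound)
      also have "\<dots> \<le> (\<integral>z. C * exp 1 * M n * q z \<partial>lborel)"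
        by (intro integral_mono integrable_norm Gfint Gfle) (use q in simp)
      also have "\<dots> = (I - 1) * M n" by (simp add: I_def)
      also have "\<dots> \<le> I * M n" using M(1)[of n] by (simp add: algebra_simps)
      finally show "norm (G n s) \<le> I * M n" .
    qed (use G_der I M Gzero[of 0] \<rho>' in auto)
    moreover have "\<xi>0 + norm (\<xi> - \<xi>0) *\<^sub>R \<mu> = \<xi>" using False by (simp add: \<mu>_def sgn_div_norm)
    ultimately show ?thesis unfolding G0 by (simp add: g_def)
  qed
  define \<delta>0 where "\<delta>0 = \<rho> / (DIM('a) * Z + 1)"
  have dz: "DIM('a) * Z + 1 > 0" using Z by (simp add: add_nonneg_pos)
  have \<delta>0: "\<delta>0 > 0" unfolding \<delta>0_def using \<rho> dz by simp
  define \<delta> where "\<delta> n = \<delta>0 / real (Suc n)" for n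
  have \<delta>: "\<delta> n > 0" "DIM('a) * (\<delta> n * Z) < \<rho>" for n
  proof -
    show d: "\<delta> n > 0" using \<delta>0 by (simp add: \<delta>_def)
    have "\<delta> n \<le> \<delta>0" using \<delta>0 by (simp add: \<delta>_def divide_le_eq mult_le_cancel_left1)
    then have "DIM('a) * Z * \<delta> n \<le> DIM('a) * Z * \<delta>0" using Z by (intro mult_left_mono) auto
    also have "\<dots> < (DIM('a) * Z + 1) * \<delta>0" using \<delta>0 by (simp add: algebra_simps)
    also have "\<dots> = \<rho>" unfolding \<delta>0_def using dz by simp
    finally show "DIM('a) * (\<delta> n * Z) < \<rho>" by (simp add: mult_ac)
  qed
  have \<delta>lim: "\<delta> \<longlonglongrightarrow> 0" unfolding \<delta>_def by (rule lim_const_over_n[THEN LIMSEQ_Suc])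
  have "(\<lambda>n. \<integral>z. h z * of_real (cutoff_weight (\<delta> n) z) * cis (- (\<xi> \<bullet> z)) \<partial>lborel) \<longlonglongrightarrow>
      (\<integral>z. h z * cis (- (\<xi> \<bullet> z)) \<partial>lborel)"
  proof (rule integral_dominated_convergence)
    show "integrable lborel (\<lambda>z. norm (h z))" using hint by simp
    show "AE z in lborel. (\<lambda>n. h z * of_real (cutoff_weight (\<delta> n) z) * cis (- (\<xi> \<bullet> z))) \<longlonglongrightarrow> h z * cis (- (\<xi> \<bullet> z))"
    proof (rule AE_I2)
      fix z :: 'a
      have "(\<lambda>n. cutoff_weight (\<delta> n) z) \<longlonglongrightarrow> (\<Prod>e\<in>(Basis::'a set). 1)"
        unfolding cutoff_weight_def by (rule tendsto_prod) (rule cosine_weight_tendsto_1[OF \<delta>lim])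
      then have "(\<lambda>n. h z * of_real (cutoff_weight (\<delta> n) z) * cis (- (\<xi> \<bullet> z))) \<longlonglongrightarrow> h z * of_real 1 * cis (- (\<xi> \<bullet> z))"
        by (intro tendsto_intros) simp
      then show "(\<lambda>n. h z * of_real (cutoff_weight (\<delta> n) z) * cis (- (\<xi> \<bullet> z))) \<longlonglongrightarrow> h z * cis (- (\<xi> \<bullet> z))" by simp
    qed
    show "AE z in lborel. norm (h z * of_real (cutoff_weight (\<delta> n) z) * cis (- (\<xi> \<bullet> z))) \<le> norm (h z)" for n
      by (auto simp: norm_mult abs_of_nonneg[OF cutoff_weight_bounds(1)] intro!: AE_I2 mult_left_le cutoff_weight_bounds)
  qed measurable
  then show ?thesis using weighted[OF \<delta>] by (simp add: LIMSEQ_const_iff)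
qed

section \<open>The Bessel inequality for the Fourier transform\<close>

lemma integral_lborel_prod:
  fixes f :: "'a::euclidean_space \<Rightarrow> real \<Rightarrow> complex"
  assumes f: "\<And>b. b \<in> Basis \<Longrightarrow> integrable lborel (f b)"
  shows "integrable lborel (\<lambda>x::'a. \<Prod>b\<in>Basis. f b (x \<bullet> b))"
    and "(\<integral>x. (\<Prod>b\<in>(Basis::'a set). f b (x \<bullet> b)) \<partial>lborel) = (\<Prod>b\<in>Basis. integral\<^sup>L lborel (f b))"
proof -
  have L: "(lborel :: 'a measure) = distr (\<Pi>\<^sub>M b\<in>(Basis::'a set). lborel) borel (\<lambda>f. \<Sum>b\<in>Basis. f b *\<^sub>R b)"
    by (rule lborel_eq)
  interpret P: product_sigma_finite "\<lambda>_::'a. lborel :: real measure" by standard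
  have [measurable]: "(\<lambda>x::'a. \<Prod>b\<in>Basis. f b (x \<bullet> b)) \<in> borel_measurable borel"
  proof (rule borel_measurable_prod)
    fix b :: 'a assume "b \<in> Basis"
    then have [measurable]: "f b \<in> borel_measurable borel" using f borel_measurable_integrable by force
    show "(\<lambda>x::'a. f b (x \<bullet> b)) \<in> borel_measurable borel" by measurable
  qed
  have [measurable]: "(\<lambda>g. \<Sum>b\<in>Basis. g b *\<^sub>R b) \<in> (\<Pi>\<^sub>M b\<in>(Basis::'a set). lborel) \<rightarrow>\<^sub>M borel" by measurable
  have eq: "(\<Prod>b\<in>Basis. f b ((\<Sum>b\<in>Basis. g b *\<^sub>R b) \<bullet> b)) = (\<Prod>b\<in>(Basis::'a set). f b (g b))" for g :: "'a \<Rightarrow> real"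
    by (intro prod.cong refl) simp
  have "integrable (\<Pi>\<^sub>M b\<in>(Basis::'a set). lborel) (\<lambda>g. \<Prod>b\<in>Basis. f b (g b))"
    by (rule P.product_integrable_prod[OF finite_Basis f])
  then show "integrable lborel (\<lambda>x::'a. \<Prod>b\<in>Basis. f b (x \<bullet> b))"
    unfolding L by (subst integrable_distr_eq) (simp_all only: eq, measurable)
  have "(\<integral>x. (\<Prod>b\<in>(Basis::'a set). f b (x \<bullet> b)) \<partial>lborel) = (\<integral>g. (\<Prod>b\<in>Basis. f b (g b)) \<partial>(\<Pi>\<^sub>M b\<in>(Basis::'a set). lborel))"
    unfolding L by (subst integral_distr) (simp_all only: eq, measurable)
  also have "\<dots> = (\<Prod>b\<in>Basis. integral\<^sup>L lborel (f b))"
    by (rule P.product_integral_prod[OF finite_Basis f])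
  finally show "(\<integral>x. (\<Prod>b\<in>(Basis::'a set). f b (x \<bullet> b)) \<partial>lborel) = (\<Prod>b\<in>Basis. integral\<^sup>L lborel (f b))" .
qed

definition gauss_weight :: "real \<Rightarrow> 'a::euclidean_space \<Rightarrow> real" where
  "gauss_weight \<epsilon> z = exp (- (\<epsilon>\<^sup>2 * (norm z)\<^sup>2 / 2))"

text \<open>
  The Fourier transform of \<open>gauss_weight \<epsilon>\<close>, of total mass \<open>(2 \<pi>) ^ DIM('a)\<close>.
\<close>
definition gauss_kernel :: "real \<Rightarrow> 'a::euclidean_space \<Rightarrow> real" where
  "gauss_kernel \<epsilon> u = (\<Prod>b\<in>Basis. 2 * pi * normal_density 0 \<epsilon> (u \<bullet> b))"

lemma gauss_weight_measurable [measurable]: "gauss_weight \<epsilon> \<in> borel_measurable borel"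
  unfolding gauss_weight_def by measurable

lemma gauss_kernel_measurable [measurable]: "gauss_kernel \<epsilon> \<in> borel_measurable borel"
  unfolding gauss_kernel_def by measurable

lemma gauss_weight_bounds: "0 < gauss_weight \<epsilon> z" "gauss_weight \<epsilon> z \<le> 1"
  by (auto simp: gauss_weight_def)

lemma gauss_kernel_nonneg: "0 \<le> gauss_kernel \<epsilon> u"
  unfolding gauss_kernel_def by (intro prod_nonneg) auto

text \<open>
  The characteristic function of the normal distribution, rescaled.
\<close>
lemma gauss_fourier_real:
  assumes \<epsilon>: "\<epsilon> > 0"
  shows "integrable lborel (\<lambda>x::real. of_real (exp (- (\<epsilon>\<^sup>2 * x\<^sup>2 / 2))) * cis (u * x))"
    and "(\<integral>x. of_real (exp (- (\<epsilon>\<^sup>2 * x\<^sup>2 / 2))) * cis (u * x) \<partial>lborel) = of_real (2 * pi * normal_density 0 \<epsilon> u)"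
proof -
  define f where "f y = std_normal_density y *\<^sub>R cis ((u / \<epsilon>) * y)" for y
  have intf: "integrable lborel f"
    unfolding f_def by (rule Bochner_Integration.integrable_bound[OF integrable_normal_density[of 1 0]]) auto
  have If: "(\<integral>y. f y \<partial>lborel) = of_real (exp (- ((u / \<epsilon>)\<^sup>2) / 2))"
  proof -
    have "char std_normal_distribution (u / \<epsilon>) = (\<integral>y. f y \<partial>lborel)"
      unfolding char_def f_def cis_conv_exp
      by (subst integral_density) (auto simp: normal_density_nonneg)
    then show ?thesis by (simp add: char_std_normal_distribution)
  qed
  have fe: "f (0 + \<epsilon> * x) = of_real (1 / sqrt (2 * pi)) * (of_real (exp (- (\<epsilon>\<^sup>2 * x\<^sup>2 / 2))) * cis (u * x))" for x
    using \<epsilon> by (simp add: f_def std_normal_density_def scaleR_conv_of_real power_mult_distrib mult_ac)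
  have "integrable lborel (\<lambda>x. f (0 + \<epsilon> * x))" using intf \<epsilon> by (intro lborel_integrable_real_affine) auto
  then have "integrable lborel (\<lambda>x. of_real (sqrt (2 * pi)) * f (0 + \<epsilon> * x))" by (rule integrable_mult_right)
  moreover have "of_real (sqrt (2 * pi)) * (of_real (1 / sqrt (2 * pi)) * w) = w" for w :: complex
    unfolding mult.assoc[symmetric] of_real_mult[symmetric] by simp
  ultimately show "integrable lborel (\<lambda>x::real. of_real (exp (- (\<epsilon>\<^sup>2 * x\<^sup>2 / 2))) * cis (u * x))"
    unfolding fe by (simp only:)
  have "(\<integral>y. f y \<partial>lborel) = \<bar>\<epsilon>\<bar> *\<^sub>R (\<integral>x. f (0 + \<epsilon> * x) \<partial>lborel)"
    using \<epsilon> by (intro lborel_integral_real_affine) auto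
  then have "of_real (exp (- ((u / \<epsilon>)\<^sup>2) / 2)) = \<epsilon> *\<^sub>R (of_real (1 / sqrt (2 * pi)) * (\<integral>x. of_real (exp (- (\<epsilon>\<^sup>2 * x\<^sup>2 / 2))) * cis (u * x) \<partial>lborel))"
    unfolding If fe using \<epsilon> by simp
  then have "(\<integral>x. of_real (exp (- (\<epsilon>\<^sup>2 * x\<^sup>2 / 2))) * cis (u * x) \<partial>lborel) = of_real (sqrt (2 * pi) / \<epsilon> * exp (- ((u / \<epsilon>)\<^sup>2) / 2))"
    using \<epsilon> by (simp add: scaleR_conv_of_real field_simps)
  also have "sqrt (2 * pi) / \<epsilon> * exp (- ((u / \<epsilon>)\<^sup>2) / 2) = 2 * pi * normal_density 0 \<epsilon> u"
  proof -
    have "sqrt (2 * pi * \<epsilon>\<^sup>2) = sqrt (2 * pi) * \<epsilon>" using \<epsilon> by (simp add: real_sqrt_mult)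
    then have "2 * pi * normal_density 0 \<epsilon> u = (2 * pi / sqrt (2 * pi)) / \<epsilon> * exp (- ((u / \<epsilon>)\<^sup>2) / 2)"
      by (simp add: normal_density_def power_divide)
    then show ?thesis by (simp only: real_div_sqrt) (simp add: real_div_sqrt)
  qed
  finally show "(\<integral>x. of_real (exp (- (\<epsilon>\<^sup>2 * x\<^sup>2 / 2))) * cis (u * x) \<partial>lborel) = of_real (2 * pi * normal_density 0 \<epsilon> u)" .
qed

lemma gauss_fourier:
  fixes u :: "'a::euclidean_space"
  assumes \<epsilon>: "\<epsilon> > 0"
  shows "integrable lborel (\<lambda>z::'a. of_real (gauss_weight \<epsilon> z) * cis (u \<bullet> z))"
    and "(\<integral>z. of_real (gauss_weight \<epsilon> z) * cis (u \<bullet> z) \<partial>lborel) = of_real (gauss_kernel \<epsilon> u)"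
proof -
  have cis_sum: "cis (\<Sum>b\<in>A. h b) = (\<Prod>b\<in>A. cis (h b))" if "finite A" for A :: "'a set" and h
    using that by (induction A rule: finite_induct) (auto simp: cis_mult[symmetric])
  have eq: "of_real (gauss_weight \<epsilon> z) * cis (u \<bullet> z) =
      (\<Prod>b\<in>Basis. of_real (exp (- (\<epsilon>\<^sup>2 * (z \<bullet> b)\<^sup>2 / 2))) * cis ((u \<bullet> b) * (z \<bullet> b)))" for z :: 'a
  proof -
    have "gauss_weight \<epsilon> z = exp (\<Sum>b\<in>Basis. - (\<epsilon>\<^sup>2 * (z \<bullet> b)\<^sup>2 / 2))"
      unfolding gauss_weight_def power2_norm_eq_inner euclidean_inner[of z z]
      by (simp add: sum_negf sum_distrib_left sum_divide_distrib power2_eq_square)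
    moreover have "cis (u \<bullet> z) = (\<Prod>b\<in>Basis. cis ((u \<bullet> b) * (z \<bullet> b)))"
      by (subst euclidean_inner) (simp add: cis_sum)
    ultimately show ?thesis by (simp add: exp_sum prod.distrib)
  qed
  show "integrable lborel (\<lambda>z::'a. of_real (gauss_weight \<epsilon> z) * cis (u \<bullet> z))"
    unfolding eq by (rule integral_lborel_prod(1)) (rule gauss_fourier_real(1)[OF \<epsilon>])
  have "(\<integral>z. of_real (gauss_weight \<epsilon> z) * cis (u \<bullet> z) \<partial>lborel) =
      (\<Prod>b\<in>(Basis::'a set). \<integral>x. of_real (exp (- (\<epsilon>\<^sup>2 * x\<^sup>2 / 2))) * cis ((u \<bullet> b) * x) \<partial>lborel)"
    unfolding eq by (rule integral_lborel_prod(2)) (rule gauss_fourier_real(1)[OF \<epsilon>])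
  also have "\<dots> = of_real (gauss_kernel \<epsilon> u)"
    unfolding gauss_kernel_def gauss_fourier_real(2)[OF \<epsilon>] by simp
  finally show "(\<integral>z. of_real (gauss_weight \<epsilon> z) * cis (u \<bullet> z) \<partial>lborel) = of_real (gauss_kernel \<epsilon> u)" .
qed

lemma integrable_gauss_weight: "\<epsilon> > 0 \<Longrightarrow> integrable lborel (gauss_weight \<epsilon> :: 'a::euclidean_space \<Rightarrow> real)"
  using integrable_norm[OF gauss_fourier(1)[of \<epsilon> "0::'a"]]
  by (simp add: norm_mult abs_of_pos[OF gauss_weight_bounds(1)])

lemma cnj_measurable [measurable]: "cnj \<in> borel_measurable borel"
  by (intro borel_measurable_continuous_onI continuous_intros)

lemma nn_integral_lborel_translate:
  fixes f :: "'a::euclidean_space \<Rightarrow> ennreal"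
  assumes [measurable]: "f \<in> borel_measurable borel"
  shows "(\<integral>\<^sup>+y. f (c + y) \<partial>lborel) = (\<integral>\<^sup>+y. f y \<partial>lborel)"
proof -
  have "(\<integral>\<^sup>+y. f y \<partial>lborel) = (\<integral>\<^sup>+y. f y \<partial>(distr lborel borel ((+) c)))"
    by (simp only: lborel_distr_plus)
  also have "\<dots> = (\<integral>\<^sup>+y. f (c + y) \<partial>lborel)" by (rule nn_integral_distr) measurable
  finally show ?thesis by simp
qed

lemma nn_integral_gauss_kernel:
  fixes x :: "'a::euclidean_space"
  assumes \<epsilon>: "\<epsilon> > 0"
  shows "(\<integral>\<^sup>+y. ennreal (gauss_kernel \<epsilon> (x - y)) \<partial>lborel) = ennreal ((2 * pi) ^ DIM('a))"
proof -
  have even: "gauss_kernel \<epsilon> (x - y) = gauss_kernel \<epsilon> (- x + y)" for x y :: 'a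
    unfolding gauss_kernel_def
    by (intro prod.cong refl) (simp add: normal_density_def inner_diff_left inner_add_left power2_commute)
  have "(\<integral>\<^sup>+y. ennreal (gauss_kernel \<epsilon> (x - y)) \<partial>lborel) = (\<integral>\<^sup>+y. ennreal (gauss_kernel \<epsilon> (y::'a)) \<partial>lborel)"
    unfolding even by (rule nn_integral_lborel_translate) measurable
  also have "\<dots> = (\<integral>\<^sup>+y. (\<Prod>b\<in>(Basis::'a set). ennreal (2 * pi * normal_density 0 \<epsilon> (y \<bullet> b))) \<partial>lborel)"
    unfolding gauss_kernel_def by (subst prod_ennreal) auto
  also have "\<dots> = (\<Prod>b\<in>(Basis::'a set). \<integral>\<^sup>+x. ennreal (2 * pi * normal_density 0 \<epsilon> x) \<partial>lborel)"
    by (rule nn_integral_lborel_prod) auto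
  also have "(\<integral>\<^sup>+x. ennreal (2 * pi * normal_density 0 \<epsilon> x) \<partial>lborel) = ennreal (2 * pi)"
    using \<epsilon> by (subst nn_integral_eq_integral) auto
  finally show ?thesis by (simp add: ennreal_power)
qed

lemma integrable_pair_mult:
  fixes g :: "'a::euclidean_space \<Rightarrow> complex" and m :: "'b::euclidean_space \<Rightarrow> complex"
  assumes g: "integrable lborel g" and m: "integrable lborel m"
    and [measurable]: "K \<in> borel_measurable (borel \<Otimes>\<^sub>M borel)" and K1: "\<And>x y. norm (K (x, y)) \<le> 1"
  shows "integrable (lborel \<Otimes>\<^sub>M lborel) (\<lambda>(x, y). g x * m y * K (x, y))"
proof -
  have [measurable]: "g \<in> borel_measurable borel" "m \<in> borel_measurable borel"
    using g m by (simp_all add: borel_measurable_integrable)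
  have "integrable (lborel \<Otimes>\<^sub>M lborel) (\<lambda>(x, y). g x * m y)"
  proof (rule lborel_pair.Fubini_integrable)
    show "integrable lborel (\<lambda>x. \<integral>y. norm (case (x, y) of (x, y) \<Rightarrow> g x * m y) \<partial>lborel)"
      using g m by (simp add: norm_mult)
    show "AE x in lborel. integrable lborel (\<lambda>y. case (x, y) of (x, y) \<Rightarrow> g x * m y)"
      using m by simp
  qed measurable
  then show ?thesis
  proof (rule Bochner_Integration.integrable_bound)
    have "norm (g x * m y) * norm (K (x, y)) \<le> norm (g x * m y)" for x y
      by (intro mult_left_le K1) auto
    then show "AE p in lborel \<Otimes>\<^sub>M lborel. norm (case p of (x, y) \<Rightarrow> g x * m y * K (x, y)) \<le> norm (case p of (x, y) \<Rightarrow> g x * m y)"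
      by (intro AE_I2) (auto simp: norm_mult)
  qed measurable
qed

text \<open>
  The Gaussian makes all integrals absolutely convergent, so that the order of integration may be exchanged.
\<close>
lemma gauss_parseval:
  fixes m :: "'a::euclidean_space \<Rightarrow> complex"
  assumes m: "integrable lborel m" and \<epsilon>: "\<epsilon> > 0"
  defines "M z \<equiv> (\<integral>\<xi>. m \<xi> * cis (\<xi> \<bullet> z) \<partial>lborel)"
  shows "(\<integral>z. of_real (gauss_weight \<epsilon> z * (norm (M z))\<^sup>2) \<partial>lborel) =
    (\<integral>\<xi>. m \<xi> * (\<integral>\<eta>. cnj (m \<eta>) * of_real (gauss_kernel \<epsilon> (\<xi> - \<eta>)) \<partial>lborel) \<partial>lborel)"
    and "integrable lborel (\<lambda>z. gauss_weight \<epsilon> z * (norm (M z))\<^sup>2)"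
proof -
  have [measurable]: "m \<in> borel_measurable borel" using m by (simp add: borel_measurable_integrable)
  have [measurable]: "M \<in> borel_measurable borel" unfolding M_def by measurable
  define I where "I = (\<integral>\<xi>. norm (m \<xi>) \<partial>lborel)"
  have MI: "norm (M z) \<le> I" for z
    unfolding M_def I_def by (rule order_trans[OF integral_norm_bound]) (simp add: norm_mult)
  have I0: "0 \<le> I" using order_trans[OF norm_ge_zero MI] .
  have gw: "integrable lborel (gauss_weight \<epsilon> :: 'a \<Rightarrow> real)" by (rule integrable_gauss_weight[OF \<epsilon>])
  then have W: "integrable lborel (\<lambda>z::'a. of_real (gauss_weight \<epsilon> z) :: complex)"
    by simp
  show "integrable lborel (\<lambda>z. gauss_weight \<epsilon> z * (norm (M z))\<^sup>2)"
  proof (rule Bochner_Integration.integrable_bound)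
    show "integrable lborel (\<lambda>z::'a. gauss_weight \<epsilon> z * I\<^sup>2)"
      using gw by simp
    show "AE z in lborel. norm (gauss_weight \<epsilon> z * (norm (M z))\<^sup>2) \<le> norm (gauss_weight \<epsilon> z * I\<^sup>2)"
      using MI by (intro AE_I2) (auto simp: abs_mult intro!: mult_left_mono power_mono)
  qed measurable
  have WM: "integrable lborel (\<lambda>z. of_real (gauss_weight \<epsilon> z) * cnj (M z))"
  proof (rule Bochner_Integration.integrable_bound)
    show "integrable lborel (\<lambda>z::'a. gauss_weight \<epsilon> z * I)"
      using gw by simp
    show "AE z in lborel. norm (of_real (gauss_weight \<epsilon> z) * cnj (M z)) \<le> norm (gauss_weight \<epsilon> z * I)"
      using MI I0 by (intro AE_I2) (auto simp: norm_mult abs_mult intro!: mult_left_mono)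
  qed measurable
  have inner: "(\<integral>z. of_real (gauss_weight \<epsilon> z) * cnj (M z) * cis (\<xi> \<bullet> z) \<partial>lborel) =
      (\<integral>\<eta>. cnj (m \<eta>) * of_real (gauss_kernel \<epsilon> (\<xi> - \<eta>)) \<partial>lborel)" for \<xi>
  proof -
    have cm: "integrable lborel (\<lambda>\<eta>. cnj (m \<eta>))" using m by simp
    have "integrable (lborel \<Otimes>\<^sub>M lborel) (\<lambda>(z, \<eta>). of_real (gauss_weight \<epsilon> z) * cnj (m \<eta>) * cis ((\<xi> - \<eta>) \<bullet> z))"
      using integrable_pair_mult[OF W cm, of "\<lambda>(z, \<eta>). cis ((\<xi> - \<eta>) \<bullet> z)"] by simp
    then have "(\<integral>\<eta>. (\<integral>z. of_real (gauss_weight \<epsilon> z) * cnj (m \<eta>) * cis ((\<xi> - \<eta>) \<bullet> z) \<partial>lborel) \<partial>lborel) =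
      (\<integral>z. (\<integral>\<eta>. of_real (gauss_weight \<epsilon> z) * cnj (m \<eta>) * cis ((\<xi> - \<eta>) \<bullet> z) \<partial>lborel) \<partial>lborel)"
      by (rule lborel_pair.Fubini_integral)
    also have "\<dots> = (\<integral>z. of_real (gauss_weight \<epsilon> z) * cnj (M z) * cis (\<xi> \<bullet> z) \<partial>lborel)"
    proof (intro Bochner_Integration.integral_cong refl)
      fix z
      have "(\<integral>\<eta>. of_real (gauss_weight \<epsilon> z) * cnj (m \<eta>) * cis ((\<xi> - \<eta>) \<bullet> z) \<partial>lborel) =
        (\<integral>\<eta>. (of_real (gauss_weight \<epsilon> z) * cis (\<xi> \<bullet> z)) * cnj (m \<eta> * cis (\<eta> \<bullet> z)) \<partial>lborel)"
        by (intro Bochner_Integration.integral_cong refl)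
          (simp add: cis_cnj cis_mult inner_diff_left mult.assoc mult.left_commute)
      also have "\<dots> = (of_real (gauss_weight \<epsilon> z) * cis (\<xi> \<bullet> z)) * cnj (M z)"
        unfolding M_def integral_mult_right_zero by (simp del: complex_cnj_mult)
      finally show "(\<integral>\<eta>. of_real (gauss_weight \<epsilon> z) * cnj (m \<eta>) * cis ((\<xi> - \<eta>) \<bullet> z) \<partial>lborel) =
        of_real (gauss_weight \<epsilon> z) * cnj (M z) * cis (\<xi> \<bullet> z)" by (simp add: mult_ac)
    qed
    finally have "(\<integral>z. of_real (gauss_weight \<epsilon> z) * cnj (M z) * cis (\<xi> \<bullet> z) \<partial>lborel) =
      (\<integral>\<eta>. (\<integral>z. of_real (gauss_weight \<epsilon> z) * cnj (m \<eta>) * cis ((\<xi> - \<eta>) \<bullet> z) \<partial>lborel) \<partial>lborel)" by simp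
    also have "\<dots> = (\<integral>\<eta>. cnj (m \<eta>) * of_real (gauss_kernel \<epsilon> (\<xi> - \<eta>)) \<partial>lborel)"
    proof (intro Bochner_Integration.integral_cong refl)
      fix \<eta>
      have "(\<integral>z. of_real (gauss_weight \<epsilon> z) * cnj (m \<eta>) * cis ((\<xi> - \<eta>) \<bullet> z) \<partial>lborel) =
        (\<integral>z. cnj (m \<eta>) * (of_real (gauss_weight \<epsilon> z) * cis ((\<xi> - \<eta>) \<bullet> z)) \<partial>lborel)"
        by (simp add: mult_ac)
      then show "(\<integral>z. of_real (gauss_weight \<epsilon> z) * cnj (m \<eta>) * cis ((\<xi> - \<eta>) \<bullet> z) \<partial>lborel) =
        cnj (m \<eta>) * of_real (gauss_kernel \<epsilon> (\<xi> - \<eta>))"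
        by (simp only: integral_mult_right_zero gauss_fourier(2)[OF \<epsilon>])
    qed
    finally show ?thesis .
  qed
  have "integrable (lborel \<Otimes>\<^sub>M lborel) (\<lambda>(z, \<xi>). (of_real (gauss_weight \<epsilon> z) * cnj (M z)) * m \<xi> * cis (\<xi> \<bullet> z))"
    using integrable_pair_mult[OF WM m, of "\<lambda>(z, \<xi>). cis (\<xi> \<bullet> z)"] by simp
  then have "(\<integral>\<xi>. (\<integral>z. (of_real (gauss_weight \<epsilon> z) * cnj (M z)) * m \<xi> * cis (\<xi> \<bullet> z) \<partial>lborel) \<partial>lborel) =
    (\<integral>z. (\<integral>\<xi>. (of_real (gauss_weight \<epsilon> z) * cnj (M z)) * m \<xi> * cis (\<xi> \<bullet> z) \<partial>lborel) \<partial>lborel)"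
    by (rule lborel_pair.Fubini_integral)
  also have "\<dots> = (\<integral>z. of_real (gauss_weight \<epsilon> z * (norm (M z))\<^sup>2) \<partial>lborel)"
  proof (intro Bochner_Integration.integral_cong refl)
    fix z
    have "(\<integral>\<xi>. (of_real (gauss_weight \<epsilon> z) * cnj (M z)) * m \<xi> * cis (\<xi> \<bullet> z) \<partial>lborel) =
      (of_real (gauss_weight \<epsilon> z) * cnj (M z)) * M z"
      unfolding M_def mult.assoc[of "of_real (gauss_weight \<epsilon> z) * _"] by (rule integral_mult_right_zero)
    then show "(\<integral>\<xi>. (of_real (gauss_weight \<epsilon> z) * cnj (M z)) * m \<xi> * cis (\<xi> \<bullet> z) \<partial>lborel) =
      of_real (gauss_weight \<epsilon> z * (norm (M z))\<^sup>2)"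
      by (simp only: of_real_mult complex_norm_square of_real_power[symmetric] mult.assoc mult.commute[of "M z"])
  qed
  finally have "(\<integral>z. of_real (gauss_weight \<epsilon> z * (norm (M z))\<^sup>2) \<partial>lborel) =
    (\<integral>\<xi>. (\<integral>z. (of_real (gauss_weight \<epsilon> z) * cnj (M z)) * m \<xi> * cis (\<xi> \<bullet> z) \<partial>lborel) \<partial>lborel)" by simp
  also have "\<dots> = (\<integral>\<xi>. m \<xi> * (\<integral>\<eta>. cnj (m \<eta>) * of_real (gauss_kernel \<epsilon> (\<xi> - \<eta>)) \<partial>lborel) \<partial>lborel)"
  proof (intro Bochner_Integration.integral_cong refl)
    fix \<xi>
    have "(\<integral>z. (of_real (gauss_weight \<epsilon> z) * cnj (M z)) * m \<xi> * cis (\<xi> \<bullet> z) \<partial>lborel) =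
      (\<integral>z. m \<xi> * (of_real (gauss_weight \<epsilon> z) * cnj (M z) * cis (\<xi> \<bullet> z)) \<partial>lborel)" by (simp add: mult_ac)
    then show "(\<integral>z. (of_real (gauss_weight \<epsilon> z) * cnj (M z)) * m \<xi> * cis (\<xi> \<bullet> z) \<partial>lborel) =
      m \<xi> * (\<integral>\<eta>. cnj (m \<eta>) * of_real (gauss_kernel \<epsilon> (\<xi> - \<eta>)) \<partial>lborel)"
      by (simp only: integral_mult_right_zero inner)
  qed
  finally show "(\<integral>z. of_real (gauss_weight \<epsilon> z * (norm (M z))\<^sup>2) \<partial>lborel) =
    (\<integral>\<xi>. m \<xi> * (\<integral>\<eta>. cnj (m \<eta>) * of_real (gauss_kernel \<epsilon> (\<xi> - \<eta>)) \<partial>lborel) \<partial>lborel)" .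
qed

text \<open>
  The inequality in Plancherel's theorem, by regularization: the norm weighted with a Gaussian is a quadratic form in \<open>m\<close>
  with kernel \<open>gauss_kernel \<epsilon> (\<xi> - \<eta>)\<close>, and Schur's test bounds it by the mass of the kernel, uniformly in \<open>\<epsilon>\<close>.
\<close>
theorem fourier_bessel:
  fixes m :: "'a::euclidean_space \<Rightarrow> complex"
  assumes m: "integrable lborel m"
  shows "(\<integral>\<^sup>+z. ennreal ((norm (\<integral>\<xi>. m \<xi> * cis (\<xi> \<bullet> z) \<partial>lborel))\<^sup>2) \<partial>lborel) \<le>
    ennreal ((2 * pi) ^ DIM('a)) * (\<integral>\<^sup>+\<xi>. ennreal ((norm (m \<xi>))\<^sup>2) \<partial>lborel)"
proof -
  have [measurable]: "m \<in> borel_measurable borel" using m by (simp add: borel_measurable_integrable)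
  define M where "M z = (\<integral>\<xi>. m \<xi> * cis (\<xi> \<bullet> z) \<partial>lborel)" for z
  have [measurable]: "M \<in> borel_measurable borel" unfolding M_def by measurable
  define N where "N = (\<integral>\<^sup>+\<xi>. ennreal ((norm (m \<xi>))\<^sup>2) \<partial>lborel)"
  define c where "c = ennreal ((2 * pi) ^ DIM('a))"
  have bound: "(\<integral>\<^sup>+z. ennreal (gauss_weight \<epsilon> z * (norm (M z))\<^sup>2) \<partial>lborel) \<le> c * N" if \<epsilon>: "\<epsilon> > 0" for \<epsilon>
  proof -
    let ?k = "\<lambda>\<xi> \<eta>. ennreal (gauss_kernel \<epsilon> (\<xi> - \<eta>))"
    have P: "(\<integral>z. of_real (gauss_weight \<epsilon> z * (norm (M z))\<^sup>2) \<partial>lborel) =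
      (\<integral>\<xi>. m \<xi> * (\<integral>\<eta>. cnj (m \<eta>) * of_real (gauss_kernel \<epsilon> (\<xi> - \<eta>)) \<partial>lborel) \<partial>lborel)"
      unfolding M_def by (rule gauss_parseval(1)[OF m \<epsilon>])
    have int: "integrable lborel (\<lambda>z. gauss_weight \<epsilon> z * (norm (M z))\<^sup>2)"
      unfolding M_def by (rule gauss_parseval(2)[OF m \<epsilon>])
    have nonneg: "0 \<le> gauss_weight \<epsilon> z * (norm (M z))\<^sup>2" for z using gauss_weight_bounds(1)[of \<epsilon> z] by simp
    define Q where "Q = (\<integral>\<xi>. m \<xi> * (\<integral>\<eta>. cnj (m \<eta>) * of_real (gauss_kernel \<epsilon> (\<xi> - \<eta>)) \<partial>lborel) \<partial>lborel)"
    define D where "D = (\<integral>\<^sup>+\<xi>. ennreal (norm (m \<xi>)) * (\<integral>\<^sup>+\<eta>. ennreal (norm (m \<eta>)) * ?k \<xi> \<eta> \<partial>lborel) \<partial>lborel)"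
    define E where "E = (\<integral>\<^sup>+\<xi>. (\<integral>\<^sup>+\<eta>. ennreal ((norm (m \<xi>))\<^sup>2 / 2) * ?k \<xi> \<eta> \<partial>lborel) \<partial>lborel)"
    define E' where "E' = (\<integral>\<^sup>+\<xi>. (\<integral>\<^sup>+\<eta>. ennreal ((norm (m \<eta>))\<^sup>2 / 2) * ?k \<xi> \<eta> \<partial>lborel) \<partial>lborel)"
    have "(\<integral>z. gauss_weight \<epsilon> z * (norm (M z))\<^sup>2 \<partial>lborel) = norm (\<integral>z. of_real (gauss_weight \<epsilon> z * (norm (M z))\<^sup>2) \<partial>lborel :: complex)"
      unfolding integral_complex_of_real norm_of_real using nonneg by (simp add: integral_nonneg)
    then have "(\<integral>z. gauss_weight \<epsilon> z * (norm (M z))\<^sup>2 \<partial>lborel) = norm Q" by (simp only: P Q_def)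
    moreover have "(\<integral>\<^sup>+z. ennreal (gauss_weight \<epsilon> z * (norm (M z))\<^sup>2) \<partial>lborel) = ennreal (\<integral>z. gauss_weight \<epsilon> z * (norm (M z))\<^sup>2 \<partial>lborel)"
      by (rule nn_integral_eq_integral[OF int]) (use nonneg in auto)
    ultimately have 1: "(\<integral>\<^sup>+z. ennreal (gauss_weight \<epsilon> z * (norm (M z))\<^sup>2) \<partial>lborel) = ennreal (norm Q)" by simp
    have 2: "ennreal (norm Q) \<le> D"
    proof -
      have le: "ennreal (norm (integral\<^sup>L lborel f)) \<le> (\<integral>\<^sup>+x. ennreal (norm (f x)) \<partial>lborel)" for f :: "'a \<Rightarrow> complex"
      proof (cases "integrable lborel f")
        case True
        then show ?thesis by (rule integral_norm_bound_ennreal)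
      qed (simp add: not_integrable_integral_eq)
      have "ennreal (norm (m \<xi> * (\<integral>\<eta>. cnj (m \<eta>) * of_real (gauss_kernel \<epsilon> (\<xi> - \<eta>)) \<partial>lborel))) \<le>
          ennreal (norm (m \<xi>)) * (\<integral>\<^sup>+\<eta>. ennreal (norm (m \<eta>)) * ?k \<xi> \<eta> \<partial>lborel)" for \<xi>
      proof -
        have "ennreal (norm (\<integral>\<eta>. cnj (m \<eta>) * of_real (gauss_kernel \<epsilon> (\<xi> - \<eta>)) \<partial>lborel)) \<le>
          (\<integral>\<^sup>+\<eta>. ennreal (norm (cnj (m \<eta>) * of_real (gauss_kernel \<epsilon> (\<xi> - \<eta>)))) \<partial>lborel)" by (rule le)
        also have "\<dots> = (\<integral>\<^sup>+\<eta>. ennreal (norm (m \<eta>)) * ?k \<xi> \<eta> \<partial>lborel)"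
          by (simp add: norm_mult ennreal_mult' gauss_kernel_nonneg)
        finally show ?thesis by (simp add: norm_mult ennreal_mult' mult_left_mono)
      qed
      then show ?thesis unfolding Q_def D_def by (rule order_trans[OF le nn_integral_mono])
    qed
    have "D = (\<integral>\<^sup>+\<xi>. (\<integral>\<^sup>+\<eta>. ennreal (norm (m \<xi>)) * (ennreal (norm (m \<eta>)) * ?k \<xi> \<eta>) \<partial>lborel) \<partial>lborel)"
      unfolding D_def by (intro nn_integral_cong) (simp add: nn_integral_cmult)
    also have "\<dots> \<le> (\<integral>\<^sup>+\<xi>. (\<integral>\<^sup>+\<eta>. ennreal ((norm (m \<xi>))\<^sup>2 / 2) * ?k \<xi> \<eta> + ennreal ((norm (m \<eta>))\<^sup>2 / 2) * ?k \<xi> \<eta> \<partial>lborel) \<partial>lborel)"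
    proof (intro nn_integral_mono)
      fix \<xi> \<eta>
      have "norm (m \<xi>) * norm (m \<eta>) \<le> (norm (m \<xi>))\<^sup>2 / 2 + (norm (m \<eta>))\<^sup>2 / 2"
        using sum_squares_bound[of "norm (m \<xi>)" "norm (m \<eta>)"] by simp
      then have "ennreal (norm (m \<xi>) * norm (m \<eta>)) * ?k \<xi> \<eta> \<le> ennreal ((norm (m \<xi>))\<^sup>2 / 2 + (norm (m \<eta>))\<^sup>2 / 2) * ?k \<xi> \<eta>"
        by (intro mult_right_mono ennreal_leI) auto
      then show "ennreal (norm (m \<xi>)) * (ennreal (norm (m \<eta>)) * ?k \<xi> \<eta>) \<le>
          ennreal ((norm (m \<xi>))\<^sup>2 / 2) * ?k \<xi> \<eta> + ennreal ((norm (m \<eta>))\<^sup>2 / 2) * ?k \<xi> \<eta>"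
        by (simp add: ennreal_mult' ennreal_plus distrib_right mult.assoc)
    qed
    also have "\<dots> = E + E'"
      unfolding E_def E'_def
      by (subst nn_integral_add[symmetric]) (auto intro!: nn_integral_cong simp: nn_integral_add)
    finally have 3: "D \<le> E + E'" .
    have "E' = (\<integral>\<^sup>+\<eta>. (\<integral>\<^sup>+\<xi>. ennreal ((norm (m \<eta>))\<^sup>2 / 2) * ?k \<xi> \<eta> \<partial>lborel) \<partial>lborel)"
      unfolding E'_def by (rule lborel_pair.Fubini') measurable
    also have "\<dots> = E"
    proof -
      have "gauss_kernel \<epsilon> (\<xi> - \<eta>) = gauss_kernel \<epsilon> (\<eta> - \<xi>)" for \<xi> \<eta> :: 'a
        unfolding gauss_kernel_def
        by (intro prod.cong refl) (simp add: normal_density_def inner_diff_left power2_commute)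
      then show ?thesis unfolding E_def by (intro nn_integral_cong) simp
    qed
    finally have 4: "E' = E" .
    have 5: "E = (\<integral>\<^sup>+\<xi>. ennreal ((norm (m \<xi>))\<^sup>2 / 2) * c \<partial>lborel)"
      unfolding E_def c_def by (intro nn_integral_cong) (simp add: nn_integral_cmult nn_integral_gauss_kernel[OF \<epsilon>])
    have "E + E = (\<integral>\<^sup>+\<xi>. ennreal ((norm (m \<xi>))\<^sup>2 / 2) * c + ennreal ((norm (m \<xi>))\<^sup>2 / 2) * c \<partial>lborel)"
      unfolding 5 by (rule nn_integral_add[symmetric]) measurable
    also have "\<dots> = (\<integral>\<^sup>+\<xi>. c * ennreal ((norm (m \<xi>))\<^sup>2) \<partial>lborel)"
    proof (rule nn_integral_cong)
      fix \<xi>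
      have "ennreal ((norm (m \<xi>))\<^sup>2) = ennreal ((norm (m \<xi>))\<^sup>2 / 2) + ennreal ((norm (m \<xi>))\<^sup>2 / 2)"
        by (subst ennreal_plus[symmetric]) auto
      then show "ennreal ((norm (m \<xi>))\<^sup>2 / 2) * c + ennreal ((norm (m \<xi>))\<^sup>2 / 2) * c = c * ennreal ((norm (m \<xi>))\<^sup>2)"
        by (simp only: distrib_left mult.commute)
    qed
    also have "\<dots> = c * N" unfolding N_def by (rule nn_integral_cmult) measurable
    finally have 6: "E + E = c * N" .
    show ?thesis using 1 2 3 4 6 by (metis order_trans)
  qed
  define \<epsilon> where "\<epsilon> n = 1 / real (Suc n)" for n
  have \<epsilon>: "\<epsilon> n > 0" "\<epsilon> \<longlonglongrightarrow> 0" for n unfolding \<epsilon>_def using LIMSEQ_inverse_real_of_nat by (auto simp: divide_inverse)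
  have lim: "(\<lambda>n. ennreal (gauss_weight (\<epsilon> n) z * (norm (M z))\<^sup>2)) \<longlonglongrightarrow> ennreal ((norm (M z))\<^sup>2)" for z
  proof -
    have "(\<lambda>n. gauss_weight (\<epsilon> n) z * (norm (M z))\<^sup>2) \<longlonglongrightarrow> exp (- (0\<^sup>2 * (norm z)\<^sup>2 / 2)) * (norm (M z))\<^sup>2"
      unfolding gauss_weight_def by (intro tendsto_intros \<epsilon>) auto
    then show ?thesis by (intro tendsto_ennrealI) simp
  qed
  have "(\<integral>\<^sup>+z. ennreal ((norm (M z))\<^sup>2) \<partial>lborel) = (\<integral>\<^sup>+z. liminf (\<lambda>n. ennreal (gauss_weight (\<epsilon> n) z * (norm (M z))\<^sup>2)) \<partial>lborel)"
    by (intro nn_integral_cong) (simp add: lim_imp_Liminf[OF _ lim])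
  also have "\<dots> \<le> liminf (\<lambda>n. \<integral>\<^sup>+z. ennreal (gauss_weight (\<epsilon> n) z * (norm (M z))\<^sup>2) \<partial>lborel)"
    by (rule nn_integral_liminf) measurable
  also have "\<dots> \<le> c * N" by (rule Liminf_le) (use bound \<epsilon> in auto)
  finally show ?thesis by (simp add: M_def c_def N_def)
qed

section \<open>Injectivity of the Fourier transform\<close>

text \<open>
  The positive and the negative part of \<open>f\<close> are densities of measures that agree on boxes, and boxes are stable
  under intersection and generate the Borel sets.
\<close>
lemma AE_zero_of_box_integrals_real:
  fixes f :: "'a::euclidean_space \<Rightarrow> real"
  assumes f: "integrable lborel f" and zero: "\<And>a b. (\<integral>x. indicator (box a b) x * f x \<partial>lborel) = 0"
  shows "AE x in lborel. f x = 0"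
proof -
  have [measurable]: "f \<in> borel_measurable borel" using f by (simp add: borel_measurable_integrable)
  have fin: "(\<integral>\<^sup>+x. ennreal (s * f x) * indicator X x \<partial>lborel) \<noteq> \<infinity>" if "\<bar>s\<bar> = 1" for s X
  proof -
    have "(\<integral>\<^sup>+x. ennreal (s * f x) * indicator X x \<partial>lborel) \<le> (\<integral>\<^sup>+x. ennreal (norm (f x)) \<partial>lborel)"
      using that by (intro nn_integral_mono) (auto simp: indicator_def abs_if split: if_splits intro!: ennreal_leI)
    also have "\<dots> < \<infinity>" using f by (simp add: integrable_iff_bounded)
    finally show ?thesis by simp
  qed
  have eq: "(\<integral>\<^sup>+x. ennreal (f x) * indicator (box a b) x \<partial>lborel) = (\<integral>\<^sup>+x. ennreal (- f x) * indicator (box a b) x \<partial>lborel)" for a b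
  proof -
    define g where "g x = indicator (box a b) x * f x" for x
    have g: "integrable lborel g"
      unfolding g_def by (rule Bochner_Integration.integrable_bound[OF f]) (auto simp: indicator_def)
    have [measurable]: "g \<in> borel_measurable borel" unfolding g_def by measurable
    have 1: "(\<integral>\<^sup>+x. ennreal (f x) * indicator (box a b) x \<partial>lborel) = (\<integral>\<^sup>+x. ennreal (g x) \<partial>lborel)"
      by (intro nn_integral_cong) (auto simp: g_def indicator_def)
    have 2: "(\<integral>\<^sup>+x. ennreal (- f x) * indicator (box a b) x \<partial>lborel) = (\<integral>\<^sup>+x. ennreal (- g x) \<partial>lborel)"
      by (intro nn_integral_cong) (auto simp: g_def indicator_def)
    have fin1: "(\<integral>\<^sup>+x. ennreal (g x) \<partial>lborel) \<noteq> \<infinity>" "(\<integral>\<^sup>+x. ennreal (- g x) \<partial>lborel) \<noteq> \<infinity>"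
      using fin[of 1 "box a b"] fin[of "-1" "box a b"] 1 2 by simp_all
    have "enn2real (\<integral>\<^sup>+x. ennreal (g x) \<partial>lborel) - enn2real (\<integral>\<^sup>+x. ennreal (- g x) \<partial>lborel) = 0"
    proof -
      have "integral\<^sup>L lborel g = 0" using zero[of a b] by (simp add: g_def[abs_def])
      then show ?thesis using real_lebesgue_integral_def[OF g] by simp
    qed
    then have "ennreal (enn2real (\<integral>\<^sup>+x. ennreal (g x) \<partial>lborel)) = ennreal (enn2real (\<integral>\<^sup>+x. ennreal (- g x) \<partial>lborel))" by simp
    then show ?thesis unfolding 1 2 using fin1 by (simp add: ennreal_enn2real_if)
  qed
  have "density lborel (\<lambda>x. ennreal (f x)) = density lborel (\<lambda>x. ennreal (- f x))"
  proof (rule measure_eqI_generator_eq)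
    let ?E = "range (\<lambda>(a, b). box a b::'a set)"
    show "Int_stable ?E" by (auto simp: Int_stable_def box_Int_box)
    show "?E \<subseteq> Pow UNIV" "sets (density lborel (\<lambda>x. ennreal (f x))) = sigma_sets UNIV ?E"
      "sets (density lborel (\<lambda>x. ennreal (- f x))) = sigma_sets UNIV ?E"
      by (simp_all add: borel_eq_box)
    let ?A = "\<lambda>n::nat. box (- (real n *\<^sub>R One)) (real n *\<^sub>R One) :: 'a set"
    show "range ?A \<subseteq> ?E" "(\<Union>i. ?A i) = UNIV" unfolding UN_box_eq_UNIV by auto
    show "emeasure (density lborel (\<lambda>x. ennreal (f x))) (?A i) \<noteq> \<infinity>" for i
      using fin[of 1 "?A i"] by (simp add: emeasure_density)
    fix X assume "X \<in> ?E"
    then obtain a b where X: "X = box a b" by auto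
    show "emeasure (density lborel (\<lambda>x. ennreal (f x))) X = emeasure (density lborel (\<lambda>x. ennreal (- f x))) X"
      unfolding X by (simp add: emeasure_density eq)
  qed
  then have "AE x in lborel. ennreal (f x) = ennreal (- f x)"
    by (subst (asm) sigma_finite_measure.density_unique_iff[OF sigma_finite_lborel]) auto
  then show ?thesis
  proof eventually_elim
    case (elim x)
    then show ?case by (cases "f x \<ge> 0") (auto simp: ennreal_neg)
  qed
qed

lemma AE_zero_of_box_integrals:
  fixes g :: "'a::euclidean_space \<Rightarrow> complex"
  assumes g: "integrable lborel g" and zero: "\<And>a b. (\<integral>x. g x * of_real (indicator (box a b) x) \<partial>lborel) = 0"
  shows "AE x in lborel. g x = 0"
proof -
  have gi: "integrable lborel (\<lambda>x. g x * of_real (indicator (box a b) x))" for a b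
    by (rule Bochner_Integration.integrable_bound[OF g])
      (use g in \<open>auto simp: borel_measurable_integrable norm_mult indicator_def\<close>)
  have "AE x in lborel. Re (g x) = 0"
  proof (rule AE_zero_of_box_integrals_real)
    show "integrable lborel (\<lambda>x. Re (g x))" using g by simp
    fix a b
    have "(\<integral>x. indicator (box a b) x * Re (g x) \<partial>lborel) = (\<integral>x. Re (g x * of_real (indicator (box a b) x)) \<partial>lborel)"
      by (simp add: mult.commute)
    also have "\<dots> = Re (\<integral>x. g x * of_real (indicator (box a b) x) \<partial>lborel)"
      by (rule integral_Re[OF gi])
    finally show "(\<integral>x. indicator (box a b) x * Re (g x) \<partial>lborel) = 0" by (simp add: zero)
  qed
  moreover have "AE x in lborel. Im (g x) = 0"
  proof (rule AE_zero_of_box_integrals_real)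
    show "integrable lborel (\<lambda>x. Im (g x))" using g by simp
    fix a b
    have "(\<integral>x. indicator (box a b) x * Im (g x) \<partial>lborel) = (\<integral>x. Im (g x * of_real (indicator (box a b) x)) \<partial>lborel)"
      by (simp add: mult.commute)
    also have "\<dots> = Im (\<integral>x. g x * of_real (indicator (box a b) x) \<partial>lborel)"
      by (rule integral_Im[OF gi])
    finally show "(\<integral>x. indicator (box a b) x * Im (g x) \<partial>lborel) = 0" by (simp add: zero)
  qed
  ultimately show ?thesis by eventually_elim (simp add: complex_eq_iff)
qed

lemma lborel_integral_affine:
  fixes f :: "'a::euclidean_space \<Rightarrow> real"
  assumes [measurable]: "f \<in> borel_measurable borel" and c: "c \<noteq> 0"
  shows "(\<integral>y. f y \<partial>lborel) = (\<integral>u. \<bar>c\<bar> ^ DIM('a) * f (t + c *\<^sub>R u) \<partial>lborel)"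
proof -
  have "(\<integral>y. f y \<partial>lborel) = (\<integral>y. f y \<partial>(density (distr lborel borel (\<lambda>x. t + c *\<^sub>R x)) (\<lambda>_. ennreal (\<bar>c\<bar> ^ DIM('a)))))"
    using lborel_affine[OF c, of t] by simp
  also have "\<dots> = (\<integral>y. \<bar>c\<bar> ^ DIM('a) *\<^sub>R f y \<partial>(distr lborel borel (\<lambda>x. t + c *\<^sub>R x)))"
    by (rule integral_density) auto
  also have "\<dots> = (\<integral>u. \<bar>c\<bar> ^ DIM('a) * f (t + c *\<^sub>R u) \<partial>lborel)"
    by (subst integral_distr) auto
  finally show ?thesis .
qed

lemma gauss_kernel_scale:
  fixes u :: "'a::euclidean_space"
  assumes \<epsilon>: "\<epsilon> > 0"
  shows "\<bar>\<epsilon>\<bar> ^ DIM('a) * gauss_kernel \<epsilon> (- (\<epsilon> *\<^sub>R u)) = gauss_kernel 1 u"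
proof -
  have 1: "\<epsilon> * (2 * pi * normal_density 0 \<epsilon> (- (\<epsilon> * x))) = 2 * pi * normal_density 0 1 x" for x
  proof -
    have "sqrt (2 * pi * \<epsilon>\<^sup>2) = sqrt (2 * pi) * \<epsilon>" using \<epsilon> by (simp add: real_sqrt_mult)
    then show ?thesis using \<epsilon> by (simp add: normal_density_def power_mult_distrib)
  qed
  have "\<bar>\<epsilon>\<bar> ^ DIM('a) = (\<Prod>b\<in>(Basis::'a set). \<epsilon>)" using \<epsilon> by simp
  then show ?thesis
    unfolding gauss_kernel_def by (simp only: prod.distrib[symmetric] inner_minus_left inner_scaleR_left 1)
qed

lemma gauss_kernel_le:
  fixes u :: "'a::euclidean_space"
  assumes \<epsilon>: "\<epsilon> > 0"
  shows "gauss_kernel \<epsilon> u \<le> (2 * pi / sqrt (2 * pi * \<epsilon>\<^sup>2)) ^ DIM('a)"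
proof -
  have "gauss_kernel \<epsilon> u \<le> (\<Prod>b\<in>(Basis::'a set). 2 * pi / sqrt (2 * pi * \<epsilon>\<^sup>2))"
    unfolding gauss_kernel_def by (intro prod_mono) (auto simp: normal_density_def intro!: divide_right_mono)
  then show ?thesis by simp
qed

lemma integrable_gauss_kernel:
  fixes x :: "'a::euclidean_space"
  assumes \<epsilon>: "\<epsilon> > 0"
  shows "integrable lborel (\<lambda>y. gauss_kernel \<epsilon> (x - y))" "(\<integral>y. gauss_kernel \<epsilon> (x - y) \<partial>lborel) = (2 * pi) ^ DIM('a)"
proof -
  show "integrable lborel (\<lambda>y. gauss_kernel \<epsilon> (x - y))"
    using nn_integral_gauss_kernel[OF \<epsilon>, of x] by (intro integrableI_bounded) (auto simp: gauss_kernel_nonneg)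
  show "(\<integral>y. gauss_kernel \<epsilon> (x - y) \<partial>lborel) = (2 * pi) ^ DIM('a)"
    by (subst integral_eq_nn_integral) (auto simp: gauss_kernel_nonneg nn_integral_gauss_kernel[OF \<epsilon>, of x])
qed

text \<open>
  If the Fourier transform of \<open>g\<close> is zero then so is every convolution of \<open>g\<close> with a Gaussian. Hence the integral of \<open>g\<close> against the
  smoothed indicator of a box is zero, and letting the Gaussian shrink gives the integral of \<open>g\<close> over the box.
\<close>
theorem fourier_injective:
  fixes g :: "'a::euclidean_space \<Rightarrow> complex"
  assumes g: "integrable lborel g" and zero: "\<And>\<xi>. (\<integral>x. g x * cis (- (\<xi> \<bullet> x)) \<partial>lborel) = 0"
  shows "AE x in lborel. g x = 0"
proof (rule AE_zero_of_box_integrals[OF g])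
  fix a b :: 'a
  have [measurable]: "g \<in> borel_measurable borel" using g by (simp add: borel_measurable_integrable)
  have step1: "(\<integral>x. g x * of_real (gauss_kernel \<epsilon> (x - y)) \<partial>lborel) = 0" if \<epsilon>: "\<epsilon> > 0" for \<epsilon> y
  proof -
    have W: "integrable lborel (\<lambda>z. complex_of_real (gauss_weight \<epsilon> (z::'a)))"
      by (rule integrable_of_real[OF integrable_gauss_weight[OF \<epsilon>]])
    have "integrable (lborel \<Otimes>\<^sub>M lborel) (\<lambda>(x, z). g x * of_real (gauss_weight \<epsilon> z) * cis ((x - y) \<bullet> z))"
      using integrable_pair_mult[OF g W, of "\<lambda>(x, z). cis ((x - y) \<bullet> z)"] by simp
    then have "(\<integral>z. (\<integral>x. g x * of_real (gauss_weight \<epsilon> z) * cis ((x - y) \<bullet> z) \<partial>lborel) \<partial>lborel) =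
      (\<integral>x. (\<integral>z. g x * of_real (gauss_weight \<epsilon> z) * cis ((x - y) \<bullet> z) \<partial>lborel) \<partial>lborel)"
      by (rule lborel_pair.Fubini_integral)
    moreover have "(\<integral>z. g x * of_real (gauss_weight \<epsilon> z) * cis ((x - y) \<bullet> z) \<partial>lborel) = g x * of_real (gauss_kernel \<epsilon> (x - y))" for x
      unfolding mult.assoc[of "g x"] integral_mult_right_zero gauss_fourier(2)[OF \<epsilon>] ..
    moreover have "(\<integral>x. g x * of_real (gauss_weight \<epsilon> z) * cis ((x - y) \<bullet> z) \<partial>lborel) = 0" for z
    proof -
      have "(\<integral>x. g x * of_real (gauss_weight \<epsilon> z) * cis ((x - y) \<bullet> z) \<partial>lborel) =
        (\<integral>x. (of_real (gauss_weight \<epsilon> z) * cis (- (y \<bullet> z))) * (g x * cis (- (- z \<bullet> x))) \<partial>lborel)"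
        by (intro Bochner_Integration.integral_cong refl)
          (simp add: inner_diff_left inner_commute[of z] cis_mult mult.assoc mult.left_commute)
      then show ?thesis by (simp only: integral_mult_right_zero zero mult_zero_right)
    qed
    ultimately show ?thesis by simp
  qed
  define B where "B = box a b"
  have [measurable]: "B \<in> sets borel" by (simp add: B_def)
  define H where "H \<epsilon> x = (\<integral>y. indicator B y * gauss_kernel \<epsilon> (x - y) \<partial>lborel)" for \<epsilon> x
  have step2: "(\<integral>x. g x * of_real (H \<epsilon> x) \<partial>lborel) = 0" if \<epsilon>: "\<epsilon> > 0" for \<epsilon>
  proof -
    define K where "K = (2 * pi / sqrt (2 * pi * \<epsilon>\<^sup>2)) ^ DIM('a)"
    have K: "K > 0" using \<epsilon> by (simp add: K_def)
    have iB: "integrable lborel (\<lambda>y. complex_of_real (indicator B y))"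
      using emeasure_lborel_box_finite[of a b] by (intro integrable_of_real integrable_real_indicator) (auto simp: B_def)
    have kb: "norm (complex_of_real (gauss_kernel \<epsilon> (x - y) / K)) \<le> 1" for x y :: 'a
      unfolding norm_of_real using gauss_kernel_le[OF \<epsilon>, of "x - y"] K gauss_kernel_nonneg[of \<epsilon> "x - y"]
      by (simp add: K_def[symmetric])
    have "integrable (lborel \<Otimes>\<^sub>M lborel) (\<lambda>(x, y). g x * of_real (indicator B y) * of_real (gauss_kernel \<epsilon> (x - y) / K))"
      using integrable_pair_mult[OF g iB, of "\<lambda>(x, y). of_real (gauss_kernel \<epsilon> (x - y) / K)"] kb
      by simp
    then have "integrable (lborel \<Otimes>\<^sub>M lborel) (\<lambda>p. of_real K * (case p of (x, y) \<Rightarrow> g x * of_real (indicator B y) * of_real (gauss_kernel \<epsilon> (x - y) / K)))"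
      by (rule integrable_mult_right)
    also have "(\<lambda>p. of_real K * (case p of (x, y) \<Rightarrow> g x * of_real (indicator B y) * of_real (gauss_kernel \<epsilon> (x - y) / K))) =
      (\<lambda>(x, y). g x * of_real (indicator B y) * of_real (gauss_kernel \<epsilon> (x - y)))"
      using K by (auto simp: fun_eq_iff)
    finally have "(\<integral>y. (\<integral>x. g x * of_real (indicator B y) * of_real (gauss_kernel \<epsilon> (x - y)) \<partial>lborel) \<partial>lborel) =
      (\<integral>x. (\<integral>y. g x * of_real (indicator B y) * of_real (gauss_kernel \<epsilon> (x - y)) \<partial>lborel) \<partial>lborel)"
      by (rule lborel_pair.Fubini_integral)
    moreover have "(\<integral>y. g x * of_real (indicator B y) * of_real (gauss_kernel \<epsilon> (x - y)) \<partial>lborel) = g x * of_real (H \<epsilon> x)" for x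
    proof -
      have "(\<integral>y. g x * of_real (indicator B y) * of_real (gauss_kernel \<epsilon> (x - y)) \<partial>lborel) =
        g x * (\<integral>y. of_real (indicator B y * gauss_kernel \<epsilon> (x - y)) \<partial>lborel)"
        unfolding mult.assoc of_real_mult by (rule integral_mult_right_zero)
      then show ?thesis unfolding H_def integral_complex_of_real .
    qed
    moreover have "(\<integral>x. g x * of_real (indicator B y) * of_real (gauss_kernel \<epsilon> (x - y)) \<partial>lborel) = 0" for y
    proof -
      have "(\<integral>x. g x * of_real (indicator B y) * of_real (gauss_kernel \<epsilon> (x - y)) \<partial>lborel) =
        (\<integral>x. of_real (indicator B y) * (g x * of_real (gauss_kernel \<epsilon> (x - y))) \<partial>lborel)" by (simp add: mult_ac)
      then show ?thesis by (simp only: integral_mult_right_zero step1[OF \<epsilon>] mult_zero_right)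
    qed
    ultimately show ?thesis by simp
  qed
  \<comment> \<open>Off the boundary of the box, a null set, the smoothed indicators tend to \<open>c\<close> times the indicator.\<close>
  define \<epsilon> where "\<epsilon> n = 1 / real (Suc n)" for n
  have \<epsilon>: "\<epsilon> n > 0" "\<epsilon> \<longlonglongrightarrow> 0" for n unfolding \<epsilon>_def using LIMSEQ_inverse_real_of_nat by (auto simp: divide_inverse)
  define c where "c = (2 * pi) ^ DIM('a)"
  have k1: "integrable lborel (gauss_kernel 1 :: 'a \<Rightarrow> real)" "(\<integral>u. gauss_kernel 1 (u::'a) \<partial>lborel) = c"
  proof -
    have even: "gauss_kernel 1 (0 - u) = gauss_kernel 1 (u::'a)" for u
      unfolding gauss_kernel_def by (intro prod.cong refl) (simp add: normal_density_def)
    show "integrable lborel (gauss_kernel 1 :: 'a \<Rightarrow> real)" using integrable_gauss_kernel(1)[of 1 "0::'a"] unfolding even by simp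
    show "(\<integral>u. gauss_kernel 1 (u::'a) \<partial>lborel) = c"
      using integrable_gauss_kernel(2)[of 1 "0::'a"] unfolding even c_def by simp
  qed
  have H_le: "\<bar>H e x\<bar> \<le> c" if "e > 0" for e x
  proof -
    have "\<bar>H e x\<bar> \<le> (\<integral>y. \<bar>indicator B y * gauss_kernel e (x - y)\<bar> \<partial>lborel)" unfolding H_def by (rule integral_abs_bound)
    also have "\<dots> \<le> (\<integral>y. gauss_kernel e (x - y) \<partial>lborel)"
    proof (rule integral_mono)
      show "integrable lborel (\<lambda>y. \<bar>indicator B y * gauss_kernel e (x - y)\<bar>)"
        using integrable_gauss_kernel(1)[OF that, of x]
        by (rule Bochner_Integration.integrable_bound) (auto simp: indicator_def)
    qed (use integrable_gauss_kernel(1)[OF that, of x] in \<open>auto simp: indicator_def gauss_kernel_nonneg\<close>)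
    finally show ?thesis by (simp add: integrable_gauss_kernel[OF that] c_def)
  qed
  have [measurable]: "H e \<in> borel_measurable borel" for e unfolding H_def by measurable
  have H_scale: "H e x = (\<integral>u. indicator B (x + e *\<^sub>R u) * gauss_kernel 1 u \<partial>lborel)" if e: "e > 0" for e x
  proof -
    have "H e x = (\<integral>u. \<bar>e\<bar> ^ DIM('a) * (indicator B (x + e *\<^sub>R u) * gauss_kernel e (x - (x + e *\<^sub>R u))) \<partial>lborel)"
      unfolding H_def by (rule lborel_integral_affine) (use e in auto)
    also have "\<dots> = (\<integral>u. indicator B (x + e *\<^sub>R u) * gauss_kernel 1 u \<partial>lborel)"
    proof (intro Bochner_Integration.integral_cong refl)
      fix u
      have "\<bar>e\<bar> ^ DIM('a) * (indicator B (x + e *\<^sub>R u) * gauss_kernel e (x - (x + e *\<^sub>R u))) =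
        indicator B (x + e *\<^sub>R u) * (\<bar>e\<bar> ^ DIM('a) * gauss_kernel e (- (e *\<^sub>R u)))" by simp
      then show "\<bar>e\<bar> ^ DIM('a) * (indicator B (x + e *\<^sub>R u) * gauss_kernel e (x - (x + e *\<^sub>R u))) =
        indicator B (x + e *\<^sub>R u) * gauss_kernel 1 u" unfolding gauss_kernel_scale[OF e] .
    qed
    finally show ?thesis .
  qed
  have H_lim: "(\<lambda>n. H (\<epsilon> n) x) \<longlonglongrightarrow> indicator B x * c" if x: "x \<notin> cbox a b - box a b" for x
  proof -
    have ev: "\<forall>\<^sub>F n in sequentially. indicator B (x + \<epsilon> n *\<^sub>R u) = (indicator B x :: real)" for u
    proof -
      have lim: "(\<lambda>n. x + \<epsilon> n *\<^sub>R u) \<longlonglongrightarrow> x" using \<epsilon>(2) by (auto intro!: tendsto_eq_intros)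
      show ?thesis
      proof (cases "x \<in> box a b")
        case True
        have "\<forall>\<^sub>F n in sequentially. x + \<epsilon> n *\<^sub>R u \<in> box a b" using topological_tendstoD[OF lim open_box True] .
        then show ?thesis by eventually_elim (use True in \<open>simp add: B_def\<close>)
      next
        case False
        then have "x \<in> - cbox a b" using x by simp
        then have "\<forall>\<^sub>F n in sequentially. x + \<epsilon> n *\<^sub>R u \<in> - cbox a b"
          using topological_tendstoD[OF lim, of "- cbox a b"] by (simp add: open_Compl closed_cbox)
        then show ?thesis by eventually_elim (use False box_subset_cbox[of a b] in \<open>auto simp: B_def indicator_def\<close>)
      qed
    qed
    have "(\<lambda>n. \<integral>u. indicator B (x + \<epsilon> n *\<^sub>R u) * gauss_kernel 1 u \<partial>lborel) \<longlonglongrightarrow> (\<integral>u. indicator B x * gauss_kernel 1 (u::'a) \<partial>lborel)"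
    proof (rule integral_dominated_convergence)
      show "integrable lborel (gauss_kernel 1 :: 'a \<Rightarrow> real)" by (rule k1)
      show "AE u in lborel. (\<lambda>n. indicator B (x + \<epsilon> n *\<^sub>R u) * gauss_kernel 1 u) \<longlonglongrightarrow> indicator B x * gauss_kernel 1 u"
        by (intro AE_I2 tendsto_mult tendsto_const tendsto_eventually ev)
      show "AE u in lborel. norm (indicator B (x + \<epsilon> n *\<^sub>R u) * gauss_kernel 1 u) \<le> gauss_kernel 1 u" for n
        by (intro AE_I2) (auto simp: indicator_def gauss_kernel_nonneg)
    qed measurable
    then show ?thesis using k1 by (simp add: H_scale[OF \<epsilon>(1)])
  qed
  have AEx: "AE x in lborel. x \<notin> cbox a b - box a b"
  proof (rule AE_not_in)
    have "emeasure lborel (cbox a b - box a b) = emeasure lborel (cbox a b) - emeasure lborel (box a b)"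
      using emeasure_lborel_box_finite[of a b] by (intro emeasure_Diff) (auto simp: box_subset_cbox)
    then show "cbox a b - box a b \<in> null_sets lborel"
      by (auto simp: null_sets_def emeasure_lborel_cbox_eq emeasure_lborel_box_eq)
  qed
  have "(\<lambda>n. \<integral>x. g x * of_real (H (\<epsilon> n) x) \<partial>lborel) \<longlonglongrightarrow> (\<integral>x. g x * of_real (indicator B x * c) \<partial>lborel)"
  proof (rule integral_dominated_convergence)
    show "integrable lborel (\<lambda>x. norm (g x) * c)" using g by simp
    show "AE x in lborel. (\<lambda>n. g x * of_real (H (\<epsilon> n) x)) \<longlonglongrightarrow> g x * of_real (indicator B x * c)"
      using AEx by eventually_elim (intro tendsto_intros H_lim)
    show "AE x in lborel. norm (g x * of_real (H (\<epsilon> n) x)) \<le> norm (g x) * c" for n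
      by (intro AE_I2) (auto simp: norm_mult intro!: mult_left_mono H_le \<epsilon>)
  qed measurable
  then have "(\<integral>x. g x * of_real (indicator B x * c) \<partial>lborel) = 0"
    by (simp add: step2[OF \<epsilon>(1)] LIMSEQ_const_iff)
  moreover have "(\<integral>x. g x * of_real (indicator B x * c) \<partial>lborel) = of_real c * (\<integral>x. g x * of_real (indicator B x) \<partial>lborel)"
    unfolding integral_mult_right_zero[symmetric] by (simp add: mult_ac)
  ultimately show "(\<integral>x. g x * of_real (indicator (box a b) x) \<partial>lborel) = 0"
    by (simp add: c_def B_def)
qed

section \<open>Square integrable functions and unitary groups\<close>

lemma L2_measurable: "f \<in> L2 \<Longrightarrow> f \<in> borel_measurable borel"
  by (simp add: L2_def)

lemma L2_integrable: "f \<in> L2 \<Longrightarrow> integrable lborel (\<lambda>x. (cmod (f x))\<^sup>2)"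
  by (simp add: L2_def)

lemma L2_I:
  assumes "f \<in> borel_measurable borel" and "integrable lborel g" and "\<And>x. (cmod (f x))\<^sup>2 \<le> g x"
  shows "f \<in> L2"
proof -
  have "(cmod (f x))\<^sup>2 \<le> \<bar>g x\<bar>" for x using assms(3)[of x] by linarith
  then show ?thesis unfolding L2_def using assms(1)
    by (auto intro!: Bochner_Integration.integrable_bound[OF assms(2)])
qed

lemma L2_scale:
  assumes f: "f \<in> L2" shows "(\<lambda>x. c * f x) \<in> L2"
proof (rule L2_I)
  show "integrable lborel (\<lambda>x. (cmod c)\<^sup>2 * (cmod (f x))\<^sup>2)" using L2_integrable[OF f] by simp
qed (use L2_measurable[OF f] in \<open>auto simp: norm_mult power_mult_distrib\<close>)

lemma L2_add:
  assumes f: "f \<in> L2" and g: "g \<in> L2" shows "(\<lambda>x. f x + g x) \<in> L2"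
proof (rule L2_I)
  show "integrable lborel (\<lambda>x. 2 * (cmod (f x))\<^sup>2 + 2 * (cmod (g x))\<^sup>2)"
    using L2_integrable[OF f] L2_integrable[OF g] by simp
  fix x
  have "(cmod (f x + g x))\<^sup>2 \<le> (cmod (f x) + cmod (g x))\<^sup>2" by (intro power_mono norm_triangle_ineq) auto
  then show "(cmod (f x + g x))\<^sup>2 \<le> 2 * (cmod (f x))\<^sup>2 + 2 * (cmod (g x))\<^sup>2"
    using sum_squares_bound[of "cmod (f x)" "cmod (g x)"] by (simp add: power2_sum)
qed (use L2_measurable[OF f] L2_measurable[OF g] in auto)

lemma L2_diff: "f \<in> L2 \<Longrightarrow> g \<in> L2 \<Longrightarrow> (\<lambda>x. f x - g x) \<in> L2"
  using L2_add[of f "\<lambda>x. (-1) * g x"] L2_scale[of g "-1"] by simp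

lemma L2_norm_nonneg: "0 \<le> L2_norm f"
  by (simp add: L2_norm_def)

lemma L2_norm_sq: "(L2_norm f)\<^sup>2 = (\<integral>x. (cmod (f x))\<^sup>2 \<partial>lborel)"
  by (simp add: L2_norm_def)

lemma L2_norm_cong_AE:
  assumes "f \<in> borel_measurable borel" "g \<in> borel_measurable borel" "AE x in lborel. f x = g x"
  shows "L2_norm f = L2_norm g"
  unfolding L2_norm_def by (intro arg_cong[where f = sqrt] integral_cong_AE) (use assms in auto)

definition L2_inner :: "('a::euclidean_space \<Rightarrow> complex) \<Rightarrow> ('a \<Rightarrow> complex) \<Rightarrow> complex" where
  "L2_inner f g = (\<integral>x. f x * cnj (g x) \<partial>lborel)"

lemma L2_inner_integrable:
  assumes f: "f \<in> L2" and g: "g \<in> L2"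
  shows "integrable lborel (\<lambda>x. f x * cnj (g x))"
proof (rule Bochner_Integration.integrable_bound)
  show "integrable lborel (\<lambda>x. (cmod (f x))\<^sup>2 + (cmod (g x))\<^sup>2)"
    using L2_integrable[OF f] L2_integrable[OF g] by simp
  show "(\<lambda>x. f x * cnj (g x)) \<in> borel_measurable lborel"
    using L2_measurable[OF f] L2_measurable[OF g] by measurable
  have "2 * (cmod (f x) * cmod (g x)) \<le> (cmod (f x))\<^sup>2 + (cmod (g x))\<^sup>2" for x
    using sum_squares_bound[of "cmod (f x)" "cmod (g x)"] by simp
  moreover have "0 \<le> cmod (f x) * cmod (g x)" for x by simp
  ultimately have "cmod (f x) * cmod (g x) \<le> (cmod (f x))\<^sup>2 + (cmod (g x))\<^sup>2" for x by (smt (verit))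
  then show "AE x in lborel. norm (f x * cnj (g x)) \<le> norm ((cmod (f x))\<^sup>2 + (cmod (g x))\<^sup>2)"
    by (intro AE_I2) (auto simp: norm_mult)
qed

lemma L2_norm_eq_0:
  assumes f: "f \<in> L2" and "L2_norm f = 0" shows "AE x in lborel. f x = 0"
proof -
  have "(\<integral>x. (cmod (f x))\<^sup>2 \<partial>lborel) = 0" using assms(2) L2_norm_sq[of f] by simp
  then have "AE x in lborel. (cmod (f x))\<^sup>2 = 0"
    by (subst (asm) integral_nonneg_eq_0_iff_AE[OF L2_integrable[OF f]]) auto
  then show ?thesis by simp
qed

lemma L2_Cauchy_Schwarz:
  assumes f: "f \<in> L2" and g: "g \<in> L2"
  shows "cmod (L2_inner f g) \<le> L2_norm f * L2_norm g"
proof -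
  have null: ?thesis if "AE x in lborel. f x * cnj (g x) = 0"
  proof -
    have "L2_inner f g = (\<integral>x. 0 \<partial>(lborel :: 'a measure))" unfolding L2_inner_def
      using L2_measurable[OF f] L2_measurable[OF g] that by (intro integral_cong_AE) auto
    then show ?thesis by (simp add: L2_norm_nonneg)
  qed
  consider "L2_norm f = 0" | "L2_norm g = 0" | "L2_norm f > 0" "L2_norm g > 0"
    using L2_norm_nonneg[of f] L2_norm_nonneg[of g] by linarith
  then show ?thesis
  proof cases
    case 1
    from L2_norm_eq_0[OF f this] show ?thesis by (intro null) (auto elim: eventually_mono)
  next
    case 2
    from L2_norm_eq_0[OF g this] show ?thesis by (intro null) (auto elim: eventually_mono)
  next
    case 3
    define a b where "a = L2_norm f" and "b = L2_norm g"
    have ab: "a > 0" "b > 0" using 3 by (auto simp: a_def b_def)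
    have sq: "(\<integral>x. (cmod (f x))\<^sup>2 \<partial>lborel) = a\<^sup>2" "(\<integral>x. (cmod (g x))\<^sup>2 \<partial>lborel) = b\<^sup>2"
      by (simp_all add: a_def b_def L2_norm_sq)
    have "cmod (L2_inner f g) \<le> (\<integral>x. norm (f x * cnj (g x)) \<partial>lborel)"
      unfolding L2_inner_def by (rule integral_norm_bound)
    also have "\<dots> \<le> (\<integral>x. b / (2 * a) * (cmod (f x))\<^sup>2 + a / (2 * b) * (cmod (g x))\<^sup>2 \<partial>lborel)"
    proof (rule integral_mono)
      show "integrable lborel (\<lambda>x. norm (f x * cnj (g x)))" using L2_inner_integrable[OF f g] by simp
      show "integrable lborel (\<lambda>x. b / (2 * a) * (cmod (f x))\<^sup>2 + a / (2 * b) * (cmod (g x))\<^sup>2)"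
        using L2_integrable[OF f] L2_integrable[OF g] by simp
      fix x
      have "0 \<le> (b * cmod (f x) - a * cmod (g x))\<^sup>2" by simp
      then have "2 * (a * b) * (cmod (f x) * cmod (g x)) \<le> b\<^sup>2 * (cmod (f x))\<^sup>2 + a\<^sup>2 * (cmod (g x))\<^sup>2"
        by (simp add: power2_eq_square algebra_simps)
      then have "cmod (f x) * cmod (g x) \<le> (b\<^sup>2 * (cmod (f x))\<^sup>2 + a\<^sup>2 * (cmod (g x))\<^sup>2) / (2 * (a * b))"
        using ab by (subst pos_le_divide_eq) (auto simp: mult.commute)
      also have "\<dots> = b / (2 * a) * (cmod (f x))\<^sup>2 + a / (2 * b) * (cmod (g x))\<^sup>2"
        using ab by (simp add: power2_eq_square field_simps)
      finally show "norm (f x * cnj (g x)) \<le> b / (2 * a) * (cmod (f x))\<^sup>2 + a / (2 * b) * (cmod (g x))\<^sup>2"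
        by (simp add: norm_mult)
    qed
    also have "\<dots> = b / (2 * a) * a\<^sup>2 + a / (2 * b) * b\<^sup>2"
      using L2_integrable[OF f] L2_integrable[OF g] by (simp add: sq)
    also have "\<dots> = a * b" using ab by (simp add: power2_eq_square field_simps)
    finally show ?thesis by (simp add: a_def b_def)
  qed
qed

lemma L2_inner_diff_left: "f \<in> L2 \<Longrightarrow> g \<in> L2 \<Longrightarrow> h \<in> L2 \<Longrightarrow> L2_inner (\<lambda>x. f x - g x) h = L2_inner f h - L2_inner g h"
  unfolding L2_inner_def by (simp add: left_diff_distrib L2_inner_integrable)

lemma L2_inner_diff_right: "f \<in> L2 \<Longrightarrow> g \<in> L2 \<Longrightarrow> h \<in> L2 \<Longrightarrow> L2_inner h (\<lambda>x. f x - g x) = L2_inner h f - L2_inner h g"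
  unfolding L2_inner_def by (simp add: right_diff_distrib L2_inner_integrable)

lemma L2_inner_scale_right: "L2_inner f (\<lambda>x. c * g x) = cnj c * L2_inner f g"
  unfolding L2_inner_def by (simp add: mult.left_commute)

lemma L2_inner_cong_AE:
  assumes "f \<in> L2" "f' \<in> L2" "g \<in> L2" "g' \<in> L2"
    and "AE x in lborel. f x = f' x" "AE x in lborel. g x = g' x"
  shows "L2_inner f g = L2_inner f' g'"
  unfolding L2_inner_def
proof (rule integral_cong_AE)
  show "AE x in lborel. f x * cnj (g x) = f' x * cnj (g' x)" using assms(5,6) by eventually_elim simp
qed (use assms(1-4)[THEN L2_measurable] in auto)

lemma L2_norm_add_scale_sq:
  assumes f: "f \<in> L2" and g: "g \<in> L2"
  shows "(L2_norm (\<lambda>x. 1 * f x + c * g x))\<^sup>2 = (L2_norm f)\<^sup>2 + 2 * Re (cnj c * L2_inner f g) + (cmod c)\<^sup>2 * (L2_norm g)\<^sup>2"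
proof -
  define R where "R x = Re (cnj c * (f x * cnj (g x)))" for x
  have pt: "(cmod (1 * f x + c * g x))\<^sup>2 = (cmod (f x))\<^sup>2 + 2 * R x + (cmod c)\<^sup>2 * (cmod (g x))\<^sup>2" for x
    unfolding R_def cmod_power2 by (simp add: power2_eq_square algebra_simps)
  have i: "integrable lborel (\<lambda>x. cnj c * (f x * cnj (g x)))"
    using L2_inner_integrable[OF f g] by simp
  have "(\<integral>x. R x \<partial>lborel) = Re (cnj c * L2_inner f g)"
    unfolding R_def L2_inner_def integral_Re[OF i] by simp
  moreover have "integrable lborel R" unfolding R_def[abs_def] using i by (rule integrable_Re)
  ultimately show ?thesis
    unfolding L2_norm_sq pt using L2_integrable[OF f] L2_integrable[OF g] by simp
qed

lemma L2_inner_tendsto: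
  assumes F: "\<And>h. F h \<in> L2" "f \<in> L2" "((\<lambda>h. L2_norm (\<lambda>x. F h x - f x)) \<longlongrightarrow> 0) A"
    and G: "\<And>h. G h \<in> L2" "g \<in> L2" "((\<lambda>h. L2_norm (\<lambda>x. G h x - g x)) \<longlongrightarrow> 0) A"
  shows "((\<lambda>h. L2_inner (F h) (G h)) \<longlongrightarrow> L2_inner f g) A"
proof -
  have "((\<lambda>h. L2_inner (F h) (G h) - L2_inner f g) \<longlongrightarrow> 0) A"
  proof (rule Lim_null_comparison)
    have "norm (L2_inner (F h) (G h) - L2_inner f g) \<le>
      L2_norm (\<lambda>x. F h x - f x) * L2_norm (\<lambda>x. G h x - g x) + L2_norm (\<lambda>x. F h x - f x) * L2_norm g +
        L2_norm f * L2_norm (\<lambda>x. G h x - g x)" for h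
    proof -
      have dF: "(\<lambda>x. F h x - f x) \<in> L2" and dG: "(\<lambda>x. G h x - g x) \<in> L2" using F G by (auto intro: L2_diff)
      have "L2_inner (F h) (G h) - L2_inner f g = L2_inner (\<lambda>x. F h x - f x) (\<lambda>x. G h x - g x) +
        L2_inner (\<lambda>x. F h x - f x) g + L2_inner f (\<lambda>x. G h x - g x)"
        using F G dF dG by (simp add: L2_inner_diff_left L2_inner_diff_right)
      then show ?thesis
        using L2_Cauchy_Schwarz[OF dF dG] L2_Cauchy_Schwarz[OF dF G(2)] L2_Cauchy_Schwarz[OF F(2) dG]
        by (simp only:) (intro norm_triangle_le add_mono; simp)
    qed
    then show "\<forall>\<^sub>F h in A. norm (L2_inner (F h) (G h) - L2_inner f g) \<le>
      L2_norm (\<lambda>x. F h x - f x) * L2_norm (\<lambda>x. G h x - g x) + L2_norm (\<lambda>x. F h x - f x) * L2_norm g +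
        L2_norm f * L2_norm (\<lambda>x. G h x - g x)" by simp
    show "((\<lambda>h. L2_norm (\<lambda>x. F h x - f x) * L2_norm (\<lambda>x. G h x - g x) + L2_norm (\<lambda>x. F h x - f x) * L2_norm g +
        L2_norm f * L2_norm (\<lambda>x. G h x - g x)) \<longlongrightarrow> 0) A"
      using F(3) G(3) by (auto intro!: tendsto_eq_intros)
  qed
  then show ?thesis by (simp add: LIM_zero_iff)
qed

text \<open>
  Polarization of the isometry.
\<close>
lemma (in unitary_group) L2_inner_preserved:
  assumes f: "f \<in> L2" and g: "g \<in> L2"
  shows "L2_inner (U t f) (U t g) = L2_inner f g"
proof -
  have key: "Re (cnj c * L2_inner (U t f) (U t g)) = Re (cnj c * L2_inner f g)" for c
  proof -
    have s: "(\<lambda>y. 1 * f y + c * g y) \<in> L2" using f L2_scale[OF g] by (simp add: L2_add)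
    have s': "(\<lambda>y. 1 * U t f y + c * U t g y) \<in> L2" using closed[OF f] L2_scale[OF closed[OF g]] by (simp add: L2_add)
    have "L2_norm (\<lambda>y. 1 * U t f y + c * U t g y) = L2_norm (U t (\<lambda>y. 1 * f y + c * g y))"
      by (rule L2_norm_cong_AE[OF L2_measurable[OF s'] L2_measurable[OF closed[OF s]]])
        (use linear[OF f g, of t 1 c] in \<open>auto elim: eventually_mono\<close>)
    also have "\<dots> = L2_norm (\<lambda>y. 1 * f y + c * g y)" by (rule isometry[OF s])
    finally show ?thesis
      using L2_norm_add_scale_sq[OF f g, of c] L2_norm_add_scale_sq[OF closed[OF f] closed[OF g], of t c t]
      by (simp add: isometry[OF f] isometry[OF g])
  qed
  show ?thesis using key[of 1] key[of \<i>] by (simp add: complex_eq_iff)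
qed

lemma (in unitary_group) L2_inner_adjoint:
  assumes f: "f \<in> L2" and g: "g \<in> L2"
  shows "L2_inner (U t f) g = L2_inner f (U (- t) g)"
proof -
  have "AE x in lborel. U t (U (- t) g) x = g x"
    using group_law[OF g, of t "- t"] at_zero[OF g] by eventually_elim simp
  then have "L2_inner (U t f) g = L2_inner (U t f) (U t (U (- t) g))"
    by (intro L2_inner_cong_AE closed f g) (auto elim: eventually_mono)
  then show ?thesis by (simp add: L2_inner_preserved[OF f closed[OF g]])
qed

text \<open>
  Put \<open>g = U t f\<close>. The increment of the pairing from \<open>t\<close> to \<open>t + h\<close> is
  \<open>\<langle>U h g, \<Phi> (t + h) - \<Phi> t\<rangle> + \<langle>g, U (- h) (\<Phi> t) - \<Phi> t\<rangle>\<close>; divided by \<open>h\<close> the two terms tend to \<open>\<langle>g, D t\<rangle>\<close> and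
  \<open>- \<langle>g, D t\<rangle>\<close>. In this form the derivative of the group only falls on \<open>\<Phi> t\<close>, so that \<open>f\<close> may be arbitrary.
\<close>
theorem (in unitary_group) pairing_with_solution_constant:
  assumes f: "f \<in> L2" and \<Phi>: "\<And>t. \<Phi> t \<in> L2" and D: "\<And>t. (\<Phi> t, D t) \<in> generator_graph U"
    and der: "\<And>t. ((\<lambda>h. L2_norm (\<lambda>x. (\<Phi> (t + h) x - \<Phi> t x) / complex_of_real h - D t x)) \<longlongrightarrow> 0) (at 0)"
  shows "L2_inner (U t f) (\<Phi> t) = L2_inner f (\<Phi> 0)"
proof -
  have D2: "D t \<in> L2" for t using D[of t] by (simp add: generator_graph_def)
  define E where "E t = L2_inner (U t f) (\<Phi> t)" for t
  have "(E has_vector_derivative 0) (at t)" for t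
  proof -
    define g where "g = U t f"
    have g: "g \<in> L2" using closed[OF f] by (simp add: g_def)
    define q where "q h x = (\<Phi> (t + h) x - \<Phi> t x) / complex_of_real h" for h x
    define r where "r h x = (U h (\<Phi> t) x - \<Phi> t x) / complex_of_real h" for h x
    have qL: "q h \<in> L2" and rL: "r h \<in> L2" for h
      using L2_scale[OF L2_diff[OF \<Phi>[of "t + h"] \<Phi>[of t]], of "1 / complex_of_real h"]
        L2_scale[OF L2_diff[OF closed[OF \<Phi>[of t], of h] \<Phi>[of t]], of "1 / complex_of_real h"]
      by (simp_all add: q_def[abs_def] r_def[abs_def])
    have quot: "(E (t + h) - E t) /\<^sub>R h = L2_inner (U h g) (q h) - L2_inner g (r (- h))" if h: "h \<noteq> 0" for h
    proof -
      have "E (t + h) = L2_inner (U h g) (\<Phi> (t + h))"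
        unfolding E_def g_def using group_law[OF f, of h t]
        by (intro L2_inner_cong_AE closed f \<Phi>) (auto simp: add.commute)
      moreover have "L2_inner (U h g) (q h) = (L2_inner (U h g) (\<Phi> (t + h)) - L2_inner (U h g) (\<Phi> t)) / h"
        using L2_inner_scale_right[of "U h g" "1 / complex_of_real h" "\<lambda>x. \<Phi> (t + h) x - \<Phi> t x"]
          L2_inner_diff_right[OF \<Phi>[of "t + h"] \<Phi>[of t] closed[OF g, of h]]
        by (simp add: q_def[abs_def])
      moreover have "L2_inner g (r (- h)) = - ((L2_inner g (U (- h) (\<Phi> t)) - L2_inner g (\<Phi> t)) / h)"
        using L2_inner_scale_right[of g "1 / complex_of_real (- h)" "\<lambda>x. U (- h) (\<Phi> t) x - \<Phi> t x"]
          L2_inner_diff_right[OF closed[OF \<Phi>[of t], of "- h"] \<Phi>[of t] g]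
        by (simp add: r_def[abs_def])
      moreover have "L2_inner (U h g) (\<Phi> t) = L2_inner g (U (- h) (\<Phi> t))" by (rule L2_inner_adjoint[OF g \<Phi>])
      moreover have "(E (t + h) - E t) /\<^sub>R h = (E (t + h) - E t) / h" by (simp add: scaleR_conv_of_real divide_inverse mult.commute)
      moreover have "E t = L2_inner g (\<Phi> t)" by (simp add: E_def g_def)
      ultimately show ?thesis by (simp add: diff_divide_distrib)
    qed
    have r0: "((\<lambda>h. L2_norm (\<lambda>x. r h x - D t x)) \<longlongrightarrow> 0) (at 0)"
      using D[of t] by (simp add: generator_graph_def r_def)
    have r1: "((\<lambda>h. L2_norm (\<lambda>x. r (- h) x - D t x)) \<longlongrightarrow> 0) (at 0)"
      by (rule filterlim_compose[OF r0]) (simp add: filterlim_def filtermap_at_minus)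
    have "((\<lambda>h. L2_inner (U h g) (q h) - L2_inner g (r (- h))) \<longlongrightarrow> L2_inner g (D t) - L2_inner g (D t)) (at 0)"
    proof (rule tendsto_diff)
      show "((\<lambda>h. L2_inner (U h g) (q h)) \<longlongrightarrow> L2_inner g (D t)) (at 0)"
        by (rule L2_inner_tendsto[OF closed[OF g] g strongly_continuous[OF g] qL D2])
          (use der[of t] in \<open>simp add: q_def\<close>)
      show "((\<lambda>h. L2_inner g (r (- h))) \<longlongrightarrow> L2_inner g (D t)) (at 0)"
        by (rule L2_inner_tendsto[OF g g _ rL D2 r1]) (simp add: L2_norm_def)
    qed
    then have "((\<lambda>h. L2_inner (U h g) (q h) - L2_inner g (r (- h))) \<longlongrightarrow> 0) (at 0)" by simp
    then have "((\<lambda>h. (E (t + h) - E t) /\<^sub>R h) \<longlongrightarrow> 0) (at 0)"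
      by (rule Lim_transform_eventually) (auto simp: eventually_at_filter quot)
    then have "((\<lambda>h. norm ((E (t + h) - E t) /\<^sub>R h)) \<longlongrightarrow> 0) (at 0)" by (rule tendsto_norm_zero)
    then show ?thesis
      unfolding has_vector_derivative_def has_derivative_at by (simp add: divide_inverse mult.commute)
  qed
  then have "(E has_derivative (\<lambda>h. 0)) (at t within UNIV)" for t by (simp add: has_vector_derivative_def)
  from has_derivative_zero_unique[OF convex_UNIV this, of t 0] have "E t = E 0" by simp
  also have "E 0 = L2_inner f (\<Phi> 0)"
    unfolding E_def by (intro L2_inner_cong_AE closed f \<Phi> at_zero) auto
  finally show ?thesis by (simp add: E_def)
qed

section \<open>Smooth functions and cutoffs\<close>

lemma Ck_SucI:
  assumes "\<And>x. (f has_derivative f' x) (at x)" "\<And>e. Ck n (\<lambda>x. f' x e)"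
  shows "Ck (Suc n) f"
proof -
  have "frechet_derivative f (at x) = f' x" for x using frechet_derivative_at[OF assms(1)] by simp
  then show ?thesis using assms by (auto simp: differentiable_on_def differentiable_def)
qed

lemma Ck_SucD:
  assumes "Ck (Suc n) f"
  shows "(f has_derivative frechet_derivative f (at x)) (at x)" "Ck n (\<lambda>x. frechet_derivative f (at x) e)"
  using assms by (auto simp: differentiable_on_def frechet_derivative_works)

lemma Ck_Suc_imp_Ck: "Ck (Suc n) f \<Longrightarrow> Ck n f"
proof (induction n arbitrary: f)
  case 0
  then show ?case by (auto intro: differentiable_imp_continuous_on)
next
  case (Suc n)
  have "Ck n (\<lambda>x. frechet_derivative f (at x) e)" for e
    by (rule Suc.IH) (rule Ck_SucD(2)[OF Suc.prems])
  then show ?case using Suc.prems by simp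
qed

lemma Ck_continuous: "Ck n f \<Longrightarrow> continuous_on UNIV f"
  by (induction n) (auto dest: Ck_Suc_imp_Ck intro: differentiable_imp_continuous_on)

lemma Ck_const: "Ck n (\<lambda>x. c)"
proof (induction n arbitrary: c)
  case (Suc n)
  show ?case by (rule Ck_SucI[where f' = "\<lambda>x e. 0"]) (auto intro: Suc)
qed simp

lemma Ck_add: "Ck n f \<Longrightarrow> Ck n g \<Longrightarrow> Ck n (\<lambda>x. f x + g x)"
proof (induction n arbitrary: f g)
  case (Suc n)
  show ?case
    by (rule Ck_SucI) (rule has_derivative_add[OF Ck_SucD(1)[OF Suc.prems(1)] Ck_SucD(1)[OF Suc.prems(2)]],
      rule Suc.IH[OF Ck_SucD(2)[OF Suc.prems(1)] Ck_SucD(2)[OF Suc.prems(2)]])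
qed (simp add: continuous_on_add)

lemma Ck_mult: "Ck n f \<Longrightarrow> Ck n g \<Longrightarrow> Ck n (\<lambda>x. f x * g x)"
proof (induction n arbitrary: f g)
  case (Suc n)
  show ?case
    by (rule Ck_SucI) (rule has_derivative_mult[OF Ck_SucD(1)[OF Suc.prems(1)] Ck_SucD(1)[OF Suc.prems(2)]],
      rule Ck_add[OF Suc.IH[OF Ck_Suc_imp_Ck[OF Suc.prems(1)] Ck_SucD(2)[OF Suc.prems(2)]]
        Suc.IH[OF Ck_SucD(2)[OF Suc.prems(1)] Ck_Suc_imp_Ck[OF Suc.prems(2)]]])
qed (simp add: continuous_on_mult)

lemma Ck_bounded_linear: "bounded_linear f \<Longrightarrow> Ck n f"
proof (cases n)
  case (Suc m)
  assume "bounded_linear f"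
  then show ?thesis unfolding Suc
    by (intro Ck_SucI[where f' = "\<lambda>x e. f e"] bounded_linear_imp_has_derivative Ck_const)
qed (simp add: linear_continuous_on)

lemma Ck_sum: "(\<And>i. i \<in> A \<Longrightarrow> Ck n (f i)) \<Longrightarrow> Ck n (\<lambda>x. \<Sum>i\<in>A. f i x)"
  by (induction A rule: infinite_finite_induct) (auto intro: Ck_add Ck_const)

text \<open>
  Differentiating \<open>p (1 / s) exp (1 - 1 / s)\<close> replaces the polynomial \<open>p\<close> by \<open>X\<^sup>2 (p - p')\<close>.
\<close>
primrec bump_poly :: "nat \<Rightarrow> real poly" where
  "bump_poly 0 = 1"
| "bump_poly (Suc m) = monom 1 2 * (bump_poly m - pderiv (bump_poly m))"

text \<open>
  The \<open>m\<close>-th derivative of the smooth function that is \<open>exp (1 - 1 / s)\<close> for \<open>s > 0\<close> and 0 for \<open>s \<le> 0\<close>.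
\<close>
definition bump :: "nat \<Rightarrow> real \<Rightarrow> real" where
  "bump m s = (if s > 0 then poly (bump_poly m) (1 / s) * exp (1 - 1 / s) else 0)"

lemma poly_times_exp_minus_tendsto_0:
  "((\<lambda>u. poly p u * exp (1 - u)) \<longlongrightarrow> 0) (at_top :: real filter)"
proof -
  have eq: "poly p u * exp (1 - u) = (\<Sum>i\<le>degree p. coeff p i * exp 1 * (u ^ i / exp u))" for u :: real
    by (simp add: poly_altdef sum_distrib_left sum_divide_distrib exp_diff mult_ac)
  have "((\<lambda>u. \<Sum>i\<le>degree p. coeff p i * exp 1 * (u ^ i / exp u)) \<longlongrightarrow> (\<Sum>i\<le>degree p. coeff p i * exp 1 * 0)) (at_top :: real filter)"
    by (intro tendsto_intros tendsto_power_div_exp_0)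
  then show ?thesis unfolding eq by simp
qed

lemma bump_has_derivative: "(bump m has_real_derivative bump (Suc m) s) (at s)"
proof -
  consider "s > 0" | "s < 0" | "s = 0" by linarith
  then show ?thesis
  proof cases
    case 1
    have "((\<lambda>s. poly (bump_poly m) (1 / s) * exp (1 - 1 / s)) has_real_derivative bump (Suc m) s) (at s)"
      using 1 by (auto intro!: derivative_eq_intros DERIV_chain'[where g = "poly (bump_poly m)"] poly_DERIV
          simp: bump_def poly_monom power2_eq_square field_simps)
    then show ?thesis
      by (rule has_field_derivative_transform_within_open[where S = "{0<..}"]) (use 1 in \<open>auto simp: bump_def\<close>)
  next
    case 2
    have "((\<lambda>s. 0) has_real_derivative 0) (at s)" by simp
    then have "(bump m has_real_derivative 0) (at s)"
      by (rule has_field_derivative_transform_within_open[where S = "{..<0}"]) (use 2 in \<open>auto simp: bump_def\<close>)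
    then show ?thesis using 2 by (simp add: bump_def)
  next
    case 3
    have "((\<lambda>h. (bump m (0 + h) - bump m 0) / h) \<longlongrightarrow> 0) (at 0)"
    proof (rule filterlim_split_at)
      have "((\<lambda>h. 0) \<longlongrightarrow> (0::real)) (at_left 0)" by simp
      then show "((\<lambda>h. (bump m (0 + h) - bump m 0) / h) \<longlongrightarrow> 0) (at_left 0)"
        by (rule Lim_transform_eventually) (auto simp: eventually_at_filter bump_def)
      have "((\<lambda>h. poly (bump_poly m * [:0, 1:]) (inverse h) * exp (1 - inverse h)) \<longlongrightarrow> 0) (at_right 0)"
        by (rule filterlim_compose[OF poly_times_exp_minus_tendsto_0 filterlim_inverse_at_top_right])
      then show "((\<lambda>h. (bump m (0 + h) - bump m 0) / h) \<longlongrightarrow> 0) (at_right 0)"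
        by (rule Lim_transform_eventually) (auto simp: eventually_at_filter bump_def divide_inverse mult_ac)
    qed
    then show ?thesis using 3 by (simp add: DERIV_def bump_def)
  qed
qed

lemma bump_continuous: "continuous_on S (bump m)"
  by (intro DERIV_continuous_on[where D = "bump (Suc m)"] DERIV_subset[OF bump_has_derivative]) auto

lemma bump_bounded: "\<exists>C>0. \<forall>s\<le>1. \<bar>bump m s\<bar> \<le> C"
proof -
  have "compact (bump m ` {0..1})" by (intro compact_continuous_image bump_continuous) auto
  then obtain C where C: "\<And>s. s \<in> {0..1} \<Longrightarrow> \<bar>bump m s\<bar> \<le> C"
    using compact_imp_bounded bounded_iff by (metis imageI real_norm_def)
  have "\<bar>bump m s\<bar> \<le> max C 1" if "s \<le> 1" for s
    using C[of s] that by (cases "s \<ge> 0") (auto simp: bump_def)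
  then show ?thesis by (intro exI[of _ "max C 1"]) auto
qed

lemma bump_0_1: "bump 0 1 = 1"
  by (simp add: bump_def)

lemma bump_eq_0: "s \<le> 0 \<Longrightarrow> bump m s = 0"
  by (simp add: bump_def)

definition ball_level :: "real \<Rightarrow> 'a::euclidean_space \<Rightarrow> real" where
  "ball_level R x = 1 - (x \<bullet> x) / R\<^sup>2"

lemma ball_level_le_1: "ball_level R x \<le> 1"
  by (simp add: ball_level_def)

lemma ball_level_has_derivative: "(ball_level R has_derivative (\<lambda>e. - (2 / R\<^sup>2) * (x \<bullet> e))) (at x)"
  unfolding ball_level_def
  by (auto intro!: derivative_eq_intros simp: fun_eq_iff inner_commute divide_inverse algebra_simps)

lemma bump_ball_has_derivative:
  "((\<lambda>x. complex_of_real (bump m (ball_level R x))) has_derivative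
    (\<lambda>e. complex_of_real (bump (Suc m) (ball_level R x)) * of_real (- (2 / R\<^sup>2) * (x \<bullet> e)))) (at x)"
proof -
  have "((\<lambda>x. bump m (ball_level R x)) has_derivative
    (\<lambda>e. bump (Suc m) (ball_level R x) * (- (2 / R\<^sup>2) * (x \<bullet> e)))) (at x)"
    using has_derivative_compose[OF ball_level_has_derivative
        bump_has_derivative[of m "ball_level R x", unfolded has_field_derivative_def]]
    by simp
  from has_derivative_of_real[OF this] show ?thesis by (simp only: of_real_mult)
qed

lemma Ck_bump_ball: "Ck n (\<lambda>x::'a::euclidean_space. complex_of_real (bump m (ball_level R x)))"
proof (induction n arbitrary: m)
  case 0
  have "continuous_on UNIV (ball_level R :: 'a \<Rightarrow> real)"
    unfolding ball_level_def divide_inverse by (intro continuous_intros)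
  then show ?case
    by (auto intro!: continuous_intros continuous_on_compose2[OF bump_continuous])
next
  case (Suc n)
  show ?case
  proof (rule Ck_SucI[OF bump_ball_has_derivative])
    fix e :: 'a
    have "bounded_linear (\<lambda>x::'a. complex_of_real (- (2 / R\<^sup>2) * (x \<bullet> e)))"
      by (intro bounded_linear_compose[OF bounded_linear_of_real] bounded_linear_const_mult bounded_linear_inner_left)
    then show "Ck n (\<lambda>x. complex_of_real (bump (Suc m) (ball_level R x)) * of_real (- (2 / R\<^sup>2) * (x \<bullet> e)))"
      by (intro Ck_mult Suc Ck_bounded_linear)
  qed
qed

lemma test_function_bump_times:
  fixes \<Phi> :: "'a::euclidean_space \<Rightarrow> complex"
  assumes "\<And>n. Ck n \<Phi>" and R: "R > 0"
  shows "(\<lambda>x. complex_of_real (bump 0 (ball_level R x)) * \<Phi> x) \<in> test_functions"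
proof -
  have "bump 0 (ball_level R x) = 0" if "x \<notin> cball 0 R" for x :: 'a
  proof (rule bump_eq_0)
    have "R\<^sup>2 \<le> (norm x)\<^sup>2" using that R by (intro power_mono) auto
    then show "ball_level R x \<le> 0" using R by (simp add: ball_level_def power2_norm_eq_inner)
  qed
  then show ?thesis unfolding test_functions_def
    using assms by (auto intro!: Ck_mult Ck_bump_ball exI[of _ "cball 0 R"])
qed

section \<open>The modulus of a skew operator, and linear flows\<close>

lemma blinfun_compose_diff:
  fixes A B C D :: "'a::real_normed_vector \<Rightarrow>\<^sub>L 'a"
  shows "norm ((A o\<^sub>L A) - (B o\<^sub>L B)) \<le> (norm A + norm B) * norm (A - B)"
proof -
  have "(A o\<^sub>L A) - (B o\<^sub>L B) = (A o\<^sub>L (A - B)) + ((A - B) o\<^sub>L B)"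
    by (rule blinfun_eqI) (simp add: blinfun.diff_left blinfun.diff_right blinfun.add_left)
  then have "norm ((A o\<^sub>L A) - (B o\<^sub>L B)) \<le> norm (A o\<^sub>L (A - B)) + norm ((A - B) o\<^sub>L B)"
    by (simp only: norm_triangle_ineq)
  also have "\<dots> \<le> norm A * norm (A - B) + norm (A - B) * norm B"
    by (intro add_mono norm_blinfun_compose)
  finally show ?thesis by (simp add: algebra_simps)
qed

text \<open>
  The map \<open>Y \<mapsto> (X + Y\<^sup>2) / 2\<close> contracts the ball of radius \<open>q\<close> with constant \<open>q\<close>. The symmetric operators in this ball that commute
  with \<open>J\<close> form a closed invariant set, so the fixed point is one of them; its continuity in the parameter follows from
  the uniform contraction.
\<close>
lemma quadratic_fixed_point:
  fixes X :: "'l::topological_space \<Rightarrow> 'v::euclidean_space \<Rightarrow>\<^sub>L 'v"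
  assumes q: "0 \<le> q" "q < 1" and X: "\<And>l. l \<in> S \<Longrightarrow> norm (X l) \<le> q"
    and sym: "\<And>l v w. l \<in> S \<Longrightarrow> X l v \<bullet> w = v \<bullet> X l w"
    and comm: "\<And>l v. l \<in> S \<Longrightarrow> X l (J l v) = J l (X l v)" and J: "\<And>l. linear (J l)"
    and cont: "continuous_on S X"
  obtains Y :: "'l \<Rightarrow> 'v \<Rightarrow>\<^sub>L 'v" where
    "\<And>l. l \<in> S \<Longrightarrow> norm (Y l) \<le> q" "\<And>l v w. l \<in> S \<Longrightarrow> Y l v \<bullet> w = v \<bullet> Y l w"
    "\<And>l v. l \<in> S \<Longrightarrow> Y l (J l v) = J l (Y l v)"
    "\<And>l. l \<in> S \<Longrightarrow> Y l = (1/2) *\<^sub>R (X l + (Y l o\<^sub>L Y l))" "continuous_on S Y"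
proof -
  define K where "K l = {Y. norm Y \<le> q \<and> (\<forall>v w. blinfun_apply Y v \<bullet> w = v \<bullet> Y w) \<and> (\<forall>v. Y (J l v) = J l (Y v))}" for l
  define F where "F l Y = (1/2) *\<^sub>R (X l + (Y o\<^sub>L Y))" for l and Y :: "'v \<Rightarrow>\<^sub>L 'v"
  have lip: "norm (F l Y - F l' Z) \<le> norm (X l - X l') / 2 + q * norm (Y - Z)"
    if "norm Y \<le> q" "norm Z \<le> q" for l l' Y Z
  proof -
    have "F l Y - F l' Z = (1/2) *\<^sub>R ((X l - X l') + ((Y o\<^sub>L Y) - (Z o\<^sub>L Z)))"
      by (simp add: F_def algebra_simps)
    then have "norm (F l Y - F l' Z) = norm ((X l - X l') + ((Y o\<^sub>L Y) - (Z o\<^sub>L Z))) / 2" by simp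
    also have "norm ((X l - X l') + ((Y o\<^sub>L Y) - (Z o\<^sub>L Z))) \<le> norm (X l - X l') + (q + q) * norm (Y - Z)"
      by (intro norm_triangle_le add_left_mono order_trans[OF blinfun_compose_diff] mult_right_mono add_mono that) auto
    finally show ?thesis by (simp add: field_simps)
  qed
  have "\<exists>Y\<in>K l. F l Y = Y" if l: "l \<in> S" for l
  proof -
    have "\<exists>!Y\<in>K l. F l Y = Y"
    proof (rule Banach_fix[OF complete_eq_closed[THEN iffD2], where c = q])
      have "K l = {Y. norm Y \<le> q} \<inter> (\<Inter>v. \<Inter>w. {Y. blinfun_apply Y v \<bullet> w = v \<bullet> Y w}) \<inter> (\<Inter>v. {Y. blinfun_apply Y (J l v) = J l (Y v)})"
        by (auto simp: K_def)
      also have "closed \<dots>"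
      proof (intro closed_Int closed_INT ballI)
        show "closed {Y :: 'v \<Rightarrow>\<^sub>L 'v. norm Y \<le> q}" by (intro closed_Collect_le continuous_intros)
        show "closed {Y. blinfun_apply Y v \<bullet> w = v \<bullet> Y w}" for v w
          by (intro closed_Collect_eq continuous_intros)
        show "closed {Y. blinfun_apply Y (J l v) = J l (Y v)}" for v
          by (intro closed_Collect_eq continuous_intros
            continuous_on_compose2[OF linear_continuous_on[OF linear_conv_bounded_linear[THEN iffD1, OF J]], of UNIV]) auto
      qed
      finally show "closed (K l)" .
      have "(0 :: 'v \<Rightarrow>\<^sub>L 'v) \<in> K l" using q linear_0[OF J[of l]] by (simp add: K_def)
      then show "K l \<noteq> {}" by blast
      show "F l ` K l \<subseteq> K l"
      proof safe
        fix Y assume Y: "Y \<in> K l"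
        have "norm Y * norm Y \<le> q * q" using Y q by (intro mult_mono) (auto simp: K_def)
        then have "norm (X l + (Y o\<^sub>L Y)) \<le> q + q * q"
          by (intro norm_triangle_le add_mono X[OF l] order_trans[OF norm_blinfun_compose])
        also have "\<dots> \<le> q + q * 1" using q by (intro add_left_mono mult_left_mono) auto
        finally have "norm (F l Y) \<le> q" by (simp add: F_def)
        moreover have "F l Y v \<bullet> w = v \<bullet> F l Y w" for v w
          using Y sym[OF l] by (simp add: F_def K_def blinfun.scaleR_left blinfun.add_left inner_add_left inner_add_right)
        moreover have "F l Y (J l v) = J l (F l Y v)" for v
          using Y comm[OF l] linear_add[OF J[of l]] linear_scale[OF J[of l]]
          by (simp add: F_def K_def blinfun.scaleR_left blinfun.add_left)
        ultimately show "F l Y \<in> K l" by (simp add: K_def)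
      qed
      show "dist (F l Y) (F l Z) \<le> q * dist Y Z" if "Y \<in> K l" "Z \<in> K l" for Y Z
        using lip[of Y Z l l] that by (simp add: dist_norm K_def)
    qed (use q in auto)
    then show ?thesis by blast
  qed
  then obtain Y where Y: "\<And>l. l \<in> S \<Longrightarrow> Y l \<in> K l" "\<And>l. l \<in> S \<Longrightarrow> F l (Y l) = Y l" by metis
  have "continuous_on S Y"
    unfolding continuous_on_def
  proof
    fix l assume l: "l \<in> S"
    have "((\<lambda>m. Y m - Y l) \<longlongrightarrow> 0) (at l within S)"
    proof (rule Lim_null_comparison)
      have "norm (Y m - Y l) \<le> norm (X m - X l) / (2 * (1 - q))" if m: "m \<in> S" for m
      proof -
        have "norm (F m (Y m) - F l (Y l)) \<le> norm (X m - X l) / 2 + q * norm (Y m - Y l)"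
          using Y(1)[OF l] Y(1)[OF m] by (intro lip) (auto simp: K_def)
        then have "norm (Y m - Y l) * (1 - q) \<le> norm (X m - X l) / 2"
          using Y(2)[OF l] Y(2)[OF m] by (simp add: algebra_simps)
        then show ?thesis using q by (simp add: field_simps)
      qed
      then show "\<forall>\<^sub>F m in at l within S. norm (Y m - Y l) \<le> norm (X m - X l) / (2 * (1 - q))"
        by (auto simp: eventually_at_filter)
      have "(X \<longlongrightarrow> X l) (at l within S)" using cont l by (auto simp: continuous_on_def)
      then have "((\<lambda>m. norm (X m - X l) / (2 * (1 - q))) \<longlongrightarrow> norm (X l - X l) / (2 * (1 - q))) (at l within S)"
        using q by (intro tendsto_intros) auto
      then show "((\<lambda>m. norm (X m - X l) / (2 * (1 - q))) \<longlongrightarrow> 0) (at l within S)" by simp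
    qed
    then show "(Y \<longlongrightarrow> Y l) (at l within S)" by (simp add: LIM_zero_iff)
  qed
  moreover have "Y l = (1/2) *\<^sub>R (X l + (Y l o\<^sub>L Y l))" if "l \<in> S" for l
    using Y(2)[OF that] by (simp add: F_def)
  moreover have "norm (Y l) \<le> q" "\<And>v w. Y l v \<bullet> w = v \<bullet> Y l w" "\<And>v. Y l (J l v) = J l (Y l v)" if "l \<in> S" for l
    using Y(1)[OF that] by (simp_all add: K_def)
  ultimately show ?thesis by (intro that[of Y]) blast+
qed

text \<open>
  The operator \<open>H = \<surd>(- J\<^sup>2)\<close>. Writing \<open>- J\<^sup>2 = R\<^sup>2 (1 - X)\<close> and \<open>H = R (1 - Y)\<close>, the equation \<open>H\<^sup>2 = - J\<^sup>2\<close> becomes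
  \<open>Y = (X + Y\<^sup>2) / 2\<close>, and the bounds on \<open>J\<close> give \<open>|X v|\<^sup>2 \<le> (1 - (m / R)\<^sup>2) |v|\<^sup>2\<close>. Obtaining the root as a fixed point,
  not from an eigenbasis, gives its continuity in \<open>l\<close>.
\<close>
lemma skew_operator_modulus:
  fixes J :: "'l::topological_space \<Rightarrow> 'v::euclidean_space \<Rightarrow>\<^sub>L 'v"
  assumes cont: "continuous_on S J" and skew: "\<And>l v w. l \<in> S \<Longrightarrow> J l v \<bullet> w = - (v \<bullet> J l w)"
    and upper: "\<And>l v. l \<in> S \<Longrightarrow> norm (J l v) \<le> R * norm v"
    and lower: "\<And>l v. l \<in> S \<Longrightarrow> m * norm v \<le> norm (J l v)" and m: "0 < m" "m \<le> R"
  obtains H :: "'l \<Rightarrow> 'v \<Rightarrow>\<^sub>L 'v" and h :: real where "h > 0" "continuous_on S H"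
    "\<And>l v w. l \<in> S \<Longrightarrow> H l v \<bullet> w = v \<bullet> H l w"
    "\<And>l v. l \<in> S \<Longrightarrow> H l (J l v) = J l (H l v)"
    "\<And>l v. l \<in> S \<Longrightarrow> H l (H l v) = - J l (J l v)"
    "\<And>l v. l \<in> S \<Longrightarrow> h * (norm v)\<^sup>2 \<le> v \<bullet> H l v"
proof -
  have R: "R > 0" using m by simp
  define q where "q = sqrt (1 - (m / R)\<^sup>2)"
  have mR: "0 < m / R" "m / R \<le> 1" using m R by auto
  then have mR2: "0 < (m / R)\<^sup>2" "(m / R)\<^sup>2 \<le> 1" by (auto simp: power_le_one)
  have q: "0 \<le> q" "q < 1" "q\<^sup>2 = 1 - (m / R)\<^sup>2" using mR2 by (auto simp: q_def)
  define X where "X l = id_blinfun + (1 / R\<^sup>2) *\<^sub>R (J l o\<^sub>L J l)" for l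
  have Xv: "X l v = v + (1 / R\<^sup>2) *\<^sub>R J l (J l v)" for l v
    by (simp add: X_def blinfun.add_left blinfun.scaleR_left)
  have X_norm: "norm (X l) \<le> q" if l: "l \<in> S" for l
  proof (rule norm_blinfun_bound)
    fix v
    have JJ: "v \<bullet> J l (J l v) = - (norm (J l v))\<^sup>2" using skew[OF l, of v "J l v"] by (simp add: power2_norm_eq_inner)
    have expand: "(norm (v + k *\<^sub>R b))\<^sup>2 = (norm v)\<^sup>2 + 2 * k * (v \<bullet> b) + k\<^sup>2 * (norm b)\<^sup>2" for b :: 'v and k
      unfolding power2_norm_eq_inner
      by (simp add: inner_add_left inner_add_right inner_commute power2_eq_square algebra_simps)
    have "(norm (X l v))\<^sup>2 = (norm v)\<^sup>2 - 2 * (norm (J l v))\<^sup>2 / R\<^sup>2 + (norm (J l (J l v)))\<^sup>2 / R\<^sup>2 / R\<^sup>2"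
      unfolding Xv expand JJ by (simp add: power_divide)
    also have "(norm (J l (J l v)))\<^sup>2 / R\<^sup>2 / R\<^sup>2 \<le> (R * norm (J l v))\<^sup>2 / R\<^sup>2 / R\<^sup>2"
      by (intro divide_right_mono power_mono upper l) auto
    also have "\<dots> = (norm (J l v))\<^sup>2 / R\<^sup>2" using R by (simp add: power_mult_distrib)
    finally have "(norm (X l v))\<^sup>2 \<le> (norm v)\<^sup>2 - (norm (J l v))\<^sup>2 / R\<^sup>2" by simp
    also have "\<dots> \<le> (norm v)\<^sup>2 - (m * norm v)\<^sup>2 / R\<^sup>2"
      using m by (intro diff_left_mono divide_right_mono power_mono lower l) auto
    also have "\<dots> = (q * norm v)\<^sup>2" using R by (simp add: power_mult_distrib q(3) power_divide algebra_simps)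
    finally show "norm (X l v) \<le> q * norm v" using q by (simp add: power2_le_iff_abs_le)
  qed (rule q)
  obtain Y :: "'l \<Rightarrow> 'v \<Rightarrow>\<^sub>L 'v" where Y: "\<And>l. l \<in> S \<Longrightarrow> norm (Y l) \<le> q"
    "\<And>l v w. l \<in> S \<Longrightarrow> Y l v \<bullet> w = v \<bullet> Y l w" "\<And>l v. l \<in> S \<Longrightarrow> Y l (J l v) = J l (Y l v)"
    "\<And>l. l \<in> S \<Longrightarrow> Y l = (1/2) *\<^sub>R (X l + (Y l o\<^sub>L Y l))" "continuous_on S Y"
  proof (rule quadratic_fixed_point[OF q(1,2) X_norm, where J = "\<lambda>l. blinfun_apply (J l)"])
    show "X l v \<bullet> w = v \<bullet> X l w" if "l \<in> S" for l v w
      unfolding Xv using skew[OF that] by (simp add: inner_add_left inner_add_right)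
    show "X l (J l v) = J l (X l v)" if "l \<in> S" for l v
      unfolding Xv by (simp add: blinfun.add_right blinfun.scaleR_right)
    show "linear (blinfun_apply (J l))" for l by (rule bounded_linear.linear[OF blinfun.bounded_linear_right])
    show "continuous_on S X" unfolding X_def by (intro continuous_intros cont)
  qed blast+
  define H where "H l = R *\<^sub>R (id_blinfun - Y l)" for l
  have Hv: "H l v = R *\<^sub>R (v - Y l v)" for l v by (simp add: H_def blinfun.diff_left blinfun.scaleR_left)
  show ?thesis
  proof (rule that)
    show "R * (1 - q) > 0" using R q by simp
    show "continuous_on S H" unfolding H_def by (intro continuous_intros Y)
    fix l v w assume l: "l \<in> S"
    show "H l v \<bullet> w = v \<bullet> H l w" unfolding Hv using Y(2)[OF l] by (simp add: inner_diff_left inner_diff_right)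
    show "H l (J l v) = J l (H l v)" unfolding Hv using Y(3)[OF l] by (simp add: blinfun.diff_right blinfun.scaleR_right)
    have "Y l v = (1/2) *\<^sub>R (X l v + Y l (Y l v))"
      by (subst Y(4)[OF l]) (simp add: blinfun.scaleR_left blinfun.add_left)
    then have "2 *\<^sub>R Y l v = 2 *\<^sub>R ((1/2) *\<^sub>R (X l v + Y l (Y l v)))" by (rule arg_cong)
    then have YY: "Y l (Y l v) = 2 *\<^sub>R Y l v - X l v" by simp
    have "H l (H l v) = R\<^sup>2 *\<^sub>R (v - 2 *\<^sub>R Y l v + Y l (Y l v))"
      unfolding Hv by (simp add: blinfun.diff_right blinfun.scaleR_right power2_eq_square algebra_simps scaleR_2)
    also have "\<dots> = - J l (J l v)" unfolding YY Xv using R by (simp add: algebra_simps)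
    finally show "H l (H l v) = - J l (J l v)" .
    have "v \<bullet> Y l v \<le> norm v * (norm (Y l) * norm v)"
      by (rule order_trans[OF norm_cauchy_schwarz]) (intro mult_left_mono norm_blinfun norm_ge_zero)
    also have "\<dots> \<le> norm v * (q * norm v)" by (intro mult_left_mono mult_right_mono Y l) auto
    finally have "v \<bullet> v - v \<bullet> Y l v \<ge> (1 - q) * (norm v)\<^sup>2" by (simp add: power2_eq_square power2_norm_eq_inner[symmetric] algebra_simps)
    then show "R * (1 - q) * (norm v)\<^sup>2 \<le> v \<bullet> H l v"
      unfolding Hv using mult_left_mono[of "(1 - q) * (norm v)\<^sup>2" "v \<bullet> v - v \<bullet> Y l v" R] R by (simp add: inner_diff_right mult.assoc)
  qed
qed

text \<open>
  The solution of \<open>u' = p + A u\<close> with \<open>u 0 = 0\<close>; unlike \<open>A\<^sup>-\<^sup>1 (exp (t A) - 1) p\<close>, the power series makes sense for every \<open>A\<close>.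
\<close>
definition drift_flow :: "('v::euclidean_space \<Rightarrow>\<^sub>L 'v) \<Rightarrow> 'v \<Rightarrow> real \<Rightarrow> 'v" where
  "drift_flow A p t = (\<Sum>n. (t ^ Suc n / fact (Suc n)) *\<^sub>R ((blinfun_apply A ^^ n) p))"

lemma funpow_blinfun_norm:
  fixes A :: "'v::euclidean_space \<Rightarrow>\<^sub>L 'v"
  shows "norm ((blinfun_apply A ^^ n) p) \<le> norm A ^ n * norm p"
proof (induction n)
  case (Suc n)
  have "norm ((blinfun_apply A ^^ Suc n) p) \<le> norm A * norm ((blinfun_apply A ^^ n) p)" by (simp add: norm_blinfun)
  also have "\<dots> \<le> norm A * (norm A ^ n * norm p)" by (intro mult_left_mono Suc) auto
  finally show ?case by simp
qed simp

lemma drift_flow_term_bound: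
  fixes A :: "'v::euclidean_space \<Rightarrow>\<^sub>L 'v"
  assumes "norm A \<le> a" "\<bar>t\<bar> \<le> T"
  shows "norm ((t ^ Suc n / fact (Suc n)) *\<^sub>R ((blinfun_apply A ^^ n) p)) \<le> (T * norm p) * ((T * a) ^ n / fact n)"
proof -
  have T: "T \<ge> 0" "a \<ge> 0" using assms norm_ge_zero[of A] by linarith+
  have "norm ((t ^ Suc n / fact (Suc n)) *\<^sub>R ((blinfun_apply A ^^ n) p)) = \<bar>t\<bar> ^ Suc n / fact (Suc n) * norm ((blinfun_apply A ^^ n) p)"
    by (simp add: power_abs abs_mult)
  also have "\<dots> \<le> T ^ Suc n / fact n * (a ^ n * norm p)"
  proof (intro mult_mono frac_le power_mono assms)
    show "norm ((blinfun_apply A ^^ n) p) \<le> a ^ n * norm p"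
      using funpow_blinfun_norm[where A = A and n = n and p = p] mult_right_mono[OF power_mono[OF assms(1) norm_ge_zero], of "norm p" n] by simp
    show "(fact n :: real) \<le> fact (Suc n)" by (intro fact_mono) auto
  qed (use T in auto)
  finally show ?thesis by (simp add: power_mult_distrib mult_ac)
qed

lemma drift_flow_summable:
  fixes A :: "'v::euclidean_space \<Rightarrow>\<^sub>L 'v"
  shows "summable (\<lambda>n. (t ^ Suc n / fact (Suc n)) *\<^sub>R ((blinfun_apply A ^^ n) p))"
proof (rule summable_comparison_test')
  show "summable (\<lambda>n. (\<bar>t\<bar> * norm p) * ((\<bar>t\<bar> * norm A) ^ n / fact n))"
    using summable_exp[of "\<bar>t\<bar> * norm A"] by (intro summable_mult) (simp add: divide_inverse mult.commute)
  show "norm ((t ^ Suc n / fact (Suc n)) *\<^sub>R ((blinfun_apply A ^^ n) p)) \<le> (\<bar>t\<bar> * norm p) * ((\<bar>t\<bar> * norm A) ^ n / fact n)" if "n \<ge> 0" for n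
    by (rule drift_flow_term_bound) auto
qed

lemma drift_flow_continuous:
  fixes A :: "'l::topological_space \<Rightarrow> 'v::euclidean_space \<Rightarrow>\<^sub>L 'v"
  assumes A: "continuous_on S A" and bdd: "\<And>l. l \<in> S \<Longrightarrow> norm (A l) \<le> a"
  shows "continuous_on S (\<lambda>l. drift_flow (A l) p t)"
  unfolding drift_flow_def
proof (rule uniform_limit_theorem)
  show "uniform_limit S (\<lambda>N l. \<Sum>n<N. (t ^ Suc n / fact (Suc n)) *\<^sub>R ((blinfun_apply (A l) ^^ n) p))
    (\<lambda>l. \<Sum>n. (t ^ Suc n / fact (Suc n)) *\<^sub>R ((blinfun_apply (A l) ^^ n) p)) sequentially"
  proof (rule Weierstrass_m_test)
    show "summable (\<lambda>n. (\<bar>t\<bar> * norm p) * ((\<bar>t\<bar> * a) ^ n / fact n))"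
      using summable_exp[of "\<bar>t\<bar> * a"] by (intro summable_mult) (simp add: divide_inverse mult.commute)
    show "norm ((t ^ Suc n / fact (Suc n)) *\<^sub>R ((blinfun_apply (A l) ^^ n) p)) \<le> (\<bar>t\<bar> * norm p) * ((\<bar>t\<bar> * a) ^ n / fact n)" if "l \<in> S" for n l
      by (rule drift_flow_term_bound[OF bdd[OF that]]) auto
  qed
  have "continuous_on S (\<lambda>l. (blinfun_apply (A l) ^^ n) p)" for n
    by (induction n) (auto intro!: continuous_intros A)
  then show "\<forall>\<^sub>F N in sequentially. continuous_on S (\<lambda>l. \<Sum>n<N. (t ^ Suc n / fact (Suc n)) *\<^sub>R ((blinfun_apply (A l) ^^ n) p))"
    by (intro always_eventually allI continuous_intros)
qed auto

lemma drift_flow_0: "drift_flow A p 0 = 0"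
  by (simp add: drift_flow_def)

lemma drift_flow_has_derivative:
  fixes A :: "'v::euclidean_space \<Rightarrow>\<^sub>L 'v"
  shows "((\<lambda>t. drift_flow A p t) has_vector_derivative p + A (drift_flow A p t)) (at t)"
proof -
  define u where "u n = (blinfun_apply A ^^ n) p" for n
  have "((\<lambda>t. drift_flow A p t \<bullet> e) has_real_derivative (p + A (drift_flow A p t)) \<bullet> e) (at t)" for e
  proof -
    define c where "c n = (if n = 0 then 0 else u (n - 1) \<bullet> e / fact n)" for n
    have cS: "c (Suc n) * t ^ Suc n = ((t ^ Suc n / fact (Suc n)) *\<^sub>R u n) \<bullet> e" for n t by (simp add: c_def)
    have sm: "summable (\<lambda>n. (t ^ Suc n / fact (Suc n)) *\<^sub>R u n)" for t
      unfolding u_def by (rule drift_flow_summable)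
    have smc: "summable (\<lambda>n. c n * t ^ n)" for t
      using bounded_linear.summable[OF bounded_linear_inner_left sm[of t], of e]
      by (subst summable_Suc_iff[symmetric]) (simp only: cS)
    have flow: "drift_flow A p t \<bullet> e = (\<Sum>n. c n * t ^ n)" for t
    proof -
      have "drift_flow A p t \<bullet> e = (\<Sum>n. ((t ^ Suc n / fact (Suc n)) *\<^sub>R u n) \<bullet> e)"
        unfolding drift_flow_def u_def[symmetric]
        by (rule bounded_linear.suminf[OF bounded_linear_inner_left sm])
      also have "\<dots> = (\<Sum>n. c (Suc n) * t ^ Suc n)" by (simp only: cS)
      also have "\<dots> = (\<Sum>n. c n * t ^ n)" using suminf_split_head[OF smc[of t]] by (simp add: c_def)
      finally show ?thesis .
    qed
    have D: "((\<lambda>t. \<Sum>n. c n * t ^ n) has_real_derivative (\<Sum>n. diffs c n * t ^ n)) (at t)"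
      by (rule termdiffs_strong_converges_everywhere) (rule smc)
    have "(\<Sum>n. diffs c n * t ^ n) = (p + A (drift_flow A p t)) \<bullet> e"
    proof -
      have dn: "diffs c n * t ^ n = ((t ^ n / fact n) *\<^sub>R u n) \<bullet> e" for n
        by (simp add: diffs_def c_def del: of_nat_Suc)
      have smA: "summable (\<lambda>n. A ((t ^ Suc n / fact (Suc n)) *\<^sub>R u n))"
        by (rule bounded_linear.summable[OF blinfun.bounded_linear_right sm])
      have shift: "(t ^ Suc n / fact (Suc n)) *\<^sub>R u (Suc n) = A ((t ^ Suc n / fact (Suc n)) *\<^sub>R u n)" for n
        by (simp add: u_def blinfun.scaleR_right)
      have sm2: "summable (\<lambda>n. (t ^ n / fact n) *\<^sub>R u n)"
        using smA by (subst summable_Suc_iff[symmetric]) (simp only: shift)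
      have "(\<Sum>n. (t ^ n / fact n) *\<^sub>R u n) = u 0 + (\<Sum>n. (t ^ Suc n / fact (Suc n)) *\<^sub>R u (Suc n))"
        using suminf_split_head[OF sm2] by simp
      also have "\<dots> = p + A (drift_flow A p t)"
        unfolding shift drift_flow_def u_def[symmetric]
        by (subst bounded_linear.suminf[OF blinfun.bounded_linear_right sm]) (simp add: u_def)
      finally have "(\<Sum>n. (t ^ n / fact n) *\<^sub>R u n) = p + A (drift_flow A p t)" .
      then show ?thesis
        unfolding dn using bounded_linear.suminf[OF bounded_linear_inner_left sm2, of e] by simp
    qed
    then show ?thesis using D by (simp add: flow)
  qed
  then show ?thesis
    unfolding has_vector_derivative_def has_field_derivative_def
    by (subst has_derivative_componentwise_within) (simp add: mult_commute_abs)
qed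

section \<open>Left invariant derivatives\<close>

context two_step_lie_algebra begin

definition br :: "'v \<Rightarrow> 'v \<Rightarrow> 'z" where
  "br v e = snd (lie (v, 0) (e, 0))"

lemma bilinear_br: "bilinear br"
  unfolding bilinear_def
proof (intro conjI allI)
  have l1: "(v + v', 0) = (v, 0) + (v', 0 :: 'z)" and l2: "(c *\<^sub>R v, 0) = c *\<^sub>R (v, 0 :: 'z)" for v v' :: 'v and c by simp_all
  show "linear (br v)" for v
    unfolding br_def by (rule linearI) (simp_all only: l1 l2 bilinear_radd[OF bilinear_lie] bilinear_rmul[OF bilinear_lie] snd_add snd_scaleR)
  show "linear (\<lambda>v. br v e)" for e
    unfolding br_def by (rule linearI) (simp_all only: l1 l2 bilinear_ladd[OF bilinear_lie] bilinear_lmul[OF bilinear_lie] snd_add snd_scaleR)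
qed

lemma bounded_bilinear_br: "bounded_bilinear br"
  using bilinear_br by (simp add: bilinear_conv_bounded_bilinear)

lemma br_self: "br v v = 0"
  by (simp add: br_def lie_self)

lemma br_skew: "br v w = - br w v"
proof -
  have "br (v + w) (v + w) = br v v + br v w + (br w v + br w w)"
    by (simp add: bilinear_ladd[OF bilinear_br] bilinear_radd[OF bilinear_br] algebra_simps)
  then show ?thesis by (simp add: br_self eq_neg_iff_add_eq_0)
qed

lemma gmul_line: "gmul lie (v, z) (t *\<^sub>R (e, 0)) = (v, z) + t *\<^sub>R (e, (1/2) *\<^sub>R br v e)"
proof -
  have "gmul lie (v, z) (t *\<^sub>R e, 0) = (v + t *\<^sub>R e, z + 0 + (1/2) *\<^sub>R br v (t *\<^sub>R e))"
    unfolding br_def by (rule gmul_Pair)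
  then show ?thesis by (simp add: bilinear_rmul[OF bilinear_br])
qed

text \<open>
  In exponential coordinates the left invariant field of \<open>(e, 0)\<close> is the derivative in direction \<open>(e, [v, e] / 2)\<close>.
\<close>
lemma left_inv_eq:
  assumes "(f has_derivative f') (at (v, z))"
  shows "left_inv lie (e, 0) f (v, z) = f' (e, (1/2) *\<^sub>R br v e)"
proof -
  define w where "w = (e, (1/2) *\<^sub>R br v e)"
  have path: "((\<lambda>t::real. (v, z) + t *\<^sub>R w) has_derivative (\<lambda>t. t *\<^sub>R w)) (at 0)"
    by (auto intro!: derivative_eq_intros)
  have "((\<lambda>t. f ((v, z) + t *\<^sub>R w)) has_derivative (\<lambda>t. f' (t *\<^sub>R w))) (at 0)"
    using has_derivative_compose[OF path, of f f'] assms by simp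
  moreover have "f' (t *\<^sub>R w) = t *\<^sub>R f' w" for t
    using has_derivative_bounded_linear[OF assms] by (simp add: bounded_linear.linear linear_scale)
  ultimately have "((\<lambda>t. f ((v, z) + t *\<^sub>R w)) has_vector_derivative f' w) (at 0)"
    by (simp add: has_vector_derivative_def)
  then show ?thesis
    unfolding left_inv_def gmul_line w_def[symmetric] by (rule vector_derivative_at)
qed

lemma left_inv_mult:
  assumes "Ck (Suc n) f" "Ck (Suc m) g"
  shows "left_inv lie (e, 0) (\<lambda>x. f x * g x) = (\<lambda>x. f x * left_inv lie (e, 0) g x + left_inv lie (e, 0) f x * g x)"
proof
  fix x :: "'v \<times> 'z"
  obtain v z where x: "x = (v, z)" by fastforce
  show "left_inv lie (e, 0) (\<lambda>x. f x * g x) x = f x * left_inv lie (e, 0) g x + left_inv lie (e, 0) f x * g x"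
    unfolding x left_inv_eq[OF Ck_SucD(1)[OF assms(1)]] left_inv_eq[OF Ck_SucD(1)[OF assms(2)]]
      left_inv_eq[OF has_derivative_mult[OF Ck_SucD(1)[OF assms(1)] Ck_SucD(1)[OF assms(2)]]] ..
qed

lemma left_inv_add:
  assumes "Ck (Suc n) f" "Ck (Suc m) g"
  shows "left_inv lie (e, 0) (\<lambda>x. f x + g x) = (\<lambda>x. left_inv lie (e, 0) f x + left_inv lie (e, 0) g x)"
proof
  fix x :: "'v \<times> 'z"
  obtain v z where x: "x = (v, z)" by fastforce
  show "left_inv lie (e, 0) (\<lambda>x. f x + g x) x = left_inv lie (e, 0) f x + left_inv lie (e, 0) g x"
    unfolding x left_inv_eq[OF Ck_SucD(1)[OF assms(1)]] left_inv_eq[OF Ck_SucD(1)[OF assms(2)]]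
      left_inv_eq[OF has_derivative_add[OF Ck_SucD(1)[OF assms(1)] Ck_SucD(1)[OF assms(2)]]] ..
qed

text \<open>
  The direction of the derivative depends on the point, but its coordinates are linear functions of it.
\<close>
lemma Ck_left_inv:
  assumes "Ck (Suc n) f"
  shows "Ck n (left_inv lie (e, 0) f)"
proof -
  have eq: "left_inv lie (e, 0) f x = frechet_derivative f (at x) (e, 0) +
      (\<Sum>b\<in>Basis. complex_of_real ((1/2) * (br (fst x) e \<bullet> b)) * frechet_derivative f (at x) (0, b))" for x
  proof -
    obtain v z where x: "x = (v, z)" by fastforce
    define D where "D = frechet_derivative f (at x)"
    have D: "(f has_derivative D) (at x)" unfolding D_def by (rule Ck_SucD(1)[OF assms])
    have lin: "linear D" using has_derivative_bounded_linear[OF D] by (rule bounded_linear.linear)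
    have "(e, (1/2) *\<^sub>R br v e) = (e, 0) + (\<Sum>b\<in>Basis. ((1/2) * (br v e \<bullet> b)) *\<^sub>R (0, b))"
    proof -
      have "(1/2) *\<^sub>R br v e = (\<Sum>b\<in>Basis. ((1/2) * (br v e \<bullet> b)) *\<^sub>R b)"
        by (subst euclidean_representation[of "br v e", symmetric]) (simp add: scaleR_sum_right)
      then show ?thesis by (simp add: prod_eq_iff fst_sum snd_sum)
    qed
    then have "D (e, (1/2) *\<^sub>R br v e) = D (e, 0) + (\<Sum>b\<in>Basis. ((1/2) * (br v e \<bullet> b)) *\<^sub>R D (0, b))"
      by (simp only: linear_add[OF lin] linear_sum[OF lin] linear_scale[OF lin])
    moreover have "left_inv lie (e, 0) f x = D (e, (1/2) *\<^sub>R br v e)"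
      using left_inv_eq[of f D v z e] D by (simp add: x)
    ultimately show ?thesis by (simp add: D_def x scaleR_conv_of_real)
  qed
  have c: "Ck n (\<lambda>x. complex_of_real ((1/2) * (br (fst x) e \<bullet> b)))" for b
    by (intro Ck_bounded_linear bounded_linear_compose[OF bounded_linear_of_real] bounded_linear_const_mult
      bounded_linear_compose[OF bounded_linear_inner_left]
      bounded_linear_compose[OF bounded_bilinear.bounded_linear_left[OF bounded_bilinear_br]] bounded_linear_fst)
  show ?thesis
    unfolding ext[of "left_inv lie (e, 0) f", OF eq] by (intro Ck_add Ck_sum Ck_mult c Ck_SucD(2)[OF assms])
qed

lemma sublaplacian_mult:
  assumes f: "\<And>n. Ck n f" and g: "\<And>n. Ck n g"
  shows "sublaplacian lie (\<lambda>x. f x * g x) x = f x * sublaplacian lie g x +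
    (\<Sum>e\<in>Basis. 2 * left_inv lie (e, 0) f x * left_inv lie (e, 0) g x + left_inv lie (e, 0) (left_inv lie (e, 0) f) x * g x)"
proof -
  have "left_inv lie (e, 0) (left_inv lie (e, 0) (\<lambda>x. f x * g x)) x =
      f x * left_inv lie (e, 0) (left_inv lie (e, 0) g) x + (2 * left_inv lie (e, 0) f x * left_inv lie (e, 0) g x +
        left_inv lie (e, 0) (left_inv lie (e, 0) f) x * g x)" for e
  proof -
    let ?X = "left_inv lie (e, 0)"
    have Xf: "Ck n (?X f)" and Xg: "Ck n (?X g)" for n using f g by (auto intro: Ck_left_inv)
    have A: "?X (\<lambda>x. f x * g x) = (\<lambda>x. f x * ?X g x + ?X f x * g x)" by (rule left_inv_mult[OF f g])
    have B: "?X (\<lambda>x. f x * ?X g x + ?X f x * g x) = (\<lambda>x. ?X (\<lambda>x. f x * ?X g x) x + ?X (\<lambda>x. ?X f x * g x) x)"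
      by (rule left_inv_add[OF Ck_mult[OF f Xg] Ck_mult[OF Xf g]])
    show ?thesis unfolding A B left_inv_mult[OF f Xg] left_inv_mult[OF Xf g] by (simp add: algebra_simps)
  qed
  then show ?thesis by (simp add: sublaplacian_def sum.distrib sum_distrib_left)
qed

definition cutoff :: "real \<Rightarrow> 'v \<times> 'z \<Rightarrow> complex" where
  "cutoff R x = complex_of_real (bump 0 (ball_level R x))"

text \<open>
  The left invariant derivative of \<open>ball_level R\<close> along \<open>(e, 0)\<close>.
\<close>
definition cutoff_slope :: "real \<Rightarrow> 'v \<Rightarrow> 'v \<times> 'z \<Rightarrow> real" where
  "cutoff_slope R e x = - (2 / R\<^sup>2) * (fst x \<bullet> e + (1/2) * (snd x \<bullet> br (fst x) e))"

lemma Ck_cutoff: "Ck n (cutoff R)"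
  unfolding cutoff_def by (rule Ck_bump_ball)

lemma left_inv_bump:
  "left_inv lie (e, 0) (\<lambda>x. complex_of_real (bump m (ball_level R x))) =
    (\<lambda>x. complex_of_real (bump (Suc m) (ball_level R x)) * of_real (cutoff_slope R e x))"
proof
  fix x :: "'v \<times> 'z"
  obtain v z where x: "x = (v, z)" by fastforce
  show "left_inv lie (e, 0) (\<lambda>x. complex_of_real (bump m (ball_level R x))) x =
    complex_of_real (bump (Suc m) (ball_level R x)) * of_real (cutoff_slope R e x)"
    unfolding x left_inv_eq[OF bump_ball_has_derivative] by (simp add: cutoff_slope_def)
qed

lemma cutoff_slope_has_derivative:
  "((\<lambda>x. complex_of_real (cutoff_slope R e x)) has_derivative
    (\<lambda>d. of_real (- (2 / R\<^sup>2) * (fst d \<bullet> e + (1/2) * (snd x \<bullet> br (fst d) e + snd d \<bullet> br (fst x) e))))) (at x)"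
proof -
  have b: "((\<lambda>x. br (fst x) e) has_derivative (\<lambda>d. br (fst d) e)) (at x)" for x :: "'v \<times> 'z"
    by (intro bounded_linear_imp_has_derivative
      bounded_linear_compose[OF bounded_bilinear.bounded_linear_left[OF bounded_bilinear_br]] bounded_linear_fst)
  have "((\<lambda>x. fst x \<bullet> e + (1/2) * (snd x \<bullet> br (fst x) e)) has_derivative
      (\<lambda>d. fst d \<bullet> e + (1/2) * (snd x \<bullet> br (fst d) e + snd d \<bullet> br (fst x) e))) (at x)"
    by (auto intro!: derivative_eq_intros b)
  from has_derivative_mult_right[OF this, of "- (2 / R\<^sup>2)"] show ?thesis
    unfolding cutoff_slope_def by (rule has_derivative_of_real)
qed

lemma left_inv_cutoff_slope:
  "left_inv lie (e, 0) (\<lambda>x. complex_of_real (cutoff_slope R e x)) x =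
    of_real (- (2 / R\<^sup>2) * (e \<bullet> e + (1/4) * (norm (br (fst x) e))\<^sup>2))"
proof -
  obtain v z where x: "x = (v, z)" by fastforce
  show ?thesis
    unfolding x left_inv_eq[OF cutoff_slope_has_derivative] by (simp add: br_self power2_norm_eq_inner)
qed

lemma Ck_cutoff_slope: "Ck n (\<lambda>x. complex_of_real (cutoff_slope R e x))"
proof -
  have b: "bounded_linear (\<lambda>x. complex_of_real (snd x \<bullet> b))" "bounded_linear (\<lambda>x. complex_of_real (br (fst x) e \<bullet> b))"
    "bounded_linear (\<lambda>x. complex_of_real (fst x \<bullet> e))" for b
    by (intro bounded_linear_compose[OF bounded_linear_of_real]
      bounded_linear_compose[OF bounded_linear_inner_left] bounded_linear_snd bounded_linear_fst
      bounded_linear_compose[OF bounded_bilinear.bounded_linear_left[OF bounded_bilinear_br]])+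
  have "(\<lambda>x. complex_of_real (cutoff_slope R e x)) = (\<lambda>x. of_real (- (2 / R\<^sup>2)) * (of_real (fst x \<bullet> e) +
      of_real (1/2) * (\<Sum>b\<in>Basis. of_real (snd x \<bullet> b) * of_real (br (fst x) e \<bullet> b))))"
    unfolding cutoff_slope_def by (subst euclidean_inner[of "snd _"]) simp
  then show ?thesis by (simp only:) (intro Ck_mult Ck_add Ck_sum Ck_const Ck_bounded_linear b)
qed

lemma left_inv_left_inv_cutoff:
  "left_inv lie (e, 0) (left_inv lie (e, 0) (cutoff R)) x =
    of_real (bump 2 (ball_level R x) * (cutoff_slope R e x)\<^sup>2 +
      bump 1 (ball_level R x) * (- (2 / R\<^sup>2) * (e \<bullet> e + (1/4) * (norm (br (fst x) e))\<^sup>2)))"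
proof -
  have "left_inv lie (e, 0) (cutoff R) = (\<lambda>x. complex_of_real (bump (Suc 0) (ball_level R x)) * of_real (cutoff_slope R e x))"
    unfolding cutoff_def by (rule left_inv_bump)
  then have "left_inv lie (e, 0) (left_inv lie (e, 0) (cutoff R)) x =
      of_real (bump (Suc 0) (ball_level R x)) * left_inv lie (e, 0) (\<lambda>x. complex_of_real (cutoff_slope R e x)) x +
      left_inv lie (e, 0) (\<lambda>x. complex_of_real (bump (Suc 0) (ball_level R x))) x * of_real (cutoff_slope R e x)"
    by (simp only: left_inv_mult[OF Ck_bump_ball Ck_cutoff_slope])
  then show ?thesis
    unfolding left_inv_cutoff_slope left_inv_bump by (simp add: numeral_2_eq_2 power2_eq_square algebra_simps)
qed

lemma br_norm_le: obtains K where "K \<ge> 0" "\<And>v e. e \<in> Basis \<Longrightarrow> norm (br v e) \<le> K * norm v"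
proof -
  obtain K where K: "K > 0" "\<And>v e. norm (br v e) \<le> norm v * norm e * K"
    using bounded_bilinear.pos_bounded[OF bounded_bilinear_br] by blast
  have "norm (br v e) \<le> K * norm v" if "e \<in> Basis" for v e
    using K(2)[of v e] that by (simp add: mult.commute)
  then show ?thesis using that K(1) by (meson less_imp_le)
qed

text \<open>
  A derivative of the cutoff gains \<open>1 / R\<close> and loses only \<open>1 + |v|\<close>: the factor \<open>|z| \<le> R\<close> that comes with
  the bracket is compensated by one of the two powers of \<open>1 / R\<close>.
\<close>
lemma cutoff_slope_le:
  assumes K: "K \<ge> 0" "\<And>v e. e \<in> Basis \<Longrightarrow> norm (br v e) \<le> K * norm v" and e: "e \<in> Basis" and R: "R > 0" and x: "norm x \<le> R"
  shows "\<bar>cutoff_slope R e x\<bar> \<le> (2 + K) * (1 + norm (fst x)) / R"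
proof -
  have "\<bar>fst x \<bullet> e\<bar> \<le> norm x * 1"
    using Basis_le_norm[OF e, of "fst x"] norm_fst_le[of "fst x" "snd x"] by simp
  also have "\<dots> \<le> R * (1 + norm (fst x))" using x R by (intro mult_mono) auto
  finally have 1: "\<bar>fst x \<bullet> e\<bar> \<le> R * (1 + norm (fst x))" .
  have "\<bar>snd x \<bullet> br (fst x) e\<bar> \<le> norm (snd x) * norm (br (fst x) e)" by (rule Cauchy_Schwarz_ineq2)
  also have "\<dots> \<le> R * (K * norm (fst x))"
    using norm_snd_le[of "snd x" "fst x"] x R by (intro mult_mono K(2)[OF e]) auto
  also have "\<dots> \<le> R * (K * (1 + norm (fst x)))" using R K by (intro mult_left_mono) auto
  finally have 2: "\<bar>snd x \<bullet> br (fst x) e\<bar> \<le> R * (K * (1 + norm (fst x)))" .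
  have "\<bar>fst x \<bullet> e + (1/2) * (snd x \<bullet> br (fst x) e)\<bar> \<le> \<bar>fst x \<bullet> e\<bar> + \<bar>snd x \<bullet> br (fst x) e\<bar> / 2" by linarith
  also have "\<dots> \<le> R * (1 + norm (fst x)) + R * (K * (1 + norm (fst x))) / 2" using 1 2 by simp
  finally have "\<bar>cutoff_slope R e x\<bar> \<le> 2 / R\<^sup>2 * (R * (1 + norm (fst x)) + R * (K * (1 + norm (fst x))) / 2)"
    unfolding cutoff_slope_def abs_mult by (intro mult_mono) auto
  also have "\<dots> = (2 + K) * (1 + norm (fst x)) / R" using R by (simp add: power2_eq_square field_simps)
  finally show ?thesis .
qed

end

section \<open>Superpositions of central characters\<close>

text \<open>
  A superposition of the characters \<open>cis (\<xi> \<bullet> z)\<close> of the centre, with amplitudes that depend on \<open>v\<close>.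
\<close>
definition wave :: "'z::euclidean_space set \<Rightarrow> ('z \<Rightarrow> 'v::euclidean_space \<Rightarrow> complex) \<Rightarrow> 'v \<times> 'z \<Rightarrow> complex" where
  "wave S m x = (\<integral>\<xi>. of_real (indicator S \<xi>) * m \<xi> (fst x) * cis (\<xi> \<bullet> snd x) \<partial>lborel)"

lemma wave_measurable:
  assumes [measurable]: "S \<in> sets borel" "(\<lambda>(\<xi>, v). m \<xi> v) \<in> borel_measurable (borel \<Otimes>\<^sub>M borel)"
  shows "wave S m \<in> borel_measurable borel"
proof -
  have "wave S m \<in> borel_measurable (borel \<Otimes>\<^sub>M borel)"
    unfolding wave_def by measurable
  then show ?thesis by (simp add: borel_prod)
qed

text \<open>
  For fixed \<open>v\<close> this is the Bessel inequality in the central variable.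
\<close>
lemma wave_bessel:
  assumes [measurable]: "S \<in> sets borel" "(\<lambda>(\<xi>, v). m \<xi> v) \<in> borel_measurable (borel \<Otimes>\<^sub>M borel)"
    and fin: "emeasure lborel S < \<infinity>" and bdd: "\<And>v. \<exists>B. \<forall>\<xi>\<in>S. norm (m \<xi> v) \<le> B"
  shows "(\<integral>\<^sup>+x. ennreal ((norm (wave S m x))\<^sup>2) \<partial>lborel) \<le> ennreal ((2 * pi) ^ DIM('z)) *
    (\<integral>\<^sup>+q. indicator S (snd q) * ennreal ((norm (m (snd q) (fst q)))\<^sup>2) \<partial>(lborel \<Otimes>\<^sub>M lborel :: ('v::euclidean_space \<times> 'z::euclidean_space) measure))"
proof -
  have [measurable]: "wave S m \<in> borel_measurable (borel \<Otimes>\<^sub>M borel)"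
    using wave_measurable[OF assms(1,2)] by (simp add: borel_prod)
  have [measurable]: "(\<lambda>\<xi>. m \<xi> v) \<in> borel_measurable borel" for v
  proof -
    have "(\<lambda>\<xi>. (\<xi>, v)) \<in> borel \<rightarrow>\<^sub>M borel \<Otimes>\<^sub>M borel" by measurable
    from measurable_compose[OF this assms(2)] show ?thesis by simp
  qed
  have "(\<integral>\<^sup>+x. ennreal ((norm (wave S m x))\<^sup>2) \<partial>lborel) =
      (\<integral>\<^sup>+v. (\<integral>\<^sup>+z. ennreal ((norm (wave S m (v, z)))\<^sup>2) \<partial>lborel) \<partial>lborel)"
    unfolding lborel_prod[symmetric] by (subst lborel.nn_integral_fst[symmetric]) auto
  also have "\<dots> \<le> (\<integral>\<^sup>+v. ennreal ((2 * pi) ^ DIM('z)) * (\<integral>\<^sup>+\<xi>. indicator S \<xi> * ennreal ((norm (m \<xi> v))\<^sup>2) \<partial>lborel) \<partial>lborel)"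
  proof (rule nn_integral_mono)
    fix v :: 'v
    obtain B where B: "\<And>\<xi>. \<xi> \<in> S \<Longrightarrow> norm (m \<xi> v) \<le> B" using bdd by blast
    have "integrable lborel (\<lambda>\<xi>. complex_of_real (indicator S \<xi>) * m \<xi> v)"
    proof (rule Bochner_Integration.integrable_bound)
      show "integrable lborel (\<lambda>\<xi>. indicator S \<xi> * B)" using fin by simp
      show "AE \<xi> in lborel. norm (complex_of_real (indicator S \<xi>) * m \<xi> v) \<le> norm (indicator S \<xi> * B)"
        using B by (intro AE_I2) (force simp: indicator_def norm_mult)
    qed measurable
    from fourier_bessel[OF this]
    have "(\<integral>\<^sup>+z. ennreal ((norm (wave S m (v, z)))\<^sup>2) \<partial>lborel) \<le>
      ennreal ((2 * pi) ^ DIM('z)) * (\<integral>\<^sup>+\<xi>. ennreal ((norm (complex_of_real (indicator S \<xi>) * m \<xi> v))\<^sup>2) \<partial>lborel)"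
      by (simp add: wave_def)
    also have "(\<integral>\<^sup>+\<xi>. ennreal ((norm (complex_of_real (indicator S \<xi>) * m \<xi> v))\<^sup>2) \<partial>lborel) =
      (\<integral>\<^sup>+\<xi>. indicator S \<xi> * ennreal ((norm (m \<xi> v))\<^sup>2) \<partial>lborel)"
      by (intro nn_integral_cong) (auto simp: indicator_def)
    finally show "(\<integral>\<^sup>+z. ennreal ((norm (wave S m (v, z)))\<^sup>2) \<partial>lborel) \<le>
      ennreal ((2 * pi) ^ DIM('z)) * (\<integral>\<^sup>+\<xi>. indicator S \<xi> * ennreal ((norm (m \<xi> v))\<^sup>2) \<partial>lborel)" .
  qed
  also have "\<dots> = ennreal ((2 * pi) ^ DIM('z)) * (\<integral>\<^sup>+v. (\<integral>\<^sup>+\<xi>. indicator S \<xi> * ennreal ((norm (m \<xi> v))\<^sup>2) \<partial>lborel) \<partial>lborel)"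
  proof (rule nn_integral_cmult)
    have "(\<lambda>(v, \<xi>). indicator S \<xi> * ennreal ((norm (m \<xi> v))\<^sup>2)) \<in> borel_measurable (borel \<Otimes>\<^sub>M borel)"
      using measurable_compose[OF measurable_pair_swap' assms(2)] by (simp add: case_prod_unfold) measurable
    then show "(\<lambda>v. \<integral>\<^sup>+\<xi>. indicator S \<xi> * ennreal ((norm (m \<xi> v))\<^sup>2) \<partial>lborel) \<in> borel_measurable lborel"
      by (intro lborel.borel_measurable_nn_integral) simp
  qed
  also have "(\<integral>\<^sup>+v. (\<integral>\<^sup>+\<xi>. indicator S \<xi> * ennreal ((norm (m \<xi> v))\<^sup>2) \<partial>lborel) \<partial>lborel) =
      (\<integral>\<^sup>+q. indicator S (snd q) * ennreal ((norm (m (snd q) (fst q)))\<^sup>2) \<partial>(lborel \<Otimes>\<^sub>M lborel :: ('v \<times> 'z) measure))"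
  proof -
    have [measurable]: "(\<lambda>q. m (snd q) (fst q)) \<in> borel_measurable ((borel :: 'v measure) \<Otimes>\<^sub>M (borel :: 'z measure))"
      using measurable_compose[OF measurable_pair_swap' assms(2)] by (simp add: case_prod_unfold)
    show ?thesis by (subst lborel.nn_integral_fst[symmetric]) auto
  qed
  finally show ?thesis .
qed

lemma gauss_majorant_finite:
  assumes S: "S \<in> sets borel" "emeasure lborel S < \<infinity>" and \<epsilon>: "\<epsilon> > 0"
  shows "(\<integral>\<^sup>+q. ennreal (B\<^sup>2 * gauss_weight \<epsilon> (fst q)) * indicator S (snd q)
    \<partial>(lborel \<Otimes>\<^sub>M lborel :: ('v::euclidean_space \<times> 'z::euclidean_space) measure)) < \<infinity>"
proof -
  have [measurable]: "S \<in> sets borel" by (rule S)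
  have "(\<integral>\<^sup>+q. ennreal (B\<^sup>2 * gauss_weight \<epsilon> (fst q)) * indicator S (snd q) \<partial>(lborel \<Otimes>\<^sub>M lborel :: ('v \<times> 'z) measure)) =
      (\<integral>\<^sup>+v. (\<integral>\<^sup>+\<xi>. ennreal (B\<^sup>2 * gauss_weight \<epsilon> v) * indicator S \<xi> \<partial>(lborel :: 'z measure)) \<partial>(lborel :: 'v measure))"
    by (subst lborel.nn_integral_fst[symmetric]) auto
  also have "\<dots> = (\<integral>\<^sup>+v. ennreal (gauss_weight \<epsilon> v) * (ennreal (B\<^sup>2) * emeasure lborel S) \<partial>(lborel :: 'v measure))"
    using S by (intro nn_integral_cong)
      (subst nn_integral_cmult_indicator, auto simp: ennreal_mult' gauss_weight_bounds(1)[THEN less_imp_le] mult_ac)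
  also have "\<dots> = (\<integral>\<^sup>+v. ennreal (gauss_weight \<epsilon> v) \<partial>(lborel :: 'v measure)) * (ennreal (B\<^sup>2) * emeasure lborel S)"
    by (rule nn_integral_multc) measurable
  also have "\<dots> < \<infinity>"
    using S(2) integrable_gauss_weight[OF \<epsilon>, where 'a = 'v] gauss_weight_bounds(1)[of \<epsilon>, THEN less_imp_le]
    by (subst nn_integral_eq_integral) (auto simp: ennreal_mult_less_top)
  finally show ?thesis .
qed

lemma amplitude_sq_le:
  fixes m :: "'z::euclidean_space \<Rightarrow> 'v::euclidean_space \<Rightarrow> complex"
  assumes "\<And>\<xi> v. \<xi> \<in> S \<Longrightarrow> norm (m \<xi> v) \<le> B * gauss_weight \<epsilon> v"
  shows "indicator S (snd q) * ennreal ((norm (m (snd q) (fst q)))\<^sup>2) \<le> ennreal (B\<^sup>2 * gauss_weight \<epsilon> (fst q)) * indicator S (snd q)"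
proof (cases "snd q \<in> S")
  case True
  have "(norm (m (snd q) (fst q)))\<^sup>2 \<le> (B * gauss_weight \<epsilon> (fst q))\<^sup>2" by (intro power_mono assms True) auto
  also have "\<dots> = B\<^sup>2 * (gauss_weight \<epsilon> (fst q) * gauss_weight \<epsilon> (fst q))" by (simp add: power2_eq_square)
  also have "\<dots> \<le> B\<^sup>2 * (gauss_weight \<epsilon> (fst q) * 1)"
    using gauss_weight_bounds[of \<epsilon> "fst q"] by (intro mult_left_mono) auto
  finally show ?thesis using True by (simp add: ennreal_leI)
qed simp

lemma wave_L2:
  fixes m :: "'z::euclidean_space \<Rightarrow> 'v::euclidean_space \<Rightarrow> complex"
  assumes S: "S \<in> sets borel" and m: "(\<lambda>(\<xi>, v). m \<xi> v) \<in> borel_measurable (borel \<Otimes>\<^sub>M borel)"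
    and fin: "emeasure lborel S < \<infinity>" and le: "\<And>\<xi> v. \<xi> \<in> S \<Longrightarrow> norm (m \<xi> v) \<le> B * gauss_weight \<epsilon> v" and \<epsilon>: "\<epsilon> > 0"
  shows "wave S m \<in> L2"
proof -
  have [measurable]: "wave S m \<in> borel_measurable borel" by (rule wave_measurable[OF S m])
  have f: "(\<integral>\<^sup>+q. indicator S (snd q) * ennreal ((norm (m (snd q) (fst q)))\<^sup>2) \<partial>(lborel \<Otimes>\<^sub>M lborel :: ('v \<times> 'z) measure)) < \<infinity>"
    using nn_integral_mono[OF amplitude_sq_le[OF le]] gauss_majorant_finite[OF S fin \<epsilon>] by (rule le_less_trans)
  have "\<exists>B. \<forall>\<xi>\<in>S. norm (m \<xi> v) \<le> B" for v using le by blast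
  then have "(\<integral>\<^sup>+x. ennreal ((norm (wave S m x))\<^sup>2) \<partial>lborel) < \<infinity>"
    using wave_bessel[OF S m fin] f by (auto simp: ennreal_mult_less_top intro: le_less_trans)
  then show ?thesis unfolding L2_def by (auto intro!: integrableI_bounded)
qed

text \<open>
  Pointwise convergence of amplitudes with a Gaussian majorant implies convergence in \<open>L\<^sup>2\<close>. All limits of wave packets
  in \<open>L\<^sup>2\<close> with respect to time are reduced to this.
\<close>
lemma wave_tendsto_0:
  fixes m :: "nat \<Rightarrow> 'z::euclidean_space \<Rightarrow> 'v::euclidean_space \<Rightarrow> complex"
  assumes S: "S \<in> sets borel" and m: "\<And>n. (\<lambda>(\<xi>, v). m n \<xi> v) \<in> borel_measurable (borel \<Otimes>\<^sub>M borel)"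
    and fin: "emeasure lborel S < \<infinity>" and le: "\<And>n \<xi> v. \<xi> \<in> S \<Longrightarrow> norm (m n \<xi> v) \<le> B * gauss_weight \<epsilon> v" and \<epsilon>: "\<epsilon> > 0"
    and lim: "\<And>\<xi> v. \<xi> \<in> S \<Longrightarrow> (\<lambda>n. m n \<xi> v) \<longlonglongrightarrow> 0"
  shows "(\<lambda>n. L2_norm (wave S (m n))) \<longlonglongrightarrow> 0"
proof -
  define I where "I n = (\<integral>\<^sup>+q. indicator S (snd q) * ennreal ((norm (m n (snd q) (fst q)))\<^sup>2) \<partial>(lborel \<Otimes>\<^sub>M lborel :: ('v \<times> 'z) measure))" for n
  have [measurable]: "S \<in> sets borel" by (rule S)
  have [measurable]: "(\<lambda>q. m n (snd q) (fst q)) \<in> borel_measurable (borel \<Otimes>\<^sub>M borel)" for n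
    using measurable_compose[OF measurable_pair_swap' m[of n]] by (simp add: case_prod_unfold)
  have "(\<lambda>n. I n) \<longlonglongrightarrow> (\<integral>\<^sup>+q. 0 \<partial>(lborel \<Otimes>\<^sub>M lborel :: ('v \<times> 'z) measure))"
    unfolding I_def
  proof (rule nn_integral_dominated_convergence[OF _ _ _ _ gauss_majorant_finite[OF S fin \<epsilon>]])
    show "AE q in lborel \<Otimes>\<^sub>M lborel. indicator S (snd q) * ennreal ((norm (m n (snd q) (fst q)))\<^sup>2) \<le>
        ennreal (B\<^sup>2 * gauss_weight \<epsilon> (fst q)) * indicator S (snd q)" for n
      by (intro AE_I2 amplitude_sq_le le)
    show "AE q in lborel \<Otimes>\<^sub>M lborel. (\<lambda>n. indicator S (snd q) * ennreal ((norm (m n (snd q) (fst q)))\<^sup>2)) \<longlonglongrightarrow> 0"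
    proof (intro AE_I2)
      fix q :: "'v \<times> 'z"
      show "(\<lambda>n. indicator S (snd q) * ennreal ((norm (m n (snd q) (fst q)))\<^sup>2)) \<longlonglongrightarrow> 0"
      proof (cases "snd q \<in> S")
        case True
        have "(\<lambda>n. (norm (m n (snd q) (fst q)))\<^sup>2) \<longlonglongrightarrow> (norm (0::complex))\<^sup>2"
          by (intro tendsto_power tendsto_norm lim True)
        then have "(\<lambda>n. ennreal ((norm (m n (snd q) (fst q)))\<^sup>2)) \<longlonglongrightarrow> ennreal ((norm (0::complex))\<^sup>2)" by (rule tendsto_ennrealI)
        then show ?thesis using True by simp
      qed simp
    qed
  qed measurable
  then have I0: "I \<longlonglongrightarrow> 0" by simp
  have "(\<lambda>n. ennreal ((2 * pi) ^ DIM('z)) * I n) \<longlonglongrightarrow> ennreal ((2 * pi) ^ DIM('z)) * 0"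
    by (intro ennreal_tendsto_cmult I0) simp
  then have up: "(\<lambda>n. ennreal ((2 * pi) ^ DIM('z)) * I n) \<longlonglongrightarrow> 0" by simp
  have wL: "wave S (m n) \<in> L2" for n by (rule wave_L2[OF S m fin le \<epsilon>])
  have nn: "ennreal ((L2_norm (wave S (m n)))\<^sup>2) = (\<integral>\<^sup>+x. ennreal ((norm (wave S (m n) x))\<^sup>2) \<partial>lborel)" for n
    unfolding L2_norm_sq by (rule nn_integral_eq_integral[symmetric, OF L2_integrable[OF wL]]) simp
  have "\<exists>B. \<forall>\<xi>\<in>S. norm (m n \<xi> v) \<le> B" for n v using le by blast
  then have le: "ennreal ((L2_norm (wave S (m n)))\<^sup>2) \<le> ennreal ((2 * pi) ^ DIM('z)) * I n" for n
    unfolding nn I_def by (intro wave_bessel[OF S m fin])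
  have "(\<lambda>n. ennreal ((L2_norm (wave S (m n)))\<^sup>2)) \<longlonglongrightarrow> 0"
    by (rule tendsto_sandwich[OF _ _ tendsto_const up]) (use le in auto)
  then have "(\<lambda>n. (L2_norm (wave S (m n)))\<^sup>2) \<longlonglongrightarrow> 0"
    using tendsto_ennreal_iff[of "\<lambda>n. (L2_norm (wave S (m n)))\<^sup>2" sequentially 0] by simp
  then have "(\<lambda>n. sqrt ((L2_norm (wave S (m n)))\<^sup>2)) \<longlonglongrightarrow> sqrt 0" by (rule tendsto_real_sqrt)
  then show ?thesis by (simp add: L2_norm_nonneg)
qed

lemma L2_norm_dominated_tendsto_0:
  fixes F :: "nat \<Rightarrow> 'a::euclidean_space \<Rightarrow> complex"
  assumes F: "\<And>n. F n \<in> borel_measurable borel" and g: "integrable lborel g"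
    and le: "\<And>n x. (norm (F n x))\<^sup>2 \<le> g x" and lim: "\<And>x. (\<lambda>n. F n x) \<longlonglongrightarrow> 0"
  shows "(\<lambda>n. L2_norm (F n)) \<longlonglongrightarrow> 0"
proof -
  have [measurable]: "F n \<in> borel_measurable borel" for n by (rule F)
  have "(\<lambda>n. \<integral>x. (norm (F n x))\<^sup>2 \<partial>lborel) \<longlonglongrightarrow> (\<integral>x. 0 \<partial>(lborel :: 'a measure))"
  proof (rule integral_dominated_convergence[OF _ _ g])
    show "AE x in lborel. (\<lambda>n. (norm (F n x))\<^sup>2) \<longlonglongrightarrow> 0"
      using tendsto_power[OF tendsto_norm[OF lim], where n = 2] by (intro AE_I2) simp
  qed (use le in auto)
  then have "(\<lambda>n. sqrt (\<integral>x. (norm (F n x))\<^sup>2 \<partial>lborel)) \<longlonglongrightarrow> sqrt 0" by (intro tendsto_real_sqrt) simp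
  then show ?thesis by (simp add: L2_norm_def)
qed

section \<open>Wave packets\<close>

context two_step_lie_algebra begin

text \<open>
  The operator that represents the form \<open>(v, w) \<mapsto> \<xi> \<bullet> [v, w]\<close>.
\<close>
definition J :: "'z \<Rightarrow> 'v \<Rightarrow>\<^sub>L 'v" where
  "J \<xi> = Blinfun (\<lambda>v. \<Sum>e\<in>Basis. (\<xi> \<bullet> br v e) *\<^sub>R e)"

lemma J_apply: "J \<xi> v = (\<Sum>e\<in>Basis. (\<xi> \<bullet> br v e) *\<^sub>R e)"
proof -
  have "bounded_linear (\<lambda>v. \<Sum>e\<in>Basis. (\<xi> \<bullet> br v e) *\<^sub>R e)"
    by (intro bounded_linear_sum bounded_linear_compose[OF bounded_linear_scaleR_left]
      bounded_linear_compose[OF bounded_linear_inner_right] bounded_bilinear.bounded_linear_left[OF bounded_bilinear_br])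
  then show ?thesis by (simp add: J_def bounded_linear_Blinfun_apply)
qed

lemma J_inner: "J \<xi> v \<bullet> w = \<xi> \<bullet> br v w"
proof -
  have "J \<xi> v \<bullet> w = (\<Sum>e\<in>Basis. (\<xi> \<bullet> br v e) * (w \<bullet> e))"
    unfolding J_apply inner_sum_left by (simp add: inner_commute)
  also have "\<dots> = \<xi> \<bullet> br v (\<Sum>e\<in>Basis. (w \<bullet> e) *\<^sub>R e)"
    using bilinear_br by (simp add: bilinear_def linear_sum linear_scale inner_sum_right mult.commute)
  finally show ?thesis by (simp add: euclidean_representation)
qed

lemma J_skew: "J \<xi> v \<bullet> w = - (v \<bullet> J \<xi> w)"
  using br_skew[of v w] by (simp add: J_inner inner_commute[of v])

lemma J_self: "v \<bullet> J \<xi> v = 0" "J \<xi> v \<bullet> v = 0"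
  by (simp_all add: J_inner inner_commute[of v] br_self)

lemma J_scale: "J (c *\<^sub>R \<xi>) v = c *\<^sub>R J \<xi> v"
  by (simp add: J_apply scaleR_sum_right)

lemma J_continuous: "continuous_on S J"
proof (rule continuous_on_blinfun_componentwise)
  fix i :: 'v
  show "continuous_on S (\<lambda>\<xi>. J \<xi> i)" unfolding J_apply by (intro continuous_intros)
qed

end

text \<open>
  A box of central frequencies \<open>\<xi>\<close> on which \<open>H \<xi>\<close> is the modulus \<open>\<surd>(- (J \<xi>)\<^sup>2)\<close>, with lower bound \<open>h\<close>, and an initial momentum \<open>p\<close>.
  After the Fourier transform in \<open>z\<close> the sublaplacian is a magnetic Laplacian on \<open>\<vv>\<close> with constant field \<open>J \<xi>\<close>; its Schroedinger
  equation has Gaussian solutions of constant shape \<open>H \<xi>\<close> that follow the classical orbits.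
\<close>
locale wave_packet = two_step_lie_algebra lie
  for lie :: "'v::euclidean_space \<times> 'z::euclidean_space \<Rightarrow> 'v \<times> 'z \<Rightarrow> 'v \<times> 'z" +
  fixes lo hi :: 'z and H :: "'z \<Rightarrow> 'v \<Rightarrow>\<^sub>L 'v" and h :: real and p :: 'v
  assumes h_pos: "h > 0" and H_cont: "continuous_on (cbox lo hi) H"
    and H_sym: "\<xi> \<in> cbox lo hi \<Longrightarrow> H \<xi> v \<bullet> w = v \<bullet> H \<xi> w"
    and H_comm: "\<xi> \<in> cbox lo hi \<Longrightarrow> H \<xi> (J \<xi> v) = J \<xi> (H \<xi> v)"
    and H_sq: "\<xi> \<in> cbox lo hi \<Longrightarrow> H \<xi> (H \<xi> v) = - J \<xi> (J \<xi> v)"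
    and H_ge: "\<xi> \<in> cbox lo hi \<Longrightarrow> h * (norm v)\<^sup>2 \<le> v \<bullet> H \<xi> v"
begin

abbreviation "box_dual \<equiv> cbox lo hi"

text \<open>
  The classical orbit that starts at the origin with momentum \<open>p\<close>: \<open>ctr' = 2 mom\<close> and \<open>mom = p + J ctr\<close>.
\<close>
definition ctr :: "'z \<Rightarrow> real \<Rightarrow> 'v" where
  "ctr \<xi> t = drift_flow (2 *\<^sub>R J \<xi>) (2 *\<^sub>R p) t"

definition mom :: "'z \<Rightarrow> real \<Rightarrow> 'v" where
  "mom \<xi> t = p + J \<xi> (ctr \<xi> t)"

definition trH :: "'z \<Rightarrow> real" where
  "trH \<xi> = (\<Sum>e\<in>Basis. H \<xi> e \<bullet> e)"

text \<open>
  The exponent of the packet is \<open>phase_re + \<i> phase_im\<close>, a quadratic polynomial in \<open>v\<close> with coefficients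
  such that the packet times \<open>cis (\<xi> \<bullet> z)\<close> solves the Schroedinger equation; \<open>trH\<close> enters as the energy of the ground state.
\<close>
definition phase_re :: "'z \<Rightarrow> real \<Rightarrow> 'v \<Rightarrow> real" where
  "phase_re \<xi> t v = - (1/4) * ((v - ctr \<xi> t) \<bullet> H \<xi> (v - ctr \<xi> t))"

definition phase_im :: "'z \<Rightarrow> real \<Rightarrow> 'v \<Rightarrow> real" where
  "phase_im \<xi> t v = (p + (1/2) *\<^sub>R J \<xi> (ctr \<xi> t)) \<bullet> v - (1/2) * (ctr \<xi> t \<bullet> p) - (t/2) * trH \<xi>"

definition packet :: "'z \<Rightarrow> real \<Rightarrow> 'v \<Rightarrow> complex" where
  "packet \<xi> t v = exp (of_real (phase_re \<xi> t v) + \<i> * of_real (phase_im \<xi> t v))"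

lemma ctr_0: "ctr \<xi> 0 = 0"
  by (simp add: ctr_def drift_flow_0)

lemma ctr_has_derivative: "(ctr \<xi> has_vector_derivative 2 *\<^sub>R mom \<xi> t) (at t)"
  using drift_flow_has_derivative[of "2 *\<^sub>R J \<xi>" "2 *\<^sub>R p" t]
  by (simp add: ctr_def[abs_def] mom_def blinfun.scaleR_left scaleR_add_right)

lemma mom_has_derivative: "(mom \<xi> has_vector_derivative 2 *\<^sub>R J \<xi> (mom \<xi> t)) (at t)"
proof -
  have "((\<lambda>t. p + J \<xi> (ctr \<xi> t)) has_vector_derivative 0 + J \<xi> (2 *\<^sub>R mom \<xi> t)) (at t)"
    by (intro derivative_intros bounded_linear.has_vector_derivative[OF blinfun.bounded_linear_right ctr_has_derivative])
  then show ?thesis by (simp add: mom_def[abs_def] blinfun.scaleR_right)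
qed

text \<open>
  The magnetic force \<open>J \<xi> mom\<close> is orthogonal to the momentum.
\<close>
lemma mom_norm: "norm (mom \<xi> t) = norm p"
proof -
  have "((\<lambda>t. mom \<xi> t \<bullet> mom \<xi> t) has_vector_derivative 0) (at t)" for t
    using bounded_bilinear.has_vector_derivative[OF bounded_bilinear_inner mom_has_derivative[of \<xi> t] mom_has_derivative[of \<xi> t]]
    by (simp add: J_self)
  then have "((\<lambda>t. mom \<xi> t \<bullet> mom \<xi> t) has_derivative (\<lambda>h. 0)) (at t within UNIV)" for t
    by (simp add: has_vector_derivative_def)
  from has_derivative_zero_unique[OF convex_UNIV this, of t 0]
  have "mom \<xi> t \<bullet> mom \<xi> t = mom \<xi> 0 \<bullet> mom \<xi> 0" by simp
  then show ?thesis by (simp add: mom_def ctr_0 norm_eq_sqrt_inner)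
qed

lemma real_curve_lipschitz:
  fixes g :: "real \<Rightarrow> 'a::real_normed_vector"
  assumes "\<And>\<tau>. \<tau> \<in> closed_segment s t \<Longrightarrow> (g has_vector_derivative g' \<tau>) (at \<tau>)"
    and "\<And>\<tau>. \<tau> \<in> closed_segment s t \<Longrightarrow> norm (g' \<tau>) \<le> B"
  shows "norm (g t - g s) \<le> B * \<bar>t - s\<bar>"
proof -
  have "norm (g t - g s) \<le> B * norm (t - s)"
  proof (rule differentiable_bound[OF convex_closed_segment])
    fix \<tau> assume \<tau>: "\<tau> \<in> closed_segment s t"
    show "(g has_derivative (\<lambda>h. h *\<^sub>R g' \<tau>)) (at \<tau> within closed_segment s t)"
      using has_derivative_at_withinI assms(1)[OF \<tau>] by (simp add: has_vector_derivative_def has_derivative_at_withinI)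
    show "onorm (\<lambda>h. h *\<^sub>R g' \<tau>) \<le> B"
    proof (rule onorm_le)
      fix x :: real
      show "norm (x *\<^sub>R g' \<tau>) \<le> B * norm x"
        using mult_left_mono[OF assms(2)[OF \<tau>], of "\<bar>x\<bar>"] by (simp add: mult.commute)
    qed
  qed auto
  then show ?thesis by simp
qed

lemma ctr_norm_le: "norm (ctr \<xi> t) \<le> 2 * norm p * \<bar>t\<bar>"
  using real_curve_lipschitz[of 0 t "ctr \<xi>" "\<lambda>t. 2 *\<^sub>R mom \<xi> t" "2 * norm p"] ctr_has_derivative[of \<xi>]
  by (simp add: mom_norm ctr_0)

text \<open>
  For times that are short compared with \<open>1 / |J \<xi>|\<close> the field cannot bend the orbit back: it stays within \<open>|t| |p|\<close> of the straight
  path \<open>2 t p\<close>.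
\<close>
lemma ctr_norm_ge:
  assumes a: "norm (J \<xi>) \<le> a" and small: "4 * a * \<bar>t\<bar> \<le> 1"
  shows "\<bar>t\<bar> * norm p \<le> norm (ctr \<xi> t)"
proof -
  have a0: "a \<ge> 0" using a norm_ge_zero order_trans by blast
  have der: "((\<lambda>t. ctr \<xi> t - (2 * t) *\<^sub>R p) has_vector_derivative 2 *\<^sub>R J \<xi> (ctr \<xi> \<tau>)) (at \<tau>)" for \<tau>
  proof -
    have "((\<lambda>t. (2 * t) *\<^sub>R p) has_vector_derivative 2 *\<^sub>R p) (at \<tau>)"
      by (auto intro!: derivative_eq_intros)
    from has_vector_derivative_diff[OF ctr_has_derivative this] show ?thesis
      by (simp add: mom_def scaleR_add_right)
  qed
  have "norm ((ctr \<xi> t - (2 * t) *\<^sub>R p) - (ctr \<xi> 0 - (2 * 0) *\<^sub>R p)) \<le> norm p * \<bar>t - 0\<bar>"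
  proof (rule real_curve_lipschitz[OF der])
    fix \<tau> assume "\<tau> \<in> closed_segment 0 t"
    then have \<tau>: "\<bar>\<tau>\<bar> \<le> \<bar>t\<bar>" by (auto simp: closed_segment_eq_real_ivl split: if_splits)
    have "norm (2 *\<^sub>R J \<xi> (ctr \<xi> \<tau>)) \<le> 2 * (norm (J \<xi>) * norm (ctr \<xi> \<tau>))" using norm_blinfun[of "J \<xi>"] by simp
    also have "\<dots> \<le> 2 * (a * (2 * norm p * \<bar>t\<bar>))"
    proof -
      have "norm (ctr \<xi> \<tau>) \<le> 2 * norm p * \<bar>t\<bar>" using ctr_norm_le[of \<xi> \<tau>] mult_left_mono[OF \<tau>, of "2 * norm p"] by simp
      then show ?thesis using a a0 by (intro mult_left_mono mult_mono) auto
    qed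
    also have "\<dots> = norm p * (4 * a * \<bar>t\<bar>)" by simp
    also have "\<dots> \<le> norm p * 1" using small by (intro mult_left_mono) auto
    finally show "norm (2 *\<^sub>R J \<xi> (ctr \<xi> \<tau>)) \<le> norm p" by simp
  qed
  then have "norm (ctr \<xi> t - (2 * t) *\<^sub>R p) \<le> norm p * \<bar>t\<bar>" by (simp add: ctr_0)
  moreover have "norm ((2 * t) *\<^sub>R p) \<le> norm (ctr \<xi> t) + norm (ctr \<xi> t - (2 * t) *\<^sub>R p)"
    using norm_triangle_ineq4[of "ctr \<xi> t" "ctr \<xi> t - (2 * t) *\<^sub>R p"] by simp
  ultimately show ?thesis by (simp add: abs_mult algebra_simps)
qed

lemma J_norm_bounded: "\<exists>a. \<forall>\<xi>\<in>box_dual. norm (J \<xi>) \<le> a"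
  using compact_imp_bounded[OF compact_continuous_image[OF J_continuous compact_cbox[of lo hi]]]
  by (auto simp: bounded_iff)

lemma H_norm_bounded: "\<exists>a. \<forall>\<xi>\<in>box_dual. norm (H \<xi>) \<le> a"
  using compact_imp_bounded[OF compact_continuous_image[OF H_cont compact_cbox[of lo hi]]]
  by (auto simp: bounded_iff)

lemma ctr_continuous: "continuous_on box_dual (\<lambda>\<xi>. ctr \<xi> t)"
proof -
  obtain a where a: "\<And>\<xi>. \<xi> \<in> box_dual \<Longrightarrow> norm (J \<xi>) \<le> a" using J_norm_bounded by blast
  show ?thesis unfolding ctr_def
  proof (rule drift_flow_continuous)
    show "continuous_on box_dual (\<lambda>\<xi>. 2 *\<^sub>R J \<xi>)" by (intro continuous_intros J_continuous)
    show "norm (2 *\<^sub>R J \<xi>) \<le> 2 * a" if "\<xi> \<in> box_dual" for \<xi> using a[OF that] by simp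
  qed
qed

lemma trH_continuous: "continuous_on box_dual trH"
  unfolding trH_def by (intro continuous_intros H_cont)

lemma packet_continuous: "continuous_on (box_dual \<times> UNIV) (\<lambda>(\<xi>, v). packet \<xi> t v)"
proof -
  have 1: "continuous_on (box_dual \<times> UNIV) (\<lambda>q. ctr (fst q) t)"
    by (rule continuous_on_compose2[OF ctr_continuous]) (auto intro!: continuous_intros)
  have 2: "continuous_on (box_dual \<times> UNIV) (\<lambda>q. H (fst q))"
    by (rule continuous_on_compose2[OF H_cont]) (auto intro!: continuous_intros)
  have 3: "continuous_on (box_dual \<times> UNIV) (\<lambda>q. trH (fst q))"
    by (rule continuous_on_compose2[OF trH_continuous]) (auto intro!: continuous_intros)
  have 4: "continuous_on (box_dual \<times> UNIV) (\<lambda>q. J (fst q))"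
    by (rule continuous_on_compose2[OF J_continuous[of UNIV]]) (auto intro!: continuous_intros)
  show ?thesis
    unfolding packet_def phase_re_def phase_im_def case_prod_unfold
    by (intro continuous_intros 1 2 3 4)
qed

lemma packet_norm: "norm (packet \<xi> t v) = exp (phase_re \<xi> t v)"
  by (simp add: packet_def norm_exp_eq_Re)

lemma packet_norm_le:
  assumes "\<xi> \<in> box_dual"
  shows "norm (packet \<xi> t v) \<le> exp (- (h / 4 * (norm (v - ctr \<xi> t))\<^sup>2))"
  using H_ge[OF assms, of "v - ctr \<xi> t"] by (simp add: packet_norm phase_re_def)

text \<open>
  The logarithmic time derivative of the packet.
\<close>
definition rate :: "'z \<Rightarrow> real \<Rightarrow> 'v \<Rightarrow> complex" where
  "rate \<xi> t v = of_real (H \<xi> (v - ctr \<xi> t) \<bullet> mom \<xi> t) +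
    \<i> * of_real (J \<xi> (mom \<xi> t) \<bullet> v - mom \<xi> t \<bullet> p - (1/2) * trH \<xi>)"

lemma packet_has_time_derivative:
  assumes \<xi>: "\<xi> \<in> box_dual"
  shows "((\<lambda>t. packet \<xi> t v) has_vector_derivative rate \<xi> t v * packet \<xi> t v) (at t)"
proof -
  define y where "y t = v - ctr \<xi> t" for t
  have y: "(y has_vector_derivative - (2 *\<^sub>R mom \<xi> t)) (at t)"
    unfolding y_def[abs_def] using has_vector_derivative_diff[OF has_vector_derivative_const ctr_has_derivative, of v \<xi> t] by simp
  have Hy: "((\<lambda>t. H \<xi> (y t)) has_vector_derivative H \<xi> (- (2 *\<^sub>R mom \<xi> t))) (at t)"
    by (rule bounded_linear.has_vector_derivative[OF blinfun.bounded_linear_right y])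
  have "((\<lambda>t. y t \<bullet> H \<xi> (y t)) has_vector_derivative y t \<bullet> H \<xi> (- (2 *\<^sub>R mom \<xi> t)) + - (2 *\<^sub>R mom \<xi> t) \<bullet> H \<xi> (y t)) (at t)"
    by (rule bounded_bilinear.has_vector_derivative[OF bounded_bilinear_inner y Hy])
  also have "y t \<bullet> H \<xi> (- (2 *\<^sub>R mom \<xi> t)) + - (2 *\<^sub>R mom \<xi> t) \<bullet> H \<xi> (y t) = - 4 * (H \<xi> (y t) \<bullet> mom \<xi> t)"
    using H_sym[OF \<xi>, of "y t" "mom \<xi> t"] by (simp add: blinfun.minus_right blinfun.scaleR_right inner_commute)
  finally have "((\<lambda>t. - (1/4) * (y t \<bullet> H \<xi> (y t))) has_vector_derivative - (1/4) * (- 4 * (H \<xi> (y t) \<bullet> mom \<xi> t))) (at t)"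
    by (rule has_vector_derivative_mult_right)
  then have re: "((\<lambda>t. phase_re \<xi> t v) has_vector_derivative H \<xi> (y t) \<bullet> mom \<xi> t) (at t)"
    by (simp add: phase_re_def y_def)
  have JJ: "((\<lambda>t. p + (1/2) *\<^sub>R J \<xi> (ctr \<xi> t)) has_vector_derivative J \<xi> (mom \<xi> t)) (at t)"
  proof -
    have "((\<lambda>t. p + (1/2) *\<^sub>R J \<xi> (ctr \<xi> t)) has_vector_derivative 0 + (1/2) *\<^sub>R J \<xi> (2 *\<^sub>R mom \<xi> t)) (at t)"
      by (intro has_vector_derivative_add has_vector_derivative_const
        bounded_linear.has_vector_derivative[OF bounded_linear_scaleR_right]
        bounded_linear.has_vector_derivative[OF blinfun.bounded_linear_right ctr_has_derivative])
    then show ?thesis by (simp add: blinfun.scaleR_right)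
  qed
  have "((\<lambda>t. (p + (1/2) *\<^sub>R J \<xi> (ctr \<xi> t)) \<bullet> v) has_vector_derivative J \<xi> (mom \<xi> t) \<bullet> v) (at t)"
    by (rule bounded_linear.has_vector_derivative[OF bounded_linear_inner_left JJ])
  moreover have "((\<lambda>t. (1/2) * (ctr \<xi> t \<bullet> p)) has_vector_derivative (1/2) * ((2 *\<^sub>R mom \<xi> t) \<bullet> p)) (at t)"
    by (intro has_vector_derivative_mult_right bounded_linear.has_vector_derivative[OF bounded_linear_inner_left ctr_has_derivative])
  moreover have "((\<lambda>t. (t/2) * trH \<xi>) has_vector_derivative (1/2) * trH \<xi>) (at t)"
    by (auto intro!: derivative_eq_intros)
  ultimately have im: "((\<lambda>t. phase_im \<xi> t v) has_vector_derivative J \<xi> (mom \<xi> t) \<bullet> v - (1/2) * ((2 *\<^sub>R mom \<xi> t) \<bullet> p) - (1/2) * trH \<xi>) (at t)"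
    unfolding phase_im_def by (intro has_vector_derivative_diff)
  have c: "((\<lambda>t. of_real (phase_re \<xi> t v) + \<i> * of_real (phase_im \<xi> t v)) has_vector_derivative rate \<xi> t v) (at t)"
    using has_vector_derivative_add[OF bounded_linear.has_vector_derivative[OF bounded_linear_of_real re]
      has_vector_derivative_mult_right[OF bounded_linear.has_vector_derivative[OF bounded_linear_of_real im], of \<i>]]
    by (simp add: rate_def y_def)
  have "(exp has_field_derivative packet \<xi> t v) (at (of_real (phase_re \<xi> t v) + \<i> * of_real (phase_im \<xi> t v)))"
    unfolding packet_def by (rule DERIV_exp)
  from field_vector_diff_chain_at[OF c this] show ?thesis by (simp add: o_def packet_def[abs_def])
qed

lemma poly_gauss_bounded:
  assumes a: "a > 0"
  shows "\<exists>K\<ge>0. \<forall>r\<ge>0. (1 + r) ^ N * exp (- (a * r\<^sup>2)) \<le> (K::real)"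
proof -
  obtain K where K: "\<forall>r\<ge>0. r ^ N * exp (- (a * sqrt r)) \<le> K" using power_le_exp_sqrt[OF a, of N] by blast
  have K0: "K \<ge> 0" using K by (auto dest!: spec[of _ 1] intro: order_trans[rotated])
  have "(1 + r) ^ N * exp (- (a * r\<^sup>2)) \<le> 2 ^ N * (1 + K)" if r: "r \<ge> 0" for r
  proof -
    have "(1 + r) ^ N \<le> 2 ^ N * (1 + (r ^ 4) ^ N)"
    proof (cases "r \<le> 1")
      case True
      have "(1 + r) ^ N \<le> 2 ^ N" using True r by (intro power_mono) auto
      also have "\<dots> \<le> 2 ^ N * (1 + (r ^ 4) ^ N)" using r by simp
      finally show ?thesis .
    next
      case False
      have "r ^ 1 \<le> r ^ 4" using False by (intro power_increasing) auto
      then have "(1 + r) ^ N \<le> (2 * r ^ 4) ^ N" using False by (intro power_mono) auto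
      then show ?thesis by (rule order_trans) (simp add: power_mult_distrib distrib_left)
    qed
    then have "(1 + r) ^ N * exp (- (a * r\<^sup>2)) \<le> 2 ^ N * (1 + (r ^ 4) ^ N) * exp (- (a * r\<^sup>2))"
      by (intro mult_right_mono) auto
    also have "\<dots> = 2 ^ N * (exp (- (a * r\<^sup>2)) + (r ^ 4) ^ N * exp (- (a * sqrt (r ^ 4))))"
    proof -
      have "sqrt (r ^ 4) = r\<^sup>2" by (rule real_sqrt_unique) (simp_all flip: power_mult)
      then show ?thesis by (simp add: algebra_simps)
    qed
    also have "\<dots> \<le> 2 ^ N * (1 + K)"
      using K[rule_format, of "r ^ 4"] a r by (intro mult_left_mono add_mono) auto
    finally show ?thesis .
  qed
  then show ?thesis using K0 by (intro exI[of _ "2 ^ N * (1 + K)"]) auto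
qed

text \<open>
  Of the decay \<open>exp (- h |v - ctr|\<^sup>2 / 4)\<close> of a packet one half is given up for recentring it at the origin, and
  one half of the remainder for absorbing polynomials in \<open>v\<close>.
\<close>
definition eps :: real where "eps = sqrt (h / 8)"

lemma eps_pos: "eps > 0"
  using h_pos by (simp add: eps_def)

lemma poly_packet_bound:
  assumes T: "T \<ge> 0"
  shows "\<exists>B\<ge>0. \<forall>\<xi>\<in>box_dual. \<forall>v t. \<bar>t\<bar> \<le> T \<longrightarrow> (1 + norm v) ^ N * norm (packet \<xi> t v) \<le> B * gauss_weight eps v"
proof -
  define X where "X = 2 * norm p * T"
  have X: "X \<ge> 0" using T by (simp add: X_def)
  obtain K where K: "K \<ge> 0" "\<And>r. r \<ge> 0 \<Longrightarrow> (1 + r) ^ N * exp (- (h / 16 * r\<^sup>2)) \<le> K"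
    using poly_gauss_bounded[of "h / 16" N] h_pos by auto
  have "(1 + norm v) ^ N * norm (packet \<xi> t v) \<le> exp (h / 4 * X\<^sup>2) * K * gauss_weight eps v"
    if \<xi>: "\<xi> \<in> box_dual" and t: "\<bar>t\<bar> \<le> T" for \<xi> v t
  proof -
    have c: "norm (ctr \<xi> t) \<le> X"
      using ctr_norm_le[of \<xi> t] mult_left_mono[OF t, of "2 * norm p"] by (simp add: X_def)
    have "norm v \<le> norm (v - ctr \<xi> t) + norm (ctr \<xi> t)" using norm_triangle_ineq[of "v - ctr \<xi> t" "ctr \<xi> t"] by simp
    then have "(norm v)\<^sup>2 \<le> (norm (v - ctr \<xi> t) + X)\<^sup>2" using c by (intro power_mono) auto
    also have "\<dots> \<le> 2 * (norm (v - ctr \<xi> t))\<^sup>2 + 2 * X\<^sup>2"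
      using sum_squares_bound[of "norm (v - ctr \<xi> t)" X] by (simp add: power2_sum)
    finally have "(norm v)\<^sup>2 / 2 - X\<^sup>2 \<le> (norm (v - ctr \<xi> t))\<^sup>2" by simp
    then have "h / 4 * ((norm v)\<^sup>2 / 2 - X\<^sup>2) \<le> h / 4 * (norm (v - ctr \<xi> t))\<^sup>2"
      using h_pos by (intro mult_left_mono) auto
    then have "norm (packet \<xi> t v) \<le> exp (- (h / 4 * ((norm v)\<^sup>2 / 2 - X\<^sup>2)))"
      using packet_norm_le[OF \<xi>, of t v] by (meson exp_le_cancel_iff neg_le_iff_le order_trans)
    also have "\<dots> = exp (h / 4 * X\<^sup>2) * exp (- (h / 16 * (norm v)\<^sup>2)) * exp (- (h / 16 * (norm v)\<^sup>2))"
      by (simp add: exp_add[symmetric] algebra_simps)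
    also have "exp (- (h / 16 * (norm v)\<^sup>2)) = gauss_weight eps v"
      using h_pos by (simp add: gauss_weight_def eps_def)
    finally have "(1 + norm v) ^ N * norm (packet \<xi> t v) \<le>
        (1 + norm v) ^ N * (exp (h / 4 * X\<^sup>2) * gauss_weight eps v * gauss_weight eps v)"
      by (intro mult_left_mono) auto
    also have "\<dots> = exp (h / 4 * X\<^sup>2) * ((1 + norm v) ^ N * gauss_weight eps v) * gauss_weight eps v" by simp
    also have "\<dots> \<le> exp (h / 4 * X\<^sup>2) * K * gauss_weight eps v"
    proof -
      have "gauss_weight eps v = exp (- (h / 16 * (norm v)\<^sup>2))" using h_pos by (simp add: gauss_weight_def eps_def)
      then have "(1 + norm v) ^ N * gauss_weight eps v \<le> K" using K(2)[of "norm v"] by simp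
      then show ?thesis using gauss_weight_bounds(1)[of eps v] by (intro mult_right_mono mult_left_mono) auto
    qed
    finally show ?thesis .
  qed
  then show ?thesis using K(1) by (intro exI[of _ "exp (h / 4 * X\<^sup>2) * K"]) auto
qed

end

section \<open>Superpositions of wave packets\<close>

context wave_packet begin

text \<open>
  Polynomials in \<open>v\<close> with coefficients that depend continuously on \<open>\<xi>\<close>: the amplitudes that arise from differentiating wave
  packets.
\<close>
inductive_set symbols :: "('z \<Rightarrow> 'v \<Rightarrow> complex) set" where
  coef: "continuous_on box_dual c \<Longrightarrow> (\<lambda>\<xi> v. c \<xi>) \<in> symbols"
| coord: "(\<lambda>\<xi> v. complex_of_real (v \<bullet> e)) \<in> symbols"
| add: "f \<in> symbols \<Longrightarrow> g \<in> symbols \<Longrightarrow> (\<lambda>\<xi> v. f \<xi> v + g \<xi> v) \<in> symbols"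
| mult: "f \<in> symbols \<Longrightarrow> g \<in> symbols \<Longrightarrow> (\<lambda>\<xi> v. f \<xi> v * g \<xi> v) \<in> symbols"

lemma symbols_const: "(\<lambda>\<xi> v. k) \<in> symbols"
  by (rule coef) simp

lemma symbols_sum: "finite A \<Longrightarrow> (\<And>i. i \<in> A \<Longrightarrow> f i \<in> symbols) \<Longrightarrow> (\<lambda>\<xi> v. \<Sum>i\<in>A. f i \<xi> v) \<in> symbols"
  by (induction A rule: finite_induct) (auto intro: symbols_const add)

lemma symbols_real_coef: "continuous_on box_dual r \<Longrightarrow> (\<lambda>\<xi> v. complex_of_real (r \<xi>)) \<in> symbols"
  by (rule coef) (intro continuous_intros)

lemma symbols_inner:
  assumes "continuous_on box_dual u"
  shows "(\<lambda>\<xi> v. complex_of_real (v \<bullet> u \<xi>)) \<in> symbols"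
proof -
  have "(\<lambda>\<xi> v. complex_of_real (v \<bullet> u \<xi>)) = (\<lambda>\<xi> v. \<Sum>b\<in>Basis. complex_of_real (v \<bullet> b) * complex_of_real (u \<xi> \<bullet> b))"
    by (intro ext) (subst euclidean_inner, simp)
  moreover have "(\<lambda>\<xi> v. \<Sum>b\<in>Basis. complex_of_real (v \<bullet> b) * complex_of_real (u \<xi> \<bullet> b)) \<in> symbols"
    by (intro symbols_sum mult coord symbols_real_coef continuous_intros assms finite_Basis)
  ultimately show ?thesis by simp
qed

lemma symbols_derivative:
  assumes "g \<in> symbols"
  shows "\<exists>g'. (\<forall>d. (\<lambda>\<xi> v. g' \<xi> v d) \<in> symbols) \<and> (\<forall>\<xi> v. (g \<xi> has_derivative g' \<xi> v) (at v))"
  using assms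
proof induction
  case (coef c)
  show ?case by (intro exI[of _ "\<lambda>\<xi> v d. 0"]) (auto intro: symbols_const)
next
  case (coord e)
  have "((\<lambda>v. complex_of_real (v \<bullet> e)) has_derivative (\<lambda>d. complex_of_real (d \<bullet> e))) (at v)" for v :: 'v
    by (intro has_derivative_of_real bounded_linear_imp_has_derivative bounded_linear_inner_left)
  then show ?case by (intro exI[of _ "\<lambda>\<xi> v d. complex_of_real (d \<bullet> e)"]) (auto intro: symbols_const)
next
  case (add f g)
  then obtain f' g' where D: "\<And>d. (\<lambda>\<xi> v. f' \<xi> v d) \<in> symbols" "\<And>\<xi> v. (f \<xi> has_derivative f' \<xi> v) (at v)"
    "\<And>d. (\<lambda>\<xi> v. g' \<xi> v d) \<in> symbols" "\<And>\<xi> v. (g \<xi> has_derivative g' \<xi> v) (at v)" by blast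
  show ?case
    by (intro exI[of _ "\<lambda>\<xi> v d. f' \<xi> v d + g' \<xi> v d"] conjI allI symbols.add has_derivative_add D)
next
  case (mult f g)
  then obtain f' g' where D: "\<And>d. (\<lambda>\<xi> v. f' \<xi> v d) \<in> symbols" "\<And>\<xi> v. (f \<xi> has_derivative f' \<xi> v) (at v)"
    "\<And>d. (\<lambda>\<xi> v. g' \<xi> v d) \<in> symbols" "\<And>\<xi> v. (g \<xi> has_derivative g' \<xi> v) (at v)" by blast
  show ?case
    by (intro exI[of _ "\<lambda>\<xi> v d. f \<xi> v * g' \<xi> v d + f' \<xi> v d * g \<xi> v"] conjI allI symbols.add symbols.mult has_derivative_mult D mult(1,2))
qed

lemma symbols_continuous:
  assumes "g \<in> symbols" shows "continuous_on (box_dual \<times> UNIV) (\<lambda>(\<xi>, v). g \<xi> v)"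
  using assms
proof induction
  case (coef c)
  then show ?case unfolding case_prod_unfold
    by (rule continuous_on_compose2) (auto intro!: continuous_intros)
qed (auto simp: case_prod_unfold intro!: continuous_intros)

lemma symbols_bound:
  assumes "g \<in> symbols"
  shows "\<exists>C\<ge>0. \<exists>N. \<forall>\<xi>\<in>box_dual. \<forall>v. norm (g \<xi> v) \<le> C * (1 + norm v) ^ N"
  using assms
proof induction
  case (coef c)
  have "bounded (c ` box_dual)" using coef by (intro compact_imp_bounded compact_continuous_image) auto
  then obtain C where C: "\<forall>\<xi>\<in>box_dual. norm (c \<xi>) \<le> C" by (auto simp: bounded_iff)
  show ?case by (intro exI[of _ "max C 0"] exI[of _ "0::nat"] conjI) (use C in \<open>auto intro: max.coboundedI1\<close>)
next
  case (coord e)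
  show ?case
  proof (intro exI[of _ "norm e"] exI[of _ 1] conjI ballI allI)
    fix \<xi> v
    have "norm (complex_of_real (v \<bullet> e)) \<le> norm e * norm v" using Cauchy_Schwarz_ineq2[of v e] by (simp add: mult.commute)
    also have "\<dots> \<le> norm e * (1 + norm v) ^ 1" by (intro mult_left_mono) auto
    finally show "norm (complex_of_real (v \<bullet> e)) \<le> norm e * (1 + norm v) ^ 1" .
  qed auto
next
  case (add f g)
  then obtain C N D M where *: "C \<ge> 0" "D \<ge> 0" "\<And>\<xi> v. \<xi> \<in> box_dual \<Longrightarrow> norm (f \<xi> v) \<le> C * (1 + norm v) ^ N"
    "\<And>\<xi> v. \<xi> \<in> box_dual \<Longrightarrow> norm (g \<xi> v) \<le> D * (1 + norm v) ^ M" by blast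
  show ?case
  proof (intro exI[of _ "C + D"] exI[of _ "N + M"] conjI ballI allI)
    fix \<xi> and v :: 'v assume \<xi>: "\<xi> \<in> box_dual"
    have p: "(1 + norm v) ^ N \<le> (1 + norm v) ^ (N + M)" "(1 + norm v) ^ M \<le> (1 + norm v) ^ (N + M)"
      by (auto intro!: power_increasing)
    have "norm (f \<xi> v + g \<xi> v) \<le> C * (1 + norm v) ^ N + D * (1 + norm v) ^ M"
      by (intro norm_triangle_le add_mono * \<xi>)
    also have "\<dots> \<le> C * (1 + norm v) ^ (N + M) + D * (1 + norm v) ^ (N + M)"
      by (intro add_mono mult_left_mono p *)
    finally show "norm (f \<xi> v + g \<xi> v) \<le> (C + D) * (1 + norm v) ^ (N + M)" by (simp add: distrib_right)
  qed (use * in auto)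
next
  case (mult f g)
  then obtain C N D M where *: "C \<ge> 0" "D \<ge> 0" "\<And>\<xi> v. \<xi> \<in> box_dual \<Longrightarrow> norm (f \<xi> v) \<le> C * (1 + norm v) ^ N"
    "\<And>\<xi> v. \<xi> \<in> box_dual \<Longrightarrow> norm (g \<xi> v) \<le> D * (1 + norm v) ^ M" by blast
  show ?case
  proof (intro exI[of _ "C * D"] exI[of _ "N + M"] conjI ballI allI)
    fix \<xi> and v :: 'v assume \<xi>: "\<xi> \<in> box_dual"
    have "norm (f \<xi> v * g \<xi> v) \<le> (C * (1 + norm v) ^ N) * (D * (1 + norm v) ^ M)"
      unfolding norm_mult by (intro mult_mono * \<xi>) (use * in auto)
    then show "norm (f \<xi> v * g \<xi> v) \<le> (C * D) * (1 + norm v) ^ (N + M)" by (simp add: power_add mult_ac)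
  qed (use * in auto)
qed

text \<open>
  The amplitude is set to 0 outside the box because \<open>H\<close>, and with it the packet, is controlled only there.
\<close>
definition superpose :: "real \<Rightarrow> ('z \<Rightarrow> 'v \<Rightarrow> complex) \<Rightarrow> 'v \<times> 'z \<Rightarrow> complex" where
  "superpose t g = wave box_dual (\<lambda>\<xi> v. if \<xi> \<in> box_dual then g \<xi> v * packet \<xi> t v else 0)"

lemma superpose_symbol_measurable:
  fixes m :: "'z \<Rightarrow> 'v \<Rightarrow> complex"
  assumes "continuous_on (box_dual \<times> UNIV) (\<lambda>(\<xi>, v). m \<xi> v)"
  shows "(\<lambda>(\<xi>, v). if \<xi> \<in> box_dual then m \<xi> v else 0) \<in> borel_measurable (borel \<Otimes>\<^sub>M borel)"
proof -
  have "(\<lambda>q. indicator (box_dual \<times> UNIV) q *\<^sub>R (case q of (\<xi>, v) \<Rightarrow> m \<xi> v)) \<in> borel_measurable borel"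
    by (rule borel_measurable_continuous_on_indicator[OF _ assms]) (auto intro!: borel_closed closed_Times)
  moreover have "(\<lambda>q. indicator (box_dual \<times> UNIV) q *\<^sub>R (case q of (\<xi>, v) \<Rightarrow> m \<xi> v)) = (\<lambda>(\<xi>, v). if \<xi> \<in> box_dual then m \<xi> v else 0)"
    by (auto simp: fun_eq_iff indicator_def)
  ultimately show ?thesis by (simp only: borel_prod)
qed

lemma symbol_packet_bound:
  assumes g: "g \<in> symbols" and T: "T \<ge> 0"
  shows "\<exists>B\<ge>0. \<forall>\<xi>\<in>box_dual. \<forall>v t. \<bar>t\<bar> \<le> T \<longrightarrow> norm (g \<xi> v * packet \<xi> t v) \<le> B * gauss_weight eps v"
proof -
  obtain C N where C: "C \<ge> 0" "\<And>\<xi> v. \<xi> \<in> box_dual \<Longrightarrow> norm (g \<xi> v) \<le> C * (1 + norm v) ^ N"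
    using symbols_bound[OF g] by blast
  obtain B where B: "B \<ge> 0" "\<And>\<xi> v t. \<xi> \<in> box_dual \<Longrightarrow> \<bar>t\<bar> \<le> T \<Longrightarrow> (1 + norm v) ^ N * norm (packet \<xi> t v) \<le> B * gauss_weight eps v"
    using poly_packet_bound[OF T, of N] by blast
  have "norm (g \<xi> v * packet \<xi> t v) \<le> (C * B) * gauss_weight eps v" if "\<xi> \<in> box_dual" "\<bar>t\<bar> \<le> T" for \<xi> v t
  proof -
    have "norm (g \<xi> v * packet \<xi> t v) \<le> C * (1 + norm v) ^ N * norm (packet \<xi> t v)"
      unfolding norm_mult by (intro mult_right_mono C that) auto
    also have "\<dots> \<le> C * (B * gauss_weight eps v)" using mult_left_mono[OF B(2)[OF that, of v] C(1)] by (simp add: mult.assoc)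
    finally show ?thesis by simp
  qed
  then show ?thesis using B C by (intro exI[of _ "C * B"]) auto
qed

lemma superpose_L2:
  assumes g: "g \<in> symbols" shows "superpose t g \<in> L2"
proof -
  obtain B where B: "\<And>\<xi> v s. \<xi> \<in> box_dual \<Longrightarrow> \<bar>s\<bar> \<le> \<bar>t\<bar> \<Longrightarrow> norm (g \<xi> v * packet \<xi> s v) \<le> B * gauss_weight eps v"
    using symbol_packet_bound[OF g, of "\<bar>t\<bar>"] by auto
  have "continuous_on (box_dual \<times> UNIV) (\<lambda>(\<xi>, v). g \<xi> v * packet \<xi> t v)"
    using continuous_on_mult[OF symbols_continuous[OF g] packet_continuous[of t]] by (simp add: case_prod_unfold)
  from superpose_symbol_measurable[OF this] show ?thesis
    unfolding superpose_def by (rule wave_L2[rotated]) (use B eps_pos in \<open>auto simp: emeasure_lborel_cbox_eq\<close>)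
qed

text \<open>
  The exponent of the packet times \<open>cis (\<xi> \<bullet> z)\<close>, as a function on the group.
\<close>
definition wphase :: "real \<Rightarrow> 'z \<Rightarrow> 'v \<times> 'z \<Rightarrow> complex" where
  "wphase t \<xi> x = of_real (phase_re \<xi> t (fst x)) + \<i> * of_real (phase_im \<xi> t (fst x) + \<xi> \<bullet> snd x)"

lemma exp_wphase: "exp (wphase t \<xi> x) = packet \<xi> t (fst x) * cis (\<xi> \<bullet> snd x)"
  by (simp add: wphase_def packet_def cis_conv_exp exp_add[symmetric] algebra_simps)

lemma exp_wphase_continuous: "continuous_on (UNIV \<times> box_dual) (\<lambda>(x, \<xi>). exp (wphase t \<xi> x))"
proof -
  have "continuous_on (UNIV \<times> box_dual) (\<lambda>q. (\<lambda>(\<xi>, v). packet \<xi> t v) (snd q, fst (fst q)))"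
    by (rule continuous_on_compose2[OF packet_continuous[of t]]) (auto intro!: continuous_intros)
  then show ?thesis
    unfolding exp_wphase case_prod_unfold by (intro continuous_intros) simp
qed

lemma symbol_wphase_continuous:
  assumes g: "g \<in> symbols"
  shows "continuous_on (UNIV \<times> box_dual) (\<lambda>(x, \<xi>). g \<xi> (fst x) * exp (wphase t \<xi> x))"
proof -
  have "continuous_on (UNIV \<times> box_dual) (\<lambda>q. (\<lambda>(\<xi>, v). g \<xi> v) (snd q, fst (fst q)))"
    by (rule continuous_on_compose2[OF symbols_continuous[OF g]]) (auto intro!: continuous_intros)
  then show ?thesis using exp_wphase_continuous[of t]
    unfolding case_prod_unfold by (intro continuous_on_mult) simp_all
qed

lemma superpose_integral:
  assumes g: "g \<in> symbols"
  shows "superpose t g x = integral box_dual (\<lambda>\<xi>. g \<xi> (fst x) * exp (wphase t \<xi> x))"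
    and "(\<lambda>\<xi>. g \<xi> (fst x) * exp (wphase t \<xi> x)) integrable_on box_dual"
proof -
  have c: "continuous_on box_dual (\<lambda>\<xi>. g \<xi> (fst x) * exp (wphase t \<xi> x))"
  proof -
    have "continuous_on box_dual (\<lambda>\<xi>. (\<lambda>(x, \<xi>). g \<xi> (fst x) * exp (wphase t \<xi> x)) (x, \<xi>))"
      by (rule continuous_on_compose2[OF symbol_wphase_continuous[OF g]]) (auto intro!: continuous_intros)
    then show ?thesis by simp
  qed
  then show "(\<lambda>\<xi>. g \<xi> (fst x) * exp (wphase t \<xi> x)) integrable_on box_dual" by (rule integrable_continuous)
  have "set_integrable lborel box_dual (\<lambda>\<xi>. g \<xi> (fst x) * exp (wphase t \<xi> x))"
    unfolding set_integrable_def using c by (intro borel_integrable_compact) auto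
  from set_borel_integral_eq_integral(2)[OF this]
  have "integral box_dual (\<lambda>\<xi>. g \<xi> (fst x) * exp (wphase t \<xi> x)) =
      (\<integral>\<xi>. indicator box_dual \<xi> *\<^sub>R (g \<xi> (fst x) * exp (wphase t \<xi> x)) \<partial>lborel)"
    by (simp add: set_lebesgue_integral_def)
  also have "\<dots> = superpose t g x"
    unfolding superpose_def wave_def
    by (intro Bochner_Integration.integral_cong) (auto simp: indicator_def exp_wphase)
  finally show "superpose t g x = integral box_dual (\<lambda>\<xi>. g \<xi> (fst x) * exp (wphase t \<xi> x))" by simp
qed

lemma superpose_sum:
  assumes "finite A" "\<And>i. i \<in> A \<Longrightarrow> g i \<in> symbols"
  shows "superpose t (\<lambda>\<xi> v. \<Sum>i\<in>A. g i \<xi> v) x = (\<Sum>i\<in>A. superpose t (g i) x)"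
  using assms
  by (simp add: superpose_integral symbols_sum sum_distrib_right integral_sum)

lemma superpose_const_mult:
  assumes "g \<in> symbols"
  shows "superpose t (\<lambda>\<xi> v. k * g \<xi> v) x = k * superpose t g x"
  using assms by (simp add: superpose_integral mult symbols_const mult.assoc)

lemma superpose_v_mult:
  assumes "g \<in> symbols" "(\<lambda>\<xi> v. of_real (r v) * g \<xi> v) \<in> symbols"
  shows "superpose t (\<lambda>\<xi> v. of_real (r v) * g \<xi> v) x = of_real (r (fst x)) * superpose t g x"
  using assms by (simp add: superpose_integral mult.assoc)

text \<open>
  The derivative of the exponent \<open>wphase\<close> in direction \<open>d\<close>.
\<close>
definition slope :: "real \<Rightarrow> 'v \<times> 'z \<Rightarrow> 'z \<Rightarrow> 'v \<Rightarrow> complex" where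
  "slope t d \<xi> v = of_real (- (1/2) * ((v - ctr \<xi> t) \<bullet> H \<xi> (fst d))) +
    \<i> * of_real ((p + (1/2) *\<^sub>R J \<xi> (ctr \<xi> t)) \<bullet> fst d + \<xi> \<bullet> snd d)"

lemma wphase_has_derivative:
  assumes \<xi>: "\<xi> \<in> box_dual"
  shows "(wphase t \<xi> has_derivative (\<lambda>d. slope t d \<xi> (fst x))) (at x)"
proof -
  define y where "y x = fst x - ctr \<xi> t" for x :: "'v \<times> 'z"
  have y: "(y has_derivative fst) (at x)"
    unfolding y_def[abs_def] by (auto intro!: derivative_eq_intros)
  have Hy: "((\<lambda>x. H \<xi> (y x)) has_derivative (\<lambda>d. H \<xi> (fst d))) (at x)"
    by (rule bounded_linear.has_derivative[OF blinfun.bounded_linear_right y])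
  have "((\<lambda>x. y x \<bullet> H \<xi> (y x)) has_derivative (\<lambda>d. y x \<bullet> H \<xi> (fst d) + fst d \<bullet> H \<xi> (y x))) (at x)"
    by (rule has_derivative_inner[OF y Hy])
  also have "(\<lambda>d. y x \<bullet> H \<xi> (fst d) + fst d \<bullet> H \<xi> (y x)) = (\<lambda>d::'v \<times> 'z. 2 * (y x \<bullet> H \<xi> (fst d)))"
    using H_sym[OF \<xi>, of _ "y x"] by (intro ext) (simp add: inner_commute)
  finally have "((\<lambda>x. - (1/4) * (y x \<bullet> H \<xi> (y x))) has_derivative (\<lambda>d. - (1/4) * (2 * (y x \<bullet> H \<xi> (fst d))))) (at x)"
    by (rule has_derivative_mult_right)
  then have re: "((\<lambda>x. phase_re \<xi> t (fst x)) has_derivative (\<lambda>d. - (1/2) * (y x \<bullet> H \<xi> (fst d)))) (at x)"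
    by (simp add: phase_re_def y_def)
  have im: "((\<lambda>x. phase_im \<xi> t (fst x) + \<xi> \<bullet> snd x) has_derivative
      (\<lambda>d. (p + (1/2) *\<^sub>R J \<xi> (ctr \<xi> t)) \<bullet> fst d + \<xi> \<bullet> snd d)) (at x)"
    unfolding phase_im_def by (auto intro!: derivative_eq_intros)
  show ?thesis
    using has_derivative_add[OF has_derivative_of_real[OF re] has_derivative_mult_right[OF has_derivative_of_real[OF im], of \<i>]]
    by (simp add: wphase_def[abs_def] slope_def y_def)
qed

lemma slope_symbol: "slope t d \<in> symbols"
proof -
  have "slope t d = (\<lambda>\<xi> v. complex_of_real (v \<bullet> (- (1/2)) *\<^sub>R H \<xi> (fst d)) + (complex_of_real ((1/2) * (ctr \<xi> t \<bullet> H \<xi> (fst d))) +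
      \<i> * complex_of_real ((p + (1/2) *\<^sub>R J \<xi> (ctr \<xi> t)) \<bullet> fst d + \<xi> \<bullet> snd d)))"
    by (intro ext) (simp add: slope_def inner_diff_left field_simps)
  moreover have "\<dots> \<in> symbols"
    by (intro add mult symbols_const symbols_inner symbols_real_coef continuous_intros H_cont J_continuous ctr_continuous)
  ultimately show ?thesis by simp
qed

end

section \<open>The Schroedinger equation for wave packets\<close>

context wave_packet begin

text \<open>
  Differentiation under the integral over the compact box. The result is again a superposition with a symbol as amplitude,
  so superpositions are smooth.
\<close>
lemma superpose_has_derivative:
  assumes g: "g \<in> symbols" and g': "\<And>d. (\<lambda>\<xi> v. g' \<xi> v d) \<in> symbols" "\<And>\<xi> v. (g \<xi> has_derivative g' \<xi> v) (at v)"
  shows "(superpose t g has_derivative (\<lambda>d. superpose t (\<lambda>\<xi> v. g' \<xi> v (fst d) + g \<xi> v * slope t d \<xi> v) x)) (at x)"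
proof -
  define D where "D x \<xi> d = (g' \<xi> (fst x) (fst d) + g \<xi> (fst x) * slope t d \<xi> (fst x)) * exp (wphase t \<xi> x)" for x \<xi> d
  have der: "((\<lambda>x. g \<xi> (fst x) * exp (wphase t \<xi> x)) has_derivative D x \<xi>) (at x)" if \<xi>: "\<xi> \<in> box_dual" for x \<xi>
  proof -
    have 1: "((\<lambda>x. g \<xi> (fst x)) has_derivative (\<lambda>d. g' \<xi> (fst x) (fst d))) (at x)"
      using has_derivative_compose[OF has_derivative_fst[OF has_derivative_ident] g'(2)[of \<xi> "fst x"]] by simp
    have 2: "((\<lambda>x. exp (wphase t \<xi> x)) has_derivative (\<lambda>d. exp (wphase t \<xi> x) * slope t d \<xi> (fst x))) (at x)"
      by (rule has_derivative_compose[OF wphase_has_derivative[OF \<xi>] DERIV_exp[unfolded has_field_derivative_def]])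
    from has_derivative_mult[OF 1 2] show ?thesis
      by (rule has_derivative_eq_rhs) (simp add: D_def fun_eq_iff algebra_simps)
  qed
  have bl: "blinfun_apply (Blinfun (D x \<xi>)) = D x \<xi>" if "\<xi> \<in> box_dual" for x \<xi>
    by (rule bounded_linear_Blinfun_apply[OF has_derivative_bounded_linear[OF der[OF that]]])
  have ds: "(\<lambda>\<xi> v. g' \<xi> v (fst d) + g \<xi> v * slope t d \<xi> v) \<in> symbols" for d
    using slope_symbol[of t d] by (intro add mult g g') simp
  have cont: "continuous_on (UNIV \<times> box_dual) (\<lambda>(x, \<xi>). Blinfun (D x \<xi>))"
  proof (rule continuous_on_blinfun_componentwise)
    fix i :: "'v \<times> 'z" assume "i \<in> Basis"
    have "continuous_on (UNIV \<times> box_dual) (\<lambda>(x, \<xi>). D x \<xi> i)"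
      using symbol_wphase_continuous[OF ds[of i], of t] by (simp add: D_def)
    then show "continuous_on (UNIV \<times> box_dual) (\<lambda>q. (case q of (x, \<xi>) \<Rightarrow> Blinfun (D x \<xi>)) i)"
      by (rule continuous_on_eq) (auto simp: bl)
  qed
  have "((\<lambda>x. integral box_dual (\<lambda>\<xi>. g \<xi> (fst x) * exp (wphase t \<xi> x))) has_derivative
      integral box_dual (\<lambda>\<xi>. Blinfun (D x \<xi>))) (at x within UNIV)"
    by (rule leibniz_rule[where fx = "\<lambda>x \<xi>. Blinfun (D x \<xi>)"])
      (use der bl cont superpose_integral(2)[OF g] in auto)
  moreover have "blinfun_apply (integral box_dual (\<lambda>\<xi>. Blinfun (D x \<xi>))) d =
      superpose t (\<lambda>\<xi> v. g' \<xi> v (fst d) + g \<xi> v * slope t d \<xi> v) x" for d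
  proof -
    have "continuous_on box_dual (\<lambda>\<xi>. (\<lambda>(x, \<xi>). Blinfun (D x \<xi>)) (x, \<xi>))"
      by (rule continuous_on_compose2[OF cont]) (auto intro!: continuous_intros)
    then have "(\<lambda>\<xi>. Blinfun (D x \<xi>)) integrable_on box_dual" by (intro integrable_continuous) simp
    from blinfun_apply_integral[OF this, of d]
    have "blinfun_apply (integral box_dual (\<lambda>\<xi>. Blinfun (D x \<xi>))) d = integral box_dual (\<lambda>\<xi>. D x \<xi> d)"
      using bl by (simp cong: integral_cong)
    then show ?thesis by (simp add: superpose_integral(1)[OF ds] D_def)
  qed
  ultimately show ?thesis
    unfolding superpose_integral(1)[OF g, abs_def] by (simp add: fun_eq_iff has_derivative_eq_rhs)
qed

lemma Ck_superpose: "g \<in> symbols \<Longrightarrow> Ck n (superpose t g)"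
proof (induction n arbitrary: g)
  case 0
  obtain g' where g': "\<And>d. (\<lambda>\<xi> v. g' \<xi> v d) \<in> symbols" "\<And>\<xi> v. (g \<xi> has_derivative g' \<xi> v) (at v)"
    using symbols_derivative[OF 0] by blast
  show ?case
    using has_derivative_continuous[OF superpose_has_derivative[OF 0 g']]
    by (simp add: continuous_at_imp_continuous_on)
next
  case (Suc n)
  obtain g' where g': "\<And>d. (\<lambda>\<xi> v. g' \<xi> v d) \<in> symbols" "\<And>\<xi> v. (g \<xi> has_derivative g' \<xi> v) (at v)"
    using symbols_derivative[OF Suc.prems] by blast
  have ds: "(\<lambda>\<xi> v. g' \<xi> v (fst d) + g \<xi> v * slope t d \<xi> v) \<in> symbols" for d
    using slope_symbol[of t d] by (intro add mult Suc.prems g') simp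
  show ?case
    by (rule Ck_SucI[OF superpose_has_derivative[OF Suc.prems g']]) (rule Suc.IH[OF ds])
qed

text \<open>
  The left invariant logarithmic derivative of a packet along \<open>(e, 0)\<close>. The term of the bracket turns \<open>\<xi> \<bullet> [v, e]\<close> into \<open>- v \<bullet> J \<xi> e\<close>, so
  \<open>ell\<close> is affine in \<open>v\<close>.
\<close>
definition ell :: "real \<Rightarrow> 'v \<Rightarrow> 'z \<Rightarrow> 'v \<Rightarrow> complex" where
  "ell t e \<xi> v = slope t (e, (1/2) *\<^sub>R br v e) \<xi> v"

lemma ell_eq: "ell t e \<xi> v = (of_real (v \<bullet> (- (1/2)) *\<^sub>R H \<xi> e) + \<i> * of_real (v \<bullet> (- (1/2)) *\<^sub>R J \<xi> e)) +
    (of_real ((1/2) * (ctr \<xi> t \<bullet> H \<xi> e)) + \<i> * of_real ((p + (1/2) *\<^sub>R J \<xi> (ctr \<xi> t)) \<bullet> e))"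
proof -
  have "\<xi> \<bullet> br v e = - (v \<bullet> J \<xi> e)" using J_inner[of \<xi> v e] J_skew[of \<xi> v e] by simp
  then show ?thesis by (simp add: ell_def slope_def inner_diff_left algebra_simps)
qed

lemma ell_symbol: "ell t e \<in> symbols"
proof -
  have "(\<lambda>\<xi> v. (complex_of_real (v \<bullet> (- (1/2)) *\<^sub>R H \<xi> e) + \<i> * of_real (v \<bullet> (- (1/2)) *\<^sub>R J \<xi> e)) +
    (of_real ((1/2) * (ctr \<xi> t \<bullet> H \<xi> e)) + \<i> * of_real ((p + (1/2) *\<^sub>R J \<xi> (ctr \<xi> t)) \<bullet> e))) \<in> symbols"
    by (intro add mult symbols_const symbols_inner symbols_real_coef continuous_intros H_cont J_continuous ctr_continuous)
  then show ?thesis by (simp add: ell_eq[abs_def])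
qed

lemma ell_has_derivative:
  "(ell t e \<xi> has_derivative (\<lambda>d. of_real (d \<bullet> (- (1/2)) *\<^sub>R H \<xi> e) + \<i> * of_real (d \<bullet> (- (1/2)) *\<^sub>R J \<xi> e))) (at v)"
proof -
  have l: "((\<lambda>v. complex_of_real (v \<bullet> a)) has_derivative (\<lambda>d. of_real (d \<bullet> a))) (at v)" for a :: 'v
    by (intro has_derivative_of_real bounded_linear_imp_has_derivative bounded_linear_inner_left)
  show ?thesis
    unfolding ell_eq[abs_def]
    by (rule has_derivative_eq_rhs[OF has_derivative_add[OF has_derivative_add[OF l has_derivative_mult_right[OF l]] has_derivative_const]]) simp
qed

lemma left_inv_superpose:
  assumes g: "g \<in> symbols" and g': "\<And>d. (\<lambda>\<xi> v. g' \<xi> v d) \<in> symbols" "\<And>\<xi> v. (g \<xi> has_derivative g' \<xi> v) (at v)"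
  shows "left_inv lie (e, 0) (superpose t g) = superpose t (\<lambda>\<xi> v. g' \<xi> v e + g \<xi> v * ell t e \<xi> v)"
proof
  fix x :: "'v \<times> 'z"
  obtain v z where x: "x = (v, z)" by fastforce
  have ds: "(\<lambda>\<xi> v. g' \<xi> v (fst d) + g \<xi> v * slope t d \<xi> v) \<in> symbols" for d
    using slope_symbol[of t d] by (intro add mult g g') simp
  have es: "(\<lambda>\<xi> v. g' \<xi> v e + g \<xi> v * ell t e \<xi> v) \<in> symbols"
    using ell_symbol[of t e] by (intro add mult g g') simp
  show "left_inv lie (e, 0) (superpose t g) x = superpose t (\<lambda>\<xi> v. g' \<xi> v e + g \<xi> v * ell t e \<xi> v) x"
    unfolding x left_inv_eq[OF superpose_has_derivative[OF g g']] superpose_integral(1)[OF ds] superpose_integral(1)[OF es]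
    by (simp add: ell_def)
qed

lemma left_inv_superpose_coef:
  assumes c: "continuous_on box_dual c"
  shows "left_inv lie (e, 0) (superpose t (\<lambda>\<xi> v. c \<xi>)) = superpose t (\<lambda>\<xi> v. c \<xi> * ell t e \<xi> v)"
  using left_inv_superpose[OF coef[OF c], of "\<lambda>\<xi> v d. 0" e t] symbols_const[of 0] by simp

lemma left_inv_left_inv_superpose_coef:
  assumes c: "continuous_on box_dual c"
  shows "left_inv lie (e, 0) (left_inv lie (e, 0) (superpose t (\<lambda>\<xi> v. c \<xi>))) =
    superpose t (\<lambda>\<xi> v. c \<xi> * ((ell t e \<xi> v)\<^sup>2 - of_real ((1/2) * (H \<xi> e \<bullet> e))))"
proof -
  define g' where "g' \<xi> v d = c \<xi> * (of_real (d \<bullet> (- (1/2)) *\<^sub>R H \<xi> e) + \<i> * of_real (d \<bullet> (- (1/2)) *\<^sub>R J \<xi> e))" for \<xi> and v d :: 'v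
  have s: "(\<lambda>\<xi> v. c \<xi> * ell t e \<xi> v) \<in> symbols" using ell_symbol[of t e] by (intro mult coef c) simp
  have 1: "(\<lambda>\<xi> v. g' \<xi> v d) \<in> symbols" for d
    unfolding g'_def by (intro add mult coef c symbols_const continuous_intros H_cont J_continuous)
  have 2: "((\<lambda>v. c \<xi> * ell t e \<xi> v) has_derivative g' \<xi> v) (at v)" for \<xi> v
    unfolding g'_def by (rule has_derivative_mult_right[OF ell_has_derivative])
  have "(\<lambda>\<xi> v. g' \<xi> v e + c \<xi> * ell t e \<xi> v * ell t e \<xi> v) =
    (\<lambda>\<xi> v. c \<xi> * ((ell t e \<xi> v)\<^sup>2 - of_real ((1/2) * (H \<xi> e \<bullet> e))))"
    by (intro ext) (simp add: g'_def J_self inner_commute[of e "H _ e"] power2_eq_square algebra_simps)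
  then show ?thesis
    unfolding left_inv_superpose_coef[OF c] left_inv_superpose[OF s 1 2] by simp
qed

text \<open>
  The factor by which \<open>\<i>\<close> times the sublaplacian multiplies a packet.
\<close>
definition gen :: "real \<Rightarrow> 'z \<Rightarrow> 'v \<Rightarrow> complex" where
  "gen t \<xi> v = \<i> * (\<Sum>e\<in>Basis. (ell t e \<xi> v)\<^sup>2 - of_real ((1/2) * (H \<xi> e \<bullet> e)))"

lemma gen_symbol: "gen t \<in> symbols"
proof -
  have "(\<lambda>\<xi> v. \<i> * (\<Sum>e\<in>Basis. ell t e \<xi> v * ell t e \<xi> v + (- 1) * complex_of_real ((1/2) * (H \<xi> e \<bullet> e)))) \<in> symbols"
    using ell_symbol by (intro add mult symbols_sum finite_Basis symbols_const symbols_real_coef continuous_intros H_cont) simp_all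
  then show ?thesis by (simp add: gen_def[abs_def] power2_eq_square)
qed

text \<open>
  The packet solves the Schroedinger equation. With \<open>y = v - ctr\<close>, \<open>r = - H y / 2\<close> and \<open>q = mom + J y / 2\<close> one has
  \<open>ell t e = r \<bullet> e + \<i> q \<bullet> e\<close>, and the sum of the squares is \<open>|r|\<^sup>2 - |q|\<^sup>2 + 2 \<i> r \<bullet> q\<close>. The terms quadratic in \<open>y\<close> must cancel; they do
  since \<open>|H y| = |J y|\<close> (from \<open>H\<^sup>2 = - J\<^sup>2\<close>) and \<open>H y \<bullet> J y = 0\<close> (as \<open>H\<close> commutes with \<open>J\<close>).
\<close>
lemma gen_eq_rate:
  assumes \<xi>: "\<xi> \<in> box_dual" shows "gen t \<xi> v = rate \<xi> t v"
proof -
  define y where "y = v - ctr \<xi> t"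
  define r where "r = (- (1/2)) *\<^sub>R H \<xi> y"
  define q where "q = mom \<xi> t + (1/2) *\<^sub>R J \<xi> y"
  have l: "ell t e \<xi> v = of_real (r \<bullet> e) + \<i> * of_real (q \<bullet> e)" for e
  proof -
    have "v \<bullet> J \<xi> e = - (J \<xi> v \<bullet> e)" using J_skew[of \<xi> v e] by simp
    then have "ell t e \<xi> v = of_real (- (1/2) * (y \<bullet> H \<xi> e)) + \<i> * of_real ((p + (1/2) *\<^sub>R J \<xi> (ctr \<xi> t) + (1/2) *\<^sub>R J \<xi> v) \<bullet> e)"
      by (simp add: ell_eq y_def inner_diff_left inner_add_left algebra_simps)
    also have "y \<bullet> H \<xi> e = H \<xi> y \<bullet> e" using H_sym[OF \<xi>] by simp
    also have "p + (1/2) *\<^sub>R J \<xi> (ctr \<xi> t) + (1/2) *\<^sub>R J \<xi> v = q"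
    proof -
      have "(1/2) *\<^sub>R J \<xi> (ctr \<xi> t) = J \<xi> (ctr \<xi> t) - (1/2) *\<^sub>R J \<xi> (ctr \<xi> t)"
        using scaleR_left_diff_distrib[of 1 "1/2" "J \<xi> (ctr \<xi> t)"] by simp
      then show ?thesis by (simp add: q_def mom_def y_def blinfun.diff_right scaleR_diff_right)
    qed
    finally show ?thesis by (simp add: r_def)
  qed
  have "(\<Sum>e\<in>Basis. (ell t e \<xi> v)\<^sup>2) = of_real (r \<bullet> r - q \<bullet> q) + \<i> * of_real (2 * (r \<bullet> q))"
  proof -
    have "(ell t e \<xi> v)\<^sup>2 = of_real ((r \<bullet> e) * (r \<bullet> e) - (q \<bullet> e) * (q \<bullet> e)) + \<i> * of_real (2 * ((r \<bullet> e) * (q \<bullet> e)))" for e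
      unfolding l by (simp add: power2_eq_square algebra_simps)
    then have "(\<Sum>e\<in>Basis. (ell t e \<xi> v)\<^sup>2) =
      of_real (\<Sum>e\<in>Basis. (r \<bullet> e) * (r \<bullet> e) - (q \<bullet> e) * (q \<bullet> e)) + \<i> * of_real (\<Sum>e\<in>Basis. 2 * ((r \<bullet> e) * (q \<bullet> e)))"
      by (simp add: sum.distrib sum_distrib_left)
    then show ?thesis
      by (simp add: sum_subtractf sum_distrib_left[symmetric] euclidean_inner[of r r] euclidean_inner[of q q] euclidean_inner[of r q])
  qed
  moreover have "r \<bullet> r - q \<bullet> q = J \<xi> (mom \<xi> t) \<bullet> v - mom \<xi> t \<bullet> p"
  proof -
    have "H \<xi> y \<bullet> H \<xi> y = J \<xi> y \<bullet> J \<xi> y"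
      using H_sym[OF \<xi>, of y "H \<xi> y"] H_sq[OF \<xi>, of y] J_skew[of \<xi> y "J \<xi> y"] by simp
    then have "r \<bullet> r - q \<bullet> q = - (mom \<xi> t \<bullet> mom \<xi> t) - mom \<xi> t \<bullet> J \<xi> y"
      by (simp add: r_def q_def inner_add_left inner_add_right inner_commute)
    also have "mom \<xi> t \<bullet> J \<xi> y = - (J \<xi> (mom \<xi> t) \<bullet> v) - mom \<xi> t \<bullet> J \<xi> (ctr \<xi> t)"
      using J_skew[of \<xi> "mom \<xi> t" v] by (simp add: y_def blinfun.diff_right inner_diff_right)
    also have "J \<xi> (ctr \<xi> t) = mom \<xi> t - p" by (simp add: mom_def)
    finally show ?thesis by (simp add: inner_diff_right)
  qed
  moreover have "2 * (r \<bullet> q) = - (H \<xi> y \<bullet> mom \<xi> t)"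
  proof -
    have "H \<xi> y \<bullet> J \<xi> y = y \<bullet> J \<xi> (H \<xi> y)" using H_sym[OF \<xi>, of y "J \<xi> y"] H_comm[OF \<xi>, of y] by simp
    then have "H \<xi> y \<bullet> J \<xi> y = 0" using J_skew[of \<xi> y "H \<xi> y"] by (simp add: inner_commute)
    then show ?thesis by (simp add: r_def q_def inner_add_right)
  qed
  ultimately have "gen t \<xi> v = \<i> * (of_real (J \<xi> (mom \<xi> t) \<bullet> v - mom \<xi> t \<bullet> p) + \<i> * of_real (- (H \<xi> y \<bullet> mom \<xi> t)) - of_real ((1/2) * trH \<xi>))"
    unfolding gen_def sum_subtractf by (simp add: trH_def sum_distrib_left)
  then show ?thesis by (simp add: rate_def y_def algebra_simps)
qed

lemma sublaplacian_superpose: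
  assumes c: "continuous_on box_dual c"
  shows "\<i> * sublaplacian lie (superpose t (\<lambda>\<xi> v. c \<xi>)) x = superpose t (\<lambda>\<xi> v. c \<xi> * gen t \<xi> v) x"
proof -
  define s where "s e \<xi> v = c \<xi> * ((ell t e \<xi> v)\<^sup>2 - of_real ((1/2) * (H \<xi> e \<bullet> e)))" for e \<xi> v
  have s: "s e \<in> symbols" for e
  proof -
    have "(\<lambda>\<xi> v. c \<xi> * (ell t e \<xi> v * ell t e \<xi> v + (- 1) * complex_of_real ((1/2) * (H \<xi> e \<bullet> e)))) \<in> symbols"
      using ell_symbol[of t e] by (intro add mult coef c symbols_const symbols_real_coef continuous_intros H_cont) simp_all
    then show ?thesis by (simp add: s_def[abs_def] power2_eq_square)
  qed
  have S: "(\<lambda>\<xi> v. \<Sum>e\<in>Basis. s e \<xi> v) \<in> symbols" using s by (intro symbols_sum) auto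
  have "\<i> * sublaplacian lie (superpose t (\<lambda>\<xi> v. c \<xi>)) x = \<i> * (\<Sum>e\<in>Basis. superpose t (s e) x)"
    by (simp add: sublaplacian_def left_inv_left_inv_superpose_coef[OF c] s_def[abs_def])
  also have "\<dots> = superpose t (\<lambda>\<xi> v. \<i> * (\<Sum>e\<in>Basis. s e \<xi> v)) x"
    using s by (simp add: superpose_const_mult[OF S] superpose_sum)
  also have "(\<lambda>\<xi> v. \<i> * (\<Sum>e\<in>Basis. s e \<xi> v)) = (\<lambda>\<xi> v. c \<xi> * gen t \<xi> v)"
    by (intro ext) (simp add: s_def gen_def sum_distrib_left mult_ac)
  finally show ?thesis .
qed

end

section \<open>Wave packets and the unitary group\<close>

lemma L2_of_norm: "f \<in> L2 \<Longrightarrow> (\<lambda>x. complex_of_real (norm (f x))) \<in> L2"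
  by (auto simp: L2_def)

lemma L2_sum: "finite A \<Longrightarrow> (\<And>i. i \<in> A \<Longrightarrow> f i \<in> L2) \<Longrightarrow> (\<lambda>x. \<Sum>i\<in>A. f i x) \<in> L2"
proof (induction A rule: finite_induct)
  case empty
  show ?case by (simp add: L2_def)
next
  case (insert i A)
  then show ?case by (simp add: L2_add)
qed

text \<open>
  Derivatives of the cutoff tend to 0 with a loss that is polynomial in \<open>v\<close> and uniform in \<open>z\<close>. The Gaussian decay of
  packets in \<open>v\<close> can afford this, whereas in \<open>z\<close> superpositions are only square integrable.
\<close>
lemma (in two_step_lie_algebra) left_inv_cutoff_bounds:
  obtains M where "M \<ge> 0"
    "\<And>R x. R \<ge> 1 \<Longrightarrow> norm (cutoff R x - 1) \<le> M"
    "\<And>R e x. R \<ge> 1 \<Longrightarrow> e \<in> Basis \<Longrightarrow> norm (left_inv lie (e, 0) (cutoff R) x) \<le> M * (1 + fst x \<bullet> fst x) / R"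
    "\<And>R e x. R \<ge> 1 \<Longrightarrow> e \<in> Basis \<Longrightarrow> norm (left_inv lie (e, 0) (left_inv lie (e, 0) (cutoff R)) x) \<le> M * (1 + fst x \<bullet> fst x) / R"
proof -
  obtain C0 C1 C2 where C: "C0 > 0" "C1 > 0" "C2 > 0" "\<And>s. s \<le> 1 \<Longrightarrow> \<bar>bump 0 s\<bar> \<le> C0"
    "\<And>s. s \<le> 1 \<Longrightarrow> \<bar>bump 1 s\<bar> \<le> C1" "\<And>s. s \<le> 1 \<Longrightarrow> \<bar>bump 2 s\<bar> \<le> C2"
    using bump_bounded[of 0] bump_bounded[of 1] bump_bounded[of 2] by blast
  obtain K where K: "K \<ge> 0" "\<And>v e. e \<in> Basis \<Longrightarrow> norm (br v e) \<le> K * norm v" using br_norm_le by blast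
  define M1 where "M1 = C1 * ((2 + K) * 2)"
  define M2 where "M2 = C2 * ((2 + K)\<^sup>2 * 2) + C1 * (2 * (1 + K\<^sup>2))"
  have M: "M1 \<ge> 0" "M2 \<ge> 0" using C K by (auto simp: M1_def M2_def)
  have sq: "norm v \<le> 1 + v \<bullet> v" "(1 + norm v)\<^sup>2 \<le> 2 * (1 + v \<bullet> v)" "1 + norm v \<le> 2 * (1 + v \<bullet> v)" for v :: 'v
  proof -
    have e: "v \<bullet> v = (norm v)\<^sup>2" by (simp add: power2_norm_eq_inner)
    have n: "2 * norm v \<le> 1 + (norm v)\<^sup>2" using sum_squares_bound[of 1 "norm v"] by simp
    have s: "(1 + norm v)\<^sup>2 = 1 + (norm v)\<^sup>2 + 2 * norm v" by (simp add: power2_sum)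
    have aux: "n \<le> 1 + q \<and> 1 + q + 2 * n \<le> 2 * (1 + q) \<and> 1 + n \<le> 2 * (1 + q)"
      if "2 * n \<le> 1 + q" "0 \<le> n" "0 \<le> q" for n q :: real
      using that by auto
    show "norm v \<le> 1 + v \<bullet> v" "(1 + norm v)\<^sup>2 \<le> 2 * (1 + v \<bullet> v)" "1 + norm v \<le> 2 * (1 + v \<bullet> v)"
      unfolding e s using aux[OF n norm_ge_zero zero_le_power2] by blast+
  qed
  have out: "bump m (ball_level R x) = 0" if "\<not> norm x \<le> R" "R \<ge> 1" for m R and x :: "'v \<times> 'z"
  proof (rule bump_eq_0)
    have "R\<^sup>2 \<le> (norm x)\<^sup>2" using that by (intro power_mono) auto
    then show "ball_level R x \<le> 0" using that by (simp add: ball_level_def power2_norm_eq_inner)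
  qed
  have 0: "norm (cutoff R x - 1) \<le> C0 + 1" for R and x :: "'v \<times> 'z"
  proof -
    have "norm (cutoff R x - 1) \<le> norm (cutoff R x) + norm (1::complex)" by (rule norm_triangle_ineq4)
    then show ?thesis using C(4)[OF ball_level_le_1[of R x]] by (simp add: cutoff_def)
  qed
  have 1: "norm (left_inv lie (e, 0) (cutoff R) x) \<le> M1 * (1 + fst x \<bullet> fst x) / R" if R: "R \<ge> 1" and e: "e \<in> Basis" for R e x
  proof (cases "norm x \<le> R")
    case True
    have "\<bar>cutoff_slope R e x\<bar> \<le> (2 + K) * (1 + norm (fst x)) / R"
      by (rule cutoff_slope_le[OF K e _ True]) (use R in auto)
    also have "\<dots> \<le> (2 + K) * (2 * (1 + fst x \<bullet> fst x)) / R"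
      using R K sq(3)[of "fst x"] by (intro divide_right_mono mult_left_mono) auto
    finally have "\<bar>bump 1 (ball_level R x)\<bar> * \<bar>cutoff_slope R e x\<bar> \<le> C1 * ((2 + K) * (2 * (1 + fst x \<bullet> fst x)) / R)"
      using C by (intro mult_mono) (auto simp: ball_level_le_1)
    also have "\<dots> = M1 * (1 + fst x \<bullet> fst x) / R" by (simp add: M1_def algebra_simps)
    finally show ?thesis unfolding cutoff_def left_inv_bump norm_mult norm_of_real by simp
  next
    case False
    then show ?thesis unfolding cutoff_def left_inv_bump using M R by (simp add: out)
  qed
  have 2: "norm (left_inv lie (e, 0) (left_inv lie (e, 0) (cutoff R)) x) \<le> M2 * (1 + fst x \<bullet> fst x) / R" if R: "R \<ge> 1" and e: "e \<in> Basis" for R e x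
  proof (cases "norm x \<le> R")
    case True
    let ?q = "1 + fst x \<bullet> fst x"
    have RR: "a / R\<^sup>2 \<le> a / R" if "a \<ge> 0" for a
    proof -
      have "R \<le> R\<^sup>2" using R by (simp add: power2_eq_square)
      then show ?thesis using R that by (intro divide_left_mono) auto
    qed
    have "\<bar>cutoff_slope R e x\<bar> \<le> (2 + K) * (1 + norm (fst x)) / R"
      by (rule cutoff_slope_le[OF K e _ True]) (use R in auto)
    then have "(cutoff_slope R e x)\<^sup>2 \<le> ((2 + K) * (1 + norm (fst x)) / R)\<^sup>2" by (metis abs_ge_zero power2_abs power_mono)
    also have "\<dots> = (2 + K)\<^sup>2 * (1 + norm (fst x))\<^sup>2 / R\<^sup>2" by (simp add: power_mult_distrib power_divide)
    also have "\<dots> \<le> (2 + K)\<^sup>2 * (2 * ?q) / R\<^sup>2"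
      using R sq(2)[of "fst x"] by (intro divide_right_mono mult_left_mono) auto
    also have "\<dots> \<le> (2 + K)\<^sup>2 * (2 * ?q) / R" by (rule RR) simp
    finally have s2: "(cutoff_slope R e x)\<^sup>2 \<le> (2 + K)\<^sup>2 * (2 * ?q) / R" .
    have ee: "e \<bullet> e = 1" using e by (simp add: inner_Basis)
    have "norm (br (fst x) e) ^ 2 \<le> (K * norm (fst x))\<^sup>2" by (intro power_mono K(2)[OF e]) auto
    then have nb: "(norm (br (fst x) e))\<^sup>2 \<le> K\<^sup>2 * (fst x \<bullet> fst x)" by (simp add: power_mult_distrib power2_norm_eq_inner)
    have "1 + (1/4) * (norm (br (fst x) e))\<^sup>2 \<le> 1 + K\<^sup>2 * (fst x \<bullet> fst x)" using nb zero_le_power2[of "norm (br (fst x) e)"] by linarith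
    also have "\<dots> \<le> (1 + K\<^sup>2) * ?q" by (simp add: algebra_simps)
    finally have q: "1 + (1/4) * (norm (br (fst x) e))\<^sup>2 \<le> (1 + K\<^sup>2) * ?q" .
    have "\<bar>- (2 / R\<^sup>2) * (e \<bullet> e + (1/4) * (norm (br (fst x) e))\<^sup>2)\<bar> = 2 * (1 + (1/4) * (norm (br (fst x) e))\<^sup>2) / R\<^sup>2"
      using R by (simp add: ee abs_mult)
    also have "\<dots> \<le> 2 * ((1 + K\<^sup>2) * ?q) / R\<^sup>2" using q R by (intro divide_right_mono mult_left_mono) auto
    also have "\<dots> \<le> 2 * ((1 + K\<^sup>2) * ?q) / R" by (rule RR) simp
    finally have s1: "\<bar>- (2 / R\<^sup>2) * (e \<bullet> e + (1/4) * (norm (br (fst x) e))\<^sup>2)\<bar> \<le> 2 * ((1 + K\<^sup>2) * ?q) / R" .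
    have "\<bar>bump 2 (ball_level R x) * (cutoff_slope R e x)\<^sup>2 + bump 1 (ball_level R x) * (- (2 / R\<^sup>2) * (e \<bullet> e + (1/4) * (norm (br (fst x) e))\<^sup>2))\<bar>
      \<le> \<bar>bump 2 (ball_level R x)\<bar> * (cutoff_slope R e x)\<^sup>2 + \<bar>bump 1 (ball_level R x)\<bar> * \<bar>- (2 / R\<^sup>2) * (e \<bullet> e + (1/4) * (norm (br (fst x) e))\<^sup>2)\<bar>"
      by (rule order_trans[OF abs_triangle_ineq]) (simp add: abs_mult)
    also have "\<dots> \<le> C2 * ((2 + K)\<^sup>2 * (2 * ?q) / R) + C1 * (2 * ((1 + K\<^sup>2) * ?q) / R)"
      using C by (intro add_mono mult_mono s1 s2) (auto simp: ball_level_le_1)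
    also have "\<dots> = M2 * ?q / R" by (simp add: M2_def add_divide_distrib algebra_simps)
    finally show ?thesis unfolding left_inv_left_inv_cutoff norm_of_real .
  next
    case False
    then show ?thesis unfolding left_inv_left_inv_cutoff norm_of_real using M R by (simp add: out)
  qed
  define N where "N = C0 + 1 + M1 + M2"
  have mono: "a * (1 + fst x \<bullet> fst x) / R \<le> N * (1 + fst x \<bullet> fst x) / R" if "a \<le> N" "R \<ge> 1" for a R and x :: "'v \<times> 'z"
    using that by (intro divide_right_mono mult_right_mono) auto
  show ?thesis
  proof (rule that[of N])
    show "N \<ge> 0" using M C by (simp add: N_def)
    show "norm (cutoff R x - 1) \<le> N" if "R \<ge> 1" for R x using 0[of R x] M by (simp add: N_def)
    show "norm (left_inv lie (e, 0) (cutoff R) x) \<le> N * (1 + fst x \<bullet> fst x) / R" if "R \<ge> 1" "e \<in> Basis" for R e x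
      using 1[OF that, of x] mono[of M1 R x] that M C by (simp add: N_def)
    show "norm (left_inv lie (e, 0) (left_inv lie (e, 0) (cutoff R)) x) \<le> N * (1 + fst x \<bullet> fst x) / R" if "R \<ge> 1" "e \<in> Basis" for R e x
      using 2[OF that, of x] mono[of M2 R x] that M C by (simp add: N_def)
  qed
qed

context wave_packet begin

lemma superpose_weighted_L2:
  assumes g: "g \<in> symbols"
  shows "(\<lambda>x. complex_of_real (1 + fst x \<bullet> fst x) * superpose t g x) \<in> L2"
proof -
  have "(\<lambda>\<xi> v. (1 + (\<Sum>b\<in>Basis. complex_of_real (v \<bullet> b) * complex_of_real (v \<bullet> b))) * g \<xi> v) \<in> symbols"
    by (intro mult g add symbols_const symbols_sum coord finite_Basis)
  moreover have "(\<lambda>\<xi> v. (1 + (\<Sum>b\<in>Basis. complex_of_real (v \<bullet> b) * complex_of_real (v \<bullet> b))) * g \<xi> v) =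
      (\<lambda>\<xi> v. of_real (1 + v \<bullet> v) * g \<xi> v)"
    by (intro ext) (subst euclidean_inner[of v v for v], simp)
  ultimately have w: "(\<lambda>\<xi> v. of_real (1 + v \<bullet> v) * g \<xi> v) \<in> symbols" by simp
  have "superpose t (\<lambda>\<xi> v. of_real (1 + v \<bullet> v) * g \<xi> v) = (\<lambda>x. of_real (1 + fst x \<bullet> fst x) * superpose t g x)"
    by (rule ext) (rule superpose_v_mult[OF g w])
  with superpose_L2[OF w, of t] show ?thesis by simp
qed

text \<open>
  A superposition is smooth but not of compact support. Multiplied by \<open>cutoff R\<close> it is a test function; as \<open>R\<close> grows, the
  terms of the sublaplacian in which a derivative falls on the cutoff tend to 0 in \<open>L\<^sup>2\<close>, because \<open>1 + |v|\<^sup>2\<close> times a superposition is still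
  in \<open>L\<^sup>2\<close>.
\<close>
lemma superpose_in_closure_graph:
  assumes c: "continuous_on box_dual c"
  shows "(superpose t (\<lambda>\<xi> v. c \<xi>), superpose t (\<lambda>\<xi> v. c \<xi> * gen t \<xi> v)) \<in>
    closure_graph (\<lambda>\<phi> x. \<i> * sublaplacian lie \<phi> x)"
proof -
  define \<Phi> where "\<Phi> = superpose t (\<lambda>\<xi> v. c \<xi>)"
  define \<Psi> where "\<Psi> = superpose t (\<lambda>\<xi> v. c \<xi> * gen t \<xi> v)"
  have cs: "(\<lambda>\<xi> v. c \<xi>) \<in> symbols" by (rule coef[OF c])
  have gs: "(\<lambda>\<xi> v. c \<xi> * gen t \<xi> v) \<in> symbols" using gen_symbol[of t] by (intro mult cs) simp
  have es: "(\<lambda>\<xi> v. c \<xi> * ell t e \<xi> v) \<in> symbols" for e using ell_symbol[of t e] by (intro mult cs) simp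
  have \<Phi>L: "\<Phi> \<in> L2" and \<Psi>L: "\<Psi> \<in> L2" unfolding \<Phi>_def \<Psi>_def by (rule superpose_L2[OF cs], rule superpose_L2[OF gs])
  have Ck\<Phi>: "Ck n \<Phi>" for n unfolding \<Phi>_def by (rule Ck_superpose[OF cs])
  define R where "R n = real (Suc n)" for n
  have R: "R n \<ge> 1" for n by (simp add: R_def)
  define \<phi> where "\<phi> n x = cutoff (R n) x * \<Phi> x" for n x
  have Rinv: "(\<lambda>n. a / R n) \<longlonglongrightarrow> 0" for a
    unfolding R_def using tendsto_mult_right_zero[OF LIMSEQ_inverse_real_of_nat, of a] by (simp add: divide_inverse)
  have cut_lim: "(\<lambda>n. cutoff (R n) x) \<longlonglongrightarrow> 1" for x :: "'v \<times> 'z"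
  proof -
    have "(\<lambda>n. 1 - (x \<bullet> x) * (1 / R n)\<^sup>2) \<longlonglongrightarrow> 1 - (x \<bullet> x) * 0\<^sup>2" by (intro tendsto_intros Rinv)
    then have "(\<lambda>n. ball_level (R n) x) \<longlonglongrightarrow> 1" by (simp add: ball_level_def power_divide)
    from isCont_tendsto_compose[OF _ this, of "bump 0"]
    have "(\<lambda>n. bump 0 (ball_level (R n) x)) \<longlonglongrightarrow> 1" using bump_has_derivative[of 0 1, THEN DERIV_isCont] by (simp add: bump_0_1)
    from tendsto_of_real[OF this] show ?thesis by (simp add: cutoff_def)
  qed
  have cutm [measurable]: "cutoff (R n) \<in> borel_measurable borel" for n
    by (rule borel_measurable_continuous_onI[OF Ck_continuous[OF Ck_cutoff]])
  obtain M where M: "M \<ge> 0" "\<And>R x. R \<ge> 1 \<Longrightarrow> norm (cutoff R x - 1) \<le> M"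
    "\<And>R e x. R \<ge> 1 \<Longrightarrow> e \<in> Basis \<Longrightarrow> norm (left_inv lie (e, 0) (cutoff R) x) \<le> M * (1 + fst x \<bullet> fst x) / R"
    "\<And>R e x. R \<ge> 1 \<Longrightarrow> e \<in> Basis \<Longrightarrow> norm (left_inv lie (e, 0) (left_inv lie (e, 0) (cutoff R)) x) \<le> M * (1 + fst x \<bullet> fst x) / R"
    by (rule left_inv_cutoff_bounds) blast
  have [measurable]: "\<Phi> \<in> borel_measurable borel" "\<Psi> \<in> borel_measurable borel" using \<Phi>L \<Psi>L by (auto intro: L2_measurable)
  have 1: "(\<lambda>n. L2_norm (\<lambda>x. \<phi> n x - \<Phi> x)) \<longlonglongrightarrow> 0"
  proof (rule L2_norm_dominated_tendsto_0)
    show "(\<lambda>x. \<phi> n x - \<Phi> x) \<in> borel_measurable borel" for n unfolding \<phi>_def by measurable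
    show "integrable lborel (\<lambda>x. M\<^sup>2 * (norm (\<Phi> x))\<^sup>2)" using L2_integrable[OF \<Phi>L] by simp
    fix n x
    have "norm (\<phi> n x - \<Phi> x) = norm (cutoff (R n) x - 1) * norm (\<Phi> x)"
      by (simp add: \<phi>_def norm_mult[symmetric] algebra_simps)
    also have "\<dots> \<le> M * norm (\<Phi> x)" by (intro mult_right_mono M R) auto
    finally show "(norm (\<phi> n x - \<Phi> x))\<^sup>2 \<le> M\<^sup>2 * (norm (\<Phi> x))\<^sup>2"
      by (metis norm_ge_zero power_mono power_mult_distrib)
    have "(\<lambda>n. cutoff (R n) x * \<Phi> x - \<Phi> x) \<longlonglongrightarrow> 1 * \<Phi> x - \<Phi> x" by (intro tendsto_intros cut_lim)
    then show "(\<lambda>n. \<phi> n x - \<Phi> x) \<longlonglongrightarrow> 0" by (simp add: \<phi>_def)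
  qed
  \<comment> \<open>A majorant in \<open>L\<^sup>2\<close> for all error terms.\<close>
  define G where "G x = complex_of_real (norm (\<Psi> x)) + (\<Sum>e\<in>Basis. of_real (norm (of_real (1 + fst x \<bullet> fst x) * superpose t (\<lambda>\<xi> v. 2 * (c \<xi> * ell t e \<xi> v)) x))
      + of_real (norm (of_real (1 + fst x \<bullet> fst x) * \<Phi> x)))" for x :: "'v \<times> 'z"
  have GL: "G \<in> L2"
    unfolding G_def[abs_def] \<Phi>_def
    by (intro L2_add L2_sum L2_of_norm superpose_weighted_L2 \<Psi>L finite_Basis mult symbols_const cs es)
  have XP: "left_inv lie (e, 0) \<Phi> x = superpose t (\<lambda>\<xi> v. c \<xi> * ell t e \<xi> v) x" for e x
    unfolding \<Phi>_def left_inv_superpose_coef[OF c] ..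
  define E where "E n x = (\<Sum>e\<in>Basis. left_inv lie (e, 0) (cutoff (R n)) x * superpose t (\<lambda>\<xi> v. 2 * (c \<xi> * ell t e \<xi> v)) x +
      left_inv lie (e, 0) (left_inv lie (e, 0) (cutoff (R n))) x * \<Phi> x)" for n x
  have A: "\<i> * sublaplacian lie (\<phi> n) x - \<Psi> x = (cutoff (R n) x - 1) * \<Psi> x + \<i> * E n x" for n x
  proof -
    have "\<Psi> x = \<i> * sublaplacian lie \<Phi> x" unfolding \<Psi>_def \<Phi>_def sublaplacian_superpose[OF c] ..
    moreover have "sublaplacian lie (\<phi> n) x = cutoff (R n) x * sublaplacian lie \<Phi> x + E n x"
      unfolding \<phi>_def[abs_def] sublaplacian_mult[OF Ck_cutoff Ck\<Phi>] E_def XP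
      by (intro arg_cong2[where f = "(+)"] refl sum.cong) (simp add: superpose_const_mult[OF es])
    ultimately show ?thesis by (simp add: algebra_simps)
  qed
  have G_split: "norm (G x) = norm (\<Psi> x) + (\<Sum>e\<in>Basis. norm (of_real (1 + fst x \<bullet> fst x) * superpose t (\<lambda>\<xi> v. 2 * (c \<xi> * ell t e \<xi> v)) x)
      + norm (of_real (1 + fst x \<bullet> fst x) * \<Phi> x))" (is "_ = ?r x") for x
  proof -
    have "G x = of_real (?r x)" by (simp only: G_def of_real_add of_real_sum)
    moreover have "?r x \<ge> 0" by (intro add_nonneg_nonneg sum_nonneg) auto
    ultimately show ?thesis by (simp only: norm_of_real abs_of_nonneg)
  qed
  have E_le: "norm (E n x) \<le> M / R n * norm (G x)" for n x
  proof -
    let ?q = "1 + fst x \<bullet> fst x"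
    have q: "?q \<ge> 0" by simp
    have "norm (E n x) \<le> (\<Sum>e\<in>Basis. M / R n * (norm (of_real ?q * superpose t (\<lambda>\<xi> v. 2 * (c \<xi> * ell t e \<xi> v)) x) + norm (of_real ?q * \<Phi> x)))"
      unfolding E_def
    proof (rule order_trans[OF norm_sum sum_mono])
      fix e :: 'v assume e: "e \<in> Basis"
      have "norm (left_inv lie (e, 0) (cutoff (R n)) x * superpose t (\<lambda>\<xi> v. 2 * (c \<xi> * ell t e \<xi> v)) x +
          left_inv lie (e, 0) (left_inv lie (e, 0) (cutoff (R n))) x * \<Phi> x) \<le>
          (M * ?q / R n) * norm (superpose t (\<lambda>\<xi> v. 2 * (c \<xi> * ell t e \<xi> v)) x) + (M * ?q / R n) * norm (\<Phi> x)"
        by (rule order_trans[OF norm_triangle_ineq]) (simp only: norm_mult, intro add_mono mult_right_mono M R e norm_ge_zero)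
      also have "\<dots> = M / R n * (norm (of_real ?q * superpose t (\<lambda>\<xi> v. 2 * (c \<xi> * ell t e \<xi> v)) x) + norm (of_real ?q * \<Phi> x))"
        using q by (simp only: norm_mult norm_of_real abs_of_nonneg) (simp add: field_simps add_divide_distrib)
      finally show "norm (left_inv lie (e, 0) (cutoff (R n)) x * superpose t (\<lambda>\<xi> v. 2 * (c \<xi> * ell t e \<xi> v)) x +
          left_inv lie (e, 0) (left_inv lie (e, 0) (cutoff (R n))) x * \<Phi> x) \<le> \<dots>" .
    qed
    also have "\<dots> \<le> M / R n * norm (G x)"
      unfolding sum_distrib_left[symmetric] G_split using M(1) R[of n] by (intro mult_left_mono) auto
    finally show ?thesis .
  qed
  have 2: "(\<lambda>n. L2_norm (\<lambda>x. \<i> * sublaplacian lie (\<phi> n) x - \<Psi> x)) \<longlonglongrightarrow> 0"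
    unfolding A
  proof (rule L2_norm_dominated_tendsto_0)
    have [measurable]: "(\<lambda>x. left_inv lie (e, 0) (cutoff (R n)) x) \<in> borel_measurable borel"
      "(\<lambda>x. left_inv lie (e, 0) (left_inv lie (e, 0) (cutoff (R n))) x) \<in> borel_measurable borel"
      "(\<lambda>x. superpose t (\<lambda>\<xi> v. 2 * (c \<xi> * ell t e \<xi> v)) x) \<in> borel_measurable borel" for n e
      using borel_measurable_continuous_onI[OF Ck_continuous[OF Ck_left_inv[OF Ck_cutoff[of "Suc 0" "R n"], of e]]]
        borel_measurable_continuous_onI[OF Ck_continuous[OF Ck_left_inv[OF Ck_left_inv[OF Ck_cutoff[of "Suc (Suc 0)" "R n"], of e], of e]]]
        L2_measurable[OF superpose_L2[OF mult[OF symbols_const[of 2] es[of e]], of t]]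
      by simp_all
    show "(\<lambda>x. (cutoff (R n) x - 1) * \<Psi> x + \<i> * E n x) \<in> borel_measurable borel" for n
      unfolding E_def by measurable
    show "integrable lborel (\<lambda>x. (2 * M)\<^sup>2 * (norm (G x))\<^sup>2)" using L2_integrable[OF GL] by simp
    fix n x
    have "norm (\<Psi> x) \<le> norm (G x)" unfolding G_split by (simp add: sum_nonneg)
    then have "norm ((cutoff (R n) x - 1) * \<Psi> x) \<le> M * norm (G x)"
      unfolding norm_mult using M R by (intro mult_mono) auto
    moreover have "M / R n * norm (G x) \<le> M * norm (G x)"
      using R[of n] M(1) by (intro mult_right_mono) (auto simp: divide_le_eq mult_left_mono intro: mult_left_mono[of 1 "R n" M, simplified])
    ultimately have "norm ((cutoff (R n) x - 1) * \<Psi> x + \<i> * E n x) \<le> 2 * M * norm (G x)"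
      using norm_triangle_ineq[of "(cutoff (R n) x - 1) * \<Psi> x" "\<i> * E n x"] E_le[of n x] by (simp add: norm_mult)
    then show "(norm ((cutoff (R n) x - 1) * \<Psi> x + \<i> * E n x))\<^sup>2 \<le> (2 * M)\<^sup>2 * (norm (G x))\<^sup>2"
      by (metis norm_ge_zero power_mono power_mult_distrib)
    have "(\<lambda>n. E n x) \<longlonglongrightarrow> 0"
    proof (rule Lim_null_comparison)
      show "\<forall>\<^sub>F n in sequentially. norm (E n x) \<le> M / R n * norm (G x)" using E_le by simp
      show "(\<lambda>n. M / R n * norm (G x)) \<longlonglongrightarrow> 0" using tendsto_mult_left_zero[OF Rinv] .
    qed
    then have "(\<lambda>n. (cutoff (R n) x - 1) * \<Psi> x + \<i> * E n x) \<longlonglongrightarrow> (1 - 1) * \<Psi> x + \<i> * 0"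
      by (intro tendsto_intros cut_lim)
    then show "(\<lambda>n. (cutoff (R n) x - 1) * \<Psi> x + \<i> * E n x) \<longlonglongrightarrow> 0" by simp
  qed
  have "\<phi> n \<in> test_functions" for n
    unfolding \<phi>_def[abs_def] cutoff_def by (rule test_function_bump_times[OF Ck\<Phi>]) (use R[of n] in simp)
  then show ?thesis
    unfolding closure_graph_def \<Phi>_def[symmetric] \<Psi>_def[symmetric] using 1 2 \<Phi>L \<Psi>L by blast
qed

text \<open>
  The velocity of the packet grows linearly in \<open>v\<close>, uniformly for bounded times.
\<close>
lemma packet_difference_bound:
  assumes T: "T \<ge> 0"
  shows "\<exists>B\<ge>0. \<forall>\<xi>\<in>box_dual. \<forall>v s t. \<bar>s\<bar> \<le> T \<longrightarrow> \<bar>t\<bar> \<le> T \<longrightarrow>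
    norm (rate \<xi> s v * packet \<xi> s v) \<le> B * gauss_weight eps v \<and>
    norm (packet \<xi> t v - packet \<xi> s v) \<le> B * gauss_weight eps v * \<bar>t - s\<bar>"
proof -
  obtain a where a: "\<And>\<xi>. \<xi> \<in> box_dual \<Longrightarrow> norm (J \<xi>) \<le> a" using J_norm_bounded by blast
  obtain b where b: "\<And>\<xi>. \<xi> \<in> box_dual \<Longrightarrow> norm (H \<xi>) \<le> b" using H_norm_bounded by blast
  obtain k where k: "\<And>\<xi>. \<xi> \<in> box_dual \<Longrightarrow> \<bar>trH \<xi>\<bar> \<le> k"
    using compact_imp_bounded[OF compact_continuous_image[OF trH_continuous compact_cbox]] by (auto simp: bounded_iff)
  obtain B where B: "B \<ge> 0" "\<And>\<xi> v t. \<xi> \<in> box_dual \<Longrightarrow> \<bar>t\<bar> \<le> T \<Longrightarrow> (1 + norm v) ^ 1 * norm (packet \<xi> t v) \<le> B * gauss_weight eps v"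
    using poly_packet_bound[OF T, of 1] by blast
  define X where "X = 2 * norm p * T"
  define A where "A = \<bar>b\<bar> * (1 + X) * norm p + \<bar>a\<bar> * norm p + (norm p)\<^sup>2 + \<bar>k\<bar>"
  have X: "X \<ge> 0" using T by (simp add: X_def)
  have rate_le: "norm (rate \<xi> s v) \<le> A * (1 + norm v)" if \<xi>: "\<xi> \<in> box_dual" and s: "\<bar>s\<bar> \<le> T" for \<xi> s v
  proof -
    have "norm (ctr \<xi> s) \<le> X" using ctr_norm_le[of \<xi> s] mult_left_mono[OF s, of "2 * norm p"] by (simp add: X_def)
    then have "norm (v - ctr \<xi> s) \<le> (1 + X) * (1 + norm v)"
      using norm_triangle_ineq4[of v "ctr \<xi> s"] X by (simp add: algebra_simps) (smt (verit) mult_nonneg_nonneg norm_ge_zero)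
    then have "norm (H \<xi> (v - ctr \<xi> s)) \<le> \<bar>b\<bar> * ((1 + X) * (1 + norm v))"
      using b[OF \<xi>] by (intro order_trans[OF norm_blinfun] mult_mono) auto
    then have 1: "\<bar>H \<xi> (v - ctr \<xi> s) \<bullet> mom \<xi> s\<bar> \<le> \<bar>b\<bar> * ((1 + X) * (1 + norm v)) * norm p"
      by (intro order_trans[OF Cauchy_Schwarz_ineq2]) (auto simp: mom_norm intro: mult_right_mono)
    have "norm (J \<xi> (mom \<xi> s)) \<le> \<bar>a\<bar> * norm p"
      using a[OF \<xi>] by (intro order_trans[OF norm_blinfun]) (auto simp: mom_norm intro!: mult_right_mono)
    then have 2: "\<bar>J \<xi> (mom \<xi> s) \<bullet> v\<bar> \<le> \<bar>a\<bar> * norm p * (1 + norm v)"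
      by (intro order_trans[OF Cauchy_Schwarz_ineq2] mult_mono) auto
    have 3: "\<bar>mom \<xi> s \<bullet> p\<bar> \<le> (norm p)\<^sup>2 * (1 + norm v)"
    proof -
      have "\<bar>mom \<xi> s \<bullet> p\<bar> \<le> (norm p)\<^sup>2 * 1" using Cauchy_Schwarz_ineq2[of "mom \<xi> s" p] by (simp add: mom_norm power2_eq_square)
      also have "\<dots> \<le> (norm p)\<^sup>2 * (1 + norm v)" by (intro mult_left_mono) auto
      finally show ?thesis .
    qed
    have 4: "\<bar>(1/2) * trH \<xi>\<bar> \<le> \<bar>k\<bar> * (1 + norm v)"
    proof -
      have "\<bar>(1/2) * trH \<xi>\<bar> \<le> \<bar>k\<bar> * 1" using k[OF \<xi>] by simp
      also have "\<dots> \<le> \<bar>k\<bar> * (1 + norm v)" by (intro mult_left_mono) auto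
      finally show ?thesis .
    qed
    have tri: "\<bar>x - y - z\<bar> \<le> \<bar>x\<bar> + \<bar>y\<bar> + \<bar>z\<bar>" for x y z :: real by linarith
    have "norm (rate \<xi> s v) \<le> \<bar>H \<xi> (v - ctr \<xi> s) \<bullet> mom \<xi> s\<bar> + \<bar>J \<xi> (mom \<xi> s) \<bullet> v - mom \<xi> s \<bullet> p - (1/2) * trH \<xi>\<bar>"
      unfolding rate_def by (rule order_trans[OF norm_triangle_ineq]) (simp add: norm_mult del: of_real_diff of_real_mult)
    also have "\<dots> \<le> \<bar>b\<bar> * ((1 + X) * (1 + norm v)) * norm p + (\<bar>a\<bar> * norm p * (1 + norm v) + (norm p)\<^sup>2 * (1 + norm v) + \<bar>k\<bar> * (1 + norm v))"
      by (rule add_mono[OF 1 order_trans[OF tri add_mono[OF add_mono[OF 2 3] 4]]])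
    also have "\<dots> = A * (1 + norm v)" by (simp add: A_def algebra_simps)
    finally show ?thesis .
  qed
  have A: "A \<ge> 0" using X by (simp add: A_def)
  have r: "norm (rate \<xi> s v * packet \<xi> s v) \<le> A * B * gauss_weight eps v" if \<xi>: "\<xi> \<in> box_dual" and s: "\<bar>s\<bar> \<le> T" for \<xi> s v
  proof -
    have "norm (rate \<xi> s v * packet \<xi> s v) \<le> A * (1 + norm v) * norm (packet \<xi> s v)"
      unfolding norm_mult by (intro mult_right_mono rate_le that) auto
    also have "\<dots> \<le> A * (B * gauss_weight eps v)" using mult_left_mono[OF B(2)[OF that, of v] A] by (simp add: mult.assoc)
    finally show ?thesis by simp
  qed
  moreover have "norm (packet \<xi> t v - packet \<xi> s v) \<le> A * B * gauss_weight eps v * \<bar>t - s\<bar>"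
    if \<xi>: "\<xi> \<in> box_dual" and s: "\<bar>s\<bar> \<le> T" and t: "\<bar>t\<bar> \<le> T" for \<xi> s t v
  proof (rule real_curve_lipschitz[OF packet_has_time_derivative[OF \<xi>]])
    fix \<tau> assume "\<tau> \<in> closed_segment s t"
    then have "\<bar>\<tau>\<bar> \<le> T" using s t by (auto simp: closed_segment_eq_real_ivl split: if_splits)
    then show "norm (rate \<xi> \<tau> v * packet \<xi> \<tau> v) \<le> A * B * gauss_weight eps v" by (rule r[OF \<xi>])
  qed
  ultimately show ?thesis using A B by (intro exI[of _ "A * B"]) auto
qed

lemma superpose_integrable:
  assumes g: "g \<in> symbols"
  shows "integrable lborel (\<lambda>\<xi>. of_real (indicator box_dual \<xi>) * (if \<xi> \<in> box_dual then g \<xi> (fst x) * packet \<xi> t (fst x) else 0) * cis (\<xi> \<bullet> snd x))"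
proof -
  have "continuous_on box_dual (\<lambda>\<xi>. (\<lambda>(x, \<xi>). g \<xi> (fst x) * exp (wphase t \<xi> x)) (x, \<xi>))"
    by (rule continuous_on_compose2[OF symbol_wphase_continuous[OF g]]) (auto intro!: continuous_intros)
  then have "set_integrable lborel box_dual (\<lambda>\<xi>. g \<xi> (fst x) * exp (wphase t \<xi> x))"
    unfolding set_integrable_def by (intro borel_integrable_compact) auto
  then show ?thesis unfolding set_integrable_def
    by (rule back_subst[of "integrable lborel"]) (auto simp: fun_eq_iff indicator_def exp_wphase)
qed

lemma superpose_time_derivative:
  assumes c: "continuous_on box_dual c"
  shows "((\<lambda>h. L2_norm (\<lambda>x. (superpose (t + h) (\<lambda>\<xi> v. c \<xi>) x - superpose t (\<lambda>\<xi> v. c \<xi>) x) / complex_of_real h -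
    superpose t (\<lambda>\<xi> v. c \<xi> * gen t \<xi> v) x)) \<longlongrightarrow> 0) (at 0)"
  unfolding LIMSEQ_SEQ_conv[symmetric]
proof (intro allI impI, elim conjE)
  fix S0 :: "nat \<Rightarrow> real" assume S0: "\<forall>n. S0 n \<noteq> 0" "S0 \<longlonglongrightarrow> 0"
  \<comment> \<open>Finitely many terms are changed so that all times lie in a bounded interval.\<close>
  define S where "S n = (if \<bar>S0 n\<bar> \<le> 1 then S0 n else 1)" for n
  have ev: "\<forall>\<^sub>F n in sequentially. S n = S0 n"
  proof -
    have "\<forall>\<^sub>F n in sequentially. dist (S0 n) 0 < 1" using tendstoD[OF S0(2), of 1] by simp
    then show ?thesis by eventually_elim (simp add: S_def)
  qed
  have S: "S n \<noteq> 0" "\<bar>S n\<bar> \<le> 1" for n using S0 by (auto simp: S_def)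
  have Slim: "S \<longlonglongrightarrow> 0" by (rule Lim_transform_eventually[OF S0(2)]) (use ev in \<open>auto elim: eventually_mono\<close>)
  have cs: "(\<lambda>\<xi> v. c \<xi>) \<in> symbols" by (rule coef[OF c])
  have gs: "(\<lambda>\<xi> v. c \<xi> * gen t \<xi> v) \<in> symbols" using gen_symbol[of t] by (intro mult cs) simp
  define q where "q n \<xi> v = c \<xi> * ((packet \<xi> (t + S n) v - packet \<xi> t v) / of_real (S n) - gen t \<xi> v * packet \<xi> t v)" for n \<xi> v
  define m where "m n \<xi> v = (if \<xi> \<in> box_dual then q n \<xi> v else 0)" for n \<xi> v
  have eq: "wave box_dual (m n) x = (superpose (t + S n) (\<lambda>\<xi> v. c \<xi>) x - superpose t (\<lambda>\<xi> v. c \<xi>) x) / complex_of_real (S n) -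
    superpose t (\<lambda>\<xi> v. c \<xi> * gen t \<xi> v) x" for n x
  proof -
    let ?F = "\<lambda>g s \<xi>. complex_of_real (indicator box_dual \<xi>) * (if \<xi> \<in> box_dual then g \<xi> (fst x) * packet \<xi> s (fst x) else 0) * cis (\<xi> \<bullet> snd x)"
    have i: "integrable lborel (?F (\<lambda>\<xi> v. c \<xi>) s)" "integrable lborel (?F (\<lambda>\<xi> v. c \<xi> * gen t \<xi> v) s)" for s
      by (rule superpose_integrable[OF cs], rule superpose_integrable[OF gs])
    have "wave box_dual (m n) x = (\<integral>\<xi>. (?F (\<lambda>\<xi> v. c \<xi>) (t + S n) \<xi> - ?F (\<lambda>\<xi> v. c \<xi>) t \<xi>) / complex_of_real (S n) - ?F (\<lambda>\<xi> v. c \<xi> * gen t \<xi> v) t \<xi> \<partial>lborel)"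
      unfolding wave_def
      by (intro Bochner_Integration.integral_cong) (auto simp: m_def q_def indicator_def diff_divide_distrib algebra_simps)
    also have "\<dots> = ((\<integral>\<xi>. ?F (\<lambda>\<xi> v. c \<xi>) (t + S n) \<xi> \<partial>lborel) - (\<integral>\<xi>. ?F (\<lambda>\<xi> v. c \<xi>) t \<xi> \<partial>lborel)) / complex_of_real (S n) - (\<integral>\<xi>. ?F (\<lambda>\<xi> v. c \<xi> * gen t \<xi> v) t \<xi> \<partial>lborel)"
      by (subst Bochner_Integration.integral_diff, intro integrable_divide Bochner_Integration.integrable_diff i, rule i,
        subst integral_divide_zero, subst Bochner_Integration.integral_diff, rule i, rule i, rule refl)
    finally show ?thesis unfolding superpose_def wave_def .
  qed
  have bdc: "\<exists>K\<ge>0. \<forall>\<xi>\<in>box_dual. norm (c \<xi>) \<le> K"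
    using symbols_bound[OF cs] compact_imp_bounded[OF compact_continuous_image[OF c compact_cbox]]
    by (force simp: bounded_iff intro: order_trans[OF _ max.cobounded1] exI[of _ "max _ 0"])
  then obtain K where K: "K \<ge> 0" "\<And>\<xi>. \<xi> \<in> box_dual \<Longrightarrow> norm (c \<xi>) \<le> K" by blast
  obtain B where B: "B \<ge> 0" "\<And>\<xi> v s t'. \<xi> \<in> box_dual \<Longrightarrow> \<bar>s\<bar> \<le> \<bar>t\<bar> + 1 \<Longrightarrow> \<bar>t'\<bar> \<le> \<bar>t\<bar> + 1 \<Longrightarrow>
    norm (rate \<xi> s v * packet \<xi> s v) \<le> B * gauss_weight eps v \<and> norm (packet \<xi> t' v - packet \<xi> s v) \<le> B * gauss_weight eps v * \<bar>t' - s\<bar>"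
    using packet_difference_bound[of "\<bar>t\<bar> + 1"] by (auto simp: Ball_def)
  have "(\<lambda>n. L2_norm (wave box_dual (m n))) \<longlonglongrightarrow> 0"
  proof (rule wave_tendsto_0[OF _ _ _ _ eps_pos])
    show "box_dual \<in> sets borel" "emeasure lborel box_dual < \<infinity>" by (simp_all add: emeasure_lborel_cbox_eq)
    have "continuous_on (box_dual \<times> UNIV) (\<lambda>q. c (fst q))"
      by (rule continuous_on_compose2[OF c]) (auto intro!: continuous_intros)
    then have "continuous_on (box_dual \<times> UNIV) (\<lambda>(\<xi>, v). q n \<xi> v)" for n
      using symbols_continuous[OF gen_symbol[of t]] packet_continuous[of t] packet_continuous[of "t + S n"] S(1)
      unfolding q_def case_prod_unfold by (intro continuous_intros) auto
    from superpose_symbol_measurable[OF this]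
    show "(\<lambda>(\<xi>, v). m n \<xi> v) \<in> borel_measurable (borel \<Otimes>\<^sub>M borel)" for n by (simp add: m_def)
  next
    fix n \<xi> and v :: 'v assume \<xi>: "\<xi> \<in> box_dual"
    have t: "\<bar>t\<bar> \<le> \<bar>t\<bar> + 1" "\<bar>t + S n\<bar> \<le> \<bar>t\<bar> + 1" using S(2)[of n] by auto
    have "norm ((packet \<xi> (t + S n) v - packet \<xi> t v) / of_real (S n)) \<le> B * gauss_weight eps v"
      using B(2)[OF \<xi> t, of v] S(1)[of n] by (simp add: norm_divide divide_le_eq)
    moreover have "norm (gen t \<xi> v * packet \<xi> t v) \<le> B * gauss_weight eps v"
      using B(2)[OF \<xi> t, of v] by (simp add: gen_eq_rate[OF \<xi>])
    ultimately have "norm ((packet \<xi> (t + S n) v - packet \<xi> t v) / of_real (S n) - gen t \<xi> v * packet \<xi> t v) \<le> B * gauss_weight eps v + B * gauss_weight eps v"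
      by (intro order_trans[OF norm_triangle_ineq4] add_mono)
    then have "norm (q n \<xi> v) \<le> K * (B * gauss_weight eps v + B * gauss_weight eps v)"
      unfolding q_def norm_mult using K by (intro mult_mono) (auto simp: \<xi>)
    then show "norm (m n \<xi> v) \<le> (2 * K * B) * gauss_weight eps v" by (simp add: m_def \<xi> algebra_simps)
    have "((\<lambda>h. norm (packet \<xi> (t + h) v - packet \<xi> t v - h *\<^sub>R (rate \<xi> t v * packet \<xi> t v)) / norm h) \<longlongrightarrow> 0) (at 0)"
      using packet_has_time_derivative[OF \<xi>, of v t] unfolding has_vector_derivative_def has_derivative_at by simp
    then have "(\<lambda>n. norm (packet \<xi> (t + S n) v - packet \<xi> t v - S n *\<^sub>R (rate \<xi> t v * packet \<xi> t v)) / norm (S n)) \<longlonglongrightarrow> 0"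
      using S(1) Slim unfolding LIMSEQ_SEQ_conv[symmetric] by blast
    moreover have "norm (packet \<xi> (t + S n) v - packet \<xi> t v - S n *\<^sub>R (rate \<xi> t v * packet \<xi> t v)) / norm (S n) =
        norm ((packet \<xi> (t + S n) v - packet \<xi> t v) / of_real (S n) - gen t \<xi> v * packet \<xi> t v)" for n
    proof -
      have "(packet \<xi> (t + S n) v - packet \<xi> t v) / of_real (S n) - gen t \<xi> v * packet \<xi> t v =
          (packet \<xi> (t + S n) v - packet \<xi> t v - S n *\<^sub>R (rate \<xi> t v * packet \<xi> t v)) / of_real (S n)"
        using S(1)[of n] by (simp add: gen_eq_rate[OF \<xi>] diff_divide_distrib scaleR_conv_of_real)
      then show ?thesis by (simp add: norm_divide)
    qed
    ultimately have "(\<lambda>n. (packet \<xi> (t + S n) v - packet \<xi> t v) / of_real (S n) - gen t \<xi> v * packet \<xi> t v) \<longlonglongrightarrow> 0"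
      by (simp add: tendsto_norm_zero_iff)
    then have "(\<lambda>n. q n \<xi> v) \<longlonglongrightarrow> 0" unfolding q_def by (rule tendsto_mult_right_zero)
    then show "(\<lambda>n. m n \<xi> v) \<longlonglongrightarrow> 0" by (simp add: m_def \<xi>)
  qed
  then show "(\<lambda>n. L2_norm (\<lambda>x. (superpose (t + S0 n) (\<lambda>\<xi> v. c \<xi>) x - superpose t (\<lambda>\<xi> v. c \<xi>) x) / complex_of_real (S0 n) -
    superpose t (\<lambda>\<xi> v. c \<xi> * gen t \<xi> v) x)) \<longlonglongrightarrow> 0"
    by (rule Lim_transform_eventually) (use ev in \<open>auto elim!: eventually_mono simp: ext[OF eq]\<close>)
qed

text \<open>
  A superposition of packets with time-independent coefficients is a solution that lies in the domain of the generator at all times.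
\<close>
theorem pairing_with_superpose:
  assumes U: "sublaplacian_group lie U" and f: "f \<in> L2" and c: "continuous_on box_dual c"
  shows "L2_inner (U t f) (superpose t (\<lambda>\<xi> v. c \<xi>)) = L2_inner f (superpose 0 (\<lambda>\<xi> v. c \<xi>))"
proof -
  have "unitary_group U" using U by (simp add: sublaplacian_group_def)
  then show ?thesis
  proof (rule unitary_group.pairing_with_solution_constant[OF _ f superpose_L2[OF coef[OF c]] _ superpose_time_derivative[OF c]])
    show "(superpose t (\<lambda>\<xi> v. c \<xi>), superpose t (\<lambda>\<xi> v. c \<xi> * gen t \<xi> v)) \<in> generator_graph U" for t
      using U superpose_in_closure_graph[OF c] by (simp add: sublaplacian_group_def)
  qed
qed

end

section \<open>Functions of compact support with small Fourier transform\<close>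

lemma AE_zero_continuous_open:
  fixes f :: "'a::euclidean_space \<Rightarrow> complex"
  assumes S: "open S" "continuous_on S f" and AE: "AE x in lborel. x \<in> S \<longrightarrow> f x = 0" and x: "x \<in> S"
  shows "f x = 0"
proof (rule ccontr)
  assume "f x \<noteq> 0"
  define T where "T = S \<inter> f -` (- {0})"
  have "open T" unfolding T_def using S by (intro continuous_open_preimage) auto
  then have T: "T \<in> sets lborel" by simp
  have "AE x in lborel. x \<notin> T" using AE by eventually_elim (auto simp: T_def)
  then have "T \<in> null_sets lborel" using AE_iff_null_sets[OF T] by simp
  then have "negligible T" by (simp add: negligible_iff_null_sets null_sets_completionI)
  moreover have "T \<noteq> {}" using \<open>f x \<noteq> 0\<close> x by (auto simp: T_def)
  ultimately show False using open_not_negligible[OF \<open>open T\<close>] by blast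
qed

text \<open>
  For \<open>c 2 ^ l < |r| \<le> c 2 ^ (l + 1)\<close> the integrand is at most \<open>\<psi> (c 2 ^ (l + 1)) / (c 2 ^ l)\<^sup>2\<close>.
\<close>
lemma mono_integral_imp_not_summable:
  fixes \<psi> :: "real \<Rightarrow> real"
  assumes \<psi>0: "\<And>s. 0 \<le> s \<Longrightarrow> 0 \<le> \<psi> s" and \<psi>m: "mono_on {0..} \<psi>"
    and div: "(\<integral>\<^sup>+ r. ennreal (\<psi> \<bar>r\<bar> / (1 + r\<^sup>2)) \<partial>lborel) = \<infinity>" and c: "c > 0"
  shows "\<not> summable (\<lambda>l::nat. \<psi> (c * 2 ^ l) / 2 ^ l)"
proof
  assume sm: "summable (\<lambda>l::nat. \<psi> (c * 2 ^ l) / 2 ^ l)"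
  define a where "a l = \<psi> (c * 2 ^ Suc l) / (c * 2 ^ l)\<^sup>2" for l :: nat
  have p0: "\<psi> (c * 2 ^ l) \<ge> 0" for l :: nat using c by (intro \<psi>0) simp
  have a0: "a l \<ge> 0" for l unfolding a_def by (intro divide_nonneg_nonneg p0) simp
  have "(\<integral>\<^sup>+ r. ennreal (\<psi> \<bar>r\<bar> / (1 + r\<^sup>2)) \<partial>lborel) \<le>
      (\<integral>\<^sup>+ r. ennreal (\<psi> c) * indicator {- c..c} r + (\<Sum>l. ennreal (a l) * indicator {- (c * 2 ^ Suc l)..c * 2 ^ Suc l} r) \<partial>lborel)"
  proof (rule nn_integral_mono)
    fix r :: real
    define F where "F l = ennreal (a l) * indicator {- (c * 2 ^ Suc l)..c * 2 ^ Suc l} r" for l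
    show "ennreal (\<psi> \<bar>r\<bar> / (1 + r\<^sup>2)) \<le>
        ennreal (\<psi> c) * indicator {- c..c} r + (\<Sum>l. ennreal (a l) * indicator {- (c * 2 ^ Suc l)..c * 2 ^ Suc l} r)"
      unfolding F_def[symmetric]
    proof (cases "\<bar>r\<bar> \<le> c")
      case True
      have "\<psi> \<bar>r\<bar> / (1 + r\<^sup>2) \<le> \<psi> c / 1"
        using True c \<psi>0[of c] by (intro frac_le monotone_onD[OF \<psi>m]) auto
      then have "ennreal (\<psi> \<bar>r\<bar> / (1 + r\<^sup>2)) \<le> ennreal (\<psi> c) * indicator {- c..c} r"
        using True by (auto simp: indicator_def intro: ennreal_leI)
      then show "ennreal (\<psi> \<bar>r\<bar> / (1 + r\<^sup>2)) \<le> ennreal (\<psi> c) * indicator {- c..c} r + (\<Sum>l. F l)"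
        by (rule order_trans) simp
    next
      case False
      obtain N :: nat where "\<bar>r\<bar> / c < 2 ^ N" using real_arch_pow[of 2 "\<bar>r\<bar> / c"] by auto
      then have "\<bar>r\<bar> \<le> c * 2 ^ N" using c by (simp add: field_simps)
      from LeastI[of "\<lambda>n. \<bar>r\<bar> \<le> c * 2 ^ n", OF this]
      have N: "\<bar>r\<bar> \<le> c * 2 ^ (LEAST n. \<bar>r\<bar> \<le> c * 2 ^ n)" .
      moreover from this have "(LEAST n. \<bar>r\<bar> \<le> c * 2 ^ n) \<noteq> 0" using False by (metis mult.right_neutral power_0)
      ultimately obtain l where l: "(LEAST n. \<bar>r\<bar> \<le> c * 2 ^ n) = Suc l" by (metis not0_implies_Suc)
      then have lo: "\<not> \<bar>r\<bar> \<le> c * 2 ^ l" using not_less_Least[of l "\<lambda>n. \<bar>r\<bar> \<le> c * 2 ^ n"] by simp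
      have hi: "\<bar>r\<bar> \<le> c * 2 ^ Suc l" using N unfolding l .
      have cl: "c * 2 ^ l > 0" using c by simp
      have "(c * 2 ^ l)\<^sup>2 \<le> \<bar>r\<bar>\<^sup>2" using lo cl by (intro power_mono) auto
      then have "\<psi> \<bar>r\<bar> / (1 + r\<^sup>2) \<le> a l"
        unfolding a_def using hi cl c p0[of "Suc l"] by (intro frac_le monotone_onD[OF \<psi>m]) auto
      then have "ennreal (\<psi> \<bar>r\<bar> / (1 + r\<^sup>2)) \<le> F l"
        using hi by (auto simp: F_def indicator_def intro: ennreal_leI)
      also have "\<dots> \<le> (\<Sum>l. F l)" using sum_le_suminf[of F "{l}"] by simp
      also have "\<dots> \<le> ennreal (\<psi> c) * indicator {- c..c} r + (\<Sum>l. F l)" by simp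
      finally show "ennreal (\<psi> \<bar>r\<bar> / (1 + r\<^sup>2)) \<le> ennreal (\<psi> c) * indicator {- c..c} r + (\<Sum>l. F l)" .
    qed
  qed
  also have "\<dots> = (\<integral>\<^sup>+ r. ennreal (\<psi> c) * indicator {- c..c} r \<partial>lborel) +
      (\<Sum>l. (\<integral>\<^sup>+ r. ennreal (a l) * indicator {- (c * 2 ^ Suc l)..c * 2 ^ Suc l} r \<partial>lborel))"
    by (subst nn_integral_add) (auto simp: nn_integral_suminf)
  also have "\<dots> = ennreal (\<psi> c) * ennreal (2 * c) + (\<Sum>l. ennreal (8 / c * (\<psi> (c * 2 ^ Suc l) / 2 ^ Suc l)))"
  proof (intro arg_cong2[where f = "(+)"] suminf_cong)
    show "(\<integral>\<^sup>+ r. ennreal (\<psi> c) * indicator {- c..c} r \<partial>lborel) = ennreal (\<psi> c) * ennreal (2 * c)"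
      using c by (simp add: nn_integral_cmult_indicator)
    fix l :: nat
    have "a l * (2 * (c * 2 ^ Suc l)) = 8 / c * (\<psi> (c * 2 ^ Suc l) / 2 ^ Suc l)"
      using c by (simp add: a_def power2_eq_square field_simps)
    moreover have "(\<integral>\<^sup>+ r. ennreal (a l) * indicator {- (c * 2 ^ Suc l)..c * 2 ^ Suc l} r \<partial>lborel) = ennreal (a l) * ennreal (2 * (c * 2 ^ Suc l))"
      using c by (simp add: nn_integral_cmult_indicator del: power_Suc)
    ultimately show "(\<integral>\<^sup>+ r. ennreal (a l) * indicator {- (c * 2 ^ Suc l)..c * 2 ^ Suc l} r \<partial>lborel) = ennreal (8 / c * (\<psi> (c * 2 ^ Suc l) / 2 ^ Suc l))"
      using a0[of l] by (simp add: ennreal_mult'[symmetric] del: power_Suc)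
  qed
  also have "(\<Sum>l. ennreal (8 / c * (\<psi> (c * 2 ^ Suc l) / 2 ^ Suc l))) = ennreal (\<Sum>l. 8 / c * (\<psi> (c * 2 ^ Suc l) / 2 ^ Suc l))"
  proof (rule suminf_ennreal2)
    show "0 \<le> 8 / c * (\<psi> (c * 2 ^ Suc l) / 2 ^ Suc l)" for l using c p0[of "Suc l"] by (simp del: power_Suc)
    show "summable (\<lambda>l. 8 / c * (\<psi> (c * 2 ^ Suc l) / 2 ^ Suc l))"
      by (rule summable_mult) (use sm in \<open>subst summable_Suc_iff\<close>)
  qed
  finally have "(\<integral>\<^sup>+ r. ennreal (\<psi> \<bar>r\<bar> / (1 + r\<^sup>2)) \<partial>lborel) < \<infinity>"
    by (rule le_less_trans) (simp add: ennreal_mult_less_top)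
  then show False using div by simp
qed

text \<open>
  The terms of a convergent series tend to 0, but \<open>b (c 2 ^ l)\<^sup>2 / 2 ^ l \<ge> b c\<^sup>2\<close>. So the minimum would eventually be
  its first argument.
\<close>
lemma min_quadratic_not_summable:
  fixes \<psi> :: "real \<Rightarrow> real"
  assumes div: "\<And>c. c > 0 \<Longrightarrow> \<not> summable (\<lambda>l::nat. \<psi> (c * 2 ^ l) / 2 ^ l)" and a: "a > 0" and b: "b > 0" and c: "c > 0"
  shows "\<not> summable (\<lambda>l::nat. min (\<psi> (a * (c * 2 ^ l))) (b * (c * 2 ^ l)\<^sup>2) / 2 ^ l)"
proof
  assume sm: "summable (\<lambda>l::nat. min (\<psi> (a * (c * 2 ^ l))) (b * (c * 2 ^ l)\<^sup>2) / 2 ^ l)"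
  have "b * c\<^sup>2 > 0" using b c by simp
  with order_tendstoD(2)[OF summable_LIMSEQ_zero[OF sm]]
  have "\<forall>\<^sub>F l in sequentially. min (\<psi> (a * (c * 2 ^ l))) (b * (c * 2 ^ l)\<^sup>2) / 2 ^ l < b * c\<^sup>2" by blast
  then have "\<forall>\<^sub>F l in sequentially. min (\<psi> (a * (c * 2 ^ l))) (b * (c * 2 ^ l)\<^sup>2) / 2 ^ l = \<psi> ((a * c) * 2 ^ l) / 2 ^ l"
  proof eventually_elim
    case (elim l)
    have "b * c\<^sup>2 \<le> b * c\<^sup>2 * 2 ^ l" using mult_left_mono[of 1 "2 ^ l" "b * c\<^sup>2"] \<open>b * c\<^sup>2 > 0\<close> by simp
    also have "\<dots> = b * (c * 2 ^ l)\<^sup>2 / 2 ^ l" by (simp add: power2_eq_square)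
    finally have q: "b * c\<^sup>2 \<le> b * (c * 2 ^ l)\<^sup>2 / 2 ^ l" .
    have "\<not> b * (c * 2 ^ l)\<^sup>2 \<le> \<psi> (a * (c * 2 ^ l))"
    proof
      assume "b * (c * 2 ^ l)\<^sup>2 \<le> \<psi> (a * (c * 2 ^ l))"
      then show False using elim q by (simp only: min_absorb2)
    qed
    then show ?case by (simp add: min_def mult.assoc)
  qed
  then have "summable (\<lambda>l::nat. \<psi> ((a * c) * 2 ^ l) / 2 ^ l)" using sm by (subst (asm) summable_cong)
  then show False using div[of "a * c"] a c by simp
qed

text \<open>
  On a complex line \<open>\<zeta> \<mapsto> \<zeta> \<omega>\<close> the Fourier transform of \<open>F\<close> is an entire function \<open>G\<close> of exponential type, and \<open>exp (\<i> \<rho> \<zeta>) G \<zeta>\<close> is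
  bounded in the upper half-plane. On the real axis it decays like \<open>exp (- \<psi>1)\<close>, where \<open>\<psi>1\<close> is the minimum of a rescaled
  \<open>\<psi>\<close> and a quadratic function, whose dyadic series still diverges. Hence \<open>G\<close> vanishes on the positive imaginary axis, and so everywhere.
\<close>
theorem compact_support_log_integral_zero:
  fixes F :: "'v::euclidean_space \<Rightarrow> complex" and \<psi> :: "real \<Rightarrow> real"
  assumes F: "continuous_on UNIV F" and K: "compact K" "\<And>v. v \<notin> K \<Longrightarrow> F v = 0"
    and \<psi>0: "\<And>s. 0 \<le> s \<Longrightarrow> 0 \<le> \<psi> s" and \<psi>m: "mono_on {0..} \<psi>"
    and div: "\<And>c. c > 0 \<Longrightarrow> \<not> summable (\<lambda>l::nat. \<psi> (c * 2 ^ l) / 2 ^ l)"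
    and a: "a > 0" and b: "b > 0"
    and decay: "\<And>p. norm (\<integral>v. F v * cis (- (p \<bullet> v)) \<partial>lborel) \<le> A * (exp (- \<psi> (a * norm p)) + exp (- (b * (norm p)\<^sup>2)))"
  shows "F v = 0"
proof -
  obtain u where u: "K \<subseteq> cbox (- u) u" using bounded_subset_cbox_symmetric[OF compact_imp_bounded[OF K(1)]] by blast
  have F0: "F v = 0" if "v \<notin> cbox (- u) u" for v using K(2) u that by blast
  have Fc: "continuous_on S F" for S using F by (rule continuous_on_subset) simp
  have A: "A \<ge> 0"
  proof -
    have "0 \<le> A * (exp (- \<psi> (a * norm (0::'v))) + exp (- (b * (norm (0::'v))\<^sup>2)))" using norm_ge_zero decay order_trans by blast
    then show ?thesis by (simp add: zero_le_mult_iff add_pos_pos not_le[symmetric]) (smt (verit) exp_gt_zero)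
  qed
  have to_integral: "(\<integral>v. F v * e v \<partial>lborel) = integral (cbox (- u) u) (\<lambda>v. F v * e v)"
    if e: "continuous_on UNIV e" for e :: "'v \<Rightarrow> complex"
  proof -
    have "continuous_on (cbox (- u) u) (\<lambda>v. F v * e v)" using e by (intro continuous_on_mult Fc) (rule continuous_on_subset, auto)
    then have "set_integrable lborel (cbox (- u) u) (\<lambda>v. F v * e v)"
      unfolding set_integrable_def by (intro borel_integrable_compact) auto
    from set_borel_integral_eq_integral(2)[OF this]
    have "integral (cbox (- u) u) (\<lambda>v. F v * e v) = (\<integral>v. indicator (cbox (- u) u) v *\<^sub>R (F v * e v) \<partial>lborel)"
      by (simp add: set_lebesgue_integral_def)
    also have "\<dots> = (\<integral>v. F v * e v \<partial>lborel)"
      by (intro Bochner_Integration.integral_cong) (use F0 in \<open>auto simp: indicator_def\<close>)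
    finally show ?thesis by simp
  qed
  have line: "(\<integral>v. F v * cis (- ((x *\<^sub>R \<omega>) \<bullet> v)) \<partial>lborel) = 0" if \<omega>: "\<omega> \<noteq> 0" for \<omega> :: 'v and x :: real
  proof -
    define G where "G z = integral (cbox (- u) u) (\<lambda>v. F v * exp (- (\<i> * z * of_real (\<omega> \<bullet> v))))" for z
    have i: "(\<lambda>v. F v * exp (- (\<i> * z * of_real (\<omega> \<bullet> v)))) integrable_on cbox (- u) u" for z
      by (intro integrable_continuous continuous_intros Fc)
    have "(\<lambda>z. integral (cbox (- u) u) (\<lambda>v. F v * exp (- (\<i> * z * of_real (\<omega> \<bullet> v))))) holomorphic_on UNIV"
    proof (rule leibniz_rule_holomorphic[OF _ i _ convex_UNIV])
      show "((\<lambda>z. F v * exp (- (\<i> * z * of_real (\<omega> \<bullet> v)))) has_field_derivative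
          F v * (exp (- (\<i> * z * of_real (\<omega> \<bullet> v))) * (- (\<i> * of_real (\<omega> \<bullet> v))))) (at z within UNIV)" for z v
        by (auto intro!: derivative_eq_intros)
      have "continuous_on (UNIV \<times> cbox (- u) u) (\<lambda>q. F (snd q))"
        by (rule continuous_on_compose2[OF F]) (auto intro!: continuous_intros)
      then show "continuous_on (UNIV \<times> cbox (- u) u) (\<lambda>(z, v). F v * (exp (- (\<i> * z * of_real (\<omega> \<bullet> v))) * (- (\<i> * of_real (\<omega> \<bullet> v)))))"
        unfolding case_prod_unfold by (intro continuous_intros)
    qed
    then have hol: "G holomorphic_on UNIV" by (simp add: G_def[abs_def])
    have Greal: "G (of_real x) = (\<integral>v. F v * cis (- ((x *\<^sub>R \<omega>) \<bullet> v)) \<partial>lborel)" for x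
    proof -
      have "(\<integral>v. F v * cis (- ((x *\<^sub>R \<omega>) \<bullet> v)) \<partial>lborel) = integral (cbox (- u) u) (\<lambda>v. F v * cis (- ((x *\<^sub>R \<omega>) \<bullet> v)))"
        by (rule to_integral) (intro continuous_intros)
      then show ?thesis by (simp add: G_def cis_conv_exp mult.assoc)
    qed
    have "bounded ((\<lambda>v. \<omega> \<bullet> v) ` cbox (- u) u)"
      by (intro compact_imp_bounded compact_continuous_image continuous_intros) auto
    then obtain \<rho> where \<rho>: "\<And>v. v \<in> cbox (- u) u \<Longrightarrow> \<bar>\<omega> \<bullet> v\<bar> \<le> \<rho>" by (auto simp: bounded_iff)
    define N where "N = integral (cbox (- u) u) (\<lambda>v. norm (F v))"
    define B where "B = \<bar>N\<bar> + 2 * A + 1"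
    define \<psi>1 where "\<psi>1 r = min (\<psi> ((a * norm \<omega>) * r)) ((b * (norm \<omega>)\<^sup>2) * r\<^sup>2)" for r
    define G1 where "G1 z = exp (\<i> * of_real \<rho> * z) * G z" for z
    have ab: "a * norm \<omega> > 0" "b * (norm \<omega>)\<^sup>2 > 0" using a b \<omega> by auto
    have Gle: "norm (G z) \<le> N * exp (\<rho> * Im z)" if "Im z \<ge> 0" for z
    proof -
      have "norm (G z) \<le> integral (cbox (- u) u) (\<lambda>v. norm (F v) * exp (\<rho> * Im z))"
        unfolding G_def
      proof (rule integral_norm_bound_integral[OF i])
        show "(\<lambda>v. norm (F v) * exp (\<rho> * Im z)) integrable_on cbox (- u) u"
          by (intro integrable_continuous continuous_intros Fc)
        fix v assume "v \<in> cbox (- u) u"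
        then have "Im z * (\<omega> \<bullet> v) \<le> Im z * \<rho>" using \<rho>[of v] that by (intro mult_left_mono) auto
        then show "norm (F v * exp (- (\<i> * z * of_real (\<omega> \<bullet> v)))) \<le> norm (F v) * exp (\<rho> * Im z)"
          by (auto simp: norm_mult norm_exp_eq_Re mult.commute intro!: mult_left_mono)
      qed
      then show ?thesis by (simp add: N_def)
    qed
    have zero: "G1 (\<i> * of_real y) = 0" if y: "y > 0" for y
    proof (rule half_plane_log_integral_zero[where B = B and \<psi> = \<psi>1])
      have h1: "G1 holomorphic_on UNIV" unfolding G1_def[abs_def] by (intro holomorphic_intros hol)
      show "continuous_on {z. Im z \<ge> 0} G1" "G1 holomorphic_on {z. Im z > 0}"
        using h1 by (auto intro: holomorphic_on_subset holomorphic_on_imp_continuous_on)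
      show "norm (G1 z) \<le> B" if "Im z \<ge> 0" for z
      proof -
        have "norm (G1 z) \<le> exp (- (\<rho> * Im z)) * (N * exp (\<rho> * Im z))"
          unfolding G1_def norm_mult using Gle[OF that] by (intro mult_mono) (auto simp: norm_exp_eq_Re)
        also have "\<dots> = N" by (simp add: exp_minus)
        finally show ?thesis using A by (simp add: B_def)
      qed
      show "norm (G1 (of_real x)) \<le> B * exp (- \<psi>1 \<bar>x\<bar>)" for x :: real
      proof -
        have "norm (G1 (of_real x)) = norm (G (of_real x))" by (simp add: G1_def norm_mult norm_exp_eq_Re)
        also have "\<dots> \<le> A * (exp (- \<psi> ((a * norm \<omega>) * \<bar>x\<bar>)) + exp (- ((b * (norm \<omega>)\<^sup>2) * \<bar>x\<bar>\<^sup>2)))"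
          using decay[of "x *\<^sub>R \<omega>"] unfolding Greal by (simp add: mult_ac power_mult_distrib)
        also have "\<dots> \<le> A * (exp (- \<psi>1 \<bar>x\<bar>) + exp (- \<psi>1 \<bar>x\<bar>))"
          unfolding \<psi>1_def using A by (intro mult_left_mono add_mono) auto
        also have "\<dots> = (2 * A) * exp (- \<psi>1 \<bar>x\<bar>)" by simp
        also have "\<dots> \<le> B * exp (- \<psi>1 \<bar>x\<bar>)" by (intro mult_right_mono) (auto simp: B_def)
        finally show ?thesis .
      qed
      show "0 \<le> \<psi>1 s" if "0 \<le> s" for s
        unfolding \<psi>1_def using \<psi>0[of "(a * norm \<omega>) * s"] ab that by simp
      show "mono_on {0..} \<psi>1"
      proof (rule mono_onI)
        fix r s :: real assume "r \<in> {0..}" "s \<in> {0..}" "r \<le> s"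
        then show "\<psi>1 r \<le> \<psi>1 s" unfolding \<psi>1_def using ab
          by (intro min.mono monotone_onD[OF \<psi>m] mult_left_mono power_mono) auto
      qed
      show "\<not> summable (\<lambda>l::nat. \<psi>1 (c * 2 ^ l) / 2 ^ l)" if "c > 0" for c
        unfolding \<psi>1_def by (rule min_quadratic_not_summable[OF div ab that])
      show "B > 0" using A by (simp add: B_def)
    qed (rule y)
    have "G (of_real x) = 0"
    proof (rule analytic_continuation[OF hol open_UNIV connected_UNIV, of "{z. Re z = 0 \<and> Im z > 0}" \<i>])
      show "\<i> islimpt {z. Re z = 0 \<and> Im z > 0}"
        unfolding islimpt_approachable
      proof (intro allI impI)
        fix e :: real assume e: "e > 0"
        show "\<exists>x'\<in>{z. Re z = 0 \<and> Im z > 0}. x' \<noteq> \<i> \<and> dist x' \<i> < e"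
          using e by (intro bexI[of _ "Complex 0 (1 + e / 2)"]) (auto simp: complex_eq_iff dist_norm cmod_def)
      qed
      show "G z = 0" if "z \<in> {z. Re z = 0 \<and> Im z > 0}" for z
      proof -
        have "z = \<i> * of_real (Im z)" using that by (simp add: complex_eq_iff)
        then show ?thesis using zero[of "Im z"] that by (simp add: G1_def)
      qed
    qed auto
    then show ?thesis by (simp add: Greal)
  qed
  have all: "(\<integral>v. F v * cis (- (p \<bullet> v)) \<partial>lborel) = 0" for p
  proof (cases "p = 0")
    case True
    obtain e :: 'v where "e \<in> Basis" using nonempty_Basis by blast
    then show ?thesis using line[of e 0] True nonzero_Basis[of e] by simp
  next
    case False
    then show ?thesis using line[of p 1] by simp
  qed
  have "set_integrable lborel (cbox (- u) u) F"
    unfolding set_integrable_def by (intro borel_integrable_compact Fc) auto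
  moreover have "(\<lambda>v. indicator (cbox (- u) u) v *\<^sub>R F v) = F" using F0 by (auto simp: fun_eq_iff indicator_def)
  ultimately have "integrable lborel F" by (simp add: set_integrable_def)
  from fourier_injective[OF this all] have "AE v in lborel. v \<in> UNIV \<longrightarrow> F v = 0" by simp
  from AE_zero_continuous_open[OF open_UNIV F this] show ?thesis by simp
qed

section \<open>Pairing a solution with a wave packet\<close>

lemma tensor_integral:
  fixes g :: "'a::euclidean_space \<Rightarrow> real" and m :: "'b::euclidean_space \<Rightarrow> real"
  assumes g: "integrable lborel g" and m: "integrable lborel m"
  shows "integrable lborel (\<lambda>x. g (fst x) * m (snd x))"
    and "(\<integral>x. g (fst x) * m (snd x) \<partial>lborel) = (\<integral>x. g x \<partial>lborel) * (\<integral>x. m x \<partial>lborel)"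
proof -
  have [measurable]: "g \<in> borel_measurable borel" "m \<in> borel_measurable borel"
    using g m by (simp_all add: borel_measurable_integrable)
  have i: "integrable (lborel \<Otimes>\<^sub>M lborel) (\<lambda>x. g (fst x) * m (snd x))"
  proof (rule lborel_pair.Fubini_integrable)
    show "integrable lborel (\<lambda>x. \<integral>y. norm (g (fst (x, y)) * m (snd (x, y))) \<partial>lborel)"
      using g m by (simp add: abs_mult)
    show "AE x in lborel. integrable lborel (\<lambda>y. g (fst (x, y)) * m (snd (x, y)))"
      using m by simp
  qed measurable
  then show "integrable lborel (\<lambda>x. g (fst x) * m (snd x))" by (simp add: lborel_prod)
  show "(\<integral>x. g (fst x) * m (snd x) \<partial>lborel) = (\<integral>x. g x \<partial>lborel) * (\<integral>x. m x \<partial>lborel)"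
    using lborel_pair.integral_fst'[OF i] by (simp add: lborel_prod)
qed

definition decay_weight :: "'z::euclidean_space \<Rightarrow> real" where
  "decay_weight z = 1 / (1 + (norm z)\<^sup>2) ^ DIM('z)"

lemma decay_weight_nonneg: "0 \<le> decay_weight z"
  by (simp add: decay_weight_def)

lemma integrable_decay_weight: "integrable lborel decay_weight"
  unfolding decay_weight_def[abs_def] by (rule integrable_inverse_one_plus_norm_sq_power)

lemma gauss_weight_translate:
  fixes c :: "'v::euclidean_space"
  assumes \<epsilon>: "\<epsilon> > 0"
  shows "integrable lborel (\<lambda>v. gauss_weight \<epsilon> (v - c))"
    and "(\<integral>v. gauss_weight \<epsilon> (v - c) \<partial>lborel) = (\<integral>v. gauss_weight \<epsilon> (v::'v) \<partial>lborel)"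
proof -
  have d: "distr lborel borel ((+) (- c)) = (lborel :: 'v measure)" by (rule lborel_distr_plus)
  have m: "gauss_weight \<epsilon> \<in> borel_measurable (borel :: 'v measure)"
    using borel_measurable_integrable[OF integrable_gauss_weight[OF \<epsilon>, where 'a = 'v]] by simp
  have "integrable (distr lborel borel ((+) (- c))) (gauss_weight \<epsilon>)"
    unfolding d by (rule integrable_gauss_weight[OF \<epsilon>])
  then show "integrable lborel (\<lambda>v. gauss_weight \<epsilon> (v - c))"
    by (subst (asm) integrable_distr_eq) (use m in auto)
  have "(\<integral>v. gauss_weight \<epsilon> v \<partial>distr lborel borel ((+) (- c))) = (\<integral>v. gauss_weight \<epsilon> (v - c) \<partial>lborel)"
    by (subst integral_distr) (use m in auto)
  then show "(\<integral>v. gauss_weight \<epsilon> (v - c) \<partial>lborel) = (\<integral>v. gauss_weight \<epsilon> (v::'v) \<partial>lborel)"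
    unfolding d by simp
qed

definition partial_fourier :: "('v::euclidean_space \<times> 'z::euclidean_space \<Rightarrow> complex) \<Rightarrow> 'z \<Rightarrow> 'v \<Rightarrow> complex" where
  "partial_fourier f \<xi> v = (\<integral>z. f (v, z) * cis (- (\<xi> \<bullet> z)) \<partial>lborel)"

lemma slice_measurable:
  fixes f :: "'v::euclidean_space \<times> 'z::euclidean_space \<Rightarrow> complex"
  assumes "f \<in> borel_measurable borel" shows "(\<lambda>z. f (v, z)) \<in> borel_measurable borel"
  by (rule measurable_compose[OF _ assms]) (intro borel_measurable_continuous_onI continuous_intros)

lemma partial_fourier_continuous:
  fixes f :: "'v::euclidean_space \<times> 'z::euclidean_space \<Rightarrow> complex"
  assumes f: "f \<in> borel_measurable borel" and cont: "\<And>z. continuous_on UNIV (\<lambda>v. f (v, z))"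
    and le: "\<And>v z. norm (f (v, z)) \<le> C * decay_weight z"
  shows "continuous_on UNIV (partial_fourier f \<xi>)"
  unfolding continuous_on_sequentially
proof (intro allI ballI impI, elim conjE)
  fix s :: "nat \<Rightarrow> 'v" and v assume "s \<longlonglongrightarrow> v"
  have [measurable]: "(\<lambda>z. f (v, z)) \<in> borel_measurable borel" for v by (rule slice_measurable[OF f])
  have "(\<lambda>n. \<integral>z. f (s n, z) * cis (- (\<xi> \<bullet> z)) \<partial>lborel) \<longlonglongrightarrow> (\<integral>z. f (v, z) * cis (- (\<xi> \<bullet> z)) \<partial>lborel)"
  proof (rule integral_dominated_convergence[where w = "\<lambda>z. C * decay_weight z"])
    show "integrable lborel (\<lambda>z::'z. C * decay_weight z)" by (intro integrable_mult_right integrable_decay_weight)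
    have "(\<lambda>n. f (s n, z)) \<longlonglongrightarrow> f (v, z)" for z
      using continuous_on_tendsto_compose[OF cont \<open>s \<longlonglongrightarrow> v\<close>] by simp
    then show "AE z in lborel. (\<lambda>n. f (s n, z) * cis (- (\<xi> \<bullet> z))) \<longlonglongrightarrow> f (v, z) * cis (- (\<xi> \<bullet> z))"
      by (intro AE_I2 tendsto_intros)
  qed (use le in \<open>auto simp: norm_mult\<close>)
  then show "(partial_fourier f \<xi> \<circ> s) \<longlonglongrightarrow> partial_fourier f \<xi> v" by (simp add: partial_fourier_def o_def)
qed

context wave_packet begin

text \<open>
  The pairing of \<open>u\<close> with a single packet of frequency \<open>\<xi>\<close>. As a function of \<open>z\<close> the packet is a character and hence not in \<open>L\<^sup>2\<close>;
  the integral converges because \<open>u\<close> is dominated by \<open>decay_weight\<close>.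
\<close>
definition transform :: "('v \<times> 'z \<Rightarrow> complex) \<Rightarrow> real \<Rightarrow> 'z \<Rightarrow> complex" where
  "transform u t \<xi> = (\<integral>x. u x * cnj (exp (wphase t \<xi> x)) \<partial>lborel)"

lemma norm_exp_wphase: "norm (exp (wphase t \<xi> x)) = norm (packet \<xi> t (fst x))"
  by (simp add: exp_wphase norm_mult)

lemma exp_wphase_measurable: "(\<lambda>x. exp (wphase t \<xi> x)) \<in> borel_measurable borel"
  unfolding wphase_def phase_re_def phase_im_def
  by (intro borel_measurable_continuous_onI continuous_intros)

lemma transform_continuous:
  assumes [measurable]: "u \<in> borel_measurable borel" and ub: "AE x in lborel. norm (u x) \<le> C * decay_weight (snd x)"
  shows "continuous_on box_dual (transform u t)"
  unfolding continuous_on_sequentially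
proof (intro allI ballI impI, elim conjE)
  fix s :: "nat \<Rightarrow> 'z" and \<xi> assume s: "\<forall>n. s n \<in> box_dual" "s \<longlonglongrightarrow> \<xi>" and \<xi>: "\<xi> \<in> box_dual"
  obtain B where B: "B \<ge> 0" "\<And>\<xi> v. \<xi> \<in> box_dual \<Longrightarrow> norm (packet \<xi> t v) \<le> B * gauss_weight eps v"
    using poly_packet_bound[of "\<bar>t\<bar>" 0] by auto
  have [measurable]: "(\<lambda>x. exp (wphase t \<xi> x)) \<in> borel_measurable borel" for \<xi> by (rule exp_wphase_measurable)
  have "(\<lambda>n. \<integral>x. u x * cnj (exp (wphase t (s n) x)) \<partial>lborel) \<longlonglongrightarrow> (\<integral>x. u x * cnj (exp (wphase t \<xi> x)) \<partial>lborel)"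
  proof (rule integral_dominated_convergence[where w = "\<lambda>x. (C * B) * (gauss_weight eps (fst x) * decay_weight (snd x))"])
    show "integrable lborel (\<lambda>x::'v \<times> 'z. (C * B) * (gauss_weight eps (fst x) * decay_weight (snd x)))"
      by (intro integrable_mult_right tensor_integral integrable_gauss_weight[OF eps_pos] integrable_decay_weight)
    show "AE x in lborel. (\<lambda>n. u x * cnj (exp (wphase t (s n) x))) \<longlonglongrightarrow> u x * cnj (exp (wphase t \<xi> x))"
    proof (intro AE_I2 tendsto_mult tendsto_const tendsto_cnj)
      fix x
      have "continuous_on box_dual (\<lambda>\<xi>. (\<lambda>(x, \<xi>). exp (wphase t \<xi> x)) (x, \<xi>))"
        by (rule continuous_on_compose2[OF exp_wphase_continuous]) (auto intro!: continuous_intros)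
      from continuous_on_tendsto_compose[OF this s(2) \<xi>] s(1)
      show "(\<lambda>n. exp (wphase t (s n) x)) \<longlonglongrightarrow> exp (wphase t \<xi> x)" by simp
    qed
    show "AE x in lborel. norm (u x * cnj (exp (wphase t (s n) x))) \<le> (C * B) * (gauss_weight eps (fst x) * decay_weight (snd x))" for n
      using ub
    proof eventually_elim
      case (elim x)
      have "norm (u x * cnj (exp (wphase t (s n) x))) \<le> (C * decay_weight (snd x)) * (B * gauss_weight eps (fst x))"
        unfolding norm_mult complex_mod_cnj norm_exp_wphase
        using s(1) elim by (intro mult_mono B(2)) (auto intro: order_trans[OF norm_ge_zero elim])
      then show ?case by (simp add: mult_ac)
    qed
  qed measurable
  then show "(transform u t \<circ> s) \<longlonglongrightarrow> transform u t \<xi>" by (simp add: transform_def o_def)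
qed

text \<open>
  Exchange of the integrals over the group and over the frequencies.
\<close>
lemma inner_superpose_eq_transform:
  assumes [measurable]: "u \<in> borel_measurable borel" and ub: "AE x in lborel. norm (u x) \<le> C * decay_weight (snd x)"
    and c: "continuous_on box_dual c"
  shows "L2_inner u (superpose t (\<lambda>\<xi> v. c \<xi>)) = (\<integral>\<xi>. of_real (indicator box_dual \<xi>) * (cnj (c \<xi>) * transform u t \<xi>) \<partial>lborel)"
proof -
  obtain B where B: "B \<ge> 0" "\<And>\<xi> v. \<xi> \<in> box_dual \<Longrightarrow> norm (c \<xi> * packet \<xi> t v) \<le> B * gauss_weight eps v"
    using symbol_packet_bound[OF coef[OF c], of "\<bar>t\<bar>"] by auto
  have gw [measurable]: "gauss_weight eps \<in> borel_measurable (borel :: 'v measure)"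
    using borel_measurable_integrable[OF integrable_gauss_weight[OF eps_pos, where 'a = 'v]] by simp
  have [measurable]: "(fst :: 'v \<times> 'z \<Rightarrow> 'v) \<in> borel_measurable borel" "(snd :: 'v \<times> 'z \<Rightarrow> 'z) \<in> borel_measurable borel"
    by (intro borel_measurable_continuous_onI continuous_intros)+
  define m where "m \<xi> v = (if \<xi> \<in> box_dual then c \<xi> * packet \<xi> t v else 0)" for \<xi> and v :: 'v
  define k where "k x \<xi> = m \<xi> (fst x) * cis (\<xi> \<bullet> snd x)" for x \<xi>
  have "continuous_on (box_dual \<times> UNIV) (\<lambda>(\<xi>, v). c \<xi> * packet \<xi> t v)"
    using continuous_on_mult[OF symbols_continuous[OF coef[OF c]] packet_continuous[of t]] by (simp add: case_prod_unfold)
  from superpose_symbol_measurable[OF this] have mm [measurable]: "(\<lambda>q. m (fst q) (snd q)) \<in> borel_measurable (borel \<Otimes>\<^sub>M borel)"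
    by (simp add: m_def case_prod_unfold)
  have "(\<lambda>q. (snd q, fst (fst q))) \<in> (borel :: ('v \<times> 'z) measure) \<Otimes>\<^sub>M (borel :: 'z measure) \<rightarrow>\<^sub>M borel \<Otimes>\<^sub>M borel" by measurable
  from measurable_compose[OF this mm]
  have [measurable]: "(\<lambda>q. m (snd q) (fst (fst q))) \<in> borel_measurable ((borel :: ('v \<times> 'z) measure) \<Otimes>\<^sub>M (borel :: 'z measure))" by simp
  have [measurable]: "(\<lambda>q. k (fst q) (snd q)) \<in> borel_measurable ((borel :: ('v \<times> 'z) measure) \<Otimes>\<^sub>M (borel :: 'z measure))"
    unfolding k_def by measurable
  have kle: "norm (k x \<xi>) \<le> (B + 1) * gauss_weight eps (fst x)" for x \<xi>
  proof -
    have "norm (k x \<xi>) \<le> B * gauss_weight eps (fst x)"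
      using B gauss_weight_bounds(1)[of eps "fst x"] by (auto simp: k_def m_def norm_mult)
    also have "\<dots> \<le> (B + 1) * gauss_weight eps (fst x)"
      using gauss_weight_bounds(1)[of eps "fst x"] by (intro mult_right_mono) auto
    finally show ?thesis .
  qed
  have i1: "integrable lborel (\<lambda>x. u x * of_real (gauss_weight eps (fst x)))"
  proof (rule Bochner_Integration.integrable_bound)
    show "integrable lborel (\<lambda>x::'v \<times> 'z. C * (gauss_weight eps (fst x) * decay_weight (snd x)))"
      by (intro integrable_mult_right tensor_integral integrable_gauss_weight[OF eps_pos] integrable_decay_weight)
    show "AE x in lborel. norm (u x * of_real (gauss_weight eps (fst x))) \<le> norm (C * (gauss_weight eps (fst x) * decay_weight (snd x)))"
      using ub
    proof eventually_elim
      case (elim x)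
      have "norm (u x * of_real (gauss_weight eps (fst x))) \<le> (C * decay_weight (snd x)) * gauss_weight eps (fst x)"
        using elim gauss_weight_bounds(1)[of eps "fst x"] by (simp add: norm_mult mult_right_mono)
      then show ?case by (simp add: mult_ac)
    qed
  qed measurable
  have i2: "integrable lborel (\<lambda>\<xi>. complex_of_real (indicator box_dual \<xi>))"
    by (intro integrable_of_real integrable_real_indicator) (auto simp: emeasure_lborel_cbox_eq)
  \<comment> \<open>The integrand is written as an integrable function of \<open>x\<close> times one of \<open>\<xi>\<close> times a factor of modulus at most 1; \<open>B + 1\<close> avoids division by 0.\<close>
  define K where "K q = cnj (k (fst q) (snd q)) / of_real ((B + 1) * gauss_weight eps (fst (fst q)))" for q
  have gp: "(B + 1) * gauss_weight eps v > 0" for v :: 'v using B gauss_weight_bounds(1)[of eps v] by simp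
  have "integrable (lborel \<Otimes>\<^sub>M lborel) (\<lambda>(x, \<xi>). u x * of_real (gauss_weight eps (fst x)) * of_real (indicator box_dual \<xi>) * K (x, \<xi>))"
  proof (rule integrable_pair_mult[OF i1 i2])
    show "K \<in> borel_measurable (borel \<Otimes>\<^sub>M borel)" unfolding K_def[abs_def] by measurable
    show "norm (K (x, \<xi>)) \<le> 1" for x \<xi>
      unfolding K_def norm_divide norm_of_real complex_mod_cnj fst_conv snd_conv
      using kle[of x \<xi>] gp[of "fst x"] by (simp only: abs_of_pos divide_le_eq_1_pos)
  qed
  from integrable_mult_right[OF this, of "of_real (B + 1)"]
  have "integrable (lborel \<Otimes>\<^sub>M lborel) (\<lambda>(x, \<xi>). u x * of_real (indicator box_dual \<xi>) * cnj (k x \<xi>))"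
  proof (rule back_subst[of "integrable (lborel \<Otimes>\<^sub>M lborel)"], intro ext)
    fix q :: "('v \<times> 'z) \<times> 'z"
    have "complex_of_real (gauss_weight eps (fst (fst q))) \<noteq> 0" "complex_of_real (B + 1) \<noteq> 0"
      using gp[of "fst (fst q)"] B gauss_weight_bounds(1)[of eps "fst (fst q)"] by (simp_all del: of_real_add)
    then show "of_real (B + 1) * (case q of (x, \<xi>) \<Rightarrow> u x * of_real (gauss_weight eps (fst x)) * of_real (indicator box_dual \<xi>) * K (x, \<xi>)) =
      (case q of (x, \<xi>) \<Rightarrow> u x * of_real (indicator box_dual \<xi>) * cnj (k x \<xi>))"
      by (simp add: K_def case_prod_unfold del: of_real_add)
  qed
  from lborel_pair.Fubini_integral[OF this]
  have F: "(\<integral>\<xi>. (\<integral>x. u x * of_real (indicator box_dual \<xi>) * cnj (k x \<xi>) \<partial>lborel) \<partial>lborel) =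
      (\<integral>x. (\<integral>\<xi>. u x * of_real (indicator box_dual \<xi>) * cnj (k x \<xi>) \<partial>lborel) \<partial>lborel)" by simp
  have L: "(\<integral>\<xi>. u x * of_real (indicator box_dual \<xi>) * cnj (k x \<xi>) \<partial>lborel) = u x * cnj (superpose t (\<lambda>\<xi> v. c \<xi>) x)" for x
  proof -
    have sp: "superpose t (\<lambda>\<xi> v. c \<xi>) x = (\<integral>\<xi>. of_real (indicator box_dual \<xi>) * k x \<xi> \<partial>lborel)"
      by (simp add: superpose_def wave_def k_def m_def mult.assoc)
    have "cnj (superpose t (\<lambda>\<xi> v. c \<xi>) x) = (\<integral>\<xi>. cnj (of_real (indicator box_dual \<xi>) * k x \<xi>) \<partial>lborel)"
      unfolding sp by (rule Bochner_Integration.integral_cnj[symmetric])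
    moreover have "(\<integral>\<xi>. u x * of_real (indicator box_dual \<xi>) * cnj (k x \<xi>) \<partial>lborel) =
        u x * (\<integral>\<xi>. cnj (of_real (indicator box_dual \<xi>) * k x \<xi>) \<partial>lborel)"
      unfolding mult.assoc complex_cnj_mult complex_cnj_complex_of_real by (rule integral_mult_right_zero)
    ultimately show ?thesis by simp
  qed
  have R: "(\<integral>x. u x * of_real (indicator box_dual \<xi>) * cnj (k x \<xi>) \<partial>lborel) =
      of_real (indicator box_dual \<xi>) * (cnj (c \<xi>) * transform u t \<xi>)" for \<xi>
  proof (cases "\<xi> \<in> box_dual")
    case True
    then have "(\<integral>x. u x * of_real (indicator box_dual \<xi>) * cnj (k x \<xi>) \<partial>lborel) =
        (\<integral>x. cnj (c \<xi>) * (u x * cnj (exp (wphase t \<xi> x))) \<partial>lborel)"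
      by (intro Bochner_Integration.integral_cong) (auto simp: k_def m_def exp_wphase)
    then show ?thesis using True by (simp add: transform_def)
  qed simp
  show ?thesis unfolding L2_inner_def F[unfolded L R] ..
qed

text \<open>
  The pairing with every superposition of packets is conserved. Choosing the difference of the two transforms as coefficient
  shows that the integral of its squared modulus over the box is 0.
\<close>
lemma transform_invariant:
  assumes U: "sublaplacian_group lie U" and f: "f \<in> L2"
    and fb: "AE x in lborel. norm (f x) \<le> C * decay_weight (snd x)"
    and ub: "AE x in lborel. norm (U t f x) \<le> C * decay_weight (snd x)" and \<xi>: "\<xi> \<in> box lo hi"
  shows "transform (U t f) t \<xi> = transform f 0 \<xi>"
proof -
  have "unitary_group U" using U by (simp add: sublaplacian_group_def)
  then have uL: "U t f \<in> L2" by (rule unitary_group.closed[OF _ f])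
  note mf = L2_measurable[OF f] and mu = L2_measurable[OF uL]
  define c where "c \<xi> = transform (U t f) t \<xi> - transform f 0 \<xi>" for \<xi>
  have cf: "continuous_on box_dual (transform f 0)" and cu: "continuous_on box_dual (transform (U t f) t)"
    by (rule transform_continuous[OF mf fb], rule transform_continuous[OF mu ub])
  have c: "continuous_on box_dual c" unfolding c_def by (intro continuous_intros cf cu)
  have i: "integrable lborel (\<lambda>\<xi>. of_real (indicator box_dual \<xi>) * (cnj (c \<xi>) * d \<xi>))" if d: "continuous_on box_dual d" for d :: "'z \<Rightarrow> complex"
  proof -
    have "set_integrable lborel box_dual (\<lambda>\<xi>. cnj (c \<xi>) * d \<xi>)"
      unfolding set_integrable_def by (intro borel_integrable_compact continuous_intros c d) auto
    then show ?thesis by (simp add: set_integrable_def scaleR_conv_of_real)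
  qed
  have "(\<integral>\<xi>. of_real (indicator box_dual \<xi>) * (cnj (c \<xi>) * transform (U t f) t \<xi>) \<partial>lborel) =
      (\<integral>\<xi>. of_real (indicator box_dual \<xi>) * (cnj (c \<xi>) * transform f 0 \<xi>) \<partial>lborel)"
    using pairing_with_superpose[OF U f c, of t] inner_superpose_eq_transform[OF mu ub c, of t] inner_superpose_eq_transform[OF mf fb c, of 0]
    by simp
  then have "(\<integral>\<xi>. of_real (indicator box_dual \<xi>) * (cnj (c \<xi>) * transform (U t f) t \<xi>) -
      of_real (indicator box_dual \<xi>) * (cnj (c \<xi>) * transform f 0 \<xi>) \<partial>lborel) = 0"
    by (subst Bochner_Integration.integral_diff[OF i[OF cu] i[OF cf]]) simp
  also have "(\<lambda>\<xi>. of_real (indicator box_dual \<xi>) * (cnj (c \<xi>) * transform (U t f) t \<xi>) -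
      of_real (indicator box_dual \<xi>) * (cnj (c \<xi>) * transform f 0 \<xi>)) = (\<lambda>\<xi>. complex_of_real (indicator box_dual \<xi> * (norm (c \<xi>))\<^sup>2))"
  proof
    fix \<xi>
    have "of_real ((norm (c \<xi>))\<^sup>2) = cnj (c \<xi>) * c \<xi>" by (simp only: complex_norm_square mult.commute)
    then show "of_real (indicator box_dual \<xi>) * (cnj (c \<xi>) * transform (U t f) t \<xi>) -
      of_real (indicator box_dual \<xi>) * (cnj (c \<xi>) * transform f 0 \<xi>) = complex_of_real (indicator box_dual \<xi> * (norm (c \<xi>))\<^sup>2)"
      by (simp only: of_real_mult) (simp add: c_def algebra_simps)
  qed
  finally have "(\<integral>\<xi>. indicator box_dual \<xi> * (norm (c \<xi>))\<^sup>2 \<partial>lborel) = 0" by (simp only: integral_complex_of_real of_real_eq_0_iff)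
  moreover have "integrable lborel (\<lambda>\<xi>. indicator box_dual \<xi> * (norm (c \<xi>))\<^sup>2)"
  proof -
    have "set_integrable lborel box_dual (\<lambda>\<xi>. (norm (c \<xi>))\<^sup>2)"
      unfolding set_integrable_def by (intro borel_integrable_compact continuous_intros c) auto
    then show ?thesis by (simp add: set_integrable_def)
  qed
  ultimately have "AE \<xi> in lborel. indicator box_dual \<xi> * (norm (c \<xi>))\<^sup>2 = 0"
    by (subst (asm) integral_nonneg_eq_0_iff_AE) auto
  then have "AE \<xi> in lborel. \<xi> \<in> box lo hi \<longrightarrow> c \<xi> = 0"
    by eventually_elim (use box_subset_cbox[of lo hi] in \<open>auto simp: indicator_def split: if_splits\<close>)
  from AE_zero_continuous_open[OF open_box _ this \<xi>] show ?thesis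
    using continuous_on_subset[OF c box_subset_cbox] by (simp add: c_def)
qed

text \<open>
  A point \<open>v\<close> has distance at least \<open>|ctr| / 2\<close> from the origin, where \<open>u\<close> is small, or from the centre of the packet, where the
  packet is small. Half of the exponent of the packet is kept to integrate over \<open>v\<close>.
\<close>
lemma transform_decay:
  assumes [measurable]: "u \<in> borel_measurable borel" and C: "C \<ge> 0"
    and ub: "AE x in lborel. norm (u x) \<le> C * exp (- \<psi> (norm (fst x))) * decay_weight (snd x)"
    and \<psi>0: "\<And>s. 0 \<le> s \<Longrightarrow> 0 \<le> \<psi> s" and \<psi>m: "mono_on {0..} \<psi>" and \<xi>: "\<xi> \<in> box_dual"
  shows "norm (transform u t \<xi>) \<le> C * ((\<integral>v. gauss_weight (sqrt (h / 4)) (v::'v) \<partial>lborel) * (\<integral>z. decay_weight (z::'z) \<partial>lborel)) * (exp (- \<psi> (norm (ctr \<xi> t) / 2)) + exp (- (h / 32 * (norm (ctr \<xi> t))\<^sup>2)))"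
proof -
  let ?E = "exp (- \<psi> (norm (ctr \<xi> t) / 2)) + exp (- (h / 32 * (norm (ctr \<xi> t))\<^sup>2))"
  let ?e = "sqrt (h / 4)"
  have e: "?e > 0" using h_pos by simp
  have gw: "gauss_weight ?e w = exp (- (h / 8 * (norm w)\<^sup>2))" for w :: 'v
    using h_pos by (simp add: gauss_weight_def)
  have bound: "exp (- \<psi> (norm v)) * norm (packet \<xi> t v) \<le> ?E * gauss_weight ?e (v - ctr \<xi> t)" for v
  proof -
    define y where "y = v - ctr \<xi> t"
    have pk: "norm (packet \<xi> t v) \<le> exp (- (h / 8 * (norm y)\<^sup>2)) * exp (- (h / 8 * (norm y)\<^sup>2))"
      using packet_norm_le[OF \<xi>, of t v] by (simp add: y_def exp_add[symmetric])
    have g1: "exp (- (h / 8 * (norm y)\<^sup>2)) \<le> 1" using h_pos by simp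
    show ?thesis
    proof (cases "norm (ctr \<xi> t) / 2 \<le> norm v")
      case True
      have "exp (- \<psi> (norm v)) \<le> exp (- \<psi> (norm (ctr \<xi> t) / 2))"
        using monotone_onD[OF \<psi>m, of "norm (ctr \<xi> t) / 2" "norm v"] True by simp
      moreover have "norm (packet \<xi> t v) \<le> exp (- (h / 8 * (norm y)\<^sup>2))"
        by (rule order_trans[OF pk mult_left_le[OF g1]]) simp
      ultimately have "exp (- \<psi> (norm v)) * norm (packet \<xi> t v) \<le> exp (- \<psi> (norm (ctr \<xi> t) / 2)) * exp (- (h / 8 * (norm y)\<^sup>2))"
        by (intro mult_mono) auto
      also have "\<dots> \<le> ?E * exp (- (h / 8 * (norm y)\<^sup>2))" by (intro mult_right_mono) auto
      finally show ?thesis by (simp add: gw y_def)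
    next
      case False
      have "norm (ctr \<xi> t) \<le> norm y + norm v" using norm_triangle_ineq4[of v y] by (simp add: y_def)
      then have "(norm (ctr \<xi> t) / 2)\<^sup>2 \<le> (norm y)\<^sup>2" using False by (intro power_mono) auto
      then have "h / 8 * (norm (ctr \<xi> t) / 2)\<^sup>2 \<le> h / 8 * (norm y)\<^sup>2" using h_pos by (intro mult_left_mono) auto
      then have g2: "exp (- (h / 8 * (norm y)\<^sup>2)) \<le> exp (- (h / 32 * (norm (ctr \<xi> t))\<^sup>2))" by (simp add: power_divide)
      have "norm (packet \<xi> t v) \<le> exp (- (h / 32 * (norm (ctr \<xi> t))\<^sup>2)) * exp (- (h / 8 * (norm y)\<^sup>2))"
        by (rule order_trans[OF pk mult_right_mono[OF g2]]) simp
      then have "exp (- \<psi> (norm v)) * norm (packet \<xi> t v) \<le> 1 * (exp (- (h / 32 * (norm (ctr \<xi> t))\<^sup>2)) * exp (- (h / 8 * (norm y)\<^sup>2)))"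
        using \<psi>0[of "norm v"] by (intro mult_mono) auto
      also have "\<dots> \<le> ?E * exp (- (h / 8 * (norm y)\<^sup>2))" by (simp add: mult_right_mono)
      finally show ?thesis by (simp add: gw y_def)
    qed
  qed
  have i: "integrable lborel (\<lambda>x::'v \<times> 'z. gauss_weight ?e (fst x - ctr \<xi> t) * decay_weight (snd x))"
    by (rule tensor_integral(1)[OF gauss_weight_translate(1)[OF e] integrable_decay_weight])
  have [measurable]: "(\<lambda>x. exp (wphase t \<xi> x)) \<in> borel_measurable borel" by (rule exp_wphase_measurable)
  have le: "AE x in lborel. norm (u x * cnj (exp (wphase t \<xi> x))) \<le> C * ?E * (gauss_weight ?e (fst x - ctr \<xi> t) * decay_weight (snd x))"
    using ub
  proof eventually_elim
    case (elim x)
    have "norm (u x * cnj (exp (wphase t \<xi> x))) \<le> C * exp (- \<psi> (norm (fst x))) * decay_weight (snd x) * norm (packet \<xi> t (fst x))"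
      unfolding norm_mult complex_mod_cnj norm_exp_wphase using elim by (intro mult_right_mono) auto
    also have "\<dots> = (C * decay_weight (snd x)) * (exp (- \<psi> (norm (fst x))) * norm (packet \<xi> t (fst x)))" by simp
    also have "\<dots> \<le> (C * decay_weight (snd x)) * (?E * gauss_weight ?e (fst x - ctr \<xi> t))"
      by (intro mult_left_mono bound mult_nonneg_nonneg C decay_weight_nonneg)
    finally show ?case by (simp add: mult_ac)
  qed
  have ii: "integrable lborel (\<lambda>x. u x * cnj (exp (wphase t \<xi> x)))"
  proof (rule Bochner_Integration.integrable_bound)
    show "integrable lborel (\<lambda>x::'v \<times> 'z. C * ?E * (gauss_weight ?e (fst x - ctr \<xi> t) * decay_weight (snd x)))"
      by (intro integrable_mult_right i)
    show "AE x in lborel. norm (u x * cnj (exp (wphase t \<xi> x))) \<le> norm (C * ?E * (gauss_weight ?e (fst x - ctr \<xi> t) * decay_weight (snd x)))"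
      using le
    proof eventually_elim
      case (elim x)
      show ?case unfolding real_norm_def by (rule order_trans[OF elim abs_ge_self])
    qed
  qed measurable
  have "norm (transform u t \<xi>) \<le> (\<integral>x. norm (u x * cnj (exp (wphase t \<xi> x))) \<partial>lborel)"
    unfolding transform_def by (rule integral_norm_bound)
  also have "\<dots> \<le> (\<integral>x. C * ?E * (gauss_weight ?e (fst (x::'v \<times> 'z) - ctr \<xi> t) * decay_weight (snd x)) \<partial>lborel)"
    by (rule integral_mono_AE[OF integrable_norm[OF ii] integrable_mult_right[OF i] le])
  also have "\<dots> = C * ?E * ((\<integral>v. gauss_weight (sqrt (h / 4)) (v::'v) \<partial>lborel) * (\<integral>z. decay_weight (z::'z) \<partial>lborel))"
    by (simp only: integral_mult_right_zero tensor_integral(2)[OF gauss_weight_translate(1)[OF e] integrable_decay_weight] gauss_weight_translate(2)[OF e])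
  finally show ?thesis by (simp only: mult_ac)
qed

text \<open>
  At time 0 all packets are the same Gaussian at the origin, modulated by \<open>cis (p \<bullet> v)\<close>: the transform is a Fourier transform in \<open>v\<close>.
\<close>
lemma transform_at_zero:
  assumes [measurable]: "u \<in> borel_measurable borel" and ub: "\<And>x. norm (u x) \<le> C * decay_weight (snd x)" and \<xi>: "\<xi> \<in> box_dual"
  shows "transform u 0 \<xi> = (\<integral>v. partial_fourier u \<xi> v * of_real (exp (- ((1/4) * (v \<bullet> H \<xi> v)))) * cis (- (p \<bullet> v)) \<partial>lborel)"
proof -
  obtain B where B: "B \<ge> 0" "\<And>\<xi> v. \<xi> \<in> box_dual \<Longrightarrow> norm (packet \<xi> 0 v) \<le> B * gauss_weight eps v"
    using poly_packet_bound[of 0 0] by auto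
  have [measurable]: "(\<lambda>x. exp (wphase 0 \<xi> x)) \<in> borel_measurable borel" by (rule exp_wphase_measurable)
  have C: "0 \<le> C * decay_weight (snd x)" for x :: "'v \<times> 'z" using ub[of x] norm_ge_zero order_trans by blast
  have i: "integrable (lborel \<Otimes>\<^sub>M lborel) (\<lambda>x. u x * cnj (exp (wphase 0 \<xi> x)))"
    unfolding lborel_prod
  proof (rule Bochner_Integration.integrable_bound)
    show "integrable lborel (\<lambda>x::'v \<times> 'z. (C * B) * (gauss_weight eps (fst x) * decay_weight (snd x)))"
      by (intro integrable_mult_right tensor_integral integrable_gauss_weight[OF eps_pos] integrable_decay_weight)
    show "AE x in lborel. norm (u x * cnj (exp (wphase 0 \<xi> x))) \<le> norm ((C * B) * (gauss_weight eps (fst x) * decay_weight (snd x)))"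
    proof (intro AE_I2)
      fix x
      have "norm (u x * cnj (exp (wphase 0 \<xi> x))) \<le> (C * decay_weight (snd x)) * (B * gauss_weight eps (fst x))"
        unfolding norm_mult complex_mod_cnj norm_exp_wphase by (intro mult_mono B(2) \<xi> ub C) auto
      also have "\<dots> \<le> norm ((C * B) * (gauss_weight eps (fst x) * decay_weight (snd x)))"
        unfolding real_norm_def by (rule order_trans[OF _ abs_ge_self]) (simp add: mult_ac)
      finally show "norm (u x * cnj (exp (wphase 0 \<xi> x))) \<le> \<dots>" .
    qed
  qed measurable
  have "transform u 0 \<xi> = (\<integral>v. (\<integral>z. u (v, z) * cnj (exp (wphase 0 \<xi> (v, z))) \<partial>lborel) \<partial>lborel)"
    using lborel_pair.integral_fst'[OF i] by (simp add: transform_def lborel_prod)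
  also have "\<dots> = (\<integral>v. partial_fourier u \<xi> v * of_real (exp (- ((1/4) * (v \<bullet> H \<xi> v)))) * cis (- (p \<bullet> v)) \<partial>lborel)"
  proof (intro Bochner_Integration.integral_cong refl)
    fix v
    have "cnj (exp (wphase 0 \<xi> (v, z))) = cis (- (\<xi> \<bullet> z)) * (of_real (exp (- ((1/4) * (v \<bullet> H \<xi> v)))) * cis (- (p \<bullet> v)))" for z
    proof -
      have "packet \<xi> 0 v = of_real (exp (- ((1/4) * (v \<bullet> H \<xi> v)))) * cis (p \<bullet> v)"
      proof -
        have "phase_re \<xi> 0 v = - ((1/4) * (v \<bullet> H \<xi> v))" "phase_im \<xi> 0 v = p \<bullet> v"
          by (simp_all add: phase_re_def phase_im_def ctr_0)
        then show ?thesis by (simp only: packet_def exp_add cis_conv_exp exp_of_real)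
      qed
      then show ?thesis by (simp add: exp_wphase cis_cnj mult_ac)
    qed
    then have "(\<integral>z. u (v, z) * cnj (exp (wphase 0 \<xi> (v, z))) \<partial>lborel) =
      (\<integral>z. (u (v, z) * cis (- (\<xi> \<bullet> z))) * (of_real (exp (- ((1/4) * (v \<bullet> H \<xi> v)))) * cis (- (p \<bullet> v))) \<partial>lborel)"
      by (simp only: mult.assoc)
    also have "\<dots> = (\<integral>z. u (v, z) * cis (- (\<xi> \<bullet> z)) \<partial>lborel) * (of_real (exp (- ((1/4) * (v \<bullet> H \<xi> v)))) * cis (- (p \<bullet> v)))"
      by (rule integral_mult_left_zero)
    finally show "(\<integral>z. u (v, z) * cnj (exp (wphase 0 \<xi> (v, z))) \<partial>lborel) =
        partial_fourier u \<xi> v * of_real (exp (- ((1/4) * (v \<bullet> H \<xi> v)))) * cis (- (p \<bullet> v))"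
      by (simp only: partial_fourier_def mult.assoc)
  qed
  finally show ?thesis .
qed

text \<open>
  A packet of momentum \<open>p\<close> and small frequency has moved away from the origin by at least \<open>|t| |p|\<close> at time \<open>t\<close>, so decay of the solution in space at
  time \<open>t\<close> becomes decay of the initial value in momentum.
\<close>
theorem partial_fourier_decay:
  assumes U: "sublaplacian_group lie U" and f: "f \<in> L2"
    and fb: "\<And>x. norm (f x) \<le> C * decay_weight (snd x)"
    and ub: "AE x in lborel. norm (U t f x) \<le> C * exp (- \<psi> (norm (fst x))) * decay_weight (snd x)"
    and \<psi>0: "\<And>s. 0 \<le> s \<Longrightarrow> 0 \<le> \<psi> s" and \<psi>m: "mono_on {0..} \<psi>" and \<xi>: "\<xi> \<in> box lo hi"
    and a: "norm (J \<xi>) \<le> a" and small: "4 * a * \<bar>t\<bar> \<le> 1"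
  shows "norm (\<integral>v. partial_fourier f \<xi> v * of_real (exp (- ((1/4) * (v \<bullet> H \<xi> v)))) * cis (- (p \<bullet> v)) \<partial>lborel) \<le>
    C * ((\<integral>v. gauss_weight (sqrt (h / 4)) (v::'v) \<partial>lborel) * (\<integral>z. decay_weight (z::'z) \<partial>lborel)) * (exp (- \<psi> (\<bar>t\<bar> / 2 * norm p)) + exp (- (h / 32 * t\<^sup>2 * (norm p)\<^sup>2)))"
proof -
  have \<xi>': "\<xi> \<in> box_dual" using \<xi> box_subset_cbox by blast
  have C: "C \<ge> 0"
  proof -
    have "0 \<le> norm (f 0)" by simp
    also have "\<dots> \<le> C" using fb[of 0] by (simp add: decay_weight_def)
    finally show ?thesis .
  qed
  have "unitary_group U" using U by (simp add: sublaplacian_group_def)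
  then have uL: "U t f \<in> L2" by (rule unitary_group.closed[OF _ f])
  have ub': "AE x in lborel. norm (U t f x) \<le> C * decay_weight (snd x)"
    using ub
  proof eventually_elim
    case (elim x)
    have "C * exp (- \<psi> (norm (fst x))) * decay_weight (snd x) \<le> C * 1 * decay_weight (snd x)"
      using C \<psi>0[of "norm (fst x)"] by (intro mult_right_mono mult_left_mono decay_weight_nonneg) auto
    then show ?case using elim by simp
  qed
  have mass: "((\<integral>v. gauss_weight (sqrt (h / 4)) (v::'v) \<partial>lborel) * (\<integral>z. decay_weight (z::'z) \<partial>lborel)) \<ge> 0"
    by (intro mult_nonneg_nonneg integral_nonneg_AE AE_I2 decay_weight_nonneg gauss_weight_bounds(1)[THEN less_imp_le])
  have "transform f 0 \<xi> = transform (U t f) t \<xi>"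
    using transform_invariant[OF U f _ ub' \<xi>] fb by simp
  then have "norm (\<integral>v. partial_fourier f \<xi> v * of_real (exp (- ((1/4) * (v \<bullet> H \<xi> v)))) * cis (- (p \<bullet> v)) \<partial>lborel) =
      norm (transform (U t f) t \<xi>)"
    using transform_at_zero[OF L2_measurable[OF f] fb \<xi>'] by simp
  also have "\<dots> \<le> C * ((\<integral>v. gauss_weight (sqrt (h / 4)) (v::'v) \<partial>lborel) * (\<integral>z. decay_weight (z::'z) \<partial>lborel)) * (exp (- \<psi> (norm (ctr \<xi> t) / 2)) + exp (- (h / 32 * (norm (ctr \<xi> t))\<^sup>2)))"
    by (rule transform_decay[OF L2_measurable[OF uL] C ub \<psi>0 \<psi>m \<xi>'])
  also have "\<dots> \<le> C * ((\<integral>v. gauss_weight (sqrt (h / 4)) (v::'v) \<partial>lborel) * (\<integral>z. decay_weight (z::'z) \<partial>lborel)) * (exp (- \<psi> (\<bar>t\<bar> / 2 * norm p)) + exp (- (h / 32 * t\<^sup>2 * (norm p)\<^sup>2)))"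
  proof (intro mult_left_mono add_mono mult_nonneg_nonneg[OF C mass])
    have g: "\<bar>t\<bar> * norm p \<le> norm (ctr \<xi> t)" by (rule ctr_norm_ge[OF a small])
    show "exp (- \<psi> (norm (ctr \<xi> t) / 2)) \<le> exp (- \<psi> (\<bar>t\<bar> / 2 * norm p))"
      using monotone_onD[OF \<psi>m, of "\<bar>t\<bar> / 2 * norm p" "norm (ctr \<xi> t) / 2"] g by simp
    have "(\<bar>t\<bar> * norm p)\<^sup>2 \<le> (norm (ctr \<xi> t))\<^sup>2" using g by (intro power_mono) auto
    then have "h / 32 * (\<bar>t\<bar> * norm p)\<^sup>2 \<le> h / 32 * (norm (ctr \<xi> t))\<^sup>2" using h_pos by (intro mult_left_mono) auto
    then show "exp (- (h / 32 * (norm (ctr \<xi> t))\<^sup>2)) \<le> exp (- (h / 32 * t\<^sup>2 * (norm p)\<^sup>2))" by (simp add: power_mult_distrib)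
  qed
  finally show ?thesis .
qed

end

section \<open>The uniqueness theorem\<close>

text \<open>
  \<open>J\<close> is linear in \<open>\<xi>\<close>. A small multiple \<open>\<tau> n\<close> of a nondegenerate functional is nondegenerate, and its operator is as
  small as the time \<open>t\<close> requires; both properties persist on a small box around it.
\<close>
lemma (in two_step_lie_algebra) MW_condition_wave_packet:
  assumes MW: "MW_condition lie"
  obtains lo hi :: 'z and H h where "box lo hi \<noteq> {}" "wave_packet lie lo hi H h"
    "\<And>\<xi>. \<xi> \<in> box lo hi \<Longrightarrow> 4 * norm (J \<xi>) * \<bar>t\<bar> \<le> 1"
proof -
  obtain \<nu> where \<nu>: "linear \<nu>" "\<And>V. (\<And>V'. MW_form lie \<nu> V V' = 0) \<Longrightarrow> V = 0"
    using MW by (auto simp: MW_condition_def)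
  define n where "n = (\<Sum>b\<in>Basis. \<nu> b *\<^sub>R b)"
  have n: "\<nu> z = n \<bullet> z" for z
  proof -
    have "\<nu> z = \<nu> (\<Sum>b\<in>Basis. (z \<bullet> b) *\<^sub>R b)" by (simp add: euclidean_representation)
    also have "\<dots> = (\<Sum>b\<in>Basis. (z \<bullet> b) * \<nu> b)" by (simp add: linear_sum[OF \<nu>(1)] linear_scale[OF \<nu>(1)])
    also have "\<dots> = n \<bullet> z" unfolding n_def inner_sum_left by (simp add: inner_commute mult.commute)
    finally show ?thesis .
  qed
  have lin: "linear (blinfun_apply (J n))" by (rule bounded_linear.linear[OF blinfun.bounded_linear_right])
  have "inj (blinfun_apply (J n))"
    unfolding linear_injective_0[OF lin]
  proof (intro allI impI)
    fix v assume "J n v = 0"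
    then have "MW_form lie \<nu> v w = 0" for w using J_inner[of n v w] by (simp add: MW_form_def n br_def)
    then show "v = 0" by (rule \<nu>(2))
  qed
  then obtain B where B: "B > 0" "\<And>v. B * norm v \<le> norm (J n v)"
    using linear_inj_bounded_below_pos[OF lin] by blast
  \<comment> \<open>The scale is chosen such that \<open>4 R |t| \<le> 1\<close> for the upper bound \<open>R\<close> of \<open>J\<close> on the box.\<close>
  define \<tau> where "\<tau> = 1 / (4 * (norm (J n) + B / 2) * (\<bar>t\<bar> + 1))"
  have a0: "norm (J n) + B / 2 > 0" using B norm_ge_zero[of "J n"] by linarith
  have \<tau>: "\<tau> > 0" unfolding \<tau>_def using a0 by simp
  define m where "m = \<tau> * (B / 2)"
  define R where "R = \<tau> * (norm (J n) + B / 2)"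
  have m: "0 < m" "m \<le> R" using \<tau> B by (auto simp: m_def R_def)
  have small: "4 * R * \<bar>t\<bar> \<le> 1"
  proof -
    have "4 * (1 / (4 * x * y) * x) * s = s / y" if "x > 0" for x y s :: real using that by simp
    from this[OF a0] have "4 * R * \<bar>t\<bar> = \<bar>t\<bar> / (\<bar>t\<bar> + 1)" unfolding R_def \<tau>_def .
    then show ?thesis by simp
  qed
  define S where "S = {\<xi>. norm (J \<xi> - J (\<tau> *\<^sub>R n)) < m}"
  have "open S" unfolding S_def by (intro open_Collect_less continuous_intros J_continuous)
  moreover have "\<tau> *\<^sub>R n \<in> S" using m by (simp add: S_def)
  ultimately obtain lo hi where box: "cbox lo hi \<subseteq> S" "\<tau> *\<^sub>R n \<in> box lo hi"
    by (meson open_contains_cbox)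
  have Jn: "norm (J (\<tau> *\<^sub>R n) v) = \<tau> * norm (J n v)" for v using \<tau> by (simp add: J_scale)
  have diff: "norm (J \<xi> v - J (\<tau> *\<^sub>R n) v) \<le> m * norm v" if "\<xi> \<in> S" for \<xi> v
  proof -
    have "norm ((J \<xi> - J (\<tau> *\<^sub>R n)) v) \<le> norm (J \<xi> - J (\<tau> *\<^sub>R n)) * norm v" by (rule norm_blinfun)
    also have "\<dots> \<le> m * norm v" using that by (intro mult_right_mono) (auto simp: S_def)
    finally show ?thesis by (simp add: blinfun.diff_left)
  qed
  have upper: "norm (J \<xi> v) \<le> R * norm v" if "\<xi> \<in> S" for \<xi> v
  proof -
    have "norm (J \<xi> v) \<le> norm (J (\<tau> *\<^sub>R n) v) + norm (J \<xi> v - J (\<tau> *\<^sub>R n) v)"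
      using norm_triangle_ineq[of "J (\<tau> *\<^sub>R n) v" "J \<xi> v - J (\<tau> *\<^sub>R n) v"] by simp
    also have "\<dots> \<le> \<tau> * (norm (J n) * norm v) + m * norm v"
      using diff[OF that, of v] \<tau> norm_blinfun[of "J n" v] by (intro add_mono) (auto simp: Jn)
    also have "\<dots> = R * norm v" by (simp add: m_def R_def algebra_simps)
    finally show ?thesis .
  qed
  have lower: "m * norm v \<le> norm (J \<xi> v)" if "\<xi> \<in> S" for \<xi> v
  proof -
    have "\<tau> * (B * norm v) \<le> norm (J (\<tau> *\<^sub>R n) v)" unfolding Jn using \<tau> B by (intro mult_left_mono) auto
    also have "\<dots> \<le> norm (J \<xi> v) + norm (J \<xi> v - J (\<tau> *\<^sub>R n) v)"
      using norm_triangle_ineq4[of "J \<xi> v" "J \<xi> v - J (\<tau> *\<^sub>R n) v"] by simp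
    finally show ?thesis using diff[OF that, of v] by (simp add: m_def algebra_simps)
  qed
  obtain H :: "'z \<Rightarrow> 'v \<Rightarrow>\<^sub>L 'v" and h where H: "h > 0" "continuous_on (cbox lo hi) H"
    "\<And>l v w. l \<in> cbox lo hi \<Longrightarrow> H l v \<bullet> w = v \<bullet> H l w"
    "\<And>l v. l \<in> cbox lo hi \<Longrightarrow> H l (J l v) = J l (H l v)"
    "\<And>l v. l \<in> cbox lo hi \<Longrightarrow> H l (H l v) = - J l (J l v)"
    "\<And>l v. l \<in> cbox lo hi \<Longrightarrow> h * (norm v)\<^sup>2 \<le> v \<bullet> H l v"
    by (rule skew_operator_modulus[of "cbox lo hi" J R m])
      (use J_continuous J_skew upper lower m box in \<open>auto simp: subset_iff\<close>)
  show ?thesis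
  proof (rule that[of lo hi H h])
    show "box lo hi \<noteq> {}" using box(2) by blast
    show "wave_packet lie lo hi H h" by unfold_locales (use H in auto)
    fix \<xi> assume "\<xi> \<in> box lo hi"
    then have "\<xi> \<in> S" using box(1) box_subset_cbox by blast
    then have "norm (J \<xi>) \<le> R" using m by (intro norm_blinfun_bound upper) auto
    then have "4 * norm (J \<xi>) * \<bar>t\<bar> \<le> 4 * R * \<bar>t\<bar>" by (intro mult_right_mono) auto
    then show "4 * norm (J \<xi>) * \<bar>t\<bar> \<le> 1" using small by simp
  qed
qed

theorem theorem4p4:
  fixes lie :: "'v::euclidean_space \<times> 'z::euclidean_space \<Rightarrow> 'v \<times> 'z \<Rightarrow> 'v \<times> 'z"
    and f :: "'v \<times> 'z \<Rightarrow> complex"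
    and w :: "'v \<times> 'z \<Rightarrow> real \<Rightarrow> complex"
    and \<theta> \<psi> :: "real \<Rightarrow> real"
    and C t\<^sub>0 :: real
  assumes "two_step_lie_algebra lie"
    and "MW_condition lie"
    and "f \<in> L2"
    and "schroedinger_solution lie f w"
    and "\<And>z. continuous_on UNIV (\<lambda>v. f (v, z))"
    and "\<exists>K. compact K \<and> (\<forall>v z. v \<notin> K \<longrightarrow> f (v, z) = 0)"
    and "\<And>v z. cmod (f (v, z)) \<le>
           C * (exp (- (norm z * \<theta> (norm z))) / (1 + (norm z)\<^sup>2) ^ DIM('z))"
    and "\<And>s. 0 \<le> s \<Longrightarrow> 0 \<le> \<theta> s"
    and "antimono_on {0..} \<theta>"
    and "(\<theta> \<longlongrightarrow> 0) at_top"
    and "t\<^sub>0 \<noteq> 0"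
    and "\<And>s. 0 \<le> s \<Longrightarrow> 0 \<le> \<psi> s"
    and "mono_on {0..} \<psi>"
    and "AE (v, z) in lborel. cmod (w (v, z) t\<^sub>0) \<le>
           C * exp (- \<psi> (norm v)) *
           (exp (- (norm z * \<theta> (norm z))) / (1 + (norm z)\<^sup>2) ^ DIM('z))"
    and "(\<integral>\<^sup>+ r. ennreal (\<psi> \<bar>r\<bar> / (1 + r\<^sup>2)) \<partial>lborel) = \<infinity>"
    and "(\<integral>\<^sup>+ r\<in>{1..}. ennreal (\<theta> r / r) \<partial>lborel) = \<infinity>"
  shows "\<forall>t. AE g in lborel. w g t = 0"
proof -
  interpret two_step_lie_algebra lie by fact
  note f = \<open>f \<in> L2\<close> and decay = assms(7) and \<theta>0 = assms(8) and \<theta>m = assms(9) and \<psi>0 = assms(12) and \<psi>m = assms(13)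
  note mf = L2_measurable[OF f]
  obtain U where U: "sublaplacian_group lie U" and wU: "\<And>t. AE g in lborel. w g t = U t f g"
    using \<open>schroedinger_solution lie f w\<close> by (auto simp: schroedinger_solution_def)
  have C: "C \<ge> 0"
  proof -
    have "0 \<le> cmod (f (0, 0))" by simp
    also have "\<dots> \<le> C" using decay[of 0 0] by simp
    finally show ?thesis .
  qed
  have dw: "exp (- (norm z * \<theta> (norm z))) / (1 + (norm z)\<^sup>2) ^ DIM('z) \<le> decay_weight z" for z :: 'z
    unfolding decay_weight_def using \<theta>0[of "norm z"] by (intro divide_right_mono) auto
  have fb: "norm (f x) \<le> C * decay_weight (snd x)" for x
    using order_trans[OF decay mult_left_mono[OF dw C]] by (cases x) simp
  have ub: "AE x in lborel. norm (U t\<^sub>0 f x) \<le> C * exp (- \<psi> (norm (fst x))) * decay_weight (snd x)"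
    using wU[of "t\<^sub>0"] assms(14)
  proof eventually_elim
    case (elim x)
    have "norm (U t\<^sub>0 f x) \<le> C * exp (- \<psi> (norm (fst x))) *
        (exp (- (norm (snd x) * \<theta> (norm (snd x)))) / (1 + (norm (snd x))\<^sup>2) ^ DIM('z))"
      using elim by (cases x) simp
    also have "\<dots> \<le> C * exp (- \<psi> (norm (fst x))) * decay_weight (snd x)"
      using C by (intro mult_left_mono dw) auto
    finally show ?case .
  qed
  obtain K where K: "compact K" "\<And>v z. v \<notin> K \<Longrightarrow> f (v, z) = 0" using assms(6) by blast
  obtain lo hi H h where box: "box lo hi \<noteq> {}" and wp: "wave_packet lie lo hi H h"
    and small: "\<And>\<xi>. \<xi> \<in> box lo hi \<Longrightarrow> 4 * norm (J \<xi>) * \<bar>t\<^sub>0\<bar> \<le> 1"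
    using MW_condition_wave_packet[OF \<open>MW_condition lie\<close>, where t = "t\<^sub>0"] by metis
  have h: "h > 0" using wp by (simp add: wave_packet_def wave_packet_axioms_def)
  have local_zero: "partial_fourier f \<xi> v = 0" if \<xi>: "\<xi> \<in> box lo hi" for \<xi> v
  proof -
    define F where "F v = partial_fourier f \<xi> v * of_real (exp (- ((1/4) * (v \<bullet> H \<xi> v))))" for v
    have "F v = 0"
    proof (rule compact_support_log_integral_zero[OF _ K(1) _ \<psi>0 \<psi>m])
      show "continuous_on UNIV F"
        unfolding F_def by (intro continuous_intros partial_fourier_continuous[OF mf assms(5)]) (use fb in auto)
      show "F v = 0" if "v \<notin> K" for v using K(2)[OF that] by (simp add: F_def partial_fourier_def)
      show "\<not> summable (\<lambda>l::nat. \<psi> (c * 2 ^ l) / 2 ^ l)" if "c > 0" for c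
        by (rule mono_integral_imp_not_summable[OF \<psi>0 \<psi>m assms(15) that])
      show "\<bar>t\<^sub>0\<bar> / 2 > 0" "h / 32 * t\<^sub>0\<^sup>2 > 0" using \<open>t\<^sub>0 \<noteq> 0\<close> h by auto
      show "norm (\<integral>v. F v * cis (- (p \<bullet> v)) \<partial>lborel) \<le>
          C * ((\<integral>v. gauss_weight (sqrt (h / 4)) (v::'v) \<partial>lborel) * (\<integral>z. decay_weight (z::'z) \<partial>lborel)) *
          (exp (- \<psi> (\<bar>t\<^sub>0\<bar> / 2 * norm p)) + exp (- (h / 32 * t\<^sub>0\<^sup>2 * (norm p)\<^sup>2)))" for p
        unfolding F_def
        by (rule wave_packet.partial_fourier_decay[OF wp U f fb ub \<psi>0 \<psi>m \<xi> order_refl small[OF \<xi>]])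
    qed auto
    then show ?thesis by (simp add: F_def)
  qed
  obtain \<xi>0 where \<xi>0: "\<xi>0 \<in> box lo hi" using box by blast
  then obtain \<rho> where \<rho>: "\<rho> > 0" "ball \<xi>0 \<rho> \<subseteq> box lo hi" using open_box open_contains_ball by blast
  have slice: "AE z in lborel. f (v, z) = 0" for v
  proof -
    have ms: "(\<lambda>z. f (v, z)) \<in> borel_measurable borel" by (rule slice_measurable[OF mf])
    have all: "(\<integral>z. f (v, z) * cis (- (\<xi> \<bullet> z)) \<partial>lborel) = 0" for \<xi>
    proof (rule fourier_quasianalytic[OF ms decay \<theta>0 \<theta>m _ \<rho>(1)])
      show "\<not> summable (\<lambda>k::nat. \<theta> (256 ^ k))"
        by (rule antimono_integral_imp_not_summable[OF \<theta>0 \<theta>m assms(16)]) auto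
      show "(\<integral>z. f (v, z) * cis (- (\<xi> \<bullet> z)) \<partial>lborel) = 0" if "norm (\<xi> - \<xi>0) < \<rho>" for \<xi>
        using local_zero[of \<xi> v] \<rho>(2) that by (auto simp: partial_fourier_def subset_iff dist_norm norm_minus_commute)
    qed
    have "integrable lborel (\<lambda>z. f (v, z))"
    proof (rule Bochner_Integration.integrable_bound)
      show "integrable lborel (\<lambda>z::'z. C * decay_weight z)" by (intro integrable_mult_right integrable_decay_weight)
      show "AE z in lborel. norm (f (v, z)) \<le> norm (C * decay_weight z)"
        using fb[of "(v, _)"] by (intro AE_I2) (auto intro: order_trans[OF _ abs_ge_self])
    qed (use ms in simp)
    from fourier_injective[OF this all] show ?thesis .
  qed
  have "AE x in lborel \<Otimes>\<^sub>M lborel. f x = 0"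
  proof (rule lborel_pair.AE_pair_measure)
    show "{x \<in> space (lborel \<Otimes>\<^sub>M lborel). f x = 0} \<in> sets (lborel \<Otimes>\<^sub>M lborel)"
      unfolding lborel_prod using mf by measurable
    show "AE x in lborel. AE y in lborel. f (x, y) = 0" using slice by simp
  qed
  then have "AE x in lborel. f x = 0" by (simp only: lborel_prod)
  then have "L2_norm f = L2_norm (\<lambda>x::'v \<times> 'z. 0)" using mf by (intro L2_norm_cong_AE) auto
  then have f0: "L2_norm f = 0" by (simp add: L2_norm_def)
  have ug: "unitary_group U" using U by (simp add: sublaplacian_group_def)
  show ?thesis
  proof
    fix t
    have "AE x in lborel. U t f x = 0"
      by (rule L2_norm_eq_0[OF unitary_group.closed[OF ug f]]) (simp add: unitary_group.isometry[OF ug f] f0)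
    then show "AE g in lborel. w g t = 0" using wU[of t] by eventually_elim simp
  qed
qed

end
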